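(* Let $X$ be a compact topological space, let $\mathcal{E},\mathcal{F}$ be Banach bundles over $X$ and let $L\in\mathfrak{F}(\mathcal{E},\mathcal{F})$ be a Fredholm morphism. Then $\operatorname{ind}(L)=0\in K(X)$ if and only if $L$ is homotopic to a bundle isomorphism, that is, there exists a bundle morphism $H:\pi^\ast\mathcal{E}\to\pi^\ast\mathcal{F}$ such that $\iota_0^\ast H=L$ and $\iota_1^\ast H$ is invertible.
   Context: Scalars are $\mathbb{K}=\mathbb{R}$ or $\mathbb{C}$; $K(X)$ denotes the Grothendieck group of finite dimensional $\mathbb{K}$-vector bundles over $X$ (so $K(X)$ means $KO(X)$ in the real case). A Banach bundle $\mathcal{E}$ over $X$ is a locally trivial bundle with fibres $\mathcal{E}_\lambda$, $\lambda\in X$, isomorphic to a fixed model Banach space, with transition functions that are continuous into the bounded invertible operators with the norm topology. Bundle morphisms $\mathcal{E}\to\mathcal{F}$ are over the identity of the base, i.e. fibrewise bounded linear maps $L_\lambda:\mathcal{E}_\lambda\to\mathcal{F}_\lambda$ which in local trivialisations are norm-continuous families of bounded operators. $\mathfrak{F}_k(\mathcal{E},\mathcal{F})$, $k\in\mathbb{Z}$, is the set of morphisms for which each $L_\lambda$ is a bounded Fredholm operator of index $k$, and $\mathfrak{F}(\mathcal{E},\mathcal{F})=\bigcup_{k\in\mathbb{Z}}\mathfrak{F}_k(\mathcal{E},\mathcal{F})$; its elements are called Fredholm morphisms. $\pi:X\times[0,1]\to X$ is the projection, and $\iota_0,\iota_1:X\to X\times[0,1]$ are the inclusions $\iota_i(\lambda)=(\lambda,i)$.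 Since $\pi\circ\iota_i=\mathrm{id}_X$, the bundles $\iota_i^\ast\pi^\ast\mathcal{E}$, $\iota_i^\ast\pi^\ast\mathcal{F}$ are identified with $\mathcal{E}$, $\mathcal{F}$. Index bundle: for $L\in\mathfrak{F}(\mathcal{E},\mathcal{F})$ there exist finite dimensional subbundles $\mathcal{V}\subset\mathcal{F}$ transversal to the image of $L$, i.e. $\operatorname{im}(L_\lambda)+\mathcal{V}_\lambda=\mathcal{F}_\lambda$ for all $\lambda\in X$. For such $\mathcal{V}$, the spaces $E(L,\mathcal{V})_\lambda=\{u\in\mathcal{E}_\lambda:L_\lambda u\in\mathcal{V}_\lambda\}$ form a finite dimensional subbundle $E(L,\mathcal{V})$ of $\mathcal{E}$, and $\operatorname{ind}(L):=[E(L,\mathcal{V})]-[\mathcal{V}]\in K(X)$, which does not depend on the choice of $\mathcal{V}$.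
   Formalization: X is taken compact Hausdorff, the homotopy H runs through Fredholm morphisms, and "ind(L)=0 implies homotopic to an isomorphism" is claimed only for infinite dimensional fibres; without these the claim fails or ind is undefined (e.g. X=S², E=TS², F trivial, L=0). *)

theory Defs
  imports "HOL-Analysis.Analysis" "HOL-Computational_Algebra.Polynomial" "HOL-Algebra.Group"
begin

section \<open>Scalars and linear algebra\<close>

text \<open>
  The scalars are an arbitrary type of sort \<open>{real_normed_field, euclidean_space}\<close>. Both
  \<open>real\<close> and \<open>complex\<close> have this sort, and the lemma below shows that, up to isomorphism,
  nothing else does. This treats \<open>\<K> = \<real>\<close> and \<open>\<K> = \<complex>\<close> simultaneously.
\<close>

lemma scalars_real_or_complex:
  "(\<forall>z :: 'k :: {real_normed_field, euclidean_space}. \<exists>a. z = of_real a) \<or>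
   (\<exists>i :: 'k. i * i = -1 \<and> (\<forall>z. \<exists>a b. z = of_real a + of_real b * i))"
proof -
  have sq: "x * x = -1" if x: "norm x = 1" "x \<bullet> 1 = 0" for x :: 'k
  proof -
    have in1: "(1::'k) \<bullet> 1 = 1" by (simp flip: norm_eq_1)
    have inx: "x \<bullet> x = 1" "1 \<bullet> x = 0" using x by (simp_all add: norm_eq_1 inner_commute)
    have n1: "(norm (1 + x))\<^sup>2 = 2" "(norm (1 - x))\<^sup>2 = 2"
      using x in1 inx unfolding power2_norm_eq_inner inner_add inner_diff by simp_all
    have "(norm (1 + x) * norm (1 - x))\<^sup>2 = 4"
      using n1 by (simp add: power_mult_distrib)
    hence "(norm (1 - x * x))\<^sup>2 = 4"
      by (simp only: norm_mult[symmetric]) (simp add: algebra_simps)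
    moreover have "(x * x) \<bullet> (x * x) = 1"
      using x by (simp add: norm_mult flip: power2_norm_eq_inner)
    ultimately have "(1 + x * x) \<bullet> (1 + x * x) = 0"
      using in1 inner_commute[of "1::'k" "x * x"]
      unfolding power2_norm_eq_inner inner_add inner_diff by simp
    thus ?thesis by (simp add: eq_neg_iff_add_eq_0 add.commute)
  qed
  define im where "im z = z - of_real (z \<bullet> 1)" for z :: 'k
  have im1: "im z \<bullet> 1 = 0" for z
    by (simp add: im_def of_real_def inner_diff flip: norm_eq_1)
  have dec: "z = of_real (z \<bullet> 1) + im z" for z by (simp add: im_def)
  show ?thesis
  proof (cases "\<forall>z :: 'k. im z = 0")
    case True
    thus ?thesis using dec by (metis add.right_neutral)
  next
    case False
    then obtain w :: 'k where w: "im w \<noteq> 0" by blast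
    define u where "u z = im z / of_real (norm (im z))" for z :: 'k
    have u: "norm (u z) = 1" "u z \<bullet> 1 = 0" if "im z \<noteq> 0" for z :: 'k
    proof -
      have "u z = inverse (norm (im z)) *\<^sub>R im z"
        by (simp add: u_def scaleR_conv_of_real divide_inverse mult.commute)
      thus "norm (u z) = 1" "u z \<bullet> 1 = 0" using that im1[of z] by simp_all
    qed
    have "\<exists>a b. z = of_real a + of_real b * u w" for z :: 'k
    proof (cases "im z = 0")
      case True
      thus ?thesis using dec[of z] by (metis add.right_neutral mult_zero_left of_real_0)
    next
      case z: False
      have "(u z - u w) * (u z + u w) = 0"
        using sq[OF u[OF z]] sq[OF u[OF w]] by (simp add: algebra_simps)
      hence "u z = u w \<or> u z = - u w" by (auto simp: eq_neg_iff_add_eq_0)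
      moreover have "z = of_real (z \<bullet> 1) + of_real (norm (im z)) * u z"
        using dec[of z] z by (simp add: u_def)
      ultimately have "z = of_real (z \<bullet> 1) + of_real (norm (im z)) * u w \<or>
         z = of_real (z \<bullet> 1) + of_real (- norm (im z)) * u w" by auto
      thus ?thesis by blast
    qed
    thus ?thesis using sq[OF u[OF w]] by blast
  qed
qed

text \<open>A \<open>\<K>\<close>-Banach space is a real Banach space together with a compatible scalar multiplication
  by \<open>\<K>\<close>; completeness comes from the class \<open>banach\<close> of the carrier type.\<close>

definition normed_scale ::
  "('k :: {real_normed_field, euclidean_space} \<Rightarrow> 'm :: real_normed_vector \<Rightarrow> 'm) \<Rightarrow> bool" where
  "normed_scale s \<longleftrightarrow> vector_space s \<and> (\<forall>r x. s (of_real r) x = r *\<^sub>R x) \<and>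
     (\<forall>c x. norm (s c x) = norm c * norm x)"

definition fin_dim ::
  "('k :: field \<Rightarrow> 'v :: ab_group_add \<Rightarrow> 'v) \<Rightarrow> 'v set \<Rightarrow> bool" where
  "fin_dim s V \<longleftrightarrow> (\<exists>B. finite B \<and> V = module.span s B)"

definition linear_between ::
  "('k \<Rightarrow> 'v :: ab_group_add \<Rightarrow> 'v) \<Rightarrow> ('k \<Rightarrow> 'w :: ab_group_add \<Rightarrow> 'w)
     \<Rightarrow> 'v set \<Rightarrow> 'w set \<Rightarrow> ('v \<Rightarrow> 'w) \<Rightarrow> bool" where
  "linear_between s t A B f \<longleftrightarrow> (\<forall>u\<in>A. f u \<in> B) \<and>
     (\<forall>u\<in>A. \<forall>v\<in>A. f (u + v) = f u + f v) \<and> (\<forall>c. \<forall>u\<in>A. f (s c u) = t c (f u))"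

text \<open>The cokernel is represented by an algebraic complement \<open>C\<close> of the image. Boundedness is
  part of the notion of bundle morphism below, and closedness of the image is then automatic.\<close>

definition fredholm_of_index ::
  "('k :: field \<Rightarrow> 'v :: ab_group_add \<Rightarrow> 'v) \<Rightarrow> ('k \<Rightarrow> 'w :: ab_group_add \<Rightarrow> 'w)
     \<Rightarrow> 'v set \<Rightarrow> 'w set \<Rightarrow> ('v \<Rightarrow> 'w) \<Rightarrow> int \<Rightarrow> bool" where
  "fredholm_of_index s t A B f k \<longleftrightarrow>
     fin_dim s {u\<in>A. f u = 0} \<and>
     (\<exists>C. fin_dim t C \<and> f ` A \<inter> C = {0} \<and> {y + c | y c. y \<in> f ` A \<and> c \<in> C} = B \<and>
        k = int (vector_space.dim s {u\<in>A. f u = 0}) - int (vector_space.dim t C))"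


section \<open>Banach bundles\<close>

text \<open>
  The fibre over \<open>p\<close> is a linear subspace of an ambient \<open>\<K>\<close>-vector space \<open>'v\<close>, which serves only
  to carry the linear structure of the fibres: it has no topology, and every family of vector
  spaces embeds in a common one, such as its product. A chart \<open>(U, \<tau>)\<close> is a local trivialisation
  over \<open>U\<close>, with \<open>\<tau> p\<close> the linear isomorphism from the model Banach space \<open>'m\<close> onto the fibre
  over \<open>p\<close>. The topology of the bundle is the one defined by its charts.
\<close>

record ('b, 'k, 'v, 'm) bbundle =
  fibre :: "'b \<Rightarrow> 'v set"
  fscale :: "'k \<Rightarrow> 'v \<Rightarrow> 'v"
  mscale :: "'k \<Rightarrow> 'm \<Rightarrow> 'm"
  charts :: "('b set \<times> ('b \<Rightarrow> 'm \<Rightarrow> 'v)) set"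

text \<open>The local expressions of \<open>L\<close> are continuous families of bounded operators, for the operator
  norm. (That norm does not depend on whether an operator is regarded over \<open>\<K>\<close> or over \<open>\<real>\<close>.)\<close>

definition norm_continuous_in_charts ::
  "'b topology \<Rightarrow> ('b, 'k, 'v, 'm :: real_normed_vector) bbundle
     \<Rightarrow> ('b, 'k, 'w, 'n :: real_normed_vector) bbundle \<Rightarrow> ('b \<Rightarrow> 'v \<Rightarrow> 'w) \<Rightarrow> bool" where
  "norm_continuous_in_charts X E F L \<longleftrightarrow>
     (\<forall>(U, \<tau>)\<in>charts E. \<forall>(U', \<sigma>)\<in>charts F.
        \<exists>A :: 'b \<Rightarrow> 'm \<Rightarrow>\<^sub>L 'n. continuous_map (subtopology X (U \<inter> U')) euclidean A \<and>
          (\<forall>p\<in>U \<inter> U'. \<forall>x. L p (\<tau> p x) = \<sigma> p (blinfun_apply (A p) x)))"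

text \<open>In the last clause the local expressions of the identity are the transition functions; as
  the charts are ordered arbitrarily, their inverses are covered as well.\<close>

definition banach_bundle ::
  "'b topology \<Rightarrow>
   ('b, 'k :: {real_normed_field, euclidean_space}, 'v :: ab_group_add, 'm :: banach) bbundle \<Rightarrow> bool"
where
  "banach_bundle X E \<longleftrightarrow>
     vector_space (fscale E) \<and> normed_scale (mscale E) \<and>
     (\<forall>(U, \<tau>)\<in>charts E. openin X U \<and>
        (\<forall>p\<in>U. Vector_Spaces.linear (mscale E) (fscale E) (\<tau> p) \<and>
               bij_betw (\<tau> p) UNIV (fibre E p))) \<and>
     \<Union>(fst ` charts E) = topspace X \<and>
     norm_continuous_in_charts X E E (\<lambda>p u. u)"

definition bundle_morphism ::
  "'b topology \<Rightarrow>
   ('b, 'k, 'v :: ab_group_add, 'm :: real_normed_vector) bbundle \<Rightarrow>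
   ('b, 'k, 'w :: ab_group_add, 'n :: real_normed_vector) bbundle \<Rightarrow> ('b \<Rightarrow> 'v \<Rightarrow> 'w) \<Rightarrow> bool" where
  "bundle_morphism X E F L \<longleftrightarrow>
     (\<forall>p\<in>topspace X. linear_between (fscale E) (fscale F) (fibre E p) (fibre F p) (L p)) \<and>
     norm_continuous_in_charts X E F L"

definition bundle_iso ::
  "'b topology \<Rightarrow>
   ('b, 'k, 'v :: ab_group_add, 'm :: real_normed_vector) bbundle \<Rightarrow>
   ('b, 'k, 'w :: ab_group_add, 'n :: real_normed_vector) bbundle \<Rightarrow> ('b \<Rightarrow> 'v \<Rightarrow> 'w) \<Rightarrow> bool" where
  "bundle_iso X E F L \<longleftrightarrow> bundle_morphism X E F L \<and>
     (\<exists>M. bundle_morphism X F E M \<and>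
        (\<forall>p\<in>topspace X. (\<forall>u\<in>fibre E p. M p (L p u) = u) \<and> (\<forall>w\<in>fibre F p. L p (M p w) = w)))"

definition fredholm_morphism ::
  "'b topology \<Rightarrow>
   ('b, 'k :: field, 'v :: ab_group_add, 'm :: real_normed_vector) bbundle \<Rightarrow>
   ('b, 'k, 'w :: ab_group_add, 'n :: real_normed_vector) bbundle \<Rightarrow> ('b \<Rightarrow> 'v \<Rightarrow> 'w) \<Rightarrow> bool" where
  "fredholm_morphism X E F L \<longleftrightarrow> bundle_morphism X E F L \<and>
     (\<exists>k. \<forall>p\<in>topspace X.
        fredholm_of_index (fscale E) (fscale F) (fibre E p) (fibre F p) (L p) k)"

definition pullback ::
  "'c topology \<Rightarrow> ('c \<Rightarrow> 'b) \<Rightarrow> ('b, 'k, 'v, 'm) bbundle \<Rightarrow> ('c, 'k, 'v, 'm) bbundle" where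
  "pullback Y f E =
     \<lparr>fibre = (\<lambda>y. fibre E (f y)), fscale = fscale E, mscale = mscale E,
      charts = (\<lambda>(U, \<tau>). ({y\<in>topspace Y. f y \<in> U}, \<lambda>y. \<tau> (f y))) ` charts E\<rparr>"

definition pullback_morphism ::
  "('c \<Rightarrow> 'b) \<Rightarrow> ('b \<Rightarrow> 'v \<Rightarrow> 'w) \<Rightarrow> 'c \<Rightarrow> 'v \<Rightarrow> 'w" where
  "pullback_morphism f L = (\<lambda>y. L (f y))"

definition cylinder :: "'b topology \<Rightarrow> ('b \<times> real) topology" where
  "cylinder X = prod_topology X (top_of_set {0..1})"

definition incl :: "real \<Rightarrow> 'b \<Rightarrow> 'b \<times> real" where
  "incl t p = (p, t)"

text \<open>
  The homotopy runs through Fredholm morphisms. Pulling \<open>pullback (cylinder X) fst E\<close> back along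
  \<open>incl t\<close> gives back the fibres and charts of \<open>E\<close>, so \<open>pullback_morphism (incl t) H\<close> is a morphism
  from \<open>E\<close> to \<open>F\<close>. Equality of morphisms is equality on the fibres.
\<close>

definition homotopic_to_iso ::
  "'b topology \<Rightarrow>
   ('b, 'k :: field, 'v :: ab_group_add, 'm :: real_normed_vector) bbundle \<Rightarrow>
   ('b, 'k, 'w :: ab_group_add, 'n :: real_normed_vector) bbundle \<Rightarrow> ('b \<Rightarrow> 'v \<Rightarrow> 'w) \<Rightarrow> bool" where
  "homotopic_to_iso X E F L \<longleftrightarrow>
     (\<exists>H. fredholm_morphism (cylinder X)
            (pullback (cylinder X) fst E) (pullback (cylinder X) fst F) H \<and>
          (\<forall>p\<in>topspace X. \<forall>u\<in>fibre E p. pullback_morphism (incl 0) H p u = L p u) \<and>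
          bundle_iso X E F (pullback_morphism (incl 1) H))"


section \<open>Finite dimensional vector bundles and \<open>K(X)\<close>\<close>

text \<open>
  The rank of a finite dimensional bundle is only locally constant. A local trivialisation
  \<open>U \<times> \<K>\<^sup>n \<cong> V|\<^sub>U\<close> is recorded as a local frame \<open>(U, n, e)\<close>, with \<open>e p i\<close>, \<open>i < n\<close>, the image of the
  \<open>i\<close>-th unit vector over \<open>p\<close>. Operators are then given by matrices, and norm continuity is
  continuity of the entries.
\<close>

record ('b, 'k, 'v) vbundle =
  vfibre :: "'b \<Rightarrow> 'v set"
  vscale :: "'k \<Rightarrow> 'v \<Rightarrow> 'v"
  frames :: "('b set \<times> nat \<times> ('b \<Rightarrow> nat \<Rightarrow> 'v)) set"

definition is_basis ::
  "('k :: field \<Rightarrow> 'v :: ab_group_add \<Rightarrow> 'v) \<Rightarrow> 'v set \<Rightarrow> nat \<Rightarrow> (nat \<Rightarrow> 'v) \<Rightarrow> bool" where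
  "is_basis s V n e \<longleftrightarrow> inj_on e {..<n} \<and> \<not> module.dependent s (e ` {..<n}) \<and>
     module.span s (e ` {..<n}) = V"

definition continuous_in_frames ::
  "'b topology \<Rightarrow> ('b, 'k :: topological_space, 'v) vbundle
     \<Rightarrow> ('b, 'k, 'w :: ab_group_add) vbundle \<Rightarrow> ('b \<Rightarrow> 'v \<Rightarrow> 'w) \<Rightarrow> bool" where
  "continuous_in_frames X V W T \<longleftrightarrow>
     (\<forall>(U, n, e)\<in>frames V. \<forall>(U', m, f)\<in>frames W.
        \<exists>a :: nat \<Rightarrow> nat \<Rightarrow> 'b \<Rightarrow> 'k.
          (\<forall>i<m. \<forall>j<n. continuous_map (subtopology X (U \<inter> U')) euclidean (a i j)) \<and>
          (\<forall>p\<in>U \<inter> U'. \<forall>j<n. T p (e p j) = (\<Sum>i<m. vscale W (a i j p) (f p i))))"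

definition vector_bundle ::
  "'b topology \<Rightarrow>
   ('b, 'k :: {real_normed_field, euclidean_space}, 'v :: ab_group_add) vbundle \<Rightarrow> bool" where
  "vector_bundle X V \<longleftrightarrow>
     vector_space (vscale V) \<and>
     (\<forall>(U, n, e)\<in>frames V. openin X U \<and> (\<forall>p\<in>U. is_basis (vscale V) (vfibre V p) n (e p))) \<and>
     \<Union>(fst ` frames V) = topspace X \<and>
     continuous_in_frames X V V (\<lambda>p u. u)"

definition vbundle_morphism ::
  "'b topology \<Rightarrow> ('b, 'k :: topological_space, 'v :: ab_group_add) vbundle
     \<Rightarrow> ('b, 'k, 'w :: ab_group_add) vbundle \<Rightarrow> ('b \<Rightarrow> 'v \<Rightarrow> 'w) \<Rightarrow> bool" where
  "vbundle_morphism X V W T \<longleftrightarrow>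
     (\<forall>p\<in>topspace X. linear_between (vscale V) (vscale W) (vfibre V p) (vfibre W p) (T p)) \<and>
     continuous_in_frames X V W T"

definition vbundle_isomorphic ::
  "'b topology \<Rightarrow> ('b, 'k :: topological_space, 'v :: ab_group_add) vbundle
     \<Rightarrow> ('b, 'k, 'w :: ab_group_add) vbundle \<Rightarrow> bool" where
  "vbundle_isomorphic X V W \<longleftrightarrow>
     (\<exists>T S. vbundle_morphism X V W T \<and> vbundle_morphism X W V S \<and>
        (\<forall>p\<in>topspace X. (\<forall>u\<in>vfibre V p. S p (T p u) = u) \<and> (\<forall>w\<in>vfibre W p. T p (S p w) = w)))"

definition vbundle_sum ::
  "('b, 'k, 'v :: ab_group_add) vbundle \<Rightarrow> ('b, 'k, 'w :: ab_group_add) vbundle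
     \<Rightarrow> ('b, 'k, 'v \<times> 'w) vbundle" (infixl "\<oplus>\<^sub>V" 65) where
  "V \<oplus>\<^sub>V W =
     \<lparr>vfibre = (\<lambda>p. vfibre V p \<times> vfibre W p),
      vscale = (\<lambda>c (v, w). (vscale V c v, vscale W c w)),
      frames = {(U \<inter> U', n + m, \<lambda>p i. if i < n then (e p i, 0) else (0, f p (i - n)))
                 | U n e U' m f. (U, n, e) \<in> frames V \<and> (U', m, f) \<in> frames W}\<rparr>"

text \<open>
  To form a set of bundles, fibres are taken in one fixed vector space of countably infinite
  dimension, here \<open>'k poly\<close>, of which only the linear structure is used. Since every finite
  dimensional space has a copy in it, every vector bundle over \<open>X\<close> is isomorphic to a member
  of \<open>VB X\<close>.
\<close>

definition VB ::
  "'b topology \<Rightarrow> ('b, 'k :: {real_normed_field, euclidean_space}, 'k poly) vbundle set" where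
  "VB X = {V. vector_bundle X V \<and> vscale V = smult}"

definition zero_vbundle :: "'b topology \<Rightarrow> ('b, 'k :: comm_semiring_0, 'k poly) vbundle" where
  "zero_vbundle X =
     \<lparr>vfibre = (\<lambda>p. {0}), vscale = smult, frames = {(topspace X, 0, \<lambda>p i. 0)}\<rparr>"

text \<open>\<open>K_class X A B\<close> is \<open>[A] - [B]\<close> in \<open>K(X)\<close>: the set of all pairs \<open>(V, W)\<close> of bundles in \<open>VB X\<close>
  with \<open>[V] - [W] = [A] - [B]\<close>, that is, \<open>A \<oplus> W \<oplus> G \<cong> V \<oplus> B \<oplus> G\<close> for some vector bundle \<open>G\<close>. The
  fibres of \<open>A\<close> and \<open>B\<close> may lie in any vector spaces.\<close>

definition K_class ::
  "'b topology \<Rightarrow> ('b, 'k :: {real_normed_field, euclidean_space}, 'v :: ab_group_add) vbundle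
     \<Rightarrow> ('b, 'k, 'w :: ab_group_add) vbundle
     \<Rightarrow> (('b, 'k, 'k poly) vbundle \<times> ('b, 'k, 'k poly) vbundle) set" where
  "K_class X A B =
     {(V, W) \<in> VB X \<times> VB X.
        \<exists>G \<in> VB X. vbundle_isomorphic X ((A \<oplus>\<^sub>V W) \<oplus>\<^sub>V G) ((V \<oplus>\<^sub>V B) \<oplus>\<^sub>V G)}"

text \<open>The Grothendieck group of the monoid of isomorphism classes of vector bundles, written
  multiplicatively as groups are in HOL-Algebra: the zero of \<open>K(X)\<close> is \<open>\<one>\<^bsub>K_group X\<^esub>\<close>.\<close>

definition K_group ::
  "'b topology \<Rightarrow> (('b, 'k :: {real_normed_field, euclidean_space}, 'k poly) vbundle
                   \<times> ('b, 'k, 'k poly) vbundle) set monoid" where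
  "K_group X =
     \<lparr>carrier = {K_class X V W | V W. V \<in> VB X \<and> W \<in> VB X},
      mult = (\<lambda>a b. \<Union>(V, W)\<in>a. \<Union>(V', W')\<in>b. K_class X (V \<oplus>\<^sub>V V') (W \<oplus>\<^sub>V W')),
      one = K_class X (zero_vbundle X) (zero_vbundle X)\<rparr>"


section \<open>The index bundle\<close>

definition continuous_section ::
  "'b topology \<Rightarrow> ('b, 'k, 'v, 'm :: real_normed_vector) bbundle \<Rightarrow> 'b set \<Rightarrow> ('b \<Rightarrow> 'v) \<Rightarrow> bool"
where
  "continuous_section X E U s \<longleftrightarrow>
     (\<forall>(U', \<tau>)\<in>charts E.
        \<exists>c :: 'b \<Rightarrow> 'm. continuous_map (subtopology X (U \<inter> U')) euclidean c \<and>
          (\<forall>p\<in>U \<inter> U'. s p = \<tau> p (c p)))"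

text \<open>A family \<open>W p\<close> of finite dimensional subspaces of the fibres of \<open>E\<close>, with the bundle structure
  induced by \<open>E\<close>: its local frames are the frames consisting of continuous local sections of \<open>E\<close>.
  It is a subbundle when these frames exist around every point.\<close>

definition induced_vbundle ::
  "'b topology \<Rightarrow> ('b, 'k :: field, 'v :: ab_group_add, 'm :: real_normed_vector) bbundle
     \<Rightarrow> ('b \<Rightarrow> 'v set) \<Rightarrow> ('b, 'k, 'v) vbundle" where
  "induced_vbundle X E W =
     \<lparr>vfibre = W, vscale = fscale E,
      frames = {(U, n, e). openin X U \<and> (\<forall>i<n. continuous_section X E U (\<lambda>p. e p i)) \<and>
                           (\<forall>p\<in>U. is_basis (fscale E) (W p) n (e p))}\<rparr>"

definition fin_dim_subbundle ::
  "'b topology \<Rightarrow>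
   ('b, 'k :: {real_normed_field, euclidean_space}, 'v :: ab_group_add, 'm :: banach) bbundle
     \<Rightarrow> ('b \<Rightarrow> 'v set) \<Rightarrow> bool" where
  "fin_dim_subbundle X E W \<longleftrightarrow>
     (\<forall>p\<in>topspace X. W p \<subseteq> fibre E p) \<and> vector_bundle X (induced_vbundle X E W)"

definition transversal_subbundle ::
  "'b topology \<Rightarrow> ('b, 'k, 'v, 'm) bbundle \<Rightarrow>
   ('b, 'k :: {real_normed_field, euclidean_space}, 'w :: ab_group_add, 'n :: banach) bbundle
     \<Rightarrow> ('b \<Rightarrow> 'v \<Rightarrow> 'w) \<Rightarrow> ('b \<Rightarrow> 'w set) \<Rightarrow> bool" where
  "transversal_subbundle X E F L V \<longleftrightarrow> fin_dim_subbundle X F V \<and>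
     (\<forall>p\<in>topspace X. {y + v | y v. y \<in> L p ` fibre E p \<and> v \<in> V p} = fibre F p)"

definition index_space ::
  "('b, 'k, 'v, 'm) bbundle \<Rightarrow> ('b \<Rightarrow> 'v \<Rightarrow> 'w) \<Rightarrow> ('b \<Rightarrow> 'w set) \<Rightarrow> 'b \<Rightarrow> 'v set" where
  "index_space E L V p = {u \<in> fibre E p. L p u \<in> V p}"

text \<open>The index bundle does not depend on the transversal subbundle, so any one may be chosen.\<close>

definition ind ::
  "'b topology \<Rightarrow>
   ('b, 'k :: {real_normed_field, euclidean_space}, 'v :: ab_group_add, 'm :: banach) bbundle \<Rightarrow>
   ('b, 'k, 'w :: ab_group_add, 'n :: banach) bbundle \<Rightarrow> ('b \<Rightarrow> 'v \<Rightarrow> 'w)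
     \<Rightarrow> (('b, 'k, 'k poly) vbundle \<times> ('b, 'k, 'k poly) vbundle) set" where
  "ind X E F L =
     (let V = (SOME V. transversal_subbundle X E F L V)
      in K_class X (induced_vbundle X E (index_space E L V)) (induced_vbundle X F V))"

end

theory Submission
  imports Defs
begin

text \<open>
  Let \<open>H\<close> be a homotopy from \<open>L\<close> to an isomorphism, and \<open>V\<close> a subbundle over \<open>X \<times> [0,1]\<close> transversal to
  \<open>H\<close>. A finite dimensional subbundle of a pulled back Banach bundle has isomorphic slices, since
  a projection onto one slice is bijective on the nearby ones. Hence \<open>E(L, V\<^sub>0) \<cong> E(H\<^sub>1, V\<^sub>1) \<cong> V\<^sub>1 \<cong> V\<^sub>0\<close>.

  Conversely, if the index vanishes then \<open>E(L, V) \<oplus> G \<cong> V \<oplus> G\<close> for some \<open>G\<close>. As the fibres of \<open>F\<close> are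
  infinite dimensional, \<open>G\<close> embeds into \<open>F\<close> in general position to \<open>V\<close>, and \<open>W = V \<oplus> G\<close> admits an
  isomorphism \<open>J\<close> from \<open>E(L, W)\<close> to \<open>W\<close>. If \<open>P\<close> projects \<open>E\<close> onto \<open>E(L, W)\<close>, then \<open>L + t (J - L) P\<close> is
  Fredholm of index \<open>0\<close> for all \<open>t\<close> and bijective for \<open>t = 1\<close>.

  Locally, everything that has to be continuous is read off from the inverse of \<open>L\<close> bordered by a
  frame of \<open>V\<close> and by functionals dual to a frame of \<open>E(L, V)\<close>.
\<close>

section \<open>Banach space tools: functionals, inverses, bordered systems, general position\<close>

section \<open>Hahn--Banach\<close>

text \<open>Infinite dimensional fibres enter the converse for a reason. For \<open>L = 0\<close>
  from the tangent bundle of the 2-sphere to a trivial real bundle of rank 2, the index vanishes, as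
  the two bundles are stably isomorphic, but they are not isomorphic. Room inside \<open>F\<close>
  turns a stable isomorphism into an actual one, and it is found by Baire category: combinations of
  finitely many continuous families over a compact set fill only countably many compact sets, which
  cannot exhaust an infinite dimensional Banach space. The same device yields transversal
  subbundles, since sections that span a complement of the image may be dependent and have to be
  perturbed into independent ones. The kernel of \<open>L\<close> may jump, so it is replaced by the
  preimage of a transversal \<open>V\<close>; bordering makes the operator invertible, and its
  inverse varies continuously. Fibres carry no topology: continuity is read in charts or tested on
  local sections. Affine conditions, such as being a parametrix, survive averaging with a partition
  of unity; general position does not and is reached by a finite induction.\<close>

definition sublinear :: "('a::real_vector => real) => bool" where
  "sublinear p \<longleftrightarrow> (\<forall>x y. p (x + y) \<le> p x + p y) \<and> (\<forall>r\<ge>0. \<forall>x. p (r *\<^sub>R x) = r * p x)"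

lemma sublinearI:
  assumes "!!x y. p (x + y) \<le> p x + p y" and "p 0 = 0"
    and "!!r x. r > 0 ==> p (r *\<^sub>R x) = r * p x"
  shows "sublinear p" unfolding sublinear_def using assms by (metis less_eq_real_def mult_zero_left scaleR_zero_left)

lemma sublinear_add: "sublinear p ==> p (x + y) \<le> p x + p y"
  and sublinear_scale: "sublinear p ==> r \<ge> 0 ==> p (r *\<^sub>R x) = r * p x" by (auto simp: sublinear_def)

lemma sublinear_0: "sublinear p ==> p 0 = 0" using sublinear_scale[of p 0 0] by simp

lemma sublinear_minus: "sublinear p ==> - p (- x) \<le> p x" using sublinear_add[of p x "-x"] sublinear_0[of p] by simp

text \<open>The largest sublinear functional below \<open>q\<close> whose value at
  \<open>- a\<close> is at most \<open>- q a\<close>. A functional that no tilt lowers any further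
  is linear.\<close>

definition tilt :: "('a::real_vector => real) => 'a => 'a => real" where "tilt q a x = (INF t\<in>{0..}. q (x + t *\<^sub>R a) - t * q a)"

lemma tilt_lower:
  assumes "sublinear q" "t \<ge> 0"
  shows "- q (- x) \<le> q (x + t *\<^sub>R a) - t * q a"
  using sublinear_add[OF assms(1), of "x + t *\<^sub>R a" "- x"] sublinear_scale[OF assms, of a] by simp

lemma tilt_bdd: "sublinear q ==> bdd_below ((\<lambda>t. q (x + t *\<^sub>R a) - t * q a) ` {0..})"
  by (rule bdd_belowI2[of _ "- q (- x)"]) (auto intro: tilt_lower)

lemma tilt_le: "sublinear q ==> t \<ge> 0 ==> tilt q a x \<le> q (x + t *\<^sub>R a) - t * q a" unfolding tilt_def by (rule cINF_lower[OF tilt_bdd]) auto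

lemma tilt_le_self: "sublinear q ==> tilt q a x \<le> q x" using tilt_le[of q 0 a x] by simp

lemma tilt_greatest: "(!!t. t \<ge> 0 ==> c \<le> q (x + t *\<^sub>R a) - t * q a) ==> c \<le> tilt q a x" unfolding tilt_def by (rule cINF_greatest) auto

lemma sublinear_tilt:
  assumes q: "sublinear q"
  shows "sublinear (tilt q a)"
proof (rule sublinearI)
  fix x y
  have "tilt q a (x + y) - (q (y + t *\<^sub>R a) - t * q a) \<le> tilt q a x" if t: "t \<ge> 0" for t
  proof (rule tilt_greatest)
    fix s :: real assume s: "s \<ge> 0"
    have "tilt q a (x + y) \<le> q ((x + y) + (s + t) *\<^sub>R a) - (s + t) * q a" using tilt_le[OF q] s t by simp
    moreover have "q ((x + y) + (s + t) *\<^sub>R a) \<le> q (x + s *\<^sub>R a) + q (y + t *\<^sub>R a)"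
      using sublinear_add[OF q, of "x + s *\<^sub>R a" "y + t *\<^sub>R a"] by (simp add: algebra_simps)
    ultimately show "tilt q a (x + y) - (q (y + t *\<^sub>R a) - t * q a) \<le> q (x + s *\<^sub>R a) - s * q a" by (simp add: algebra_simps)
  qed
  hence "tilt q a (x + y) - tilt q a x \<le> tilt q a y" by (intro tilt_greatest) (simp add: algebra_simps)
  thus "tilt q a (x + y) \<le> tilt q a x + tilt q a y" by simp
next
  show "tilt q a 0 = 0" using tilt_le_self[OF q, of a 0] sublinear_0[OF q] sublinear_scale[OF q] by (intro antisym tilt_greatest) auto
next
  have le: "r * tilt q a x \<le> tilt q a (r *\<^sub>R x)" if r: "r > 0" for r x
  proof (rule tilt_greatest)
    fix t :: real assume t: "t \<ge> 0"
    have "r * tilt q a x \<le> r * (q (x + (t / r) *\<^sub>R a) - (t / r) * q a)"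
      using tilt_le[OF q, of "t / r"] r t by (intro mult_left_mono) auto
    also have "\<dots> = q (r *\<^sub>R x + t *\<^sub>R a) - t * q a"
      using sublinear_scale[OF q, of r "x + (t / r) *\<^sub>R a"] r by (simp add: algebra_simps)
    finally show "r * tilt q a x \<le> q (r *\<^sub>R x + t *\<^sub>R a) - t * q a" .
  qed
  fix r :: real and x assume r: "r > 0"
  have "inverse r * tilt q a (r *\<^sub>R x) \<le> tilt q a x" using le[of "inverse r" "r *\<^sub>R x"] r by simp
  hence "tilt q a (r *\<^sub>R x) \<le> r * tilt q a x" using r by (simp add: field_simps)
  with le[OF r] show "tilt q a (r *\<^sub>R x) = r * tilt q a x" by (simp add: antisym)
qed

text \<open>A minimal \<open>q\<close> coincides with all of its tilts. The bound
  \<open>tilt_le\<close> at \<open>t = 1\<close> then reads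
  \<open>q x + q a \<le> q (x + a)\<close>, the missing half of additivity.\<close>

lemma minimal_sublinear_linear:
  assumes q: "sublinear q" and min: "!!q'. sublinear q' ==> q' \<le> q ==> q' = q"
  shows "linear q"
proof -
  have "tilt q a = q" for a by (rule min) (auto simp: sublinear_tilt[OF q] le_fun_def tilt_le_self[OF q])
  hence "q x \<le> q (x + a) - q a" for x a using tilt_le[OF q, of 1 a x] by simp
  hence add: "q (x + a) = q x + q a" for x a using sublinear_add[OF q, of x a] by (smt (verit))
  have neg: "q (- x) = - q x" for x using add[of x "- x"] sublinear_0[OF q] by simp
  have "q (r *\<^sub>R x) = r * q x" for r x
  proof (cases "r \<ge> 0")
    case True thus ?thesis by (rule sublinear_scale[OF q])
  next
    case False
    hence "q ((-r) *\<^sub>R x) = (-r) * q x" by (intro sublinear_scale[OF q]) simp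
    thus ?thesis using neg[of "r *\<^sub>R x"] by simp
  qed
  thus ?thesis by (intro linearI) (auto simp: add)
qed

text \<open>Zorn's lemma is applied below \<open>tilt p x0\<close> and not below \<open>p\<close>:
  every functional there is at most \<open>- p x0\<close> at \<open>- x0\<close>, and for a linear
  one this forces the equality at \<open>x0\<close>.\<close>

theorem hahn_banach:
  fixes p :: "'a::real_vector => real"
  assumes p: "sublinear p"
  obtains g where "linear g" "!!x. g x \<le> p x" "g x0 = p x0"
proof -
  define A where "A = {q. sublinear q \<and> q \<le> tilt p x0}"
  have tA: "tilt p x0 \<in> A" by (simp add: A_def sublinear_tilt[OF p])
  have "\<exists>m\<in>A. \<forall>a\<in>A. m \<ge> a --> a = m"
  proof (rule predicate_Zorn)
    show "partial_order_on A (relation_of (\<lambda>x y. x \<ge> y) A)"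
      by (auto simp: partial_order_on_def preorder_on_def refl_on_def relation_of_def trans_def
          antisym_def)
  next
    fix C assume "C \<in> Chains (relation_of (\<lambda>x y. x \<ge> y) A)"
    hence C: "C \<subseteq> A" "!!a b. a \<in> C ==> b \<in> C ==> a \<le> b \<or> b \<le> a" unfolding Chains_def relation_of_def by auto
    show "\<exists>u\<in>A. \<forall>a\<in>C. a \<ge> u"
    proof (cases "C = {}")
      case True thus ?thesis using tA by blast
    next
      case False
      then obtain c0 where c0: "c0 \<in> C" by blast
      define u where "u x = (INF q\<in>C. q x)" for x
      have bdd: "bdd_below ((\<lambda>q. q x) ` C)" for x
      \<comment> \<open>Every member of the chain is below \<open>tilt p x0\<close>, so
        \<open>sublinear_minus\<close> bounds all values at \<open>x\<close> from below by the same
        number.\<close>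
      proof (rule bdd_belowI2[of _ "- tilt p x0 (- x)"])
        fix q assume "q \<in> C"
        hence "sublinear q" "q \<le> tilt p x0" using C(1) by (auto simp: A_def)
        thus "- tilt p x0 (- x) \<le> q x" using sublinear_minus[of q x] by (smt (verit) le_funD)
      qed
      have ul: "u x \<le> q x" if "q \<in> C" for q x unfolding u_def by (rule cINF_lower[OF bdd that])
      have ug: "c \<le> u x" if "!!q. q \<in> C ==> c \<le> q x" for c x unfolding u_def using False that by (rule cINF_greatest)
      have sl: "sublinear q" if "q \<in> C" for q using that C(1) by (auto simp: A_def)
      have "sublinear u"
      proof (rule sublinearI)
        fix x y
        have "u (x + y) - q1 x \<le> u y" if q1: "q1 \<in> C" for q1
        proof (rule ug)
          fix q2 assume q2: "q2 \<in> C"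
          \<comment> \<open>Subadditivity survives the infimum because two members of a chain have a
            member below both.\<close>
          obtain q where q: "q \<in> C" "q \<le> q1" "q \<le> q2" using C(2)[OF q1 q2] q1 q2 by blast
          have "u (x + y) \<le> q x + q y" using ul[OF q(1)] sublinear_add[OF sl[OF q(1)]] order_trans by blast
          also have "\<dots> \<le> q1 x + q2 y" using q by (intro add_mono) (auto simp: le_fun_def)
          finally show "u (x + y) - q1 x \<le> q2 y" by simp
        qed
        hence "u (x + y) - u y \<le> u x" by (intro ug) (simp add: algebra_simps)
        thus "u (x + y) \<le> u x + u y" by simp
      next
        have "q 0 = 0" if "q \<in> C" for q using sublinear_0[OF sl[OF that]] .
        hence "0 \<le> u 0" by (auto intro!: ug simp: order.eq_iff)
        moreover have "u 0 \<le> 0" using ul[OF c0, of 0] sublinear_0[OF sl[OF c0]] by simp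
        ultimately show "u 0 = 0" by simp
      next
        have le: "r * u x \<le> u (r *\<^sub>R x)" if r: "r > 0" for r x
        proof (rule ug)
          fix q assume q: "q \<in> C"
          have "r * u x \<le> r * q x" using ul[OF q] r by simp
          thus "r * u x \<le> q (r *\<^sub>R x)" using sublinear_scale[OF sl[OF q], of r x] r by simp
        qed
        fix r :: real and x assume r: "r > 0"
        have "inverse r * u (r *\<^sub>R x) \<le> u x" using le[of "inverse r" "r *\<^sub>R x"] r by simp
        hence "u (r *\<^sub>R x) \<le> r * u x" using r by (simp add: field_simps)
        with le[OF r] show "u (r *\<^sub>R x) = r * u x" by (simp add: antisym)
      qed
      moreover have "u \<le> tilt p x0" using ul[OF c0] c0 C(1) by (auto simp: A_def le_fun_def intro: order_trans)
      ultimately show ?thesis using ul by (auto simp: A_def le_fun_def)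
    qed
  qed
  then obtain g where g: "g \<in> A" "!!a. a \<in> A ==> a \<le> g ==> a = g" by blast
  have lin: "linear g" using g by (intro minimal_sublinear_linear) (auto simp: A_def)
  have le: "g x \<le> tilt p x0 x" for x using g(1) by (auto simp: A_def le_fun_def)
  have "g (- x0) \<le> - p x0" using le[of "- x0"] tilt_le[OF p, of 1 x0 "- x0"] sublinear_0[OF p] by simp
  hence "g x0 \<ge> p x0" using linear_neg[OF lin, of x0] by simp
  moreover have "g x \<le> p x" for x using le[of x] tilt_le_self[OF p, of x0 x] by simp
  ultimately show ?thesis using lin that by (metis order_antisym)
qed

section \<open>Linear algebra over the scalars\<close>

locale kspace =
  fixes s :: "'k :: {real_normed_field, euclidean_space} => 'm :: real_normed_vector => 'm"
  assumes normed_scale: "normed_scale s"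
begin

sublocale vector_space s using normed_scale by (simp add: normed_scale_def)

lemma scale_real: "s (of_real r) x = r *\<^sub>R x"
  and norm_scale: "norm (s c x) = norm c * norm x" using normed_scale by (auto simp: normed_scale_def)

lemma scale_scaleR: "s c (r *\<^sub>R x) = r *\<^sub>R s c x" "s (r *\<^sub>R c) x = r *\<^sub>R s c x"
  by (metis scale_left_commute scale_real, metis scale_scale scale_real scaleR_conv_of_real)

text \<open>Bilinearity is meant over the reals; it gives access to the limit rules for real bounded
  bilinear maps.\<close>

lemma bounded_bilinear_scale: "bounded_bilinear s"
  by standard (auto simp: scale_left_distrib scale_right_distrib scale_scaleR norm_scale
      intro!: exI[of _ 1])

lemma infdist_scale:
  assumes S: "subspace S" and r: "c \<noteq> 0"
  shows "infdist (s c x) S = norm c * infdist x S"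
proof -
  have le: "infdist (s c x) S \<le> norm c * infdist x S" if c: "c \<noteq> 0" for c x
  proof -
    have ne: "S \<noteq> {}" using S subspace_0 by blast
    have "infdist (s c x) S / norm c \<le> dist x y" if "y \<in> S" for y
    proof -
      have "infdist (s c x) S \<le> dist (s c x) (s c y)" using that S by (intro infdist_le) (simp add: subspace_scale)
      also have "\<dots> = norm c * dist x y" by (simp add: dist_norm norm_scale flip: scale_right_diff_distrib)
      finally show ?thesis using c by (simp add: field_simps)
    qed
    hence "infdist (s c x) S / norm c \<le> infdist x S" unfolding infdist_notempty[OF ne] using ne by (intro cINF_greatest) auto
    thus ?thesis using c by (simp add: field_simps)
  qed
  have "infdist x S \<le> norm (inverse c) * infdist (s c x) S" using le[of "inverse c" "s c x"] r by simp
  hence "norm c * infdist x S \<le> infdist (s c x) S" using r by (simp add: norm_inverse norm_divide field_simps)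
  thus ?thesis using le[OF r, of x] by simp
qed

end

text \<open>Operators are real bounded linear maps, and linearity over \<K> is kept as a separate
  property. Norm, completeness and limits are thus those of the real operator space.\<close>

definition klin :: "('k => 'm => 'm) => ('k => 'n => 'n) => ('m::real_normed_vector \<Rightarrow>\<^sub>L 'n::real_normed_vector) => bool"
  where "klin s t A \<longleftrightarrow> (\<forall>c x. A (s c x) = t c (A x))"

lemma (in kspace) klin_id: "klin s s id_blinfun" by (simp add: klin_def)

lemma (in kspace) sublinear_infdist:
  assumes S: "subspace S"
  shows "sublinear (\<lambda>x. infdist x S)"
proof (rule sublinearI)
  have ne: "S \<noteq> {}" using S subspace_0 by blast
  fix x y
  have "infdist (x + y) S - dist x a \<le> dist y b" if "a \<in> S" "b \<in> S" for a b
  proof -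
    have "infdist (x + y) S \<le> dist (x + y) (a + b)" using that S by (intro infdist_le) (simp add: subspace_add)
    also have "\<dots> \<le> dist x a + dist y b" by (simp add: dist_triangle_add)
    finally show ?thesis by simp
  qed
  hence "infdist (x + y) S - dist x a \<le> infdist y S" if "a \<in> S" for a
    unfolding infdist_notempty[OF ne, of y] using ne that by (intro cINF_greatest) auto
  hence "infdist (x + y) S - infdist y S \<le> infdist x S"
    unfolding infdist_notempty[OF ne, of x] using ne by (intro cINF_greatest) (auto simp: algebra_simps)
  thus "infdist (x + y) S \<le> infdist x S + infdist y S" by simp
next
  show "infdist 0 S = 0" using subspace_0[OF S] by simp
next
  fix r :: real and x assume "r > 0"
  thus "infdist (r *\<^sub>R x) S = r * infdist x S" using infdist_scale[OF S, of "of_real r" x] by (simp add: scale_real)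
qed

text \<open>The distance to \<open>S\<close> is the seminorm of the quotient by \<open>S\<close>. A
  linear functional below it vanishes on \<open>S\<close> and is bounded by the norm; its value at
  \<open>x0\<close> can be made equal to the distance, which is positive because \<open>S\<close> is
  closed.\<close>

theorem (in kspace) functional_extension:
  assumes S: "subspace S" "closed S" and x0: "x0 \<notin> S"
  obtains f :: "'m \<Rightarrow>\<^sub>L 'k" where "klin s (*) f" "!!y. y \<in> S ==> f y = 0" "f x0 = 1"
proof -
  obtain g where lin: "linear g" and g_le: "!!x. g x \<le> infdist x S" and g0: "g x0 = infdist x0 S"
    using hahn_banach[OF sublinear_infdist[OF S(1)]] by metis
  have ne: "S \<noteq> {}" using subspace_0[OF S(1)] by blast
  have g0pos: "g x0 > 0" using S x0 g0 infdist_nonneg[of x0 S] in_closed_iff_infdist_zero[OF S(2) ne] by (auto simp: less_le)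
  have gS: "g y = 0" if "y \<in> S" for y
  proof -
    have "- y \<in> S" using S(1) that subspace_neg by blast
    thus ?thesis using g_le[of y] g_le[of "-y"] that linear_neg[OF lin, of y] by simp
  qed
  have g_abs: "\<bar>g x\<bar> \<le> norm x" for x
  proof -
    have "infdist z S \<le> norm z" for z using infdist_le[OF subspace_0[OF S(1)], of z] by simp
    thus ?thesis using g_le[of x] g_le[of "-x"] linear_neg[OF lin, of x] by (metis abs_leI norm_minus_cancel order_trans)
  qed
  note gl = linear_add[OF lin] linear_scale[OF lin] linear_neg[OF lin] linear_0[OF lin]
  \<comment> \<open>A real functional is the real part of a \<open>\<K>\<close>-linear one.\<close>
  have "\<exists>h :: 'm => 'k. bounded_linear h \<and> (\<forall>c x. h (s c x) = c * h x) \<and> (\<forall>y\<in>S. h y = 0) \<and> h x0 \<noteq> 0"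
    using scalars_real_or_complex[where 'k = 'k]
  proof
    assume re: "\<forall>z :: 'k. \<exists>a. z = of_real a"
    define h :: "'m => 'k" where "h x = of_real (g x)" for x
    have "bounded_linear h" using g_abs by (intro bounded_linear_intro[of _ 1]) (auto simp: h_def gl scaleR_conv_of_real)
    moreover have "h (s c x) = c * h x" for c x using re by (metis h_def scale_real linear_scale[OF lin] of_real_mult real_scaleR_def)
    ultimately show ?thesis using gS g0pos by (auto simp: h_def)
  next
    assume "\<exists>i :: 'k. i * i = -1 \<and> (\<forall>z. \<exists>a b. z = of_real a + of_real b * i)"
    then obtain i :: 'k where i: "i * i = -1" and dec: "!!z. \<exists>a b. z = of_real a + of_real b * i" by blast
    define h where "h x = of_real (g x) - i * of_real (g (s i x))" for x
    have ss: "s i (s i x) = - x" for x by (simp add: i)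
    have h_add: "h (x + y) = h x + h y" for x y by (simp add: h_def gl scale_right_distrib algebra_simps)
    have h_real: "h (r *\<^sub>R x) = of_real r * h x" for r x by (simp add: h_def gl scale_scaleR algebra_simps)
    have h_i: "h (s i x) = i * h x" for x
    proof -
      have "i * h x = i * of_real (g x) - (i * i) * of_real (g (s i x))" by (simp add: h_def algebra_simps)
      thus ?thesis by (simp only: h_def ss i gl) (simp add: gl)
    qed
    have h_s: "h (s c x) = c * h x" for c x
    proof -
      obtain a b where c: "c = of_real a + of_real b * i" using dec by blast
      have "s c x = a *\<^sub>R x + b *\<^sub>R s i x" by (simp add: c scale_left_distrib scale_real flip: scale_scale)
      thus ?thesis by (simp add: h_add h_real h_i c algebra_simps)
    qed
    have ni: "norm i = 1"
    proof -
      have "norm i * norm i = 1" using i by (metis norm_mult norm_minus_cancel norm_one)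
      thus ?thesis by (metis abs_norm_cancel abs_square_eq_1 power2_eq_square)
    qed
    have "norm (h x) \<le> norm x * 2" for x
    proof -
      have "norm (h x) \<le> \<bar>g x\<bar> + \<bar>g (s i x)\<bar>"
        unfolding h_def using norm_triangle_ineq4[of "of_real (g x) :: 'k" "i * of_real (g (s i x))"] by (simp add: norm_mult ni)
      also have "\<dots> \<le> norm x + norm (s i x)" using g_abs by (intro add_mono)
      finally show ?thesis by (simp add: norm_scale ni)
    qed
    hence "bounded_linear h" by (intro bounded_linear_intro[of _ 2]) (auto simp: h_add h_real scaleR_conv_of_real)
    moreover have "h y = 0" if "y \<in> S" for y using gS[OF that] gS[OF subspace_scale[OF S(1) that, of i]] by (simp add: h_def)
    moreover have "h x0 \<noteq> 0"
    proof
      \<comment> \<open>\<open>'k\<close> comes without real and imaginary parts. Squaring the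
        equation makes a sum of two real squares vanish.\<close>
      assume "h x0 = 0"
      hence eq: "of_real (g x0) = i * of_real (g (s i x0))" by (simp add: h_def)
      hence "of_real (g x0) * of_real (g x0) = (i * i) * (of_real (g (s i x0)) * of_real (g (s i x0)) :: 'k)"
        by (simp add: algebra_simps)
      hence "(of_real (g x0 * g x0 + g (s i x0) * g (s i x0)) :: 'k) = 0" by (simp add: i)
      hence "g x0 * g x0 + g (s i x0) * g (s i x0) = 0" by (simp only: of_real_eq_0_iff)
      thus False using g0pos by (simp add: add_nonneg_eq_0_iff)
    qed
    ultimately show ?thesis using h_s by blast
  qed
  then obtain h :: "'m => 'k" where h: "bounded_linear h" "!!c x. h (s c x) = c * h x" "!!y. y \<in> S ==> h y = 0" "h x0 \<noteq> 0" by blast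
  define f where "f = Blinfun (\<lambda>x. inverse (h x0) * h x)"
  have "blinfun_apply f = (\<lambda>x. inverse (h x0) * h x)"
    unfolding f_def using bounded_linear_const_mult[OF h(1)] by (rule bounded_linear_Blinfun_apply)
  thus ?thesis using h by (intro that[of f]) (auto simp: klin_def)
qed

text \<open>A functional \<open>f\<close> that vanishes on the smaller span and is 1 at the new
  vector exhibits the larger span as the preimage of the smaller one under the continuous map
  \<open>y \<mapsto> y - s (f y) x\<close>.\<close>

lemma (in kspace) closed_span_finite:
  assumes "finite B"
  shows "closed (span B)" using assms
proof induction
  case (insert x B)
  show ?case
  proof (cases "x \<in> span B")
    case True thus ?thesis using insert by (simp add: span_redundant)
  next
    case False
    then obtain f :: "'m \<Rightarrow>\<^sub>L 'k" where f: "klin s (*) f" "!!y. y \<in> span B ==> f y = 0" "f x = 1"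
      using functional_extension[OF subspace_span insert.IH] by blast
    have "y \<in> span (insert x B) \<longleftrightarrow> y - s (f y) x \<in> span B" for y
    proof
      assume "y \<in> span (insert x B)"
      then obtain k where k: "y - s k x \<in> span B" using span_breakdown_eq by blast
      have "f y = k" using f(2)[OF k] f(1,3) by (simp add: blinfun.diff_right klin_def)
      thus "y - s (f y) x \<in> span B" using k by simp
    next
      assume "y - s (f y) x \<in> span B"
      thus "y \<in> span (insert x B)" using span_breakdown_eq by blast
    qed
    hence "span (insert x B) = (\<lambda>y. y - s (f y) x) -` span B" by auto
    moreover have "continuous_on UNIV (\<lambda>y. y - s (f y) x)"
      by (intro continuous_intros bounded_bilinear.continuous_on[OF bounded_bilinear_scale])
    ultimately show ?thesis using insert.IH continuous_closed_vimage by (metis UNIV_I continuous_on_eq_continuous_at open_UNIV)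
  qed
qed simp

text \<open>Independence of a family and not of its set of values, so that a repeated entry counts
  as a dependence. Stated with coefficients, as these are what has to vary continuously later
  on.\<close>

definition lin_indep :: "('k::field => 'v::ab_group_add => 'v) => nat => (nat => 'v) => bool" where
  "lin_indep s n e \<longleftrightarrow> (\<forall>c. (\<Sum>i<n. s (c i) (e i)) = 0 --> (\<forall>i<n. c i = 0))"

lemma lin_indepD: "lin_indep s n e ==> (\<Sum>i<n. s (c i) (e i)) = 0 ==> i < n ==> c i = 0" by (auto simp: lin_indep_def)

context vector_space
begin

lemma span_image_lessThan: "span (e ` {..<n::nat}) = {\<Sum>i<n. scale (c i) (e i) |c. True}"
proof (induction n)
  case (Suc n)
  have "x \<in> span (e ` {..<Suc n}) \<longleftrightarrow> (\<exists>c. x = (\<Sum>i<Suc n. scale (c i) (e i)))" for x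
  proof -
    have "x \<in> span (e ` {..<Suc n}) \<longleftrightarrow> (\<exists>k. x - scale k (e n) \<in> span (e ` {..<n}))"
      unfolding lessThan_Suc image_insert span_insert by (rule mem_Collect_eq)
    also have "\<dots> \<longleftrightarrow> (\<exists>k c. x - scale k (e n) = (\<Sum>i<n. scale (c i) (e i)))" unfolding Suc by blast
    also have "\<dots> \<longleftrightarrow> (\<exists>c. x = (\<Sum>i<Suc n. scale (c i) (e i)))"
    proof (rule iffI; elim exE)
      fix k c assume "x - scale k (e n) = (\<Sum>i<n. scale (c i) (e i))"
      hence "x = (\<Sum>i<Suc n. scale ((c(n := k)) i) (e i))" by (simp add: algebra_simps)
      thus "\<exists>c. x = (\<Sum>i<Suc n. scale (c i) (e i))" by blast
    next
      fix c assume "x = (\<Sum>i<Suc n. scale (c i) (e i))"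
      thus "\<exists>k c. x - scale k (e n) = (\<Sum>i<n. scale (c i) (e i))" by (intro exI[of _ "c n"] exI[of _ c]) simp
    qed
    finally show ?thesis .
  qed
  thus ?case by auto
qed simp

lemma sum_scale_single: "i < (n::nat) ==> (\<Sum>j<n. scale (if j = i then a else 0) (e j)) = scale a (e i)"
proof -
  assume i: "i < n"
  have "scale (if j = i then a else 0) (e j) = (if j = i then scale a (e j) else 0)" for j by simp
  thus ?thesis using i by (simp only:) (simp add: sum.delta)
qed

lemma lin_indep_diff:
  assumes "lin_indep scale n e" "(\<Sum>i<n. scale (c i) (e i)) = (\<Sum>i<n. scale (d i) (e i))" "i < n"
  shows "c i = d i"
proof -
  have "(\<Sum>i<n. scale (c i - d i) (e i)) = 0" using assms(2) by (simp add: scale_left_diff_distrib sum_subtractf)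
  thus ?thesis using lin_indepD[OF assms(1), of "\<lambda>i. c i - d i"] assms(3) by simp
qed

lemma lin_indep_iff: "lin_indep scale n e \<longleftrightarrow> inj_on e {..<n} \<and> independent (e ` {..<n})"
proof
  assume li: "lin_indep scale n e"
  have inj: "inj_on e {..<n}"
  proof (rule inj_onI; clarsimp)
    fix i j assume ij: "i < n" "j < n" "e i = e j"
    have "(\<Sum>k<n. scale (if k = i then 1 else 0) (e k)) = (\<Sum>k<n. scale (if k = j then 1 else 0) (e k))"
      using ij by (simp add: sum_scale_single)
    from lin_indep_diff[OF li this ij(1)] show "i = j" by (simp split: if_splits)
  qed
  have "independent (e ` {..<n})"
  proof (rule independent_if_scalars_zero)
    fix f x assume f: "(\<Sum>x\<in>e ` {..<n}. scale (f x) x) = 0" and x: "x \<in> e ` {..<n}"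
    from f have "(\<Sum>i<n. scale (f (e i)) (e i)) = 0" by (simp add: sum.reindex[OF inj])
    from lin_indepD[OF li, of "\<lambda>i. f (e i)", OF this] x show "f x = 0" by auto
  qed simp
  with inj show "inj_on e {..<n} \<and> independent (e ` {..<n})" by blast
next
  assume *: "inj_on e {..<n} \<and> independent (e ` {..<n})"
  show "lin_indep scale n e" unfolding lin_indep_def
  proof (intro allI impI)
    fix c i assume c: "(\<Sum>i<n. scale (c i) (e i)) = 0" and i: "i < n"
    define f where "f x = c (inv_into {..<n} e x)" for x
    have fe: "f (e i) = c i" if "i < n" for i using * that by (simp add: f_def inv_into_f_f)
    have "(\<Sum>x\<in>e ` {..<n}. scale (f x) x) = 0" using c fe by (simp add: sum.reindex[OF conjunct1[OF *]])
    moreover have "finite (e ` {..<n})" by simp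
    ultimately have "\<forall>x\<in>e ` {..<n}. f x = 0" using * unfolding independent_explicit_finite_subsets by blast
    hence "f (e i) = 0" using i by simp
    thus "c i = 0" using fe[OF i] by simp
  qed
qed

lemma is_basis_iff: "is_basis scale V n e \<longleftrightarrow> lin_indep scale n e \<and> V = {\<Sum>i<n. scale (c i) (e i) |c. True}"
  unfolding is_basis_def lin_indep_iff span_image_lessThan by (simp only: conj_assoc eq_commute[of V])

lemma is_basis_subspace: "is_basis scale V n e ==> subspace V" unfolding is_basis_def by (metis subspace_span)

lemma is_basis_dim: "is_basis scale V n e ==> dim V = n" unfolding is_basis_def
  by (elim conjE, drule sym) (simp only: dim_span_eq_card_independent card_image card_lessThan simp_thms)

lemma is_basis_fin_dim: "is_basis scale V n e ==> fin_dim scale V"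
  unfolding is_basis_def fin_dim_def by (metis finite_imageI finite_lessThan)

lemma fin_dim_basis:
  assumes "subspace V" "V \<subseteq> span B" "finite B"
  obtains n e where "is_basis scale V n e"
proof -
  obtain C where C: "C \<subseteq> V" "independent C" "V \<subseteq> span C" "card C = dim V" using basis_exists by blast
  have "finite C" using independent_span_bound[OF assms(3) C(2)] C(1) assms(2) by blast
  then obtain e where e: "bij_betw e {..<card C} C" using ex_bij_betw_nat_finite[of C] by (auto simp: atLeast0LessThan)
  have "span C = V" using C assms(1) span_minimal by blast
  hence "is_basis scale V (card C) e" unfolding is_basis_def using e C(2) by (auto simp: bij_betw_def)
  thus ?thesis using that by blast
qed

lemma fin_dim_basis':
  assumes "fin_dim scale V"
  obtains n e where "is_basis scale V n e"
proof -
  obtain B where "finite B" "V = span B" using assms by (auto simp: fin_dim_def)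
  hence "subspace V" "V \<subseteq> span B" "finite B" by auto
  thus ?thesis using fin_dim_basis that by metis
qed

text \<open>The basis is extracted by indices, so that the same selection can be applied to a family
  that varies over a base.\<close>

lemma lin_indep_extract:
  fixes n :: nat
  obtains r idx where "!!i. i < r ==> idx i < n" "lin_indep scale r (e \<circ> idx)"
    "{\<Sum>i<r. scale (c i) (e (idx i)) |c. True} = {\<Sum>i<n. scale (c i) (e i) |c. True}"
proof -
  obtain C where C: "C \<subseteq> e ` {..<n}" "independent C" "e ` {..<n} \<subseteq> span C" using maximal_independent_subset by blast
  have fC: "finite C" by (rule finite_subset[OF C(1)]) simp
  then obtain f where f: "bij_betw f {..<card C} C" using ex_bij_betw_nat_finite[of C] by (auto simp: atLeast0LessThan)
  have "\<exists>j<n. e j = f i" if "i < card C" for i using f that C(1) by (fastforce simp: bij_betw_def)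
  then obtain idx where idx: "!!i. i < card C ==> idx i < n \<and> e (idx i) = f i" by metis
  have eq: "(e \<circ> idx) ` {..<card C} = C" "inj_on (e \<circ> idx) {..<card C}" using f idx by (auto simp: bij_betw_def inj_on_def)
  have "span C = span (e ` {..<n})" using C by (metis span_minimal span_mono subspace_span subset_antisym)
  hence "{\<Sum>i<card C. scale (c i) (e (idx i)) |c. True} = {\<Sum>i<n. scale (c i) (e i) |c. True}"
    unfolding span_image_lessThan[of "\<lambda>i. e (idx i)", symmetric] span_image_lessThan[of e, symmetric]
    using eq(1) by (simp add: comp_def)
  moreover have "lin_indep scale (card C) (e \<circ> idx)" using C(2) eq by (simp add: lin_indep_iff)
  ultimately show ?thesis using idx by (intro that[of "card C" idx]) auto
qed

end

text \<open>Each \<open>e i\<close> is separated by Hahn--Banach from the span of the remaining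
  vectors, which is closed.\<close>

lemma (in kspace) dual_functionals:
  assumes "lin_indep s d e"
  obtains \<phi> :: "nat => 'm \<Rightarrow>\<^sub>L 'k"
  where "!!i. i < d ==> klin s (*) (\<phi> i)" "!!i j. i < d ==> j < d ==> \<phi> i (e j) = (if i = j then 1 else 0)"
proof -
  have "\<exists>f :: 'm \<Rightarrow>\<^sub>L 'k. klin s (*) f \<and> (\<forall>j<d. f (e j) = (if i = j then 1 else 0))" if i: "i < d" for i
  proof -
    have ind: "inj_on e {..<d}" "independent (e ` {..<d})" using assms lin_indep_iff by auto
    define S where "S = span (e ` ({..<d} - {i}))"
    have "e ` ({..<d} - {i}) = e ` {..<d} - {e i}" using ind(1) i by (auto simp: inj_on_def)
    hence "e i \<notin> S" using ind(2) i unfolding S_def dependent_def by auto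
    then obtain f :: "'m \<Rightarrow>\<^sub>L 'k" where "klin s (*) f" "!!y. y \<in> S ==> f y = 0" "f (e i) = 1"
      using functional_extension[of S "e i"] closed_span_finite unfolding S_def by auto
    moreover have "e j \<in> S" if "j < d" "j \<noteq> i" for j unfolding S_def using that by (intro span_base) auto
    ultimately show ?thesis by (intro exI[of _ f]) auto
  qed
  then obtain \<phi> :: "nat => 'm \<Rightarrow>\<^sub>L 'k" where "!!i. i < d ==> klin s (*) (\<phi> i) \<and> (\<forall>j<d. \<phi> i (e j) = (if i = j then 1 else 0))" by metis
  thus ?thesis using that by metis
qed

section \<open>Invertible bounded operators\<close>

text \<open>The open mapping theorem for bijections. By Baire the closure of the image of some ball
  has an interior point; this gives approximate solutions of norm at most \<open>M * norm y\<close>,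
  and repeated correction of the error turns them into exact ones.\<close>

theorem bounded_inverse:
  fixes T :: "'a::banach \<Rightarrow>\<^sub>L 'b::banach"
  assumes bij: "bij (blinfun_apply T)"
  shows "\<exists>S :: 'b \<Rightarrow>\<^sub>L 'a. (\<forall>x. S (T x) = x) \<and> (\<forall>y. T (S y) = y)"
proof -
  define C where "C n = closure (T ` ball 0 (real n))" for n
  have "\<exists>n. interior (C n) \<noteq> {}"
  proof (rule ccontr)
    assume "\<not> ?thesis"
    hence "(euclidean :: 'b topology) interior_of \<Union>(range C) = {}" by (intro Baire_category_alt disjI1)
        (auto simp: completely_metrizable_space_euclidean C_def)
    moreover have "\<Union>(range C) = UNIV"
    proof -
      have "y \<in> \<Union>(range C)" for y
      proof -
        obtain x where x: "y = T x" using bij by (metis bij_pointE)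
        obtain n where "norm x < real n" using reals_Archimedean2 by blast
        hence "y \<in> T ` ball 0 (real n)" using x by auto
        hence "y \<in> C n" unfolding C_def by (rule subsetD[OF closure_subset])
        thus ?thesis by (rule UN_I[OF UNIV_I])
      qed
      thus ?thesis by auto
    qed
    ultimately show False by simp
  qed
  then obtain n y0 where "y0 \<in> interior (C n)" by blast
  then obtain \<epsilon> where \<epsilon>: "\<epsilon> > 0" "cball y0 \<epsilon> \<subseteq> C n" by (meson mem_interior_cball)
  \<comment> \<open>The centre \<open>y0\<close> is removed by taking the difference of two
    approximants from the ball of radius \<open>n\<close>, hence \<open>2 * n\<close>; the target is
    first rescaled to norm \<epsilon>, hence the denominator.\<close>
  define M where "M = 2 * real n / \<epsilon>"
  have approx: "\<exists>x. norm x \<le> M * norm y \<and> norm (y - T x) < \<delta>" if \<delta>: "\<delta> > 0" for y \<delta>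
  proof (cases "y = 0")
    case True thus ?thesis using \<delta> by (intro exI[of _ 0]) auto
  next
    case y: False
    define r where "r = \<epsilon> / norm y"
    have r: "r > 0" "r * norm y = \<epsilon>" using \<epsilon> y by (auto simp: r_def)
    have "y0 + r *\<^sub>R y \<in> C n" "y0 \<in> C n" using \<epsilon> r by (auto simp: dist_norm subset_iff)
    moreover have "\<exists>a\<in>ball 0 (real n). dist (T a) z < r * \<delta> / 2" if "z \<in> C n" for z
    proof -
      have "r * \<delta> / 2 > 0" using r \<delta> by simp
      thus ?thesis using that unfolding C_def closure_approachable by fast
    qed
    ultimately obtain a b where ab: "a \<in> ball 0 (real n)" "dist (T a) (y0 + r *\<^sub>R y) < r * \<delta> / 2"
      "b \<in> ball 0 (real n)" "dist (T b) y0 < r * \<delta> / 2" by metis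
    define x where "x = inverse r *\<^sub>R (a - b)"
    have "norm (a - b) \<le> 2 * real n" using ab norm_triangle_ineq4[of a b] by (simp add: dist_norm)
    hence "norm x \<le> inverse r * (2 * real n)" using r by (simp add: x_def mult_left_mono)
    also have "\<dots> = M * norm y" by (simp add: M_def r_def field_simps)
    finally have nx: "norm x \<le> M * norm y" .
    have "r *\<^sub>R (y - T x) = (y0 + r *\<^sub>R y - T a) - (y0 - T b)" using r by (simp add: x_def blinfun.bilinear_simps algebra_simps)
    hence "r * norm (y - T x) = norm ((y0 + r *\<^sub>R y - T a) - (y0 - T b))" using r by (metis abs_of_pos norm_scaleR)
    also have "\<dots> \<le> norm (y0 + r *\<^sub>R y - T a) + norm (y0 - T b)" by (rule norm_triangle_ineq4)
    also have "\<dots> < r * \<delta> / 2 + r * \<delta> / 2" using ab by (intro add_strict_mono) (auto simp: dist_norm norm_minus_commute)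
    finally have "norm (y - T x) < \<delta>" using r by simp
    thus ?thesis using nx by blast
  qed
  have M0: "M \<ge> 0" using \<epsilon> by (simp add: M_def)
  have bound: "\<exists>x. T x = y \<and> norm x \<le> 2 * M * norm y" if y: "y \<noteq> 0" for y
  proof -
    \<comment> \<open>The \<open>k\<close>-th correction leaves an error below
      \<open>norm y / 2 ^ Suc k\<close>. The corrections are therefore dominated by
      \<open>M * norm y / 2 ^ k\<close> and add up to at most \<open>2 * M * norm y\<close>.\<close>
    define P where "P = (\<lambda>k z x. norm x \<le> M * norm z \<and> norm (z - T x) < norm y / 2 ^ Suc k)"
    have "\<exists>x. P k z x" for k z unfolding P_def using approx[of "norm y / 2 ^ Suc k" z] y by simp
    then obtain f where f: "!!k z. P k z (f k z)" by metis
    define z where "z = rec_nat y (\<lambda>k z. z - T (f k z))"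
    have z0: "z 0 = y" and zS: "z (Suc k) = z k - T (f k (z k))" for k by (auto simp: z_def)
    define x where "x k = f k (z k)" for k
    have nz: "norm (z k) \<le> norm y / 2 ^ k" for k
    proof (cases k)
      case (Suc j) thus ?thesis using f[of j "z j"] by (simp add: zS P_def less_imp_le)
    qed (simp add: z0)
    have nx: "norm (x k) \<le> M * norm y * (1/2) ^ k" for k
    proof -
      have "norm (x k) \<le> M * norm (z k)" using f by (simp add: P_def x_def)
      also have "\<dots> \<le> M * (norm y / 2 ^ k)" using nz M0 by (intro mult_left_mono)
      finally show ?thesis by (simp add: power_divide)
    qed
    have geo: "summable (\<lambda>k. M * norm y * (1/2) ^ k)" by (intro summable_mult summable_geometric) simp
    have sm: "summable (\<lambda>k. norm (x k))" by (rule summable_comparison_test[OF _ geo]) (use nx in auto)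
    hence sx: "summable x" by (rule summable_norm_cancel)
    have "norm (suminf x) \<le> (\<Sum>k. norm (x k))" by (rule summable_norm[OF sm])
    also have "\<dots> \<le> (\<Sum>k. M * norm y * (1/2) ^ k)" by (rule suminf_le[OF nx sm geo])
    also have "\<dots> = 2 * M * norm y" by (subst suminf_mult) (auto simp: suminf_geometric intro!: summable_geometric)
    finally have nb: "norm (suminf x) \<le> 2 * M * norm y" .
    have part: "T (\<Sum>k<n. x k) = y - z n" for n by (induction n) (auto simp: z0 zS x_def blinfun.bilinear_simps)
    have "(\<lambda>n. T (\<Sum>k<n. x k)) \<longlonglongrightarrow> T (suminf x)" using summable_LIMSEQ[OF sx] by (intro tendsto_intros)
    moreover have "z \<longlonglongrightarrow> 0"
    proof (rule Lim_null_comparison)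
      show "\<forall>\<^sub>F k in sequentially. norm (z k) \<le> norm y * (1/2) ^ k" using nz by (simp add: power_divide)
      show "(\<lambda>k. norm y * (1/2) ^ k) \<longlonglongrightarrow> 0" by (rule tendsto_mult_right_zero) (intro LIMSEQ_power_zero, simp)
    qed
    hence "(\<lambda>n. T (\<Sum>k<n. x k)) \<longlonglongrightarrow> y - 0" unfolding part by (intro tendsto_intros)
    ultimately have "T (suminf x) = y" using LIMSEQ_unique by fastforce
    thus ?thesis using nb by blast
  qed
  define g where "g = inv_into UNIV (blinfun_apply T)"
  have Tg: "T (g y) = y" and gT: "g (T x) = x" for x y using bij by (auto simp: g_def bij_def surj_f_inv_f)
  have "norm (g y) \<le> norm y * (2 * M)" for y
  proof (cases "y = 0")
    case True
    thus ?thesis using gT[of 0] by simp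
  next
    case False
    then obtain x where "T x = y" "norm x \<le> 2 * M * norm y" using bound by blast
    thus ?thesis using gT[of x] by (simp add: mult_ac)
  qed
  moreover have "g (x + y) = g x + g y" "g (r *\<^sub>R x) = r *\<^sub>R g x" for x y r
    using gT[of "g x + g y"] gT[of "r *\<^sub>R g x"] by (simp_all add: blinfun.bilinear_simps Tg)
  ultimately have "bounded_linear g" by (intro bounded_linear_intro[of g "2 * M"]) auto
  hence "blinfun_apply (Blinfun g) = g" by (rule bounded_linear_Blinfun_apply)
  thus ?thesis using Tg gT by (intro exI[of _ "Blinfun g"]) auto
qed

text \<open>Unspecified unless \<open>T\<close> is bijective. Being a function of \<open>T\<close>
  alone, it can be applied to families of operators.\<close>

definition binv :: "('a::banach \<Rightarrow>\<^sub>L 'b::banach) => ('b \<Rightarrow>\<^sub>L 'a)" where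
  "binv T = (SOME S. (\<forall>x. blinfun_apply S (T x) = x) \<and> (\<forall>y. T (S y) = y))"

lemma
  assumes "bij (blinfun_apply T)"
  shows binv_left: "binv T (T x) = x" and binv_right: "T (binv T y) = y"
  using someI_ex[OF bounded_inverse[OF assms]] unfolding binv_def by auto

text \<open>With \<open>S\<close> the inverse of \<open>T0\<close>, the equation
  \<open>T x = y\<close> is the fixed point problem for
  \<open>x \<mapsto> S (y - (T - T0) x)\<close>, and 1/2 is its contraction constant. The estimate
  follows from the resolvent identity and from
  \<open>norm (binv T) \<le> 2 * norm S\<close>.\<close>

lemma bij_perturb:
  fixes T0 :: "'a::banach \<Rightarrow>\<^sub>L 'b::banach"
  assumes bij: "bij (blinfun_apply T0)" and small: "norm (binv T0) * norm (T - T0) \<le> 1/2"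
  shows "bij (blinfun_apply T)" and "norm (binv T - binv T0) \<le> 2 * (norm (binv T0))\<^sup>2 * norm (T - T0)"
proof -
  let ?S = "binv T0"
  have "\<exists>!x. T x = y" for y
  proof -
    have "T x = y \<longleftrightarrow> ?S (y - (T - T0) x) = x" for x
    proof -
      have "?S (y - (T - T0) x) = x \<longleftrightarrow> y - (T - T0) x = T0 x" using binv_left[OF bij] binv_right[OF bij] by metis
      thus ?thesis by (auto simp: blinfun.bilinear_simps)
    qed
    moreover have "\<exists>!x. ?S (y - (T - T0) x) = x"
    proof (rule banach_fix_type[of "1/2"])
      show "\<forall>x x'. dist (?S (y - (T - T0) x)) (?S (y - (T - T0) x')) \<le> 1/2 * dist x x'"
      proof (intro allI)
        fix x x'
        have "?S (y - (T - T0) x) - ?S (y - (T - T0) x') = ?S ((T - T0) (x' - x))" by (simp add: blinfun.bilinear_simps)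
        hence "dist (?S (y - (T - T0) x)) (?S (y - (T - T0) x')) \<le> norm ?S * norm ((T - T0) (x' - x))"
          by (simp add: dist_norm norm_blinfun)
        also have "\<dots> \<le> norm ?S * (norm (T - T0) * norm (x' - x))" by (intro mult_left_mono norm_blinfun) auto
        also have "\<dots> \<le> 1/2 * norm (x' - x)" using mult_right_mono[OF small, of "norm (x' - x)"] by (simp add: mult_ac)
        finally show "dist (?S (y - (T - T0) x)) (?S (y - (T - T0) x')) \<le> 1/2 * dist x x'" by (simp add: dist_norm norm_minus_commute)
      qed
    qed auto
    ultimately show ?thesis by simp
  qed
  thus bijT: "bij (blinfun_apply T)" by (metis bijI injI surjI)
  have eq: "binv T - ?S = - (binv T o\<^sub>L ((T - T0) o\<^sub>L ?S))"
    by (rule blinfun_eqI) (simp add: blinfun.bilinear_simps binv_left[OF bijT] binv_right[OF bij])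
  have n1: "norm (binv T - ?S) \<le> norm (binv T) * (norm (T - T0) * norm ?S)" unfolding eq norm_minus_cancel
    by (intro order_trans[OF norm_blinfun_compose] mult_left_mono norm_blinfun_compose norm_ge_zero)
  also have "\<dots> \<le> norm (binv T) * (1/2)" using small by (intro mult_left_mono) (auto simp: mult.commute)
  finally have "norm (binv T) \<le> 2 * norm ?S" using norm_triangle_ineq2[of "binv T" ?S] by simp
  with n1 have "norm (binv T - ?S) \<le> (2 * norm ?S) * (norm (T - T0) * norm ?S)"
    by (meson mult_right_mono mult_nonneg_nonneg norm_ge_zero order_trans)
  thus "norm (binv T - ?S) \<le> 2 * (norm ?S)\<^sup>2 * norm (T - T0)" by (simp add: power2_eq_square mult_ac)
qed

lemma
  fixes T0 :: "'a::banach \<Rightarrow>\<^sub>L 'b::banach"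
  assumes bij: "bij (blinfun_apply T0)" and f: "(f \<longlongrightarrow> T0) F"
  shows eventually_bij: "eventually (\<lambda>x. bij (blinfun_apply (f x))) F"
    and tendsto_binv: "((\<lambda>x. binv (f x)) \<longlongrightarrow> binv T0) F"
proof -
  let ?S = "norm (binv T0)"
  have *: "((\<lambda>x. ?S * norm (f x - T0)) \<longlongrightarrow> ?S * norm (T0 - T0)) F" by (intro tendsto_intros f)
  hence ev: "eventually (\<lambda>x. ?S * norm (f x - T0) \<le> 1/2) F" by (rule eventually_mono[OF order_tendstoD(2)[of _ _ _ "1/2"]]) auto
  show "eventually (\<lambda>x. bij (blinfun_apply (f x))) F" using ev by eventually_elim (rule bij_perturb(1)[OF bij])
  have "((\<lambda>x. 2 * ?S\<^sup>2 * norm (f x - T0)) \<longlongrightarrow> 2 * ?S\<^sup>2 * norm (T0 - T0)) F" by (intro tendsto_intros f)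
  hence "((\<lambda>x. 2 * ?S\<^sup>2 * norm (f x - T0)) \<longlongrightarrow> 0) F" by simp
  moreover have "eventually (\<lambda>x. norm (binv (f x) - binv T0) \<le> 2 * ?S\<^sup>2 * norm (f x - T0)) F"
    using ev by eventually_elim (rule bij_perturb(2)[OF bij])
  ultimately have "((\<lambda>x. binv (f x) - binv T0) \<longlongrightarrow> 0) F" by (rule Lim_null_comparison[rotated])
  thus "((\<lambda>x. binv (f x)) \<longlongrightarrow> binv T0) F" by (simp add: LIM_zero_iff)
qed

section \<open>Continuity on open subsets\<close>

text \<open>The limit is taken along all of \<open>X\<close>. For open \<open>U\<close> this is
  continuity of the restriction (\<open>conton_iff\<close>); it passes to subsets at once, and the
  limit rules for filters apply pointwise.\<close>

definition conton :: "'b topology => 'b set => ('b => 'a::topological_space) => bool" where "conton X U f \<longleftrightarrow> (\<forall>p\<in>U. (f \<longlongrightarrow> f p) (atin X p))"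

lemma contonD: "conton X U f ==> p \<in> U ==> (f \<longlongrightarrow> f p) (atin X p)" by (auto simp: conton_def)

lemma eventually_atin_open: "openin X U ==> p \<in> U ==> eventually (\<lambda>q. q \<in> U) (atin X p)" by (auto simp: eventually_atin)

lemma atin_within_open:
  assumes "openin X U" "p \<in> U"
  shows "atin_within X p U = atin X p"
proof (rule filter_eqI)
  fix P
  have "eventually (\<lambda>x. x \<in> U --> P x) (atin X p) \<longleftrightarrow> eventually P (atin X p)"
    using eventually_atin_open[OF assms] by (auto elim: eventually_elim2)
  thus "eventually P (atin_within X p U) \<longleftrightarrow> eventually P (atin X p)" by (subst eventually_within_imp)
qed

lemma conton_iff:
  assumes "openin X U"
  shows "continuous_map (subtopology X U) euclidean f \<longleftrightarrow> conton X U f" using assms openin_subset[OF assms]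
  by (auto simp: continuous_map_atin conton_def atin_subtopology_within atin_within_open)

lemma conton_topspace: "continuous_map X euclidean f \<longleftrightarrow> conton X (topspace X) f" using conton_iff[of X "topspace X" f] by simp

lemma tendsto_cong_open:
  assumes "openin X U" "p \<in> U" "!!q. q \<in> U ==> f q = g q"
  shows "(f \<longlongrightarrow> l) (atin X p) \<longleftrightarrow> (g \<longlongrightarrow> l) (atin X p)"
  using eventually_atin_open[OF assms(1,2)] assms(3) by (intro filterlim_cong refl) (auto elim: eventually_mono)

lemma conton_subset: "conton X U f ==> V \<subseteq> U ==> conton X V f" by (auto simp: conton_def)

lemma conton_local:
  assumes "!!p. p \<in> U ==> \<exists>V. openin X V \<and> p \<in> V \<and> (\<exists>g. conton X V g \<and> (\<forall>q\<in>V. f q = g q))"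
  shows "conton X U f" unfolding conton_def
proof
  fix p assume "p \<in> U"
  then obtain V g where V: "openin X V" "p \<in> V" "conton X V g" "!!q. q \<in> V ==> f q = g q" using assms by metis
  have "(g \<longlongrightarrow> f p) (atin X p)" using contonD[OF V(3,2)] V(2,4) by simp
  thus "(f \<longlongrightarrow> f p) (atin X p)" using tendsto_cong_open[OF V(1,2), of f g "f p"] V(4) by simp
qed

lemma conton_const: "conton X U (\<lambda>_. c)" by (simp add: conton_def)

lemma conton_sum:
  fixes f :: "'i => 'b => 'a::real_normed_vector"
  shows "(!!i. i \<in> I ==> conton X U (f i)) ==> conton X U (\<lambda>p. \<Sum>i\<in>I. f i p)" unfolding conton_def by (auto intro!: tendsto_sum)

lemma conton_add:
  fixes f g :: "'b => 'a::real_normed_vector"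
  shows "conton X U f ==> conton X U g ==> conton X U (\<lambda>p. f p + g p)" unfolding conton_def by (auto intro!: tendsto_add)

lemma conton_diff:
  fixes f g :: "'b => 'a::real_normed_vector"
  shows "conton X U f ==> conton X U g ==> conton X U (\<lambda>p. f p - g p)" unfolding conton_def by (auto intro!: tendsto_diff)

lemma conton_bilinear:
  assumes "bounded_bilinear B" "conton X U f" "conton X U g"
  shows "conton X U (\<lambda>p. B (f p) (g p))" using assms(2,3) unfolding conton_def by (auto intro!: bounded_bilinear.tendsto[OF assms(1)])

lemmas conton_blinfun_apply = conton_bilinear[OF bounded_bilinear_blinfun_apply]
lemmas conton_blinfun_compose = conton_bilinear[OF bounded_bilinear_blinfun_compose]
lemmas (in kspace) conton_scale = conton_bilinear[OF bounded_bilinear_scale]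
lemmas conton_mult = conton_bilinear[OF bounded_bilinear_mult]

lemma conton_compose:
  assumes f: "continuous_map X Y h" and g: "conton Y V g" and V: "openin Y V"
  shows "conton X {p \<in> topspace X. h p \<in> V} (\<lambda>p. g (h p))"
proof -
  have o: "openin X {p \<in> topspace X. h p \<in> V}" using f V by (rule openin_continuous_map_preimage)
  have "continuous_map (subtopology X {p \<in> topspace X. h p \<in> V}) (subtopology Y V) h"
    using f by (auto simp: continuous_map_in_subtopology continuous_map_from_subtopology)
  hence "continuous_map (subtopology X {p \<in> topspace X. h p \<in> V}) euclidean (g \<circ> h)"
    using g conton_iff[OF V] continuous_map_compose by blast
  thus ?thesis by (simp add: conton_iff[OF o] comp_def)
qed

section \<open>Bordered operators\<close>

text \<open>Bordering by \<open>N\<close> vectors and \<open>d\<close> functionals gives a map \<open>'m \<times> \<K>\<^sup>N \<rightarrow> 'n \<times> \<K>\<^sup>d\<close>. Since \<open>N\<close>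
  and \<open>d\<close> are not types, it is stabilised by a shift to an endomorphism of bounded sequences,
  the remaining coordinates being carried along.\<close>

instantiation nat :: metric_space
begin

definition dist_nat :: "nat => nat => real" where "dist_nat m n = \<bar>real m - real n\<bar>"

definition uniformity_nat :: "(nat \<times> nat) filter" where "uniformity_nat = (INF e\<in>{0<..}. principal {(x, y). dist x y < e})"

instance
proof
  fix U :: "nat set"
  have "\<forall>\<^sub>F (x', y) in uniformity. x' = x --> y \<in> U" if "x \<in> U" for x unfolding uniformity_nat_def
  proof (rule eventually_INF1[of 1])
    have "x' = y" if "\<bar>real x' - real y\<bar> < 1" for x' y using that by linarith
    thus "\<forall>\<^sub>F (x', y) in principal {(x, y). dist x y < (1 :: real)}. x' = x --> y \<in> U"
      using that by (auto simp: eventually_principal dist_nat_def)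
  qed simp
  thus "open U \<longleftrightarrow> (\<forall>x\<in>U. \<forall>\<^sub>F (x', y) in uniformity. x' = x --> y \<in> U)" by (auto simp: open_discrete)
qed (auto simp: dist_nat_def uniformity_nat_def)

end

text \<open>The metric on \<open>nat\<close> induces the discrete topology, so the bounded
  continuous functions on it are all bounded sequences: one Banach space that absorbs any number of
  border rows and columns.\<close>

instance bcontfun :: (metric_space, banach) banach ..

type_synonym 'k bseq = "nat \<Rightarrow>\<^sub>C 'k"

lemma bseq_mem: "(!!i. norm (f i) \<le> b) ==> (f :: nat => 'k::real_normed_vector) \<in> bcontfun" by (rule bcontfun_normI) auto

text \<open>The first \<open>N\<close> coordinates are spent as coefficients of the \<open>N\<close>
  vectors and are dropped; the first \<open>d\<close> slots of the result stay free for the values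
  of the \<open>d\<close> functionals.\<close>

definition bs_shift :: "nat => nat => 'k::real_normed_vector bseq => 'k bseq" where
  "bs_shift d N z = Bcontfun (\<lambda>j. if j < d then 0 else apply_bcontfun z (j - d + N))"

definition bs_unit :: "nat => 'k::real_normed_vector => 'k bseq" where "bs_unit j c = Bcontfun (\<lambda>i. if i = j then c else 0)"

lemma bs_shift_apply: "apply_bcontfun (bs_shift d N z) j = (if j < d then 0 else apply_bcontfun z (j - d + N))" unfolding bs_shift_def
  by (subst Bcontfun_inverse) (auto intro!: bseq_mem[of _ "norm z"] simp: norm_bounded)

lemma bs_unit_apply: "apply_bcontfun (bs_unit j c) i = (if i = j then c else 0)"
  unfolding bs_unit_def by (subst Bcontfun_inverse) (auto intro!: bseq_mem[of _ "norm c"])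

lemma bounded_linear_shift: "bounded_linear (bs_shift d N)"
proof (rule bounded_linear_intro[of _ 1])
  fix z :: "'a bseq"
  have "norm (apply_bcontfun (bs_shift d N z) j) \<le> norm z" for j by (simp add: bs_shift_apply norm_bounded)
  thus "norm (bs_shift d N z) \<le> norm z * 1" by (simp add: norm_bound)
qed (auto intro!: bcontfun_eqI simp: bs_shift_apply)

lemma bounded_linear_unit: "bounded_linear (bs_unit j)"
proof (rule bounded_linear_intro[of _ 1])
  fix c :: 'a
  have "norm (apply_bcontfun (bs_unit j c) i) \<le> norm c" for i by (simp add: bs_unit_apply)
  thus "norm (bs_unit j c) \<le> norm c * 1" by (simp add: norm_bound)
qed (auto intro!: bcontfun_eqI simp: bs_unit_apply)

lemma bounded_linear_nth: "bounded_linear (\<lambda>z :: 'k::real_normed_vector bseq. apply_bcontfun z i)"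
  by (rule bounded_linear_intro[of _ 1]) (auto simp: norm_bounded)

text \<open>Assembled from compositions of operators, in order that continuity in \<open>A\<close>,
  \<open>w\<close> and \<phi> is a matter of limit rules (\<open>tendsto_border\<close>). Its effect
  on a pair is given by \<open>border_apply\<close>.\<close>

definition border :: "('k => 'n => 'n) => nat => nat => ('m::real_normed_vector \<Rightarrow>\<^sub>L 'n::real_normed_vector) => (nat => 'n)
     => (nat => 'm \<Rightarrow>\<^sub>L 'k::real_normed_field) => ('m \<times> 'k bseq) \<Rightarrow>\<^sub>L ('n \<times> 'k bseq)" where "border t N d A w \<phi> =
     (Blinfun (\<lambda>y. (y, 0)) o\<^sub>L A o\<^sub>L fst_blinfun) + (Blinfun (\<lambda>z. (0, z)) o\<^sub>L Blinfun (bs_shift d N) o\<^sub>L snd_blinfun) +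
     (\<Sum>i<N. Blinfun (\<lambda>y. (y, 0)) o\<^sub>L (bounded_bilinear.prod_left t (w i) o\<^sub>L (Blinfun (\<lambda>z. apply_bcontfun z i) o\<^sub>L snd_blinfun))) +
     (\<Sum>j<d. Blinfun (\<lambda>z. (0, z)) o\<^sub>L Blinfun (bs_unit j) o\<^sub>L (\<phi> j o\<^sub>L fst_blinfun))"

lemma bounded_linear_inl: "bounded_linear (\<lambda>y. (y, 0))"
  and bounded_linear_inr: "bounded_linear (\<lambda>z. (0, z))" by (intro bounded_linear_Pair bounded_linear_ident bounded_linear_zero)+

lemma blinfun_sum_apply: "blinfun_apply (\<Sum>i\<in>I. f i) x = (\<Sum>i\<in>I. blinfun_apply (f i) x)"
  by (induction I rule: infinite_finite_induct) (auto simp: blinfun.bilinear_simps)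

lemma border_apply:
  assumes "bounded_bilinear t"
  shows "border t N d A w \<phi> (x, z) = (A x + (\<Sum>i<N. t (apply_bcontfun z i) (w i)), bs_shift d N z + (\<Sum>j<d. bs_unit j (\<phi> j x)))"
  unfolding border_def by (simp add: blinfun.bilinear_simps blinfun_sum_apply bounded_linear_Blinfun_apply
      bounded_linear_inl bounded_linear_inr bounded_linear_shift bounded_linear_unit
      bounded_linear_nth bounded_bilinear.prod_left.rep_eq[OF assms] sum_prod)

lemma tendsto_border:
  assumes t: "bounded_bilinear t"
    and "(A \<longlongrightarrow> A0) F" "!!i. i < N ==> ((\<lambda>y. w y i) \<longlongrightarrow> w0 i) F" "!!j. j < d ==> ((\<lambda>y. \<phi> y j) \<longlongrightarrow> \<phi>0 j) F"
  shows "((\<lambda>y. border t N d (A y) (w y) (\<phi> y)) \<longlongrightarrow> border t N d A0 w0 \<phi>0) F" unfolding border_def using assms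
  by (intro tendsto_intros bounded_linear.tendsto[OF bounded_bilinear.bounded_linear_prod_left[OF t]]) auto

text \<open>The four blocks of the inverse of the bordered system: \<open>R\<close> and \<alpha> are
  the response to \<open>v\<close>, \<open>e\<close> and \<beta> that to \<zeta>. The equivalence
  expresses existence and uniqueness at once, and the sequence space has disappeared.\<close>

definition bordered_solution ::
  "('k::field => 'm => 'm) => ('k => 'n => 'n) => nat => nat => ('m::ab_group_add => 'n::ab_group_add) => (nat => 'n)
     => (nat => 'm => 'k) => ('n => 'm) => (nat => 'm) => (nat => 'n => 'k) => (nat => nat => 'k) => bool" where
  "bordered_solution s t N d A w \<phi> R e \<alpha> \<beta> \<longleftrightarrow> (\<forall>x c v \<zeta>. (A x + (\<Sum>i<N. t (c i) (w i)) = v \<and> (\<forall>j<d. \<phi> j x = \<zeta> j)) \<longleftrightarrow>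
     (x = R v + (\<Sum>j<d. s (\<zeta> j) (e j)) \<and> (\<forall>i<N. c i = \<alpha> i v + (\<Sum>j<d. \<zeta> j * \<beta> i j))))"

text \<open>The last two conditions say that \<phi> maps the preimage under \<open>A\<close> of the
  span of \<open>w\<close> isomorphically onto \<open>\<K>^d\<close>. The first is transversality of
  this span to the image of \<open>A\<close>.\<close>

lemma border_bij:
  fixes A :: "'m::banach \<Rightarrow>\<^sub>L 'n::banach"
    and \<phi> :: "nat => 'm \<Rightarrow>\<^sub>L 'k::{real_normed_field,euclidean_space}"
    and s :: "'k => 'm => 'm" and t :: "'k => 'n => 'n"
  assumes s: "kspace s" and t: "kspace t"
    and surj: "!!v. \<exists>x c. A x + (\<Sum>i<N. t (c i) (w i)) = v"
    and indep: "lin_indep t N w"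
    and \<phi>surj: "!!\<zeta>. \<exists>x c. A x = (\<Sum>i<N. t (c i) (w i)) \<and> (\<forall>j<d. \<phi> j x = \<zeta> j)"
    and \<phi>inj: "!!x c. A x = (\<Sum>i<N. t (c i) (w i)) ==> \<forall>j<d. \<phi> j x = 0 ==> x = 0"
  shows "bij (blinfun_apply (border t N d A w \<phi>))"
proof -
  interpret s: kspace s by fact
  interpret t: kspace t by fact
  note ba = border_apply[OF t.bounded_bilinear_scale]
  have coord: "apply_bcontfun (bs_shift d N z + (\<Sum>j<d. bs_unit j (\<zeta> j))) i =
      (if i < d then \<zeta> i else apply_bcontfun z (i - d + N))" for z :: "'k bseq" and \<zeta> i
  proof -
    have "apply_bcontfun (\<Sum>j<d. bs_unit j (\<zeta> j)) i = (\<Sum>j<d. if i = j then \<zeta> j else 0)"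
      by (simp add: linear_sum[OF bounded_linear.linear[OF bounded_linear_nth]] bs_unit_apply)
    thus ?thesis by (simp add: bs_shift_apply)
  qed
  show ?thesis
  proof (rule bijI)
    show "inj (blinfun_apply (border t N d A w \<phi>))"
    proof (subst linear_injective_0[OF bounded_linear.linear[OF blinfun.bounded_linear_right]], safe)
      fix x and z :: "'k bseq" assume "border t N d A w \<phi> (x, z) = 0"
      hence eq: "A x + (\<Sum>i<N. t (apply_bcontfun z i) (w i)) = 0"
        "bs_shift d N z + (\<Sum>j<d. bs_unit j (\<phi> j x)) = 0" unfolding ba by (auto simp: zero_prod_def)
      have c0: "(if i < d then \<phi> i x else apply_bcontfun z (i - d + N)) = 0" for i using coord[of z "\<lambda>j. \<phi> j x" i] eq(2) by simp
      have "A x = (\<Sum>i<N. t (- apply_bcontfun z i) (w i))" using eq(1) by (simp add: sum_negf eq_neg_iff_add_eq_0)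
      moreover have "\<forall>j<d. \<phi> j x = 0" using c0 by metis
      ultimately have x0: "x = 0" by (rule \<phi>inj)
      hence "(\<Sum>i<N. t (apply_bcontfun z i) (w i)) = 0" using eq(1) by (simp add: blinfun.zero_right)
      hence "apply_bcontfun z i = 0" if "i < N" for i using lin_indepD[OF indep] that by metis
      moreover have "apply_bcontfun z i = 0" if "i \<ge> N" for i
      proof -
        obtain k where "i = N + k" using \<open>i \<ge> N\<close> le_Suc_ex by blast
        thus ?thesis using c0[of "k + d"] by (simp add: add.commute)
      qed
      ultimately have "z = 0" by (intro bcontfun_eqI) (metis linorder_not_le zero_bcontfun.rep_eq)
      with x0 show "(x, z) = 0" by (simp add: zero_prod_def)
    qed
    show "surj (blinfun_apply (border t N d A w \<phi>))" unfolding surj_def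
    proof (intro allI)
      fix y :: "'n \<times> 'k bseq"
      obtain v \<zeta> where y: "y = (v, \<zeta>)" by fastforce
      obtain x0 c0 where 0: "A x0 + (\<Sum>i<N. t (c0 i) (w i)) = v" using surj by blast
      \<comment> \<open>\<open>h\<close> lies in the preimage of the span of \<open>w\<close>, so it
        adjusts the functionals without spoiling the first component.\<close>
      obtain h c1 where 1: "A h = (\<Sum>i<N. t (c1 i) (w i))" "\<forall>j<d. \<phi> j h = apply_bcontfun \<zeta> j - \<phi> j x0"
        using \<phi>surj[of "\<lambda>j. apply_bcontfun \<zeta> j - \<phi> j x0"] by blast
      \<comment> \<open>The first \<open>N\<close> entries are the coefficients. The others are
        forced by the shift: entry \<open>N + k\<close> is entry \<open>d + k\<close> of
        \<zeta>.\<close>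
      define z where "z = Bcontfun (\<lambda>i. if i < N then c0 i - c1 i else apply_bcontfun \<zeta> (i - N + d))"
      have "(\<lambda>i. if i < N then c0 i - c1 i else apply_bcontfun \<zeta> (i - N + d)) \<in> bcontfun"
      proof (rule bseq_mem)
        fix i
        have "norm (c0 i - c1 i) \<le> (\<Sum>i<N. norm (c0 i - c1 i))" if "i < N" using that by (intro member_le_sum) auto
        moreover have "0 \<le> (\<Sum>i<N. norm (c0 i - c1 i))" by (intro sum_nonneg) auto
        ultimately show "norm (if i < N then c0 i - c1 i else apply_bcontfun \<zeta> (i - N + d)) \<le> (\<Sum>i<N. norm (c0 i - c1 i)) + norm \<zeta>"
          using norm_bounded[of \<zeta> "i - N + d"] norm_ge_zero[of \<zeta>] by (smt (verit))
      qed
      hence z: "apply_bcontfun z = (\<lambda>i. if i < N then c0 i - c1 i else apply_bcontfun \<zeta> (i - N + d))"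
        unfolding z_def by (rule Bcontfun_inverse)
      have "A (x0 + h) + (\<Sum>i<N. t (apply_bcontfun z i) (w i)) = v"
        using 0 1(1) by (simp add: z blinfun.bilinear_simps t.scale_left_diff_distrib sum_subtractf)
      moreover have "bs_shift d N z + (\<Sum>j<d. bs_unit j (\<phi> j (x0 + h))) = \<zeta>"
        using 1(2) by (intro bcontfun_eqI) (subst coord, auto simp: z blinfun.bilinear_simps)
      ultimately have "border t N d A w \<phi> (x0 + h, z) = (v, \<zeta>)" by (simp add: ba)
      thus "\<exists>x. y = border t N d A w \<phi> x" unfolding y by (intro exI[of _ "(x0 + h, z)"]) simp
    qed
  qed
qed

text \<open>The inverse takes sequences supported below \<open>d\<close> to sequences supported
  below \<open>N\<close>, so it restricts to the finite system.\<close>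

lemma bordered_solution_of_bij:
  fixes A :: "'m::banach \<Rightarrow>\<^sub>L 'n::banach"
    and \<phi> :: "nat => 'm \<Rightarrow>\<^sub>L 'k::{real_normed_field,euclidean_space}"
    and s :: "'k => 'm => 'm" and t :: "'k => 'n => 'n"
  assumes s: "kspace s" and t: "kspace t" and A: "klin s t A" and \<phi>: "!!j. j < d ==> klin s (*) (\<phi> j)"
    and bij: "bij (blinfun_apply (border t N d A w \<phi>))"
  shows "bordered_solution s t N d A w \<phi> (\<lambda>v. fst (binv (border t N d A w \<phi>) (v, 0)))
    (\<lambda>j. fst (binv (border t N d A w \<phi>) (0, bs_unit j 1))) (\<lambda>i v. apply_bcontfun (snd (binv (border t N d A w \<phi>) (v, 0))) i)
    (\<lambda>i j. apply_bcontfun (snd (binv (border t N d A w \<phi>) (0, bs_unit j 1))) i)"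
proof -
  interpret s: kspace s by fact
  interpret t: kspace t by fact
  let ?B = "border t N d A w \<phi>"
  note ba = border_apply[OF t.bounded_bilinear_scale]
  have nth_sum: "apply_bcontfun (\<Sum>j\<in>I. f j) i = (\<Sum>j\<in>I. apply_bcontfun (f j) i)" for I :: "nat set" and f :: "nat => 'k bseq" and i
    by (simp add: linear_sum[OF bounded_linear.linear[OF bounded_linear_nth]])
  have coord: "apply_bcontfun (bs_shift d N z + (\<Sum>j<d. bs_unit j (\<zeta> j))) i =
      (if i < d then \<zeta> i else apply_bcontfun z (i - d + N))" for z :: "'k bseq" and \<zeta> i
    by (simp add: nth_sum bs_shift_apply bs_unit_apply)
  \<comment> \<open>The embedding of \<open>\<K>^N\<close> as the sequences supported below
    \<open>N\<close>.\<close>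
  define pad where "pad c = (\<Sum>i<N. bs_unit i (c i))" for c :: "nat => 'k"
  have pad: "apply_bcontfun (pad c) i = (if i < N then c i else 0)" for c i by (simp add: pad_def nth_sum bs_unit_apply)
  have Bpad: "?B (x, pad c) = (v, \<Sum>j<d. bs_unit j (\<zeta> j)) \<longleftrightarrow>
      A x + (\<Sum>i<N. t (c i) (w i)) = v \<and> (\<forall>j<d. \<phi> j x = \<zeta> j)" for x c v \<zeta>
  proof -
    have "bs_shift d N (pad c) + (\<Sum>j<d. bs_unit j (\<phi> j x)) = (\<Sum>j<d. bs_unit j (\<zeta> j)) \<longleftrightarrow> (\<forall>j<d. \<phi> j x = \<zeta> j)" (is "?l = ?r \<longleftrightarrow> _")
    proof
      assume eq: "?l = ?r"
      have "apply_bcontfun ?l j = apply_bcontfun ?r j" for j using eq by simp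
      moreover have "apply_bcontfun ?r j = (if j < d then \<zeta> j else 0)" for j by (simp add: nth_sum bs_unit_apply)
      ultimately show "\<forall>j<d. \<phi> j x = \<zeta> j" by (metis coord)
    next
      assume "\<forall>j<d. \<phi> j x = \<zeta> j"
      thus "?l = ?r" by (intro bcontfun_eqI) (subst coord, auto simp: pad nth_sum bs_unit_apply)
    qed
    moreover have "(\<Sum>i<N. t (apply_bcontfun (pad c) i) (w i)) = (\<Sum>i<N. t (c i) (w i))" by (intro sum.cong) (auto simp: pad)
    ultimately show ?thesis by (auto simp: ba)
  qed
  define R where "R v = fst (binv ?B (v, 0))" for v
  define e where "e j = fst (binv ?B (0, bs_unit j 1))" for j define \<alpha> where "\<alpha> i v = apply_bcontfun (snd (binv ?B (v, 0))) i" for i v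
  define \<beta> where "\<beta> i j = apply_bcontfun (snd (binv ?B (0, bs_unit j 1))) i" for i j
  have ispad: "z = pad (apply_bcontfun z)" if "?B (x, z) = (v, y)" "!!i. i \<ge> d ==> apply_bcontfun y i = 0" for x z v y
  proof (rule bcontfun_eqI)
    fix i
    show "apply_bcontfun z i = apply_bcontfun (pad (apply_bcontfun z)) i"
    proof (cases "i < N")
      case False
      then obtain k where k: "i = N + k" using le_Suc_ex[of N i] by auto
      have "apply_bcontfun y (k + d) = apply_bcontfun z i"
        using that(1) coord[of z "\<lambda>j. \<phi> j x" "k + d"] k by (simp add: ba add.commute)
      thus ?thesis using that(2)[of "k + d"] False by (simp add: pad)
    qed (simp add: pad)
  qed
  have solR: "A (R v) + (\<Sum>i<N. t (\<alpha> i v) (w i)) = v \<and> (\<forall>j<d. \<phi> j (R v) = 0)" for v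
  proof -
    have B: "?B (R v, snd (binv ?B (v, 0))) = (v, 0)" using binv_right[OF bij, of "(v, 0)"] by (simp add: R_def)
    have z: "snd (binv ?B (v, 0)) = pad (\<lambda>i. \<alpha> i v)" using ispad[OF B] by (simp add: \<alpha>_def)
    have "(\<Sum>j<d. bs_unit j ((\<lambda>_. 0) j)) = (0 :: 'k bseq)" by (intro bcontfun_eqI) (simp add: nth_sum bs_unit_apply)
    hence "?B (R v, pad (\<lambda>i. \<alpha> i v)) = (v, \<Sum>j<d. bs_unit j ((\<lambda>_. 0) j))" using B z by simp
    from iffD1[OF Bpad this] show ?thesis by simp
  qed
  have sole: "A (e k) + (\<Sum>i<N. t (\<beta> i k) (w i)) = 0 \<and> (\<forall>j<d. \<phi> j (e k) = (if j = k then 1 else 0))"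
    if k: "k < d" for k
  proof -
    have B: "?B (e k, snd (binv ?B (0, bs_unit k 1))) = (0, bs_unit k 1)"
      using binv_right[OF bij, of "(0, bs_unit k 1)"] by (simp add: e_def)
    have z: "snd (binv ?B (0, bs_unit k 1)) = pad (\<lambda>i. \<beta> i k)" using ispad[OF B] k by (simp add: \<beta>_def bs_unit_apply)
    have "(\<Sum>j<d. bs_unit j ((\<lambda>j. if j = k then 1 else 0) j)) = (bs_unit k 1 :: 'k bseq)"
      using k by (intro bcontfun_eqI) (simp add: nth_sum bs_unit_apply)
    hence "?B (e k, pad (\<lambda>i. \<beta> i k)) = (0, \<Sum>j<d. bs_unit j ((\<lambda>j. if j = k then 1 else 0) j))" using B z by simp
    from iffD1[OF Bpad this] show ?thesis by simp
  qed
  \<comment> \<open>Superposition of the solutions for \<open>(v, 0)\<close> and for the unit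
    vectors. This is where linearity of \<open>A\<close> and \<phi> over \<K> enters.\<close>
  have sol: "A x + (\<Sum>i<N. t (c i) (w i)) = v \<and> (\<forall>j<d. \<phi> j x = \<zeta> j)"
    if x: "x = R v + (\<Sum>j<d. s (\<zeta> j) (e j))" and c: "\<forall>i<N. c i = \<alpha> i v + (\<Sum>j<d. \<zeta> j * \<beta> i j)" for x c v \<zeta>
  proof
    have "(\<Sum>i<N. t (c i) (w i)) = (\<Sum>i<N. t (\<alpha> i v) (w i)) + (\<Sum>i<N. \<Sum>j<d. t (\<zeta> j) (t (\<beta> i j) (w i)))"
      using c by (simp add: t.scale_left_distrib t.scale_sum_left sum.distrib)
    also have "(\<Sum>i<N. \<Sum>j<d. t (\<zeta> j) (t (\<beta> i j) (w i))) = (\<Sum>j<d. t (\<zeta> j) (\<Sum>i<N. t (\<beta> i j) (w i)))"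
      by (subst sum.swap) (simp only: t.scale_sum_right)
    finally have "A x + (\<Sum>i<N. t (c i) (w i)) =
        (A (R v) + (\<Sum>i<N. t (\<alpha> i v) (w i))) + (\<Sum>j<d. t (\<zeta> j) (A (e j) + (\<Sum>i<N. t (\<beta> i j) (w i))))"
      using A by (simp add: x blinfun.bilinear_simps blinfun.sum_right klin_def t.scale_right_distrib sum.distrib)
    thus "A x + (\<Sum>i<N. t (c i) (w i)) = v" using solR sole by simp
    show "\<forall>j<d. \<phi> j x = \<zeta> j"
    proof (intro allI impI)
      fix j assume j: "j < d"
      have "\<phi> j x = (\<Sum>k<d. \<zeta> k * \<phi> j (e k))" using \<phi>[OF j] solR j by (simp add: x blinfun.bilinear_simps blinfun.sum_right klin_def)
      also have "\<dots> = (\<Sum>k<d. if k = j then \<zeta> k else 0)" using sole j by (intro sum.cong) auto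
      finally show "\<phi> j x = \<zeta> j" using j by simp
    qed
  qed
  show ?thesis unfolding bordered_solution_def R_def[symmetric] e_def[symmetric] \<alpha>_def[symmetric] \<beta>_def[symmetric]
  proof (intro allI iffI)
    fix x c v \<zeta>
    assume *: "A x + (\<Sum>i<N. t (c i) (w i)) = v \<and> (\<forall>j<d. \<phi> j x = \<zeta> j)"
    define x' where "x' = R v + (\<Sum>j<d. s (\<zeta> j) (e j))"
    define c' where "c' i = \<alpha> i v + (\<Sum>j<d. \<zeta> j * \<beta> i j)" for i
    have "?B (x, pad c) = ?B (x', pad c')" using Bpad[of x c v \<zeta>] Bpad[of x' c' v \<zeta>] * sol[OF x'_def, of c'] by (simp add: c'_def)
    hence "x = x'" "pad c = pad c'" using bij by (auto simp: bij_def dest: injD)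
    moreover have "c i = c' i" if "i < N" for i using pad[of c i] pad[of c' i] \<open>pad c = pad c'\<close> that by simp
    ultimately show "x = R v + (\<Sum>j<d. s (\<zeta> j) (e j)) \<and> (\<forall>i<N. c i = \<alpha> i v + (\<Sum>j<d. \<zeta> j * \<beta> i j))" by (simp add: x'_def c'_def)
  next
    fix x c v \<zeta>
    assume "x = R v + (\<Sum>j<d. s (\<zeta> j) (e j)) \<and> (\<forall>i<N. c i = \<alpha> i v + (\<Sum>j<d. \<zeta> j * \<beta> i j))"
    thus "A x + (\<Sum>i<N. t (c i) (w i)) = v \<and> (\<forall>j<d. \<phi> j x = \<zeta> j)" using sol by blast
  qed
qed

lemma lin_comb_memI: "x = (\<Sum>i<n. s (c i) (e i)) ==> x \<in> {\<Sum>i<n. s (c i) (e i) |c. True}" by blast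

context
  fixes s :: "'k::{real_normed_field,euclidean_space} => 'm::real_normed_vector => 'm"
    and t :: "'k => 'n::real_normed_vector => 'n"
    and A :: "'m \<Rightarrow>\<^sub>L 'n" and w \<phi> e \<beta> N d
    and R :: "'n \<Rightarrow>\<^sub>L 'm" and \<alpha> :: "nat => 'n \<Rightarrow>\<^sub>L 'k"
  assumes s: "kspace s" and t: "kspace t"
    and sol: "bordered_solution s t N d A w \<phi> R e (\<lambda>i. blinfun_apply (\<alpha> i)) \<beta>"
begin

interpretation s: kspace s by (rule s)
interpretation t: kspace t by (rule t)

lemma bordered_iff: "A x + (\<Sum>i<N. t (c i) (w i)) = v \<and> (\<forall>j<d. \<phi> j x = \<zeta> j) \<longleftrightarrow>
   x = R v + (\<Sum>j<d. s (\<zeta> j) (e j)) \<and> (\<forall>i<N. c i = \<alpha> i v + (\<Sum>j<d. \<zeta> j * \<beta> i j))" using sol unfolding bordered_solution_def by blast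

lemma bordered_parametrix: "A (R v) + (\<Sum>i<N. t (\<alpha> i v) (w i)) = v" using bordered_iff[of "R v" "\<lambda>i. \<alpha> i v" v "\<lambda>_. 0"] by simp

lemma bordered_expand: "x = R (A x + (\<Sum>i<N. t (c i) (w i))) + (\<Sum>j<d. s (\<phi> j x) (e j))"
  using bordered_iff[of x c _ "\<lambda>j. \<phi> j x"] by blast

lemma bordered_dual:
  assumes "j < d" "k < d"
  shows "\<phi> j (e k) = (if j = k then 1 else 0)"
proof -
  have "(\<Sum>j<d. s (if j = k then 1 else 0) (e j)) = e k" using s.sum_scale_single[OF assms(2), of 1 e] by simp
  hence "\<forall>j<d. \<phi> j (e k) = (if j = k then 1 else 0)"
    using bordered_iff[of "e k" "\<lambda>i. \<alpha> i 0 + (\<Sum>j<d. (if j = k then 1 else 0) * \<beta> i j)" 0 "\<lambda>j. if j = k then 1 else 0"]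
    by (simp add: blinfun.zero_right)
  thus ?thesis using assms(1) by blast
qed

lemma bordered_kernel_mem: "A (\<Sum>j<d. s (\<zeta> j) (e j)) + (\<Sum>i<N. t (\<Sum>j<d. \<zeta> j * \<beta> i j) (w i)) = 0"
  using bordered_iff[of "\<Sum>j<d. s (\<zeta> j) (e j)" "\<lambda>i. \<Sum>j<d. \<zeta> j * \<beta> i j" 0 \<zeta>] by (simp add: blinfun.zero_right)

text \<open>Uniqueness of the solution at \<open>x = 0\<close>. The assumption on \<phi> ensures
  that the functionals vanish there.\<close>

lemma bordered_coeff:
  shows "i < N ==> \<phi> = (\<lambda>j. blinfun_apply (\<psi> j)) ==> \<alpha> i (\<Sum>i<N. t (c i) (w i)) = c i"
  using bordered_iff[of 0 c "\<Sum>i<N. t (c i) (w i)" "\<lambda>_. 0"] by (simp add: blinfun.zero_right)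

lemma bordered_indep:
  assumes "\<phi> = (\<lambda>j. blinfun_apply (\<psi> j))"
  shows "lin_indep t N w" unfolding lin_indep_def using bordered_coeff[OF _ assms] by (metis blinfun.zero_right)

text \<open>For \<open>x\<close> in the preimage of the span of \<open>w\<close>, the coefficients
  can be chosen with right hand side \<open>v = 0\<close>, so that only the \<open>e j\<close>
  remain in the solution formula. The local frames of index bundles come from here.\<close>

lemma bordered_kernel_frame:
  shows "is_basis s {x. \<exists>c. A x = (\<Sum>i<N. t (c i) (w i))} d e" unfolding s.is_basis_iff
proof
  show "lin_indep s d e" unfolding lin_indep_def
  proof (intro allI impI)
    fix \<zeta> j assume z: "(\<Sum>j<d. s (\<zeta> j) (e j)) = 0" and j: "j < d"
    have "\<forall>j<d. \<phi> j 0 = \<zeta> j" if "(\<Sum>j<d. s (\<zeta> j) (e j)) = 0" for \<zeta>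
      using bordered_iff[of 0 "\<lambda>i. \<Sum>j<d. \<zeta> j * \<beta> i j" 0 \<zeta>] that by (simp add: blinfun.zero_right)
    from this[OF z] this[of "\<lambda>_. 0"] j show "\<zeta> j = 0" by simp
  qed
  show "{x. \<exists>c. A x = (\<Sum>i<N. t (c i) (w i))} = {\<Sum>j<d. s (\<zeta> j) (e j) |\<zeta>. True}"
  proof (intro Set.set_eqI iffI; elim CollectE exE conjE)
    fix x c assume "A x = (\<Sum>i<N. t (c i) (w i))"
    hence "A x + (\<Sum>i<N. t (- c i) (w i)) = 0" by (simp add: sum_negf)
    hence "x = (\<Sum>j<d. s (\<phi> j x) (e j))" using bordered_expand[of x "\<lambda>i. - c i"] by (simp add: blinfun.zero_right)
    thus "x \<in> {\<Sum>j<d. s (\<zeta> j) (e j) |\<zeta>. True}" by (rule lin_comb_memI)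
  next
    fix x \<zeta> assume "x = (\<Sum>j<d. s (\<zeta> j) (e j))"
    hence "A x = (\<Sum>i<N. t (- (\<Sum>j<d. \<zeta> j * \<beta> i j)) (w i))" using bordered_kernel_mem[of \<zeta>] by (simp add: sum_negf eq_neg_iff_add_eq_0)
    thus "x \<in> {x. \<exists>c. A x = (\<Sum>i<N. t (c i) (w i))}" by (intro CollectI exI)
  qed
qed

text \<open>A scalar multiple of a solution solves the system for the multiple of the data, and
  uniqueness identifies it with the given solution.\<close>

lemma bordered_klin:
  assumes A: "klin s t A" and \<phi>: "\<phi> = (\<lambda>j. blinfun_apply (\<psi> j))" "!!j. j < d ==> klin s (*) (\<psi> j)"
  shows "klin t s R" and "i < N ==> klin t (*) (\<alpha> i)"
proof -
  have "s a (R v) = R (t a v) \<and> (\<forall>i<N. a * \<alpha> i v = \<alpha> i (t a v))" for a v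
  proof -
    have "\<forall>j<d. \<phi> j (R v) = 0" using bordered_iff[of "R v" "\<lambda>i. \<alpha> i v" v "\<lambda>_. 0"] by simp
    hence "\<forall>j<d. \<phi> j (s a (R v)) = 0" using \<phi> by (simp add: klin_def)
    moreover have "A (s a (R v)) + (\<Sum>i<N. t (a * \<alpha> i v) (w i)) = t a (A (R v) + (\<Sum>i<N. t (\<alpha> i v) (w i)))"
      using A by (simp add: klin_def t.scale_right_distrib t.scale_sum_right)
    ultimately show ?thesis using bordered_iff[of "s a (R v)" "\<lambda>i. a * \<alpha> i v" "t a v" "\<lambda>_. 0"] by (simp add: bordered_parametrix)
  qed
  thus "klin t s R" "i < N ==> klin t (*) (\<alpha> i)" by (auto simp: klin_def)
qed

end

text \<open>Bijectivity is an open condition and inversion is continuous, so conditions at the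
  single point \<open>y0\<close> yield solution blocks that are continuous in \<open>y\<close>
  nearby.\<close>

lemma bordered_local:
  fixes A :: "'y => 'm::banach \<Rightarrow>\<^sub>L 'n::banach"
    and \<phi> :: "nat => 'y => 'm \<Rightarrow>\<^sub>L 'k::{real_normed_field,euclidean_space}"
    and s :: "'k => 'm => 'm" and t :: "'k => 'n => 'n"
  assumes s: "kspace s" and t: "kspace t" and U: "openin Y U" "y0 \<in> U"
    and cA: "conton Y U A" and A: "!!y. y \<in> U ==> klin s t (A y)"
    and cw: "!!i. i < N ==> conton Y U (w i)"
    and c\<phi>: "!!j. j < d ==> conton Y U (\<phi> j)" and \<phi>: "!!j y. j < d ==> y \<in> U ==> klin s (*) (\<phi> j y)"
    and surj: "!!v. \<exists>x c. A y0 x + (\<Sum>i<N. t (c i) (w i y0)) = v"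
    and indep: "lin_indep t N (\<lambda>i. w i y0)"
    and \<phi>surj: "!!\<zeta>. \<exists>x c. A y0 x = (\<Sum>i<N. t (c i) (w i y0)) \<and> (\<forall>j<d. \<phi> j y0 x = \<zeta> j)"
    and \<phi>inj: "!!x c. A y0 x = (\<Sum>i<N. t (c i) (w i y0)) ==> \<forall>j<d. \<phi> j y0 x = 0 ==> x = 0"
  obtains U' R e \<alpha> \<beta> where "openin Y U'" "y0 \<in> U'" "U' \<subseteq> U" "conton Y U' R" "!!j. conton Y U' (e j)" "!!i. conton Y U' (\<alpha> i)"
    "!!y. y \<in> U' ==> bordered_solution s t N d (A y) (\<lambda>i. w i y) (\<lambda>j. blinfun_apply (\<phi> j y))
       (blinfun_apply (R y)) (\<lambda>j. e j y) (\<lambda>i. blinfun_apply (\<alpha> i y)) (\<beta> y)"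
proof -
  define B where "B y = border t N d (A y) (\<lambda>i. w i y) (\<lambda>j. \<phi> j y)" for y
  have bb: "bounded_bilinear t" using t by (rule kspace.bounded_bilinear_scale)
  have cB: "conton Y U B" unfolding conton_def B_def using contonD[OF cA] contonD[OF cw] contonD[OF c\<phi>]
    by (intro ballI tendsto_border[OF bb]) auto
  have bij0: "bij (blinfun_apply (B y0))" unfolding B_def by (rule border_bij[OF s t surj indep \<phi>surj \<phi>inj])
  have "eventually (\<lambda>y. bij (blinfun_apply (B y))) (atin Y y0)" by (rule eventually_bij[OF bij0 contonD[OF cB U(2)]])
  moreover have "y0 \<in> topspace Y" using U openin_subset[OF U(1)] by auto
  ultimately obtain T where T0: "openin Y T" "y0 \<in> T" "\<forall>y\<in>T - {y0}. bij (blinfun_apply (B y))" unfolding eventually_atin by auto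
  \<comment> \<open>The filter \<open>atin\<close> leaves out the point itself; there bijectivity is
    \<open>bij0\<close>.\<close>
  have T: "openin Y T" "y0 \<in> T" "!!y. y \<in> T ==> bij (blinfun_apply (B y))" using T0 bij0 by auto
  define U' where "U' = T \<inter> U"
  have U': "openin Y U'" "y0 \<in> U'" "U' \<subseteq> U" using T U by (auto simp: U'_def)
  have bij: "bij (blinfun_apply (B y))" if "y \<in> U'" for y using T that by (auto simp: U'_def)
  have cinv: "conton Y U' (\<lambda>y. binv (B y))" unfolding conton_def using U'(3) by (intro ballI tendsto_binv bij contonD[OF cB]) auto
  define R where "R y = fst_blinfun o\<^sub>L binv (B y) o\<^sub>L Blinfun (\<lambda>v. (v, 0))" for y
  define e where "e j y = fst (binv (B y) (0, bs_unit j 1))" for j y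
  define \<alpha> where "\<alpha> i y = Blinfun (\<lambda>z. apply_bcontfun z i) o\<^sub>L (snd_blinfun o\<^sub>L binv (B y) o\<^sub>L Blinfun (\<lambda>v. (v, 0)))" for i y
  show thesis
  proof (rule that[of U' R e \<alpha> "\<lambda>y i j. apply_bcontfun (snd (binv (B y) (0, bs_unit j 1))) i", OF U'])
    show "conton Y U' R" "conton Y U' (e j)" "conton Y U' (\<alpha> i)" for i j
      using cinv unfolding R_def e_def \<alpha>_def conton_def by (auto intro!: tendsto_intros)
    fix y assume y: "y \<in> U'"
    have "R y v = fst (binv (B y) (v, 0))" "\<alpha> i y v = apply_bcontfun (snd (binv (B y) (v, 0))) i" for v i
      by (simp_all add: R_def \<alpha>_def bounded_linear_Blinfun_apply bounded_linear_inl bounded_linear_nth)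
    note this[abs_def]
    moreover have yU: "y \<in> U" using y U'(3) by blast
    note bordered_solution_of_bij[where A = "A y" and \<phi> = "\<lambda>j. \<phi> j y" and w = "\<lambda>i. w i y" and N = N,
        OF s t A[OF yU] \<phi>[OF _ yU] bij[OF y, unfolded B_def], folded B_def]
    ultimately show "bordered_solution s t N d (A y) (\<lambda>i. w i y) (\<lambda>j. blinfun_apply (\<phi> j y))
       (blinfun_apply (R y)) (\<lambda>j. e j y) (\<lambda>i. blinfun_apply (\<alpha> i y)) (\<lambda>i j. apply_bcontfun (snd (binv (B y) (0, bs_unit j 1))) i)"
      by (simp add: e_def)
  qed
qed

lemma klin_linear: "kspace s ==> kspace t ==> klin s t A ==> Vector_Spaces.linear s t (blinfun_apply A)"
  by (auto simp: Vector_Spaces.linear_iff kspace_def normed_scale_def klin_def blinfun.add_right)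

text \<open>The preimage is spanned by the kernel together with preimages \<open>g i\<close> of a
  basis of its finite dimensional image.\<close>

lemma fin_dim_preimage:
  fixes A :: "'m::real_normed_vector \<Rightarrow>\<^sub>L 'n::real_normed_vector" and N :: nat
  assumes s: "kspace s" and t: "kspace t" and A: "klin s t A" and ker: "fin_dim s {x. A x = 0}"
  shows "fin_dim s {x. \<exists>c. A x = (\<Sum>i<N. t (c i) (w i))}" (is "fin_dim s ?I")
proof -
  interpret s: kspace s by fact
  interpret t: kspace t by fact
  define W where "W = t.span (w ` {..<N})"
  have W: "?I = {x. A x \<in> W}" unfolding W_def t.span_image_lessThan by auto
  have sW: "t.subspace W" by (simp add: W_def)
  have sI: "s.subspace ?I" unfolding W s.subspace_def using A t.subspace_add[OF sW] t.subspace_scale[OF sW] t.subspace_0[OF sW]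
    by (auto simp: blinfun.bilinear_simps klin_def)
  have sV: "t.subspace (A ` ?I)" by (rule module_hom.subspace_image[OF _ sI]) (simp add: module_hom_iff_linear klin_linear[OF s t A])
  have "A ` ?I \<subseteq> t.span (w ` {..<N})" unfolding W W_def by auto
  then obtain r f where f: "is_basis t (A ` ?I) r f" by (rule t.fin_dim_basis[OF sV _ finite_imageI]) auto
  have fI: "A ` ?I = {\<Sum>i<r. t (c i) (f i) |c. True}" using f by (simp add: t.is_basis_iff)
  have "\<exists>g\<in>?I. A g = f i" if "i < r" for i
  proof -
    have "f i = (\<Sum>j<r. t (if j = i then 1 else 0) (f j))" using t.sum_scale_single[OF that, of 1 f] by simp
    hence "f i \<in> A ` ?I" unfolding fI by (rule lin_comb_memI)
    thus ?thesis by auto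
  qed
  then obtain g where g: "!!i. i < r ==> A (g i) = f i" by metis
  obtain B where B: "finite B" "{x. A x = 0} = s.span B" using ker by (auto simp: fin_dim_def)
  have sub: "?I \<subseteq> s.span (B \<union> g ` {..<r})"
  proof
    fix x assume "x \<in> ?I"
    then obtain c where c: "A x = (\<Sum>i<r. t (c i) (f i))" using fI by blast
    define y where "y = (\<Sum>i<r. s (c i) (g i))"
    have "A y = A x" using A g by (simp add: y_def blinfun.sum_right klin_def c)
    hence "x - y \<in> {x. A x = 0}" by (simp add: blinfun.diff_right)
    hence "x - y \<in> s.span B" unfolding B(2) .
    moreover have "y \<in> s.span (g ` {..<r})" unfolding s.span_image_lessThan y_def by blast
    ultimately have "x - y \<in> s.span (B \<union> g ` {..<r})" "y \<in> s.span (B \<union> g ` {..<r})" by (auto intro: subsetD[OF s.span_mono, rotated])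
    from s.span_add[OF this] show "x \<in> s.span (B \<union> g ` {..<r})" by simp
  qed
  have "finite (B \<union> g ` {..<r})" using B(1) by simp
  then obtain n e where "is_basis s ?I n e" by (rule s.fin_dim_basis[OF sI sub])
  thus ?thesis by (rule s.is_basis_fin_dim)
qed

text \<open>The functionals may be taken constant, namely dual to a basis of the preimage of the span at \<open>y0\<close>.\<close>

lemma bordered_local_fredholm:
  fixes A :: "'y => 'm::banach \<Rightarrow>\<^sub>L 'n::banach"
    and s :: "'k::{real_normed_field,euclidean_space} => 'm => 'm" and t :: "'k => 'n => 'n"
  assumes s: "kspace s" and t: "kspace t" and U: "openin Y U" "y0 \<in> U"
    and cA: "conton Y U A" and A: "!!y. y \<in> U ==> klin s t (A y)"
    and cw: "!!i. i < N ==> conton Y U (w i)"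
    and ker: "fin_dim s {x. A y0 x = 0}"
    and surj: "!!v. \<exists>x c. A y0 x + (\<Sum>i<N. t (c i) (w i y0)) = v"
    and indep: "lin_indep t N (\<lambda>i. w i y0)"
  obtains d \<phi> U' R e \<alpha> \<beta> where "openin Y U'" "y0 \<in> U'" "U' \<subseteq> U" "!!j. j < d ==> klin s (*) (\<phi> j)"
    "conton Y U' R" "!!j. conton Y U' (e j)" "!!i. conton Y U' (\<alpha> i)"
    "!!y. y \<in> U' ==> bordered_solution s t N d (A y) (\<lambda>i. w i y) (\<lambda>j. blinfun_apply (\<phi> j))
       (blinfun_apply (R y)) (\<lambda>j. e j y) (\<lambda>i. blinfun_apply (\<alpha> i y)) (\<beta> y)"
proof -
  interpret s: kspace s by fact
  interpret t: kspace t by fact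
  let ?I = "{x. \<exists>c. A y0 x = (\<Sum>i<N. t (c i) (w i y0))}"
  obtain d f where f: "is_basis s ?I d f" by (rule s.fin_dim_basis'[OF fin_dim_preimage[OF s t A[OF U(2)] ker]])
  have fI: "lin_indep s d f" "?I = {\<Sum>j<d. s (\<zeta> j) (f j) |\<zeta>. True}" using f by (simp_all add: s.is_basis_iff)
  obtain \<phi> :: "nat => 'm \<Rightarrow>\<^sub>L 'k" where \<phi>: "!!i. i < d ==> klin s (*) (\<phi> i)" "!!i j. i < d ==> j < d ==> \<phi> i (f j) = (if i = j then 1 else 0)"
    by (rule s.dual_functionals[OF fI(1)], rule that)
  have \<phi>f: "\<phi> i (\<Sum>j<d. s (\<zeta> j) (f j)) = \<zeta> i" if i: "i < d" for i \<zeta>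
  proof -
    have "\<phi> i (\<Sum>j<d. s (\<zeta> j) (f j)) = (\<Sum>j<d. \<zeta> j * \<phi> i (f j))" using \<phi>(1)[OF i] by (simp add: blinfun.sum_right klin_def)
    also have "\<dots> = (\<Sum>j<d. if j = i then \<zeta> j else 0)" using \<phi>(2)[OF i] by (intro sum.cong) auto
    finally show ?thesis using i by simp
  qed
  show thesis
  proof (rule bordered_local[where N = N and d = d and \<phi> = "\<lambda>j _. \<phi> j", OF s t U cA A cw])
    show "\<exists>x c. A y0 x = (\<Sum>i<N. t (c i) (w i y0)) \<and> (\<forall>j<d. \<phi> j x = \<zeta> j)" for \<zeta>
    proof -
      have "(\<Sum>j<d. s (\<zeta> j) (f j)) \<in> ?I" unfolding fI(2) by blast
      thus ?thesis using \<phi>f[of _ \<zeta>] by (intro exI[of _ "\<Sum>j<d. s (\<zeta> j) (f j)"]) simp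
    qed
    show "x = 0" if x: "A y0 x = (\<Sum>i<N. t (c i) (w i y0))" "\<forall>j<d. \<phi> j x = 0" for x c
    proof -
      have "x \<in> ?I" using x(1) by blast
      then obtain \<zeta> where \<zeta>: "x = (\<Sum>j<d. s (\<zeta> j) (f j))" unfolding fI(2) by blast
      hence "\<zeta> j = 0" if "j < d" for j using \<phi>f[OF that, of \<zeta>] x(2) that by simp
      thus ?thesis using \<zeta> by simp
    qed
  next
    fix U' R e \<alpha> \<beta>
    assume *: "openin Y U'" "y0 \<in> U'" "U' \<subseteq> U" "conton Y U' R" "!!j. conton Y U' (e j)" "!!i. conton Y U' (\<alpha> i)"
      "!!y. y \<in> U' ==> bordered_solution s t N d (A y) (\<lambda>i. w i y) (\<lambda>j. blinfun_apply (\<phi> j))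
         (blinfun_apply (R y)) (\<lambda>j. e j y) (\<lambda>i. blinfun_apply (\<alpha> i y)) (\<beta> y)"
    show thesis by (rule that[OF *(1-3) \<phi>(1) *(4-7)])
  qed (use surj indep \<phi>(1) in \<open>auto simp: conton_const\<close>)
qed

text \<open>The identity is bordered: its kernel is zero and any span is transversal to its image.
  The blocks \<alpha> of the inverse are then coordinate functionals for \<open>w\<close>, defined
  on the whole space and continuous in \<open>y\<close>.\<close>

lemma frame_coordinates:
  fixes w :: "nat => 'y => 'n::banach" and t :: "'k::{real_normed_field,euclidean_space} => 'n => 'n"
  assumes t: "kspace t" and U: "openin Y U" "y0 \<in> U" and cw: "!!i. i < N ==> conton Y U (w i)"
    and indep: "lin_indep t N (\<lambda>i. w i y0)"
  obtains U' \<alpha> where "openin Y U'" "y0 \<in> U'" "U' \<subseteq> U" "!!i. conton Y U' (\<alpha> i)" "!!i y. i < N ==> y \<in> U' ==> klin t (*) (\<alpha> i y)"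
    "!!i y c. i < N ==> y \<in> U' ==> \<alpha> i y (\<Sum>i<N. t (c i) (w i y)) = c i" "!!y. y \<in> U' ==> lin_indep t N (\<lambda>i. w i y)"
proof -
  interpret t: kspace t by fact
  have k: "fin_dim t {x. blinfun_apply id_blinfun x = 0}" unfolding fin_dim_def by (intro exI[of _ "{}"]) auto
  have sj: "\<exists>x c. blinfun_apply id_blinfun x + (\<Sum>i<N. t (c i) (w i y0)) = v" for v by (intro exI[of _ v] exI[of _ "\<lambda>_. 0"]) simp
  show thesis
  proof (rule bordered_local_fredholm[OF t t U conton_const t.klin_id cw k sj indep])
    fix d \<phi> U' R e \<alpha> \<beta>
    assume *: "openin Y U'" "y0 \<in> U'" "U' \<subseteq> U" "!!j. j < d ==> klin t (*) (\<phi> j)" "conton Y U' R"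
      "!!j. conton Y U' (e j)" "!!i. conton Y U' (\<alpha> i)"
      "!!y. y \<in> U' ==> bordered_solution t t N d (blinfun_apply id_blinfun) (\<lambda>i. w i y) (\<lambda>j. blinfun_apply (\<phi> j))
         (blinfun_apply (R y)) (\<lambda>j. e j y) (\<lambda>i. blinfun_apply (\<alpha> i y)) (\<beta> y)"
    note b = bordered_klin(2)[OF t t *(8) t.klin_id refl *(4)] bordered_coeff[OF t t *(8) _ refl]
      bordered_indep[OF t t *(8) refl]
    show thesis by (rule that[of U' \<alpha>, OF *(1-3,7)]) (use b in blast)+
  qed
qed

section \<open>Vectors in general position\<close>

text \<open>Riesz's argument with a functional. If the ball of radius \<epsilon> around
  \<open>y0\<close> had a finite net of mesh \<epsilon>/2, a nonzero functional vanishing on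
  \<open>y0\<close> and on the net would be bounded by half of its own norm.\<close>

lemma (in kspace) compact_empty_interior:
  assumes inf: "\<not> fin_dim s UNIV" and C: "compact (C :: 'm set)"
  shows "interior C = {}"
proof (rule ccontr)
  assume "interior C \<noteq> {}"
  then obtain y0 \<epsilon> where \<epsilon>: "\<epsilon> > 0" "cball y0 \<epsilon> \<subseteq> C" by (meson ex_in_conv mem_interior_cball)
  obtain k where k: "finite k" "C \<subseteq> (\<Union>x\<in>k. ball x (\<epsilon>/2))" using C \<epsilon>(1) unfolding compact_eq_totally_bounded by (meson half_gt_zero)
  define S where "S = span (insert y0 k)"
  have "S \<noteq> UNIV" using inf k(1) by (auto simp: S_def fin_dim_def)
  then obtain x0 where "x0 \<notin> S" by blast
  then obtain f :: "'m \<Rightarrow>\<^sub>L 'k" where f: "!!y. y \<in> S ==> f y = 0" "f x0 = 1"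
    using functional_extension[of S x0] closed_span_finite[of "insert y0 k"] k(1) by (auto simp: S_def)
  have small: "norm (f u) \<le> norm f * (\<epsilon> / 2)" if "norm u \<le> \<epsilon>" for u
  proof -
    have "y0 + u \<in> C" using \<epsilon>(2) that by (auto simp: dist_norm)
    then obtain c where c: "c \<in> k" "dist c (y0 + u) < \<epsilon>/2" using k(2) by auto
    have "f (y0 + u - c) = f u" using f(1)[of y0] f(1)[of c] c(1) by (simp add: S_def span_base blinfun.bilinear_simps)
    moreover have "norm (f (y0 + u - c)) \<le> norm f * norm (y0 + u - c)" by (rule norm_blinfun)
    moreover have "norm f * norm (y0 + u - c) \<le> norm f * (\<epsilon> / 2)"
      using c(2) by (intro mult_left_mono) (auto simp: dist_norm norm_minus_commute)
    ultimately show ?thesis by simp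
  qed
  have "norm f \<le> norm f / 2"
  proof (rule norm_blinfun_bound)
    fix v
    show "norm (f v) \<le> norm f / 2 * norm v"
    proof (cases "v = 0")
      case False
      have "norm (f ((\<epsilon> / norm v) *\<^sub>R v)) \<le> norm f * (\<epsilon> / 2)" using small \<epsilon>(1) False by simp
      thus ?thesis using \<epsilon>(1) False by (simp add: blinfun.bilinear_simps field_simps)
    qed (simp add: blinfun.zero_right)
  qed simp
  hence "f = 0" using norm_ge_zero[of f] by simp
  thus False using f(2) by simp
qed

text \<open>With coefficients of norm at most \<open>R\<close> the combinations form a compact set,
  the continuous image of \<open>K\<close> times a product of balls. By Baire the countable union
  over \<open>R\<close> does not exhaust the space.\<close>

lemma avoid_compact_family:
  fixes y :: "nat => 'x => 'm::banach" and s :: "'k::{real_normed_field,euclidean_space} => 'm => 'm"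
  assumes s: "kspace s" and inf: "\<not> fin_dim s UNIV"
    and K: "compactin X K" and y: "!!j. j < q ==> continuous_map (subtopology X K) euclidean (y j)"
  obtains x where "!!p a. p \<in> K ==> x \<noteq> (\<Sum>j<q. s (a j) (y j p))"
proof -
  interpret kspace s by fact
  define Z where "Z R = prod_topology (subtopology X K)
     (product_topology (\<lambda>_. subtopology euclidean (cball (0::'k) (real R))) {..<q})" for R
  define g where "g = (\<lambda>(p, a). \<Sum>j<q. s (a j) (y j p))"
  define C where "C R = g ` topspace (Z R)" for R
  have "compact (C R)" for R
  proof -
    have "compact_space (Z R)" unfolding Z_def compact_space_prod_topology compact_space_product_topology
      using K by (auto simp: compact_space_subtopology compactin_euclidean_iff)
    moreover have "continuous_map (Z R) euclidean g"
    proof -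
      have "continuous_map (Z R) euclidean (\<lambda>z. snd z j)" if "j < q" for j
      proof -
        have "continuous_map (Z R) (subtopology euclidean (cball 0 (real R))) ((\<lambda>a. a j) \<circ> snd)" unfolding Z_def using that
          by (intro continuous_map_compose[OF continuous_map_snd continuous_map_product_projection]) simp
        thus ?thesis by (simp add: continuous_map_in_subtopology comp_def)
      qed
      moreover have "continuous_map (Z R) euclidean (\<lambda>z. y j (fst z))" if "j < q" for j
        using continuous_map_compose[OF continuous_map_fst y[OF that]] unfolding Z_def comp_def by blast
      ultimately have "continuous_map (Z R) euclidean (\<lambda>z. \<Sum>j<q. s (snd z j) (y j (fst z)))"
        unfolding conton_topspace by (intro conton_sum conton_scale) auto
      thus ?thesis by (simp add: g_def case_prod_beta')
    qed
    ultimately show ?thesis unfolding C_def compact_space_def using image_compactin compactin_euclidean_iff by blast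
  qed
  hence "(euclidean :: 'm topology) interior_of \<Union>(range C) = {}" using compact_empty_interior[OF inf]
    by (intro Baire_category_alt disjI1) (auto simp: compact_imp_closed completely_metrizable_space_euclidean)
  then obtain x where x: "x \<notin> \<Union>(range C)"
    by (metis UNIV_I interior_of_topspace subsetI subset_antisym topspace_euclidean subset_UNIV empty_iff)
  show thesis
  proof (rule that)
    fix p a assume p: "p \<in> K"
    show "x \<noteq> (\<Sum>j<q. s (a j) (y j p))"
    proof
      assume eq: "x = (\<Sum>j<q. s (a j) (y j p))"
      obtain R :: nat where R: "(\<Sum>j<q. norm (a j)) \<le> real R" using real_arch_simple by blast
      have "norm (a j) \<le> real R" if "j < q" for j using that R member_le_sum[of j "{..<q}" "\<lambda>j. norm (a j)"] by simp
      moreover have "p \<in> topspace X" using K p compactin_subset_topspace by blast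
      ultimately have "(p, restrict a {..<q}) \<in> topspace (Z R)" using p by (auto simp: Z_def)
      moreover have "g (p, restrict a {..<q}) = x" unfolding g_def eq by (auto intro: sum.cong)
      ultimately have "x \<in> C R" unfolding C_def by blast
      thus False using x by blast
    qed
  qed
qed

text \<open>One vector at a time: the vectors already chosen join the family as constant functions
  before the next one is picked.\<close>

lemma avoid_compact_families:
  fixes y :: "nat => 'x => 'm::banach" and s :: "'k::{real_normed_field,euclidean_space} => 'm => 'm"
  assumes s: "kspace s" and inf: "\<not> fin_dim s UNIV"
    and K: "compactin X K" and y: "!!j. j < q ==> continuous_map (subtopology X K) euclidean (y j)"
  shows "\<exists>x. \<forall>p\<in>K. \<forall>a c. (\<Sum>l<(r::nat). s (c l) (x l)) = (\<Sum>j<q. s (a j) (y j p)) --> (\<forall>l<r. c l = 0)"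
proof (induction r)
  case (Suc r)
  interpret kspace s by fact
  obtain x where x: "!!p a c. p \<in> K ==> (\<Sum>l<r. s (c l) (x l)) = (\<Sum>j<q. s (a j) (y j p)) ==> (\<forall>l<r. c l = 0)" using Suc by blast
  define y' where "y' j = (if j < q then y j else (\<lambda>_. x (j - q)))" for j
  have split: "(\<Sum>j<q+r. s (a j) (y' j p)) = (\<Sum>j<q. s (a j) (y j p)) + (\<Sum>l<r. s (a (q + l)) (x l))" for a p
    by (induction r) (simp_all add: y'_def)
  have "continuous_map (subtopology X K) euclidean (y' j)" if "j < q + r" for j using y by (auto simp: y'_def)
  then obtain z where z: "!!p a. p \<in> K ==> z \<noteq> (\<Sum>j<q+r. s (a j) (y' j p))"
    by (rule avoid_compact_family[OF s inf K, where y = y' and q = "q + r"]) (assumption, rule that)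
  have "\<forall>l<Suc r. c l = 0" if p: "p \<in> K"
    and eq: "(\<Sum>l<Suc r. s (c l) ((x(r := z)) l)) = (\<Sum>j<q. s (a j) (y j p))" for p a c
  proof -
    have eq': "(\<Sum>l<r. s (c l) (x l)) + s (c r) z = (\<Sum>j<q. s (a j) (y j p))" using eq by simp
    have cr: "c r = 0"
    proof (rule ccontr)
      assume cr: "c r \<noteq> 0"
      have sz: "s (c r) z = (\<Sum>j<q. s (a j) (y j p)) - (\<Sum>l<r. s (c l) (x l))" using eq' by (simp add: algebra_simps)
      have "z = s (inverse (c r)) (s (c r) z)" using cr by simp
      also have "\<dots> = (\<Sum>j<q+r. s (inverse (c r) * (if j < q then a j else - c (j - q))) (y' j p))"
        unfolding sz split by (simp add: scale_right_diff_distrib scale_sum_right sum_negf)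
      finally show False by (rule notE[OF z[OF p]])
    qed
    hence "(\<Sum>l<r. s (c l) (x l)) = (\<Sum>j<q. s (a j) (y j p))" using eq' by simp
    hence "\<forall>l<r. c l = 0" by (rule x[OF p])
    thus ?thesis using cr by (simp add: less_Suc_eq)
  qed
  thus ?case by blast
qed simp

section \<open>Finite dimensional vector bundles and the zero of \<open>K(X)\<close>\<close>

section \<open>Sections of finite dimensional bundles\<close>

abbreviation vfibre_linear where "vfibre_linear V W p \<equiv> linear_between (vscale V) (vscale W) (vfibre V p) (vfibre W p)"

definition vsec :: "'b topology => ('b, 'k :: {real_normed_field, euclidean_space}, 'v :: ab_group_add) vbundle
     => 'b set => ('b => 'v) => bool" where "vsec X V U \<sigma> \<longleftrightarrow> (\<forall>(U', n, e)\<in>frames V. \<exists>a. (\<forall>i<n. conton X (U \<inter> U') (a i)) \<and>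
     (\<forall>p\<in>U \<inter> U'. \<sigma> p = (\<Sum>i<n. vscale V (a i p) (e p i))))"

lemma vsecD:
  assumes "vsec X V U \<sigma>" "(U', n, e) \<in> frames V"
  obtains a where "!!i. i < n ==> conton X (U \<inter> U') (a i)" "!!p. p \<in> U ==> p \<in> U' ==> \<sigma> p = (\<Sum>i<n. vscale V (a i p) (e p i))"
proof -
  from bspec[OF assms(1)[unfolded vsec_def] assms(2)] obtain a where
    "(\<forall>i<n. conton X (U \<inter> U') (a i)) \<and> (\<forall>p\<in>U \<inter> U'. \<sigma> p = (\<Sum>i<n. vscale V (a i p) (e p i)))" unfolding prod.case by (rule exE)
  thus ?thesis by (intro that[of a]) auto
qed

lemma vb_vs: "vector_bundle X V ==> vector_space (vscale V)" by (simp add: vector_bundle_def)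

lemma vb_frame:
  assumes "vector_bundle X V" "(U, n, e) \<in> frames V"
  shows "openin X U" and "p \<in> U ==> is_basis (vscale V) (vfibre V p) n (e p)"
proof -
  have *: "\<forall>(U, n, e)\<in>frames V. openin X U \<and> (\<forall>p\<in>U. is_basis (vscale V) (vfibre V p) n (e p))"
    using assms(1) unfolding vector_bundle_def by (elim conjE)
  show "openin X U" "p \<in> U ==> is_basis (vscale V) (vfibre V p) n (e p)" using bspec[OF * assms(2)] by auto
qed

lemma vb_frame':
  assumes "vector_bundle X V" "(U, n, e) \<in> frames V" "p \<in> U"
  shows "lin_indep (vscale V) n (e p)" and "vfibre V p = {\<Sum>i<n. vscale V (c i) (e p i) |c. True}"
proof -
  note * = iffD1[OF vector_space.is_basis_iff[OF vb_vs[OF assms(1)]] vb_frame(2)[OF assms(1,2,3)]]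
  show "lin_indep (vscale V) n (e p)" by (rule conjunct1[OF *])
  show "vfibre V p = {\<Sum>i<n. vscale V (c i) (e p i) |c. True}" by (rule conjunct2[OF *])
qed

lemma vb_cover:
  assumes "vector_bundle X V" "p \<in> topspace X"
  obtains U n e where "(U, n, e) \<in> frames V" "p \<in> U"
proof -
  have "p \<in> \<Union>(fst ` frames V)" using assms unfolding vector_bundle_def by simp
  thus ?thesis using that by force
qed

lemma vb_subspace:
  assumes "vector_bundle X V" "p \<in> topspace X"
  shows "module.subspace (vscale V) (vfibre V p)"
proof -
  obtain U n e where f: "(U, n, e) \<in> frames V" "p \<in> U" using vb_cover[OF assms] .
  show ?thesis by (rule vector_space.is_basis_subspace[OF vb_vs[OF assms(1)] vb_frame(2)[OF assms(1) f]])
qed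

lemma continuous_in_framesD:
  assumes "continuous_in_frames X V W T" "(U, n, e) \<in> frames V" "(U', m, f) \<in> frames W"
  shows "\<exists>a. (\<forall>i<m. \<forall>j<n. continuous_map (subtopology X (U \<inter> U')) euclidean (a i j)) \<and>
          (\<forall>p\<in>U \<inter> U'. \<forall>j<n. T p (e p j) = (\<Sum>i<m. vscale W (a i j p) (f p i)))"
  using bspec[OF bspec[OF assms(1)[unfolded continuous_in_frames_def] assms(2), unfolded prod.case] assms(3)] unfolding prod.case .

lemma vb_frame_sec:
  assumes V: "vector_bundle X V" and f: "(U, n, e) \<in> frames V" and j: "j < n"
  shows "vsec X V U (\<lambda>p. e p j)" unfolding vsec_def
proof clarify
  fix U' m f assume f': "(U', m, f) \<in> frames V"
  have o: "openin X (U \<inter> U')" using vb_frame(1)[OF V] f f' by auto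
  have "continuous_in_frames X V V (\<lambda>p u. u)" using V by (simp add: vector_bundle_def)
  from continuous_in_framesD[OF this f f']
  obtain a where "\<forall>i<m. \<forall>j<n. continuous_map (subtopology X (U \<inter> U')) euclidean (a i j)"
    "\<forall>p\<in>U \<inter> U'. \<forall>j<n. e p j = (\<Sum>i<m. vscale V (a i j p) (f p i))" by blast
  thus "\<exists>a. (\<forall>i<m. conton X (U \<inter> U') (a i)) \<and> (\<forall>p\<in>U \<inter> U'. e p j = (\<Sum>i<m. vscale V (a i p) (f p i)))"
    using j by (intro exI[of _ "\<lambda>i. a i j"]) (auto simp: conton_iff[OF o])
qed

lemma vsec_fibre:
  assumes V: "vector_bundle X V" and "vsec X V U \<sigma>" "p \<in> U" "p \<in> topspace X"
  shows "\<sigma> p \<in> vfibre V p"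
proof -
  obtain U' n e where f: "(U', n, e) \<in> frames V" "p \<in> U'" using vb_cover[OF V assms(4)] .
  obtain a where "!!p. p \<in> U ==> p \<in> U' ==> \<sigma> p = (\<Sum>i<n. vscale V (a i p) (e p i))" using vsecD[OF assms(2) f(1)] by metis
  hence "\<sigma> p = (\<Sum>i<n. vscale V (a i p) (e p i))" using assms(3) f(2) by blast
  thus ?thesis unfolding vb_frame'(2)[OF V f] by (rule lin_comb_memI)
qed

text \<open>One frame around each point suffices: coefficients in any other frame arise by
  multiplication with a transition matrix, which is continuous by
  \<open>vb_frame_sec\<close>.\<close>

lemma vsec_local:
  assumes V: "vector_bundle X V" and U: "openin X U"
    and loc: "!!p. p \<in> U ==> \<exists>W U' n e a. openin X W \<and> p \<in> W \<and> (U', n, e) \<in> frames V \<and> W \<subseteq> U' \<and>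
      (\<forall>i<n. conton X W (a i)) \<and> (\<forall>q\<in>W. \<sigma> q = (\<Sum>i<n. vscale V (a i q) (e q i)))"
  shows "vsec X V U \<sigma>" unfolding vsec_def
proof clarify
  interpret vector_space "vscale V" using V by (rule vb_vs)
  fix U'' m f assume f: "(U'', m, f) \<in> frames V"
  note oU'' = vb_frame(1)[OF V f]
  have ex: "\<exists>c. \<sigma> q = (\<Sum>i<m. vscale V (c i) (f q i))" if q: "q \<in> U" "q \<in> U''" for q
  proof -
    obtain W U' n e a where *: "q \<in> W" "(U', n, e) \<in> frames V" "W \<subseteq> U'"
      "\<forall>q\<in>W. \<sigma> q = (\<Sum>i<n. vscale V (a i q) (e q i))" using loc[OF q(1)] by (elim exE conjE)
    have "\<sigma> q = (\<Sum>i<n. vscale V (a i q) (e q i))" using * by blast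
    moreover have "q \<in> U'" using * by blast
    ultimately have "\<sigma> q \<in> vfibre V q" unfolding vb_frame'(2)[OF V *(2) \<open>q \<in> U'\<close>] by (intro lin_comb_memI)
    thus ?thesis unfolding vb_frame'(2)[OF V f q(2)] by blast
  qed
  \<comment> \<open>The coefficients are chosen pointwise. Being unique, they agree near each point
    with a continuous expression.\<close>
  define b where "b i q = (SOME c. \<sigma> q = (\<Sum>i<m. vscale V (c i) (f q i))) i" for i q
  have b: "\<sigma> q = (\<Sum>i<m. vscale V (b i q) (f q i))" if q: "q \<in> U" "q \<in> U''" for q using someI_ex[OF ex[OF q]] unfolding b_def .
  have "conton X (U \<inter> U'') (b i)" if i: "i < m" for i
  proof (rule conton_local)
    fix p assume p: "p \<in> U \<inter> U''"
    obtain W U' n e a where *: "openin X W" "p \<in> W" "(U', n, e) \<in> frames V" "W \<subseteq> U'"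
      "\<forall>i<n. conton X W (a i)" "\<forall>q\<in>W. \<sigma> q = (\<Sum>i<n. vscale V (a i q) (e q i))" using loc[OF IntD1[OF p]] by (elim exE conjE)
    have "\<exists>g. (\<forall>i<m. conton X (U' \<inter> U'') (g i)) \<and> (\<forall>p\<in>U' \<inter> U''. e p j = (\<Sum>i<m. vscale V (g i p) (f p i)))"
      if "j < n" for j using bspec[OF vb_frame_sec[OF V *(3) that, unfolded vsec_def] f] unfolding prod.case .
    then obtain g where g: "!!i j. j < n ==> i < m ==> conton X (U' \<inter> U'') (g j i)"
      "!!j p. j < n ==> p \<in> U' \<inter> U'' ==> e p j = (\<Sum>i<m. vscale V (g j i p) (f p i))" by metis
    define O' where "O' = W \<inter> (U \<inter> U'')"
    have O': "openin X O'" "p \<in> O'" using * U oU'' p by (auto simp: O'_def)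
    have "b i q = (\<Sum>j<n. a j q * g j i q)" if q: "q \<in> O'" for q
    proof -
      have q': "q \<in> W" "q \<in> U" "q \<in> U''" "q \<in> U' \<inter> U''" using q *(4) by (auto simp: O'_def)
      have "(\<Sum>i<m. vscale V (b i q) (f q i)) = (\<Sum>j<n. vscale V (a j q) (e q j))" using b[OF q'(2,3)] bspec[OF *(6) q'(1)] by simp
      also have "\<dots> = (\<Sum>j<n. \<Sum>i<m. vscale V (a j q * g j i q) (f q i))"
        using g(2)[OF _ q'(4)] by (intro sum.cong) (auto simp: scale_sum_right)
      also have "\<dots> = (\<Sum>i<m. vscale V (\<Sum>j<n. a j q * g j i q) (f q i))" by (subst sum.swap) (simp add: scale_sum_left)
      finally show ?thesis by (rule lin_indep_diff[OF vb_frame'(1)[OF V f q'(3)] _ i])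
    qed
    moreover have "conton X O' (\<lambda>q. \<Sum>j<n. a j q * g j i q)"
    proof (intro conton_sum conton_mult)
      fix j assume "j \<in> {..<n}"
      hence j: "j < n" by simp
      show "conton X O' (a j)" by (rule conton_subset[of X W]) (use *(5) j in \<open>auto simp: O'_def\<close>)
      show "conton X O' (g j i)" by (rule conton_subset[OF g(1)[OF j i]]) (use *(4) in \<open>auto simp: O'_def\<close>)
    qed
    ultimately show "\<exists>W. openin X W \<and> p \<in> W \<and> (\<exists>g. conton X W g \<and> (\<forall>q\<in>W. b i q = g q))" using O' by blast
  qed
  thus "\<exists>a. (\<forall>i<m. conton X (U \<inter> U'') (a i)) \<and> (\<forall>p\<in>U \<inter> U''. \<sigma> p = (\<Sum>i<m. vscale V (a i p) (f p i)))"
    using b by (intro exI[of _ b]) auto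
qed

lemma vsec_frame_comb:
  assumes V: "vector_bundle X V" and f: "(U', n, e) \<in> frames V"
    and U: "openin X U" "U \<subseteq> U'" and a: "!!i. i < n ==> conton X U (a i)"
    and \<sigma>: "!!q. q \<in> U ==> \<sigma> q = (\<Sum>i<n. vscale V (a i q) (e q i))"
  shows "vsec X V U \<sigma>"
proof (rule vsec_local[OF V U(1)])
  fix p assume p: "p \<in> U"
  show "\<exists>W U' n e a. openin X W \<and> p \<in> W \<and> (U', n, e) \<in> frames V \<and> W \<subseteq> U' \<and>
      (\<forall>i<n. conton X W (a i)) \<and> (\<forall>q\<in>W. \<sigma> q = (\<Sum>i<n. vscale V (a i q) (e q i)))"
    using p f U a \<sigma> by (intro exI[of _ U] exI[of _ U'] exI[of _ n] exI[of _ e] exI[of _ a]) auto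
qed

lemma vsecI:
  assumes "!!U' n e. (U', n, e) \<in> frames V ==> \<exists>a. (\<forall>i<n. conton X (U \<inter> U') (a i)) \<and>
     (\<forall>p\<in>U \<inter> U'. \<sigma> p = (\<Sum>i<n. vscale V (a i p) (e p i)))"
  shows "vsec X V U \<sigma>" unfolding vsec_def by (clarify, rule assms)

lemma vsec_locally:
  assumes V: "vector_bundle X V" and U: "openin X U"
    and loc: "!!p. p \<in> U ==> \<exists>W \<tau>. openin X W \<and> p \<in> W \<and> vsec X V W \<tau> \<and> (\<forall>q\<in>W. \<sigma> q = \<tau> q)"
  shows "vsec X V U \<sigma>"
proof (rule vsec_local[OF V U])
  fix p assume p: "p \<in> U"
  then obtain W \<tau> where W: "openin X W" "p \<in> W" "vsec X V W \<tau>" "\<forall>q\<in>W. \<sigma> q = \<tau> q" using loc by metis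
  have "p \<in> topspace X" using openin_subset[OF U] p by blast
  then obtain U' n e where f: "(U', n, e) \<in> frames V" "p \<in> U'" using vb_cover[OF V] by metis
  obtain a where a: "!!i. i < n ==> conton X (W \<inter> U') (a i)"
    "!!p. p \<in> W ==> p \<in> U' ==> \<tau> p = (\<Sum>i<n. vscale V (a i p) (e p i))" using vsecD[OF W(3) f(1)] by metis
  show "\<exists>W U' n e a. openin X W \<and> p \<in> W \<and> (U', n, e) \<in> frames V \<and> W \<subseteq> U' \<and>
      (\<forall>i<n. conton X W (a i)) \<and> (\<forall>q\<in>W. \<sigma> q = (\<Sum>i<n. vscale V (a i q) (e q i)))" using W f a vb_frame(1)[OF V f(1)]
    by (intro exI[of _ "W \<inter> U'"] exI[of _ U'] exI[of _ n] exI[of _ e] exI[of _ a]) auto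
qed

text \<open>Morphisms tested on local sections instead of matrices: composition is immediate, and
  maps into direct sums are checked by components. For vector bundles the notion agrees with the
  given one by \<open>secmap_iff_morphism\<close>.\<close>

definition secmap :: "'b topology => ('b, 'k :: {real_normed_field, euclidean_space}, 'v :: ab_group_add) vbundle
     => ('b, 'k, 'w :: ab_group_add) vbundle => ('b => 'v => 'w) => bool" where "secmap X V W T \<longleftrightarrow>
     (\<forall>p\<in>topspace X. vfibre_linear V W p (T p)) \<and> (\<forall>U \<sigma>. openin X U --> vsec X V U \<sigma> --> vsec X W U (\<lambda>p. T p (\<sigma> p)))"

lemma linear_between_comb:
  assumes s: "vector_space s" and t: "vector_space t" and V: "module.subspace s V"
    and T: "linear_between s t V W T" and e: "!!i. i < n ==> e i \<in> V"
  shows "T (\<Sum>i<(n::nat). s (c i) (e i)) = (\<Sum>i<n. t (c i) (T (e i)))"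
proof -
  interpret s: vector_space s by fact
  interpret t: vector_space t by fact
  have T0: "T 0 = 0" using T s.subspace_0[OF V] unfolding linear_between_def by (metis s.scale_zero_left t.scale_zero_left)
  show ?thesis using e
  proof (induction n)
    case (Suc n)
    have "(\<Sum>i<n. s (c i) (e i)) \<in> V" using Suc.prems by (intro s.subspace_sum[OF V] s.subspace_scale[OF V]) auto
    moreover have "s (c n) (e n) \<in> V" "e n \<in> V" using Suc.prems by (auto intro: s.subspace_scale[OF V])
    ultimately show ?case using T Suc unfolding linear_between_def by simp
  qed (simp add: T0)
qed

lemma vb_frame_mem:
  assumes V: "vector_bundle X V" and f: "(U, n, e) \<in> frames V" and "i < n" "p \<in> U"
  shows "e p i \<in> vfibre V p"
  using vsec_fibre[OF V vb_frame_sec[OF V f assms(3)] assms(4)] openin_subset[OF vb_frame(1)[OF V f]] assms(4) by auto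

text \<open>In one direction the matrix acts on coefficient vectors; in the other its columns are
  the coefficients of the images of the frame sections.\<close>

lemma secmap_iff_morphism:
  assumes V: "vector_bundle X V" and W: "vector_bundle X W"
  shows "vbundle_morphism X V W T \<longleftrightarrow> secmap X V W T"
proof
  assume T: "vbundle_morphism X V W T"
  hence lin: "!!p. p \<in> topspace X ==> vfibre_linear V W p (T p)"
    and ct: "continuous_in_frames X V W T" by (auto simp: vbundle_morphism_def)
  interpret W: vector_space "vscale W" using W by (rule vb_vs)
  have "vsec X W U (\<lambda>p. T p (\<sigma> p))" if U: "openin X U" and \<sigma>: "vsec X V U \<sigma>" for U \<sigma>
  proof (rule vsec_local[OF W U])
    fix p assume p: "p \<in> U"
    have "p \<in> topspace X" using openin_subset[OF U] p by blast
    obtain U' n e where f: "(U', n, e) \<in> frames V" "p \<in> U'" using vb_cover[OF V \<open>p \<in> topspace X\<close>] .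
    obtain U'' m g where f': "(U'', m, g) \<in> frames W" "p \<in> U''" using vb_cover[OF W \<open>p \<in> topspace X\<close>] .
    note o = vb_frame(1)[OF V f(1)] vb_frame(1)[OF W f'(1)]
    obtain c where c: "!!i. i < n ==> conton X (U \<inter> U') (c i)"
      "!!p. p \<in> U ==> p \<in> U' ==> \<sigma> p = (\<Sum>i<n. vscale V (c i p) (e p i))" using vsecD[OF \<sigma> f(1)] by metis
    from continuous_in_framesD[OF ct f(1) f'(1)]
    obtain a where "\<forall>i<m. \<forall>j<n. continuous_map (subtopology X (U' \<inter> U'')) euclidean (a i j)"
      and a2: "\<forall>p\<in>U' \<inter> U''. \<forall>j<n. T p (e p j) = (\<Sum>i<m. vscale W (a i j p) (g p i))" by blast
    hence a1: "!!i j. i < m ==> j < n ==> conton X (U' \<inter> U'') (a i j)" by (simp add: conton_iff[OF openin_Int[OF o]])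
    have "T q (\<sigma> q) = (\<Sum>i<m. vscale W (\<Sum>j<n. a i j q * c j q) (g q i))" if q: "q \<in> U \<inter> U' \<inter> U''" for q
    proof -
      have qX: "q \<in> topspace X" using openin_subset[OF U] q by blast
      have "T q (\<sigma> q) = (\<Sum>j<n. vscale W (c j q) (T q (e q j)))" using q vb_frame_mem[OF V f(1)] by (subst c(2))
          (auto intro!: linear_between_comb[OF vb_vs[OF V] vb_vs[OF W] vb_subspace[OF V qX] lin[OF qX]])
      also have "\<dots> = (\<Sum>j<n. \<Sum>i<m. vscale W (a i j q * c j q) (g q i))"
        using a2 q by (intro sum.cong) (auto simp: W.scale_sum_right mult.commute)
      also have "\<dots> = (\<Sum>i<m. vscale W (\<Sum>j<n. a i j q * c j q) (g q i))" by (subst sum.swap) (simp add: W.scale_sum_left)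
      finally show ?thesis .
    qed
    moreover have "conton X (U \<inter> U' \<inter> U'') (\<lambda>q. \<Sum>j<n. a i j q * c j q)" if "i < m" for i
      by (intro conton_sum conton_mult; rule conton_subset[OF a1] conton_subset[OF c(1)]) (use that in auto)
    ultimately show "\<exists>Wo U' n e a. openin X Wo \<and> p \<in> Wo \<and> (U', n, e) \<in> frames W \<and> Wo \<subseteq> U' \<and>
      (\<forall>i<n. conton X Wo (a i)) \<and> (\<forall>q\<in>Wo. T q (\<sigma> q) = (\<Sum>i<n. vscale W (a i q) (e q i)))" using U o p f f'
      by (intro exI[of _ "U \<inter> U' \<inter> U''"] exI[of _ U''] exI[of _ m] exI[of _ g]
          exI[of _ "\<lambda>i q. \<Sum>j<n. a i j q * c j q"]) auto
  qed
  thus "secmap X V W T" using lin by (auto simp: secmap_def)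
next
  assume T: "secmap X V W T"
  have "continuous_in_frames X V W T" unfolding continuous_in_frames_def
  proof clarify
    fix U n e U' m f assume f: "(U, n, e) \<in> frames V" "(U', m, f) \<in> frames W"
    have o: "openin X (U \<inter> U')" using vb_frame(1)[OF V f(1)] vb_frame(1)[OF W f(2)] by auto
    have "\<exists>a. (\<forall>i<m. conton X (U \<inter> U') (a i)) \<and> (\<forall>p\<in>U \<inter> U'. T p (e p j) = (\<Sum>i<m. vscale W (a i p) (f p i)))"
      if j: "j < n" for j
    proof -
      have "vsec X W U (\<lambda>p. T p (e p j))" using T vb_frame_sec[OF V f(1) j] vb_frame(1)[OF V f(1)] by (auto simp: secmap_def)
      from bspec[OF this[unfolded vsec_def] f(2)] show ?thesis unfolding prod.case .
    qed
    then obtain a where "!!j i. j < n ==> i < m ==> conton X (U \<inter> U') (a j i)"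
      "!!j p. j < n ==> p \<in> U \<inter> U' ==> T p (e p j) = (\<Sum>i<m. vscale W (a j i p) (f p i))" by metis
    thus "\<exists>a. (\<forall>i<m. \<forall>j<n. continuous_map (subtopology X (U \<inter> U')) euclidean (a i j)) \<and>
          (\<forall>p\<in>U \<inter> U'. \<forall>j<n. T p (e p j) = (\<Sum>i<m. vscale W (a i j p) (f p i)))"
      using o by (intro exI[of _ "\<lambda>i j. a j i"]) (auto simp: conton_iff)
  qed
  thus "vbundle_morphism X V W T" using T by (auto simp: secmap_def vbundle_morphism_def)
qed

lemma secmap_linear: "secmap X V W T ==> p \<in> topspace X ==>
    vfibre_linear V W p (T p)"
  and secmap_sec: "secmap X V W T ==> openin X U ==> vsec X V U \<sigma> ==> vsec X W U (\<lambda>p. T p (\<sigma> p))"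
  unfolding secmap_def by (elim conjE, erule (1) bspec) (elim conjE allE impE, assumption+)

lemma secmap_mem: "secmap X V W T ==> p \<in> topspace X ==> u \<in> vfibre V p ==> T p u \<in> vfibre W p"
  by (drule (1) secmap_linear) (simp add: linear_between_def)

lemma linear_between_compose: "linear_between s t A B f ==> linear_between t r B C g ==> linear_between s r A C (\<lambda>u. g (f u))"
  unfolding linear_between_def by auto

lemma secmap_compose:
  assumes "secmap X V W T" "secmap X W Z S"
  shows "secmap X V Z (\<lambda>p u. S p (T p u))" unfolding secmap_def
proof (intro conjI ballI allI impI)
  fix p assume p: "p \<in> topspace X"
  show "vfibre_linear V Z p (\<lambda>u. S p (T p u))"
    by (rule linear_between_compose[OF secmap_linear[OF assms(1) p] secmap_linear[OF assms(2) p]])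
next
  fix U \<sigma> assume "openin X U" "vsec X V U \<sigma>"
  from secmap_sec[OF assms(2) this(1) secmap_sec[OF assms(1) this]]
  show "vsec X Z U (\<lambda>p. S p (T p (\<sigma> p)))" .
qed

text \<open>Carries the bundle property of both sides along, so that isomorphisms can be chained by
  transitivity.\<close>

definition vb_iso :: "'b topology => ('b, 'k :: {real_normed_field, euclidean_space}, 'v :: ab_group_add) vbundle
     => ('b, 'k, 'w :: ab_group_add) vbundle => bool" where
  "vb_iso X V W \<longleftrightarrow> vector_bundle X V \<and> vector_bundle X W \<and> vbundle_isomorphic X V W"

lemma vb_isoI:
  assumes "vector_bundle X V" "vector_bundle X W" "secmap X V W T" "secmap X W V S"
    "!!p u. p \<in> topspace X ==> u \<in> vfibre V p ==> S p (T p u) = u" "!!p w. p \<in> topspace X ==> w \<in> vfibre W p ==> T p (S p w) = w"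
  shows "vb_iso X V W"
proof -
  have m: "vbundle_morphism X V W T" "vbundle_morphism X W V S"
    unfolding secmap_iff_morphism[OF assms(1,2)] secmap_iff_morphism[OF assms(2,1)] by (rule assms(3), rule assms(4))
  have "\<forall>p\<in>topspace X. (\<forall>u\<in>vfibre V p. S p (T p u) = u) \<and> (\<forall>w\<in>vfibre W p. T p (S p w) = w)"
  proof (intro ballI conjI)
    fix p assume p: "p \<in> topspace X"
    show "S p (T p u) = u" if "u \<in> vfibre V p" for u using p that by (rule assms(5))
    show "T p (S p w) = w" if "w \<in> vfibre W p" for w using p that by (rule assms(6))
  qed
  with m have "vbundle_isomorphic X V W" unfolding vbundle_isomorphic_def by blast
  thus ?thesis using assms(1,2) unfolding vb_iso_def by blast
qed

lemma vb_isoE: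
  assumes "vb_iso X V W"
  obtains T S where "secmap X V W T" "secmap X W V S" "!!p u. p \<in> topspace X ==> u \<in> vfibre V p ==> S p (T p u) = u"
    "!!p w. p \<in> topspace X ==> w \<in> vfibre W p ==> T p (S p w) = w"
proof -
  have V: "vector_bundle X V" and W: "vector_bundle X W" using assms by (auto simp: vb_iso_def)
  obtain T S where "vbundle_morphism X V W T" "vbundle_morphism X W V S"
    "\<forall>p\<in>topspace X. (\<forall>u\<in>vfibre V p. S p (T p u) = u) \<and> (\<forall>w\<in>vfibre W p. T p (S p w) = w)"
    using assms unfolding vb_iso_def vbundle_isomorphic_def by blast
  thus ?thesis unfolding secmap_iff_morphism[OF V W] secmap_iff_morphism[OF W V] using that[of T S] by metis
qed

lemma vb_iso_sym: "vb_iso X V W ==> vb_iso X W V"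
proof -
  assume i: "vb_iso X V W"
  obtain T S where "secmap X V W T" "secmap X W V S" "!!p u. p \<in> topspace X ==> u \<in> vfibre V p ==> S p (T p u) = u"
    "!!p w. p \<in> topspace X ==> w \<in> vfibre W p ==> T p (S p w) = w" by (rule vb_isoE[OF i], rule that)
  moreover have "vector_bundle X V" "vector_bundle X W" using i by (simp_all add: vb_iso_def)
  ultimately show ?thesis by (intro vb_isoI[of X W V S T])
qed

lemma vb_iso_trans [trans]:
  assumes "vb_iso X V W" "vb_iso X W Z"
  shows "vb_iso X V Z"
proof -
  obtain T S where 1: "secmap X V W T" "secmap X W V S" "!!p u. p \<in> topspace X ==> u \<in> vfibre V p ==> S p (T p u) = u"
    "!!p w. p \<in> topspace X ==> w \<in> vfibre W p ==> T p (S p w) = w" by (rule vb_isoE[OF assms(1)], rule that)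
  obtain T' S' where 2: "secmap X W Z T'" "secmap X Z W S'" "!!p u. p \<in> topspace X ==> u \<in> vfibre W p ==> S' p (T' p u) = u"
    "!!p w. p \<in> topspace X ==> w \<in> vfibre Z p ==> T' p (S' p w) = w" by (rule vb_isoE[OF assms(2)], rule that)
  show ?thesis
  proof (rule vb_isoI[OF _ _ secmap_compose[OF 1(1) 2(1)] secmap_compose[OF 2(2) 1(2)]])
    show "vector_bundle X V" "vector_bundle X Z" using assms by (auto simp: vb_iso_def)
    fix p assume p: "p \<in> topspace X"
    show "S p (S' p (T' p (T p u))) = u" if "u \<in> vfibre V p" for u using 1(3)[OF p that] 2(3)[OF p secmap_mem[OF 1(1) p that]] by simp
    show "T' p (T p (S p (S' p w))) = w" if "w \<in> vfibre Z p" for w using 2(4)[OF p that] 1(4)[OF p secmap_mem[OF 2(2) p that]] by simp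
  qed
qed

lemma sum_lessThan_add:
  fixes f :: "nat => 'a::comm_monoid_add"
  shows "(\<Sum>i<n+m. f i) = (\<Sum>i<n. f i) + (\<Sum>i<m. f (n + i))" by (induction m) (simp_all add: add.assoc)

section \<open>Direct sums\<close>

lemma vector_space_prod:
  assumes "vector_space s" "vector_space t"
  shows "vector_space (\<lambda>c (v, w). (s c v, t c w))"
proof -
  interpret s: vector_space s by fact
  interpret t: vector_space t by fact
  show ?thesis by standard (auto simp: s.scale_right_distrib t.scale_right_distrib
        s.scale_left_distrib t.scale_left_distrib)
qed

lemma vscale_sum: "vscale (V \<oplus>\<^sub>V W) c (v, w) = (vscale V c v, vscale W c w)"
  and vfibre_sum: "vfibre (V \<oplus>\<^sub>V W) p = vfibre V p \<times> vfibre W p" by (simp_all add: vbundle_sum_def)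

abbreviation sum_frame :: "nat => ('b => nat => 'v) => ('b => nat => 'w) => 'b => nat => 'v::zero \<times> 'w::zero" where
  "sum_frame n e f \<equiv> \<lambda>p i. if i < n then (e p i, 0) else (0, f p (i - n))"

lemma frames_sumI: "(U1, n, e) \<in> frames V ==> (U2, m, f) \<in> frames W ==> (U1 \<inter> U2, n + m, sum_frame n e f) \<in> frames (V \<oplus>\<^sub>V W)"
  unfolding vbundle_sum_def by simp blast

lemma frames_sumE:
  assumes "(U, k, g) \<in> frames (V \<oplus>\<^sub>V W)"
  obtains U1 n e U2 m f where "(U1, n, e) \<in> frames V" "(U2, m, f) \<in> frames W" "U = U1 \<inter> U2" "k = n + m" "g = sum_frame n e f"
  using assms unfolding vbundle_sum_def by (simp, elim exE conjE) (rule that)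

lemma frame_comb_sum:
  assumes V: "vector_space (vscale V)" and W: "vector_space (vscale W)"
  shows "(\<Sum>i<n+m. vscale (V \<oplus>\<^sub>V W) (c i) (sum_frame n e f p i)) = (\<Sum>i<n. vscale V (c i) (e p i), \<Sum>i<m. vscale W (c (n + i)) (f p i))"
proof -
  interpret V: vector_space "vscale V" by fact
  interpret W: vector_space "vscale W" by fact
  have "(\<Sum>i<n+m. vscale (V \<oplus>\<^sub>V W) (c i) (sum_frame n e f p i)) =
      (\<Sum>i<n. (vscale V (c i) (e p i), 0)) + (\<Sum>i<m. (0, vscale W (c (n + i)) (f p i)))"
    unfolding sum_lessThan_add by (simp add: vscale_sum)
  also have "\<dots> = (\<Sum>i<n. vscale V (c i) (e p i), \<Sum>i<m. vscale W (c (n + i)) (f p i))"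
    by (simp add: sum_prod[symmetric] prod_eq_iff fst_sum snd_sum)
  finally show ?thesis .
qed

lemma is_basis_sum:
  assumes V: "vector_bundle X V" and W: "vector_bundle X W"
    and f: "(U, n, e) \<in> frames V" "(U', m, f) \<in> frames W" and p: "p \<in> U" "p \<in> U'"
  shows "is_basis (vscale (V \<oplus>\<^sub>V W)) (vfibre (V \<oplus>\<^sub>V W) p) (n + m) (sum_frame n e f p)"
proof -
  note vs = vb_vs[OF V] vb_vs[OF W]
  have vsum: "vector_space (vscale (V \<oplus>\<^sub>V W))" using vector_space_prod[OF vs] by (simp add: vbundle_sum_def)
  note 1 = vb_frame'[OF V f(1) p(1)] and 2 = vb_frame'[OF W f(2) p(2)]
  show ?thesis unfolding vector_space.is_basis_iff[OF vsum] frame_comb_sum[OF vs]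
  proof
    show "lin_indep (vscale (V \<oplus>\<^sub>V W)) (n + m) (sum_frame n e f p)" unfolding lin_indep_def frame_comb_sum[OF vs]
    proof (intro allI impI)
      fix c i assume *: "(\<Sum>i<n. vscale V (c i) (e p i), \<Sum>i<m. vscale W (c (n + i)) (f p i)) = 0" and i: "i < n + m"
      hence a: "(\<Sum>i<n. vscale V (c i) (e p i)) = 0" and b: "(\<Sum>i<m. vscale W (c (n + i)) (f p i)) = 0" by (auto simp: zero_prod_def)
      show "c i = 0"
      proof (cases "i < n")
        case True thus ?thesis using lin_indepD[OF 1(1) a] by simp
      next
        case False
        hence "c (n + (i - n)) = 0" using lin_indepD[OF 2(1) b, of "i - n"] i by simp
        thus ?thesis using False by simp
      qed
    qed
    show "vfibre (V \<oplus>\<^sub>V W) p = {(\<Sum>i<n. vscale V (c i) (e p i), \<Sum>i<m. vscale W (c (n + i)) (f p i)) |c. True}"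
      unfolding vfibre_sum 1(2) 2(2)
    proof (intro subset_antisym subsetI)
      fix x assume "x \<in> {\<Sum>i<n. vscale V (c i) (e p i) |c. True} \<times> {\<Sum>i<m. vscale W (c i) (f p i) |c. True}"
      then obtain a b where x: "x = (\<Sum>i<n. vscale V (a i) (e p i), \<Sum>i<m. vscale W (b i) (f p i))" by auto
      have "x = (\<Sum>i<n. vscale V ((\<lambda>i. if i < n then a i else b (i - n)) i) (e p i),
          \<Sum>i<m. vscale W ((\<lambda>i. if i < n then a i else b (i - n)) (n + i)) (f p i))" unfolding x by simp
      thus "x \<in> {(\<Sum>i<n. vscale V (c i) (e p i), \<Sum>i<m. vscale W (c (n + i)) (f p i)) |c. True}"
        by (intro CollectI exI[of _ "\<lambda>i. if i < n then a i else b (i - n)"] conjI TrueI)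
    qed auto
  qed
qed

lemma vector_bundle_sum:
  assumes V: "vector_bundle X V" and W: "vector_bundle X W"
  shows "vector_bundle X (V \<oplus>\<^sub>V W)" unfolding vector_bundle_def
proof (intro conjI)
  note vs = vb_vs[OF V] vb_vs[OF W]
  show "vector_space (vscale (V \<oplus>\<^sub>V W))" using vector_space_prod[OF vs] by (simp add: vbundle_sum_def)
  show "\<forall>(U, n, e)\<in>frames (V \<oplus>\<^sub>V W). openin X U \<and> (\<forall>p\<in>U. is_basis (vscale (V \<oplus>\<^sub>V W)) (vfibre (V \<oplus>\<^sub>V W) p) n (e p))"
  proof clarify
    fix U k g assume "(U, k, g) \<in> frames (V \<oplus>\<^sub>V W)"
    then obtain U1 n e U2 m f where *: "(U1, n, e) \<in> frames V" "(U2, m, f) \<in> frames W"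
      "U = U1 \<inter> U2" "k = n + m" "g = sum_frame n e f" by (rule frames_sumE)
    have "openin X U" unfolding *(3) using vb_frame(1)[OF V *(1)] vb_frame(1)[OF W *(2)] by (rule openin_Int)
    moreover have "is_basis (vscale (V \<oplus>\<^sub>V W)) (vfibre (V \<oplus>\<^sub>V W) p) k (g p)" if "p \<in> U" for p
      using is_basis_sum[OF V W *(1,2), of p] that unfolding *(3-5) by simp
    ultimately show "openin X U \<and> (\<forall>p\<in>U. is_basis (vscale (V \<oplus>\<^sub>V W)) (vfibre (V \<oplus>\<^sub>V W) p) k (g p))" by blast
  qed
  show "\<Union>(fst ` frames (V \<oplus>\<^sub>V W)) = topspace X"
  proof (intro subset_antisym subsetI)
    fix p assume "p \<in> \<Union>(fst ` frames (V \<oplus>\<^sub>V W))"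
    then obtain U k g where "(U, k, g) \<in> frames (V \<oplus>\<^sub>V W)" "p \<in> U" by force
    then obtain U1 n e where "(U1, n, e) \<in> frames V" "p \<in> U1" by (auto elim!: frames_sumE)
    thus "p \<in> topspace X" using openin_subset[OF vb_frame(1)[OF V]] by blast
  next
    fix p assume p: "p \<in> topspace X"
    obtain U1 n e where f1: "(U1, n, e) \<in> frames V" "p \<in> U1" using vb_cover[OF V p] .
    obtain U2 m f where f2: "(U2, m, f) \<in> frames W" "p \<in> U2" using vb_cover[OF W p] .
    have "(U1 \<inter> U2, n + m, sum_frame n e f) \<in> frames (V \<oplus>\<^sub>V W)" by (rule frames_sumI[OF f1(1) f2(1)])
    hence "U1 \<inter> U2 \<in> fst ` frames (V \<oplus>\<^sub>V W)" by force
    thus "p \<in> \<Union>(fst ` frames (V \<oplus>\<^sub>V W))" using f1 f2 by blast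
  qed
  show "continuous_in_frames X (V \<oplus>\<^sub>V W) (V \<oplus>\<^sub>V W) (\<lambda>p u. u)" unfolding continuous_in_frames_def
  proof clarify
    fix U k g U' k' g' assume fr: "(U, k, g) \<in> frames (V \<oplus>\<^sub>V W)" "(U', k', g') \<in> frames (V \<oplus>\<^sub>V W)"
    obtain U1 n e U2 m f where *: "(U1, n, e) \<in> frames V" "(U2, m, f) \<in> frames W"
      "U = U1 \<inter> U2" "k = n + m" "g = sum_frame n e f" using fr(1) by (rule frames_sumE)
    obtain U1' n' e' U2' m' f' where star: "(U1', n', e') \<in> frames V" "(U2', m', f') \<in> frames W"
      "U' = U1' \<inter> U2'" "k' = n' + m'" "g' = sum_frame n' e' f'" using fr(2) by (rule frames_sumE)
    note o = vb_frame(1)[OF V *(1)] vb_frame(1)[OF W *(2)] vb_frame(1)[OF V star(1)] vb_frame(1)[OF W star(2)]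
    have oo: "openin X (U \<inter> U')" unfolding *(3) star(3) using o by auto
    interpret V: vector_space "vscale V" by (rule vs)
    interpret W: vector_space "vscale W" by (rule vs)
    have "\<exists>a. (\<forall>i<k'. conton X (U \<inter> U') (a i)) \<and> (\<forall>p\<in>U \<inter> U'. g p j = (\<Sum>i<k'. vscale (V \<oplus>\<^sub>V W) (a i p) (g' p i)))"
      if j: "j < k" for j
    proof (cases "j < n")
      case True
      obtain a where a: "!!i. i < n' ==> conton X (U1 \<inter> U1') (a i)" "!!p. p \<in> U1 ==> p \<in> U1' ==> e p j = (\<Sum>i<n'. vscale V (a i p) (e' p i))"
        by (rule vsecD[OF vb_frame_sec[OF V *(1) True] star(1)], rule that)
      have "conton X (U \<inter> U') (if i < n' then a i else (\<lambda>_. 0))" for i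
        using conton_subset[OF a(1)[of i], of "U \<inter> U'"] by (auto simp: *(3) star(3) conton_const)
      moreover have "g p j = (\<Sum>i<k'. vscale (V \<oplus>\<^sub>V W) ((if i < n' then a i else (\<lambda>_. 0)) p) (g' p i))"
        if "p \<in> U \<inter> U'" for p using True that a(2)[of p] unfolding *(3,5) star(3,4,5)
        by (subst frame_comb_sum[OF vs, where p = p and e = e' and f = f']) simp
      ultimately show ?thesis by (intro exI[of _ "\<lambda>i. if i < n' then a i else (\<lambda>_. 0)"]) blast
    next
      case False
      hence j': "j - n < m" using j *(4) by simp
      obtain a where a: "!!i. i < m' ==> conton X (U2 \<inter> U2') (a i)"
        "!!p. p \<in> U2 ==> p \<in> U2' ==> f p (j - n) = (\<Sum>i<m'. vscale W (a i p) (f' p i))"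
        by (rule vsecD[OF vb_frame_sec[OF W *(2) j'] star(2)], rule that)
      have "conton X (U \<inter> U') (if i < n' then (\<lambda>_. 0) else a (i - n'))" if "i < k'" for i using that star(4)
        by (cases "i < n'") (auto simp: *(3) star(3) conton_const intro!: conton_subset[OF a(1)])
      moreover have "g p j = (\<Sum>i<k'. vscale (V \<oplus>\<^sub>V W) ((if i < n' then (\<lambda>_. 0) else a (i - n')) p) (g' p i))"
        if "p \<in> U \<inter> U'" for p using False that a(2)[of p] unfolding *(3,5) star(3,4,5)
        by (subst frame_comb_sum[OF vs, where p = p and e = e' and f = f']) simp
      ultimately show ?thesis by (intro exI[of _ "\<lambda>i. if i < n' then (\<lambda>_. 0) else a (i - n')"]) blast
    qed
    then obtain a where a: "!!i j. j < k ==> i < k' ==> conton X (U \<inter> U') (a j i)"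
      "!!j p. j < k ==> p \<in> U \<inter> U' ==> g p j = (\<Sum>i<k'. vscale (V \<oplus>\<^sub>V W) (a j i p) (g' p i))" by metis
    show "\<exists>a. (\<forall>i<k'. \<forall>j<k. continuous_map (subtopology X (U \<inter> U')) euclidean (a i j)) \<and>
        (\<forall>p\<in>U \<inter> U'. \<forall>j<k. g p j = (\<Sum>i<k'. vscale (V \<oplus>\<^sub>V W) (a i j p) (g' p i)))"
      by (intro exI[of _ "\<lambda>i j. a j i"] conjI allI impI ballI) (simp_all add: conton_iff[OF oo] a(1) a(2)[symmetric])
  qed
qed

text \<open>With this, commutativity, associativity and the like need no frames: the maps only
  rearrange components of sections.\<close>

lemma vsec_sum_iff:
  assumes V: "vector_bundle X V" and W: "vector_bundle X W" and U: "openin X U"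
  shows "vsec X (V \<oplus>\<^sub>V W) U \<sigma> \<longleftrightarrow> vsec X V U (\<lambda>p. fst (\<sigma> p)) \<and> vsec X W U (\<lambda>p. snd (\<sigma> p))"
proof
  note vs = vb_vs[OF V] vb_vs[OF W]
  note VW = vector_bundle_sum[OF V W]
  have fr: "\<exists>U1 n e U2 m f. (U1, n, e) \<in> frames V \<and> (U2, m, f) \<in> frames W \<and> p \<in> U1 \<and> p \<in> U2 \<and>
      openin X U1 \<and> openin X U2 \<and> (U1 \<inter> U2, n + m, sum_frame n e f) \<in> frames (V \<oplus>\<^sub>V W)" if "p \<in> U" for p
  proof -
    have p: "p \<in> topspace X" using openin_subset[OF U] that by blast
    obtain U1 n e where f1: "(U1, n, e) \<in> frames V" "p \<in> U1" using vb_cover[OF V p] .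
    obtain U2 m f where f2: "(U2, m, f) \<in> frames W" "p \<in> U2" using vb_cover[OF W p] .
    have "(U1 \<inter> U2, n + m, sum_frame n e f) \<in> frames (V \<oplus>\<^sub>V W)" by (rule frames_sumI[OF f1(1) f2(1)])
    thus ?thesis using f1 f2 vb_frame(1)[OF V f1(1)] vb_frame(1)[OF W f2(1)] by blast
  qed
  {
    assume \<sigma>: "vsec X (V \<oplus>\<^sub>V W) U \<sigma>"
    show "vsec X V U (\<lambda>p. fst (\<sigma> p)) \<and> vsec X W U (\<lambda>p. snd (\<sigma> p))"
    proof (intro conjI vsec_locally[OF V U] vsec_locally[OF W U])
      fix p assume p: "p \<in> U"
      obtain U1 n e U2 m f where *: "(U1, n, e) \<in> frames V" "(U2, m, f) \<in> frames W" "p \<in> U1" "p \<in> U2"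
        "openin X U1" "openin X U2" "(U1 \<inter> U2, n + m, sum_frame n e f) \<in> frames (V \<oplus>\<^sub>V W)" using fr[OF p] by blast
      obtain a where a: "!!i. i < n + m ==> conton X (U \<inter> (U1 \<inter> U2)) (a i)"
        "!!p. p \<in> U ==> p \<in> U1 \<inter> U2 ==> \<sigma> p = (\<Sum>i<n+m. vscale (V \<oplus>\<^sub>V W) (a i p) (sum_frame n e f p i))"
        by (rule vsecD[OF \<sigma> *(7)], rule that)
      define O' where "O' = U \<inter> (U1 \<inter> U2)"
      have O': "openin X O'" "p \<in> O'" using * U p by (auto simp: O'_def)
      have s: "\<sigma> q = (\<Sum>i<n. vscale V (a i q) (e q i), \<Sum>i<m. vscale W (a (n + i) q) (f q i))" if "q \<in> O'" for q
        using a(2)[of q] that frame_comb_sum[OF vs, where p = q and e = e and f = f] by (simp add: O'_def)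
      have "vsec X V O' (\<lambda>q. fst (\<sigma> q))" by (rule vsec_frame_comb[OF V *(1) O'(1), of a]) (use s a(1) in \<open>auto simp: O'_def\<close>)
      thus "\<exists>W \<tau>. openin X W \<and> p \<in> W \<and> vsec X V W \<tau> \<and> (\<forall>q\<in>W. fst (\<sigma> q) = \<tau> q)" using O' by blast
      have "vsec X W O' (\<lambda>q. snd (\<sigma> q))"
        by (rule vsec_frame_comb[OF W *(2) O'(1), of "\<lambda>i. a (n + i)"]) (use s a(1) in \<open>auto simp: O'_def\<close>)
      thus "\<exists>Z \<tau>. openin X Z \<and> p \<in> Z \<and> vsec X W Z \<tau> \<and> (\<forall>q\<in>Z. snd (\<sigma> q) = \<tau> q)" using O' by blast
    qed
  next
    assume \<sigma>: "vsec X V U (\<lambda>p. fst (\<sigma> p)) \<and> vsec X W U (\<lambda>p. snd (\<sigma> p))"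
    show "vsec X (V \<oplus>\<^sub>V W) U \<sigma>"
    proof (rule vsec_locally[OF VW U])
      fix p assume p: "p \<in> U"
      obtain U1 n e U2 m f where *: "(U1, n, e) \<in> frames V" "(U2, m, f) \<in> frames W" "p \<in> U1" "p \<in> U2"
        "openin X U1" "openin X U2" "(U1 \<inter> U2, n + m, sum_frame n e f) \<in> frames (V \<oplus>\<^sub>V W)" using fr[OF p] by blast
      obtain a where a: "!!i. i < n ==> conton X (U \<inter> U1) (a i)" "!!p. p \<in> U ==> p \<in> U1 ==> fst (\<sigma> p) = (\<Sum>i<n. vscale V (a i p) (e p i))"
        by (rule vsecD[OF conjunct1[OF \<sigma>] *(1)], rule that)
      obtain b where b: "!!i. i < m ==> conton X (U \<inter> U2) (b i)" "!!p. p \<in> U ==> p \<in> U2 ==> snd (\<sigma> p) = (\<Sum>i<m. vscale W (b i p) (f p i))"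
        by (rule vsecD[OF conjunct2[OF \<sigma>] *(2)], rule that)
      define O' where "O' = U \<inter> (U1 \<inter> U2)"
      have O': "openin X O'" "p \<in> O'" "O' \<subseteq> U1 \<inter> U2" using * U p by (auto simp: O'_def)
      define c where "c i = (if i < n then a i else b (i - n))" for i
      have "vsec X (V \<oplus>\<^sub>V W) O' \<sigma>"
      proof (rule vsec_frame_comb[OF VW *(7) O'(1,3), of c])
        show "conton X O' (c i)" if "i < n + m" for i using that
          by (cases "i < n") (auto simp: c_def O'_def intro!: conton_subset[OF a(1)] conton_subset[OF b(1)])
        show "\<sigma> q = (\<Sum>i<n+m. vscale (V \<oplus>\<^sub>V W) (c i q) (sum_frame n e f q i))" if "q \<in> O'" for q
          using that a(2)[of q] b(2)[of q] frame_comb_sum[OF vs, where p = q and e = e and f = f]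
          by (simp add: c_def O'_def prod_eq_iff)
      qed
      thus "\<exists>W' \<tau>. openin X W' \<and> p \<in> W' \<and> vsec X (V \<oplus>\<^sub>V W) W' \<tau> \<and> (\<forall>q\<in>W'. \<sigma> q = \<tau> q)" using O' by blast
    qed
  }
qed

lemma secmap_sumI:
  assumes bundles: "vector_bundle X V" "vector_bundle X W" and lin: "!!p. p \<in> topspace X ==>
      linear_between (vscale Z) (vscale (V \<oplus>\<^sub>V W)) (vfibre Z p) (vfibre (V \<oplus>\<^sub>V W) p) (T p)"
    and "!!U \<sigma>. openin X U ==> vsec X Z U \<sigma> ==>
      vsec X V U (\<lambda>p. fst (T p (\<sigma> p))) \<and> vsec X W U (\<lambda>p. snd (T p (\<sigma> p)))"
  shows "secmap X Z (V \<oplus>\<^sub>V W) T" unfolding secmap_def using assms by (simp add: vsec_sum_iff)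

lemma vb_iso_refl:
  assumes "vector_bundle X V"
  shows "vb_iso X V V"
proof -
  have "secmap X V V (\<lambda>p u. u)" unfolding secmap_def by (simp add: linear_between_def)
  from vb_isoI[OF assms assms this this] show ?thesis by simp
qed

lemma vb_iso_sum_cong:
  assumes "vb_iso X V V'" "vb_iso X W W'"
  shows "vb_iso X (V \<oplus>\<^sub>V W) (V' \<oplus>\<^sub>V W')"
proof -
  have vb: "vector_bundle X V" "vector_bundle X V'" "vector_bundle X W" "vector_bundle X W'" using assms by (simp_all add: vb_iso_def)
  obtain T S where 1: "secmap X V V' T" "secmap X V' V S" "!!p u. p \<in> topspace X ==> u \<in> vfibre V p ==> S p (T p u) = u"
    "!!p w. p \<in> topspace X ==> w \<in> vfibre V' p ==> T p (S p w) = w" by (rule vb_isoE[OF assms(1)], rule that)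
  obtain T' S' where 2: "secmap X W W' T'" "secmap X W' W S'" "!!p u. p \<in> topspace X ==> u \<in> vfibre W p ==> S' p (T' p u) = u"
    "!!p w. p \<in> topspace X ==> w \<in> vfibre W' p ==> T' p (S' p w) = w" by (rule vb_isoE[OF assms(2)], rule that)
  have sm: "secmap X (A \<oplus>\<^sub>V B) (A' \<oplus>\<^sub>V B') (\<lambda>p (u, v). (f p u, g p v))"
    if "secmap X A A' f" "secmap X B B' g" "vector_bundle X A" "vector_bundle X B" "vector_bundle X A'" "vector_bundle X B'"
    for f g and A :: "('a, 'b, 'g::ab_group_add) vbundle" and A' :: "('a, 'b, 'h::ab_group_add) vbundle"
    and B :: "('a, 'b, 'i::ab_group_add) vbundle" and B' :: "('a, 'b, 'j::ab_group_add) vbundle"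
  proof (rule secmap_sumI[OF that(5,6)])
    fix p assume p: "p \<in> topspace X"
    show "linear_between (vscale (A \<oplus>\<^sub>V B)) (vscale (A' \<oplus>\<^sub>V B')) (vfibre (A \<oplus>\<^sub>V B) p) (vfibre (A' \<oplus>\<^sub>V B') p) (\<lambda>(u, v). (f p u, g p v))"
      using secmap_linear[OF that(1) p] secmap_linear[OF that(2) p]
      unfolding linear_between_def vfibre_sum by (simp add: vscale_sum split_beta)
  next
    fix U \<sigma> assume "openin X U" "vsec X (A \<oplus>\<^sub>V B) U \<sigma>"
    thus "vsec X A' U (\<lambda>p. fst (case \<sigma> p of (u, v) => (f p u, g p v))) \<and>
        vsec X B' U (\<lambda>p. snd (case \<sigma> p of (u, v) => (f p u, g p v)))"
      using secmap_sec[OF that(1)] secmap_sec[OF that(2)] vsec_sum_iff[OF that(3,4)] by (simp add: split_beta)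
  qed
  show ?thesis by (rule vb_isoI[OF vector_bundle_sum[OF vb(1,3)] vector_bundle_sum[OF vb(2,4)]
          sm[OF 1(1) 2(1) vb(1,3,2,4)] sm[OF 1(2) 2(2) vb(2,4,1,3)]]) (auto simp: vfibre_sum 1 2)
qed

section \<open>The class of a formal difference\<close>

lemma vector_space_smult: "vector_space (smult :: 'k::field => 'k poly => 'k poly)"
  by standard (auto simp: smult_add_right smult_add_left)

lemma vector_bundle_zero: "vector_bundle X (zero_vbundle X)"
proof -
  have "is_basis smult {0 :: 'k::field poly} 0 (\<lambda>i. 0)" by (simp add: vector_space.is_basis_iff[OF vector_space_smult] lin_indep_def)
  thus ?thesis by (auto simp: vector_bundle_def zero_vbundle_def vector_space_smult continuous_in_frames_def)
qed

lemma zero_in_VB: "zero_vbundle X \<in> VB X" using vector_bundle_zero by (simp add: VB_def zero_vbundle_def)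

lemma vsec_zero_iff: "U \<subseteq> topspace X ==> vsec X (zero_vbundle X) U \<sigma> \<longleftrightarrow> (\<forall>p\<in>U. \<sigma> p = 0)" by (auto simp: vsec_def zero_vbundle_def)

lemma vb_iso_zero_right:
  assumes V: "vector_bundle X V"
  shows "vb_iso X (V \<oplus>\<^sub>V zero_vbundle X) V"
proof (rule vb_isoI[where T = "\<lambda>p (v, z). v" and S = "\<lambda>p v. (v, 0)", OF vector_bundle_sum[OF V vector_bundle_zero] V])
  have o: "openin X U ==> U \<subseteq> topspace X" for U by (rule openin_subset)
  show "secmap X (V \<oplus>\<^sub>V zero_vbundle X) V (\<lambda>p (v, z). v)" unfolding secmap_def
    by (auto simp: linear_between_def vfibre_sum vscale_sum vsec_sum_iff[OF V vector_bundle_zero] split_beta)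
  show "secmap X V (V \<oplus>\<^sub>V zero_vbundle X) (\<lambda>p v. (v, 0))" by (rule secmap_sumI[OF V vector_bundle_zero])
      (auto simp: linear_between_def vfibre_sum vscale_sum zero_vbundle_def vsec_zero_iff[OF o, unfolded zero_vbundle_def])
qed (auto simp: vfibre_sum zero_vbundle_def)

lemma vb_iso_comm:
  assumes V: "vector_bundle X V" and W: "vector_bundle X W"
  shows "vb_iso X (V \<oplus>\<^sub>V W) (W \<oplus>\<^sub>V V)"
proof -
  have "secmap X (A \<oplus>\<^sub>V B) (B \<oplus>\<^sub>V A) (\<lambda>p (v, w). (w, v))" if "vector_bundle X A" "vector_bundle X B"
    for A :: "('a, 'b, 'g::ab_group_add) vbundle" and B :: "('a, 'b, 'h::ab_group_add) vbundle" by (rule secmap_sumI[OF that(2,1)])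
      (auto simp: linear_between_def vfibre_sum vscale_sum vsec_sum_iff[OF that] split_beta)
  from vb_isoI[OF vector_bundle_sum[OF V W] vector_bundle_sum[OF W V] this[OF V W] this[OF W V]]
  show ?thesis by (auto simp: vfibre_sum)
qed

lemma vb_iso_assoc:
  assumes V: "vector_bundle X V" and W: "vector_bundle X W" and Z: "vector_bundle X Z"
  shows "vb_iso X ((V \<oplus>\<^sub>V W) \<oplus>\<^sub>V Z) (V \<oplus>\<^sub>V (W \<oplus>\<^sub>V Z))"
proof (rule vb_isoI[where T = "\<lambda>p ((v, w), z). (v, (w, z))" and S = "\<lambda>p (v, (w, z)). ((v, w), z)"])
  note VW = vector_bundle_sum[OF V W] and WZ = vector_bundle_sum[OF W Z]
  show "vector_bundle X ((V \<oplus>\<^sub>V W) \<oplus>\<^sub>V Z)" "vector_bundle X (V \<oplus>\<^sub>V (W \<oplus>\<^sub>V Z))"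
    by (rule vector_bundle_sum[OF VW Z], rule vector_bundle_sum[OF V WZ])
  note simps = vfibre_sum vscale_sum vsec_sum_iff[OF V W] vsec_sum_iff[OF W Z]
    vsec_sum_iff[OF VW Z] vsec_sum_iff[OF V WZ] split_beta
  show "secmap X ((V \<oplus>\<^sub>V W) \<oplus>\<^sub>V Z) (V \<oplus>\<^sub>V (W \<oplus>\<^sub>V Z)) (\<lambda>p ((v, w), z). (v, (w, z)))"
    by (rule secmap_sumI[OF V WZ]) (auto simp: linear_between_def simps)
  show "secmap X (V \<oplus>\<^sub>V (W \<oplus>\<^sub>V Z)) ((V \<oplus>\<^sub>V W) \<oplus>\<^sub>V Z) (\<lambda>p (v, (w, z)). ((v, w), z))"
    by (rule secmap_sumI[OF VW Z]) (auto simp: linear_between_def simps)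
qed (auto simp: vfibre_sum)

lemma vb_iso_swap_middle:
  assumes V: "vector_bundle X V" and W: "vector_bundle X W" and Z: "vector_bundle X Z"
  shows "vb_iso X ((V \<oplus>\<^sub>V W) \<oplus>\<^sub>V Z) ((V \<oplus>\<^sub>V Z) \<oplus>\<^sub>V W)"
proof -
  have "vb_iso X ((V \<oplus>\<^sub>V W) \<oplus>\<^sub>V Z) (V \<oplus>\<^sub>V (W \<oplus>\<^sub>V Z))" by (rule vb_iso_assoc[OF assms])
  also have "vb_iso X \<dots> (V \<oplus>\<^sub>V (Z \<oplus>\<^sub>V W))" by (rule vb_iso_sum_cong[OF vb_iso_refl[OF V] vb_iso_comm[OF W Z]])
  also have "vb_iso X \<dots> ((V \<oplus>\<^sub>V Z) \<oplus>\<^sub>V W)" by (rule vb_iso_sym[OF vb_iso_assoc[OF V Z W]])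
  finally show ?thesis .
qed

text \<open>The fibrewise embeddings \<open>T p\<close> into polynomials are chosen without regard
  to continuity in \<open>p\<close>. The frames of the copy are by definition the images of those of
  \<open>V\<close>, so all transition matrices stay the same.\<close>

lemma vb_copy:
  fixes V :: "('b, 'k :: {real_normed_field, euclidean_space}, 'v :: ab_group_add) vbundle"
  assumes V: "vector_bundle X V"
  obtains G where "G \<in> VB X" "vb_iso X V G"
proof -
  interpret V: vector_space "vscale V" by (rule vb_vs[OF V])
  interpret P: vector_space "smult :: 'k => 'k poly => 'k poly" by (rule vector_space_smult)
  have "\<exists>T :: 'v => 'k poly. linear_between (vscale V) smult (vfibre V p) UNIV T \<and> inj_on T (vfibre V p)"
    if p: "p \<in> topspace X" for p
  proof -
    obtain U n e where f: "(U, n, e) \<in> frames V" "p \<in> U" using vb_cover[OF V p] .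
    note b = vb_frame'[OF V f]
    define c where "c u = (SOME c. u = (\<Sum>i<n. vscale V (c i) (e p i)))" for u
    have c: "u = (\<Sum>i<n. vscale V (c u i) (e p i))" if "u \<in> vfibre V p" for u
    proof -
      have "\<exists>c. u = (\<Sum>i<n. vscale V (c i) (e p i))" using that unfolding b(2) by blast
      thus ?thesis unfolding c_def by (rule someI_ex)
    qed
    note sub = vb_subspace[OF V p]
    \<comment> \<open>The coordinates in one frame at \<open>p\<close> become the coefficients of a
      polynomial.\<close>
    define T where "T u = (\<Sum>i<n. monom (c u i) i)" for u
    have coeff: "coeff (T u) i = (if i < n then c u i else 0)" for u i by (simp add: T_def coeff_sum)
    have add: "c (u + v) i = c u i + c v i" if uv: "u \<in> vfibre V p" "v \<in> vfibre V p" and "i < n" for u v i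
    proof (rule V.lin_indep_diff[OF b(1) _ that(3)])
      have "(\<Sum>i<n. vscale V (c (u + v) i) (e p i)) = u + v" using c[OF V.subspace_add[OF sub uv]] by simp
      also have "\<dots> = (\<Sum>i<n. vscale V (c u i) (e p i)) + (\<Sum>i<n. vscale V (c v i) (e p i))" using c[OF uv(1)] c[OF uv(2)] by simp
      finally show "(\<Sum>i<n. vscale V (c (u + v) i) (e p i)) = (\<Sum>i<n. vscale V (c u i + c v i) (e p i))"
        by (simp add: V.scale_left_distrib sum.distrib)
    qed
    have scl: "c (vscale V a u) i = a * c u i" if u: "u \<in> vfibre V p" and "i < n" for a u i
    proof (rule V.lin_indep_diff[OF b(1) _ that(2)])
      have "(\<Sum>i<n. vscale V (c (vscale V a u) i) (e p i)) = vscale V a u" using c[OF V.subspace_scale[OF sub u, of a]] by simp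
      also have "\<dots> = vscale V a (\<Sum>i<n. vscale V (c u i) (e p i))" using c[OF u] by simp
      finally show "(\<Sum>i<n. vscale V (c (vscale V a u) i) (e p i)) = (\<Sum>i<n. vscale V (a * c u i) (e p i))"
        by (simp add: V.scale_sum_right)
    qed
    have "linear_between (vscale V) smult (vfibre V p) UNIV T"
      unfolding linear_between_def using add scl by (auto intro!: poly_eqI simp: coeff)
    moreover have "inj_on T (vfibre V p)"
    proof (rule inj_onI)
      fix u v assume uv: "u \<in> vfibre V p" "v \<in> vfibre V p" "T u = T v"
      have "c u i = c v i" if "i < n" for i using coeff[of u i] coeff[of v i] uv(3) that by simp
      thus "u = v" by (subst c[OF uv(1)], subst c[OF uv(2)]) simp
    qed
    ultimately show ?thesis by blast
  qed
  then obtain T :: "'b => 'v => 'k poly" where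
    lin: "!!p. p \<in> topspace X ==> linear_between (vscale V) smult (vfibre V p) UNIV (T p)" and
    inj: "!!p. p \<in> topspace X ==> inj_on (T p) (vfibre V p)" by metis
  define G where "G = \<lparr>vfibre = (\<lambda>p. T p ` vfibre V p), vscale = smult,
     frames = (\<lambda>(U, n, e). (U, n, \<lambda>p i. T p (e p i))) ` frames V\<rparr>"
  have Gs: "vscale G = smult" "!!p. vfibre G p = T p ` vfibre V p" by (simp_all add: G_def)
  have G_frame: "\<exists>e. (U, n, e) \<in> frames V \<and> g = (\<lambda>p i. T p (e p i))" if "(U, n, g) \<in> frames G" for U n g
    using that by (auto simp: G_def)
  have G_frameI: "(U, n, \<lambda>p i. T p (e p i)) \<in> frames G" if "(U, n, e) \<in> frames V" for U n e using that by (force simp: G_def)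
  have Tcomb: "T p (\<Sum>i<n. vscale V (c i) (e p i)) = (\<Sum>i<n. smult (c i) (T p (e p i)))"
    if f: "(U, n, e) \<in> frames V" "p \<in> U" for U n e p c
  proof -
    have p: "p \<in> topspace X" using openin_subset[OF vb_frame(1)[OF V f(1)]] f(2) by blast
    show ?thesis by (rule linear_between_comb[OF vb_vs[OF V] vector_space_smult vb_subspace[OF V p] lin[OF p]])
        (rule vb_frame_mem[OF V f(1) _ f(2)])
  qed
  have T0: "T p 0 = 0" if p: "p \<in> topspace X" for p
  proof -
    obtain U n e where f: "(U, n, e) \<in> frames V" "p \<in> U" using vb_cover[OF V p] .
    show ?thesis using Tcomb[OF f, of "\<lambda>_. 0"] by simp
  qed
  have basis: "is_basis smult (vfibre G p) n (\<lambda>i. T p (e p i))" if f: "(U, n, e) \<in> frames V" "p \<in> U" for U n e p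
    unfolding P.is_basis_iff
  proof
    have p: "p \<in> topspace X" using openin_subset[OF vb_frame(1)[OF V f(1)]] f(2) by blast
    note b = vb_frame'[OF V f]
    show "lin_indep smult n (\<lambda>i. T p (e p i))" unfolding lin_indep_def
    proof (intro allI impI)
      fix c i assume "(\<Sum>i<n. smult (c i) (T p (e p i))) = 0" and i: "i < n"
      hence "T p (\<Sum>i<n. vscale V (c i) (e p i)) = T p 0" using Tcomb[OF f] T0[OF p] by simp
      moreover have "(\<Sum>i<n. vscale V (c i) (e p i)) \<in> vfibre V p" unfolding b(2) by blast
      moreover have "0 \<in> vfibre V p" using V.subspace_0[OF vb_subspace[OF V p]] .
      ultimately have "(\<Sum>i<n. vscale V (c i) (e p i)) = 0" using inj[OF p] by (auto dest: inj_onD)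
      thus "c i = 0" using lin_indepD[OF b(1)] i by blast
    qed
    show "vfibre G p = {\<Sum>i<n. smult (c i) (T p (e p i)) |c. True}" unfolding Gs b(2) Tcomb[OF f, symmetric] by auto
  qed
  have VG: "vector_bundle X G" unfolding vector_bundle_def
  proof (intro conjI)
    show "vector_space (vscale G)" by (simp add: Gs vector_space_smult)
    show "\<forall>(U, n, g)\<in>frames G. openin X U \<and> (\<forall>p\<in>U. is_basis (vscale G) (vfibre G p) n (g p))"
    proof clarify
      fix U n g assume "(U, n, g) \<in> frames G"
      then obtain e where e: "(U, n, e) \<in> frames V" "g = (\<lambda>p i. T p (e p i))" using G_frame by metis
      show "openin X U \<and> (\<forall>p\<in>U. is_basis (vscale G) (vfibre G p) n (g p))"
        unfolding e(2) Gs(1) using vb_frame(1)[OF V e(1)] basis[OF e(1)] by blast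
    qed
    show "\<Union>(fst ` frames G) = topspace X"
    proof -
      have "fst ` frames G = fst ` frames V" by (force simp: G_def)
      thus ?thesis using V by (simp add: vector_bundle_def)
    qed
    show "continuous_in_frames X G G (\<lambda>p u. u)" unfolding continuous_in_frames_def
    proof clarify
      fix U n g U' m g' assume fr: "(U, n, g) \<in> frames G" "(U', m, g') \<in> frames G"
      obtain e where e: "(U, n, e) \<in> frames V" "g = (\<lambda>p i. T p (e p i))" using G_frame[OF fr(1)] by blast
      obtain e' where e': "(U', m, e') \<in> frames V" "g' = (\<lambda>p i. T p (e' p i))" using G_frame[OF fr(2)] by blast
      have "continuous_in_frames X V V (\<lambda>p u. u)" using V by (simp add: vector_bundle_def)
      from continuous_in_framesD[OF this e(1) e'(1)]
      obtain a where a: "\<forall>i<m. \<forall>j<n. continuous_map (subtopology X (U \<inter> U')) euclidean (a i j)"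
        "\<forall>p\<in>U \<inter> U'. \<forall>j<n. e p j = (\<Sum>i<m. vscale V (a i j p) (e' p i))" by blast
      have "g p j = (\<Sum>i<m. vscale G (a i j p) (g' p i))" if "p \<in> U \<inter> U'" "j < n" for p j
        using a(2) that Tcomb[OF e'(1), of p "\<lambda>i. a i j p"] by (simp add: e(2) e'(2) Gs)
      thus "\<exists>a. (\<forall>i<m. \<forall>j<n. continuous_map (subtopology X (U \<inter> U')) euclidean (a i j)) \<and>
          (\<forall>p\<in>U \<inter> U'. \<forall>j<n. g p j = (\<Sum>i<m. vscale G (a i j p) (g' p i)))" using a(1) by blast
    qed
  qed
  define S where "S p = inv_into (vfibre V p) (T p)" for p
  have ST: "S p (T p u) = u" if "p \<in> topspace X" "u \<in> vfibre V p" for p u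
    unfolding S_def using inj[OF that(1)] that(2) by (rule inv_into_f_f)
  have secT: "secmap X V G T" unfolding secmap_def
  proof (intro conjI ballI allI impI)
    fix p assume "p \<in> topspace X"
    thus "vfibre_linear V G p (T p)" using lin[of p] unfolding linear_between_def Gs by blast
  next
    fix U \<sigma> assume U: "openin X U" and \<sigma>: "vsec X V U \<sigma>"
    show "vsec X G U (\<lambda>p. T p (\<sigma> p))"
    proof (rule vsecI)
      fix U' n g assume "(U', n, g) \<in> frames G"
      then obtain e where e: "(U', n, e) \<in> frames V" "g = (\<lambda>p i. T p (e p i))" using G_frame by metis
      obtain a where a: "!!i. i < n ==> conton X (U \<inter> U') (a i)"
        "!!p. p \<in> U ==> p \<in> U' ==> \<sigma> p = (\<Sum>i<n. vscale V (a i p) (e p i))" by (rule vsecD[OF \<sigma> e(1)], rule that)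
      have "T p (\<sigma> p) = (\<Sum>i<n. vscale G (a i p) (g p i))" if "p \<in> U \<inter> U'" for p
        using a(2)[of p] Tcomb[OF e(1), of p "\<lambda>i. a i p"] that by (simp add: e(2) Gs)
      thus "\<exists>a. (\<forall>i<n. conton X (U \<inter> U') (a i)) \<and> (\<forall>p\<in>U \<inter> U'. T p (\<sigma> p) = (\<Sum>i<n. vscale G (a i p) (g p i)))" using a(1) by blast
    qed
  qed
  have secS: "secmap X G V S" unfolding secmap_def
  proof (intro conjI ballI allI impI)
    fix p assume p: "p \<in> topspace X"
    note sub = vb_subspace[OF V p]
    have l: "T p (u + v) = T p u + T p v" "T p (vscale V c u) = smult c (T p u)"
      if "u \<in> vfibre V p" "v \<in> vfibre V p" for u v c using lin[OF p] that unfolding linear_between_def by auto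
    have l': "S p (T p u + T p v) = u + v" "S p (smult c (T p u)) = vscale V c u"
      if "u \<in> vfibre V p" "v \<in> vfibre V p" for u v c
      using ST[OF p V.subspace_add[OF sub that]] ST[OF p V.subspace_scale[OF sub that(1), of c]] l[OF that] by simp_all
    show "vfibre_linear G V p (S p)" unfolding linear_between_def Gs using l' by (auto simp: ST[OF p])
  next
    fix U \<sigma> assume U: "openin X U" and \<sigma>: "vsec X G U \<sigma>"
    show "vsec X V U (\<lambda>p. S p (\<sigma> p))"
    proof (rule vsecI)
      fix U' n e assume e: "(U', n, e) \<in> frames V"
      obtain a where a: "!!i. i < n ==> conton X (U \<inter> U') (a i)" "!!p. p \<in> U ==> p \<in> U' ==> \<sigma> p = (\<Sum>i<n. vscale G (a i p) (T p (e p i)))"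
        by (rule vsecD[OF \<sigma> G_frameI[OF e]], rule that)
      have "S p (\<sigma> p) = (\<Sum>i<n. vscale V (a i p) (e p i))" if "p \<in> U \<inter> U'" for p
      proof -
        have p: "p \<in> topspace X" using openin_subset[OF U] that by blast
        have "p \<in> U'" using that by blast
        have "(\<Sum>i<n. vscale V (a i p) (e p i)) \<in> vfibre V p"
          unfolding vb_frame'(2)[OF V e \<open>p \<in> U'\<close>] by (rule lin_comb_memI) (rule refl)
        from ST[OF p this] show ?thesis using a(2)[of p] Tcomb[OF e, of p "\<lambda>i. a i p"] that by (simp add: Gs)
      qed
      thus "\<exists>a. (\<forall>i<n. conton X (U \<inter> U') (a i)) \<and> (\<forall>p\<in>U \<inter> U'. S p (\<sigma> p) = (\<Sum>i<n. vscale V (a i p) (e p i)))" using a(1) by blast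
    qed
  qed
  have TS: "T p (S p w) = w" if "p \<in> topspace X" "w \<in> vfibre G p" for p w using that unfolding Gs S_def by (auto intro: f_inv_into_f)
  have "vb_iso X V G" by (rule vb_isoI[OF V VG secT secS ST TS])
  moreover have "G \<in> VB X" using VG by (simp add: VB_def Gs)
  ultimately show ?thesis using that by blast
qed

definition stably_iso :: "'b topology => ('b, 'k :: {real_normed_field, euclidean_space}, 'v :: ab_group_add) vbundle
     => ('b, 'k, 'w :: ab_group_add) vbundle => bool" where "stably_iso X A B \<longleftrightarrow> (\<exists>G\<in>VB X. vb_iso X (A \<oplus>\<^sub>V G) (B \<oplus>\<^sub>V G))"

lemma VB_bundle: "V \<in> VB X ==> vector_bundle X V" by (simp add: VB_def)

text \<open>Stabilisation by an arbitrary bundle, which is then replaced by a copy in \<open>VB X\<close>.\<close>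

lemma stably_isoI:
  assumes A: "vector_bundle X A" and B: "vector_bundle X B" and iso: "vb_iso X (A \<oplus>\<^sub>V Q) (B \<oplus>\<^sub>V Q)"
    and Q: "vector_bundle X Q"
  shows "stably_iso X A B"
proof -
  obtain G where G: "G \<in> VB X" "vb_iso X Q G" by (rule vb_copy[OF Q])
  have "vb_iso X (A \<oplus>\<^sub>V G) (A \<oplus>\<^sub>V Q)" by (rule vb_iso_sum_cong[OF vb_iso_refl[OF A] vb_iso_sym[OF G(2)]])
  also note iso
  also have "vb_iso X (B \<oplus>\<^sub>V Q) (B \<oplus>\<^sub>V G)" by (rule vb_iso_sum_cong[OF vb_iso_refl[OF B] G(2)])
  finally show ?thesis using G(1) unfolding stably_iso_def by blast
qed

text \<open>Membership of the pair of zero bundles in the class of \<open>A\<close> and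
  \<open>B\<close> is already stable isomorphism. Conversely, a stable isomorphism of
  \<open>A\<close> and \<open>B\<close> allows them to be exchanged and absorbed into the
  stabilising summand, so both classes contain the same pairs.\<close>

lemma K_class_one_iff:
  fixes A :: "('b, 'k :: {real_normed_field, euclidean_space}, 'v :: ab_group_add) vbundle"
    and B :: "('b, 'k, 'w :: ab_group_add) vbundle"
  assumes A: "vector_bundle X A" and B: "vector_bundle X B"
  shows "K_class X A B = \<one>\<^bsub>K_group X\<^esub> \<longleftrightarrow> stably_iso X A B"
proof -
  let ?Z = "zero_vbundle X :: ('b, 'k, 'k poly) vbundle"
  note Z = vector_bundle_zero[where X = X and 'b = 'k]
  have one: "\<one>\<^bsub>K_group X\<^esub> = K_class X ?Z ?Z" by (simp add: K_group_def)
  have mem: "(V, W) \<in> K_class X A' B' \<longleftrightarrow> V \<in> VB X \<and> W \<in> VB X \<and> (\<exists>G\<in>VB X. vb_iso X ((A' \<oplus>\<^sub>V W) \<oplus>\<^sub>V G) ((V \<oplus>\<^sub>V B') \<oplus>\<^sub>V G))"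
    if "vector_bundle X A'" "vector_bundle X B'" for V W
    and A' :: "('b, 'k, 'x :: ab_group_add) vbundle" and B' :: "('b, 'k, 'y :: ab_group_add) vbundle"
    using that unfolding K_class_def vb_iso_def by (auto intro!: vector_bundle_sum VB_bundle)
  have zr: "vb_iso X (V \<oplus>\<^sub>V ?Z) V" if "vector_bundle X V" for V :: "('b, 'k, 'x :: ab_group_add) vbundle"
    by (rule vb_iso_zero_right[OF that])
  have zl: "vb_iso X (?Z \<oplus>\<^sub>V V) V" if "vector_bundle X V" for V :: "('b, 'k, 'x :: ab_group_add) vbundle"
    by (rule vb_iso_trans[OF vb_iso_comm[OF Z that] zr[OF that]])
  show ?thesis unfolding one
  proof
    assume eq: "K_class X A B = K_class X ?Z ?Z"
    have "(?Z, ?Z) \<in> K_class X ?Z ?Z" unfolding mem[OF Z Z] by (intro conjI bexI[of _ ?Z] zero_in_VB vb_iso_refl vector_bundle_sum Z)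
    hence "(?Z, ?Z) \<in> K_class X A B" using eq by simp
    then obtain G where G: "G \<in> VB X" and i: "vb_iso X ((A \<oplus>\<^sub>V ?Z) \<oplus>\<^sub>V G) ((?Z \<oplus>\<^sub>V B) \<oplus>\<^sub>V G)" unfolding mem[OF A B] by blast
    note rG = vb_iso_refl[OF VB_bundle[OF G]]
    have "vb_iso X (A \<oplus>\<^sub>V G) ((A \<oplus>\<^sub>V ?Z) \<oplus>\<^sub>V G)" by (rule vb_iso_sum_cong[OF vb_iso_sym[OF zr[OF A]] rG])
    also note i
    also have "vb_iso X ((?Z \<oplus>\<^sub>V B) \<oplus>\<^sub>V G) (B \<oplus>\<^sub>V G)" by (rule vb_iso_sum_cong[OF zl[OF B] rG])
    finally show "stably_iso X A B" using G unfolding stably_iso_def by blast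
  next
    assume "stably_iso X A B"
    then obtain G where G: "G \<in> VB X" and i: "vb_iso X (A \<oplus>\<^sub>V G) (B \<oplus>\<^sub>V G)" unfolding stably_iso_def by blast
    note GV = VB_bundle[OF G]
    have iff: "(\<exists>H\<in>VB X. vb_iso X ((A \<oplus>\<^sub>V W) \<oplus>\<^sub>V H) ((V \<oplus>\<^sub>V B) \<oplus>\<^sub>V H)) \<longleftrightarrow>
        (\<exists>H\<in>VB X. vb_iso X (W \<oplus>\<^sub>V H) (V \<oplus>\<^sub>V H))" if VW: "V \<in> VB X" "W \<in> VB X" for V W
    proof -
      note V = VB_bundle[OF VW(1)] and W = VB_bundle[OF VW(2)]
      show ?thesis unfolding stably_iso_def[symmetric]
      proof
        assume "stably_iso X (A \<oplus>\<^sub>V W) (V \<oplus>\<^sub>V B)"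
        then obtain H where H: "H \<in> VB X" and j: "vb_iso X ((A \<oplus>\<^sub>V W) \<oplus>\<^sub>V H) ((V \<oplus>\<^sub>V B) \<oplus>\<^sub>V H)" unfolding stably_iso_def by blast
        note HV = VB_bundle[OF H]
        note s = vector_bundle_sum
        \<comment> \<open>The stabiliser is
          \<open>(B \<oplus>\<^sub>V G) \<oplus>\<^sub>V H\<close>. Next to \<open>W\<close> its
          \<open>B\<close> is traded for \<open>A\<close> with the help of \<open>G\<close>, and
          then \<open>j\<close> turns \<open>A\<close>, \<open>W\<close> and \<open>H\<close> into
          \<open>V\<close>, \<open>B\<close> and \<open>H\<close>.\<close>
        have "vb_iso X (W \<oplus>\<^sub>V ((B \<oplus>\<^sub>V G) \<oplus>\<^sub>V H)) (W \<oplus>\<^sub>V ((A \<oplus>\<^sub>V G) \<oplus>\<^sub>V H))"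
          by (intro vb_iso_sum_cong vb_iso_refl[OF W] vb_iso_sym[OF i] vb_iso_refl[OF HV])
        also have "vb_iso X \<dots> (((A \<oplus>\<^sub>V G) \<oplus>\<^sub>V H) \<oplus>\<^sub>V W)" by (intro vb_iso_comm s A GV HV W)
        also have "vb_iso X \<dots> (((A \<oplus>\<^sub>V G) \<oplus>\<^sub>V W) \<oplus>\<^sub>V H)" by (intro vb_iso_swap_middle s A GV HV W)
        also have "vb_iso X \<dots> (((A \<oplus>\<^sub>V W) \<oplus>\<^sub>V G) \<oplus>\<^sub>V H)" by (intro vb_iso_sum_cong vb_iso_swap_middle vb_iso_refl A GV HV W)
        also have "vb_iso X \<dots> (((A \<oplus>\<^sub>V W) \<oplus>\<^sub>V H) \<oplus>\<^sub>V G)" by (intro vb_iso_swap_middle s A GV HV W)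
        also have "vb_iso X \<dots> (((V \<oplus>\<^sub>V B) \<oplus>\<^sub>V H) \<oplus>\<^sub>V G)" by (intro vb_iso_sum_cong j vb_iso_refl GV)
        also have "vb_iso X \<dots> (((V \<oplus>\<^sub>V B) \<oplus>\<^sub>V G) \<oplus>\<^sub>V H)" by (intro vb_iso_swap_middle s V B GV HV)
        also have "vb_iso X \<dots> ((V \<oplus>\<^sub>V (B \<oplus>\<^sub>V G)) \<oplus>\<^sub>V H)" by (intro vb_iso_sum_cong vb_iso_assoc vb_iso_refl V B GV HV)
        also have "vb_iso X \<dots> (V \<oplus>\<^sub>V ((B \<oplus>\<^sub>V G) \<oplus>\<^sub>V H))" by (intro vb_iso_assoc s V B GV HV)
        finally show "stably_iso X W V" by (rule stably_isoI[OF W V]) (intro s B GV HV)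
      next
        assume "stably_iso X W V"
        then obtain H where H: "H \<in> VB X" and j: "vb_iso X (W \<oplus>\<^sub>V H) (V \<oplus>\<^sub>V H)" unfolding stably_iso_def by blast
        note HV = VB_bundle[OF H]
        note s = vector_bundle_sum
        \<comment> \<open>Here \<open>G \<oplus>\<^sub>V H\<close> stabilises: \<open>G\<close>
          serves the pair \<open>A\<close>, \<open>B\<close> and \<open>H\<close> the pair
          \<open>W\<close>, \<open>V\<close>.\<close>
        have "vb_iso X ((A \<oplus>\<^sub>V W) \<oplus>\<^sub>V (G \<oplus>\<^sub>V H)) (((A \<oplus>\<^sub>V W) \<oplus>\<^sub>V G) \<oplus>\<^sub>V H)" by (intro vb_iso_sym[OF vb_iso_assoc] s A GV HV W)
        also have "vb_iso X \<dots> (((A \<oplus>\<^sub>V G) \<oplus>\<^sub>V W) \<oplus>\<^sub>V H)" by (intro vb_iso_sum_cong vb_iso_swap_middle vb_iso_refl A GV HV W)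
        also have "vb_iso X \<dots> ((A \<oplus>\<^sub>V G) \<oplus>\<^sub>V (W \<oplus>\<^sub>V H))" by (intro vb_iso_assoc s A GV HV W)
        also have "vb_iso X \<dots> ((B \<oplus>\<^sub>V G) \<oplus>\<^sub>V (V \<oplus>\<^sub>V H))" by (rule vb_iso_sum_cong[OF i j])
        also have "vb_iso X \<dots> (((B \<oplus>\<^sub>V G) \<oplus>\<^sub>V V) \<oplus>\<^sub>V H)" by (intro vb_iso_sym[OF vb_iso_assoc] s B GV HV V)
        also have "vb_iso X \<dots> (((B \<oplus>\<^sub>V V) \<oplus>\<^sub>V G) \<oplus>\<^sub>V H)" by (intro vb_iso_sum_cong vb_iso_swap_middle vb_iso_refl B GV HV V)
        also have "vb_iso X \<dots> (((V \<oplus>\<^sub>V B) \<oplus>\<^sub>V G) \<oplus>\<^sub>V H)" by (intro vb_iso_sum_cong vb_iso_comm vb_iso_refl B GV HV V)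
        also have "vb_iso X \<dots> ((V \<oplus>\<^sub>V B) \<oplus>\<^sub>V (G \<oplus>\<^sub>V H))" by (intro vb_iso_assoc s B GV HV V)
        finally show "stably_iso X (A \<oplus>\<^sub>V W) (V \<oplus>\<^sub>V B)" by (rule stably_isoI[OF s[OF A W] s[OF V B]]) (intro s GV HV)
      qed
    qed
    have iff0: "(\<exists>H\<in>VB X. vb_iso X ((?Z \<oplus>\<^sub>V W) \<oplus>\<^sub>V H) ((V \<oplus>\<^sub>V ?Z) \<oplus>\<^sub>V H)) \<longleftrightarrow>
        (\<exists>H\<in>VB X. vb_iso X (W \<oplus>\<^sub>V H) (V \<oplus>\<^sub>V H))" if VW: "V \<in> VB X" "W \<in> VB X" for V W
    proof (intro bex_cong refl)
      fix H :: "('b, 'k, 'k poly) vbundle" assume "H \<in> VB X"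
      note V = VB_bundle[OF VW(1)] and W = VB_bundle[OF VW(2)] and HV = VB_bundle[OF this]
      have l: "vb_iso X ((?Z \<oplus>\<^sub>V W) \<oplus>\<^sub>V H) (W \<oplus>\<^sub>V H)" by (rule vb_iso_sum_cong[OF zl[OF W] vb_iso_refl[OF HV]])
      have r: "vb_iso X ((V \<oplus>\<^sub>V ?Z) \<oplus>\<^sub>V H) (V \<oplus>\<^sub>V H)" by (rule vb_iso_sum_cong[OF zr[OF V] vb_iso_refl[OF HV]])
      show "vb_iso X ((?Z \<oplus>\<^sub>V W) \<oplus>\<^sub>V H) ((V \<oplus>\<^sub>V ?Z) \<oplus>\<^sub>V H) \<longleftrightarrow> vb_iso X (W \<oplus>\<^sub>V H) (V \<oplus>\<^sub>V H)"
        using vb_iso_trans[OF vb_iso_trans[OF vb_iso_sym[OF l]] r] vb_iso_trans[OF vb_iso_trans[OF l] vb_iso_sym[OF r]] by blast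
    qed
    show "K_class X A B = K_class X ?Z ?Z"
    proof (rule Set.set_eqI)
      fix VW :: "('b, 'k, 'k poly) vbundle \<times> ('b, 'k, 'k poly) vbundle"
      obtain V W where VW: "VW = (V, W)" by fastforce
      show "VW \<in> K_class X A B \<longleftrightarrow> VW \<in> K_class X ?Z ?Z" unfolding VW mem[OF A B] mem[OF Z Z] using iff[of V W] iff0[of V W] by blast
    qed
  qed
qed

section \<open>Banach bundles: sections, subbundles, morphisms, gluing\<close>

section \<open>Charts and sections of Banach bundles\<close>

lemma bb_kspace: "banach_bundle X E ==> kspace (mscale E)"
  and bb_vs: "banach_bundle X E ==> vector_space (fscale E)" by (simp_all add: banach_bundle_def kspace_def)

lemma bb_chart:
  assumes "banach_bundle X E" "(U, \<tau>) \<in> charts E"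
  shows "openin X U" and "p \<in> U ==> Vector_Spaces.linear (mscale E) (fscale E) (\<tau> p)"
    and "p \<in> U ==> bij_betw (\<tau> p) UNIV (fibre E p)"
proof -
  have *: "\<forall>(U, \<tau>)\<in>charts E. openin X U \<and> (\<forall>p\<in>U. Vector_Spaces.linear (mscale E) (fscale E) (\<tau> p) \<and> bij_betw (\<tau> p) UNIV (fibre E p))"
    using assms(1) unfolding banach_bundle_def by (elim conjE)
  show "openin X U" "p \<in> U ==> Vector_Spaces.linear (mscale E) (fscale E) (\<tau> p)" "p \<in> U ==> bij_betw (\<tau> p) UNIV (fibre E p)"
    using bspec[OF * assms(2)] by auto
qed

lemma bb_cover:
  assumes "banach_bundle X E" "p \<in> topspace X"
  obtains U \<tau> where "(U, \<tau>) \<in> charts E" "p \<in> U"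
proof -
  have "p \<in> \<Union>(fst ` charts E)" using assms unfolding banach_bundle_def by simp
  thus ?thesis using that by force
qed

lemma norm_continuous_in_chartsD:
  assumes "norm_continuous_in_charts X E F L" "(U, \<tau>) \<in> charts E" "(U', \<sigma>) \<in> charts F"
  obtains A where "continuous_map (subtopology X (U \<inter> U')) euclidean A"
    "!!p x. p \<in> U ==> p \<in> U' ==> L p (\<tau> p x) = \<sigma> p (blinfun_apply (A p) x)"
proof -
  from bspec[OF bspec[OF assms(1)[unfolded norm_continuous_in_charts_def] assms(2), unfolded prod.case] assms(3)]
  obtain A where "continuous_map (subtopology X (U \<inter> U')) euclidean A \<and>
    (\<forall>p\<in>U \<inter> U'. \<forall>x. L p (\<tau> p x) = \<sigma> p (blinfun_apply (A p) x))" unfolding prod.case by (rule exE)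
  thus ?thesis by (intro that[of A]) auto
qed

lemma bb_trans:
  assumes E: "banach_bundle X E" and c: "(U, \<tau>) \<in> charts E" "(U', \<tau>') \<in> charts E"
  obtains A where "conton X (U \<inter> U') A" "!!p x. p \<in> U ==> p \<in> U' ==> \<tau> p x = \<tau>' p (blinfun_apply (A p) x)"
proof -
  have "norm_continuous_in_charts X E E (\<lambda>p u. u)" using E by (simp add: banach_bundle_def)
  obtain A where
    A: "continuous_map (subtopology X (U \<inter> U')) euclidean A" "!!p x. p \<in> U ==> p \<in> U' ==> \<tau> p x = \<tau>' p (blinfun_apply (A p) x)"
    by (rule norm_continuous_in_chartsD[OF \<open>norm_continuous_in_charts X E E (\<lambda>p u. u)\<close> c], rule that)
  have "conton X (U \<inter> U') A" using A(1) conton_iff[OF openin_Int[OF bb_chart(1)[OF E c(1)] bb_chart(1)[OF E c(2)]], of A] by simp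
  thus ?thesis using A(2) by (rule that)
qed

context
  fixes X :: "'b topology"
    and E :: "('b, 'k :: {real_normed_field, euclidean_space}, 'v :: ab_group_add, 'm :: banach) bbundle"
    and U \<tau>
  assumes E: "banach_bundle X E" and c: "(U, \<tau>) \<in> charts E"
begin

lemma chart_add: "p \<in> U ==> \<tau> p (x + y) = \<tau> p x + \<tau> p y"
  and chart_scale: "p \<in> U ==> \<tau> p (mscale E a x) = fscale E a (\<tau> p x)"
  using bb_chart(2)[OF E c] unfolding Vector_Spaces.linear_iff by auto

lemma chart_0: "p \<in> U ==> \<tau> p 0 = 0" using chart_add[of p 0 0] by simp

lemma chart_sum: "p \<in> U ==> \<tau> p (\<Sum>i\<in>I. f i) = (\<Sum>i\<in>I. \<tau> p (f i))"
  by (induction I rule: infinite_finite_induct) (auto simp: chart_0 chart_add)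

lemma chart_comb: "p \<in> U ==> \<tau> p (\<Sum>i\<in>I. mscale E (a i) (f i)) = (\<Sum>i\<in>I. fscale E (a i) (\<tau> p (f i)))" by (simp add: chart_sum chart_scale)

lemma chart_mem: "p \<in> U ==> \<tau> p x \<in> fibre E p" using bb_chart(3)[OF E c, of p] by (auto simp: bij_betw_def)

lemma chart_inj: "p \<in> U ==> \<tau> p x = \<tau> p y \<longleftrightarrow> x = y" using bb_chart(3)[OF E c, of p] by (auto simp: bij_betw_def dest: injD)

lemma chart_eq_0: "p \<in> U ==> \<tau> p x = 0 \<longleftrightarrow> x = 0" using chart_inj[of p x 0] by (simp add: chart_0)

lemma chart_surj:
  assumes "p \<in> U" "u \<in> fibre E p"
  obtains x where "u = \<tau> p x" using bb_chart(3)[OF E c, of p] assms by (auto simp: bij_betw_def)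

lemma chart_topspace: "p \<in> U ==> p \<in> topspace X" using openin_subset[OF bb_chart(1)[OF E c]] by blast

lemma chart_lin_indep:
  assumes "p \<in> U"
  shows "lin_indep (mscale E) n w \<longleftrightarrow> lin_indep (fscale E) n (\<lambda>i. \<tau> p (w i))"
  unfolding lin_indep_def chart_comb[OF assms, symmetric] chart_eq_0[OF assms] ..

lemma chart_is_basis:
  assumes p: "p \<in> U"
  shows "is_basis (fscale E) (\<tau> p ` I) n (\<lambda>i. \<tau> p (w i)) \<longleftrightarrow> is_basis (mscale E) I n w"
proof -
  interpret m: kspace "mscale E" by (rule bb_kspace[OF E])
  have inj: "inj (\<tau> p)" using bb_chart(3)[OF E c p] by (auto simp: bij_betw_def)
  have "{\<Sum>i<n. fscale E (c i) (\<tau> p (w i)) |c. True} = \<tau> p ` {\<Sum>i<n. mscale E (c i) (w i) |c. True}"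
    unfolding chart_comb[OF p, symmetric] by auto
  thus ?thesis unfolding vector_space.is_basis_iff[OF bb_vs[OF E]] m.is_basis_iff chart_lin_indep[OF p]
    by (simp add: inj_image_eq_iff[OF inj])
qed

end

lemma bb_subspace:
  assumes E: "banach_bundle X E" and p: "p \<in> topspace X"
  shows "module.subspace (fscale E) (fibre E p)"
proof -
  interpret f: vector_space "fscale E" by (rule bb_vs[OF E])
  obtain U \<tau> where c: "(U, \<tau>) \<in> charts E" "p \<in> U" using bb_cover[OF E p] .
  note ch = chart_add[OF E c] chart_scale[OF E c] chart_mem[OF E c] chart_0[OF E c]
  show ?thesis unfolding f.subspace_def
  proof (intro conjI ballI allI)
    show "0 \<in> fibre E p" using ch(3)[of 0] ch(4) by simp
    fix x assume "x \<in> fibre E p"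
    then obtain x' where x: "x = \<tau> p x'" by (rule chart_surj[OF E c])
    show "fscale E a x \<in> fibre E p" for a unfolding x ch(2)[symmetric] by (rule ch(3))
    fix y assume "y \<in> fibre E p"
    then obtain y' where y: "y = \<tau> p y'" by (rule chart_surj[OF E c])
    show "x + y \<in> fibre E p" unfolding x y ch(1)[symmetric] by (rule ch(3))
  qed
qed

lemma csecD:
  assumes E: "banach_bundle X E" and s: "continuous_section X E U s" and U: "openin X U" and c: "(U', \<tau>) \<in> charts E"
  obtains x where "conton X (U \<inter> U') x" "!!p. p \<in> U ==> p \<in> U' ==> s p = \<tau> p (x p)"
proof -
  from bspec[OF s[unfolded continuous_section_def] c]
  obtain x where x: "continuous_map (subtopology X (U \<inter> U')) euclidean x \<and> (\<forall>p\<in>U \<inter> U'. s p = \<tau> p (x p))"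
    unfolding prod.case by (rule exE)
  hence "conton X (U \<inter> U') x" using conton_iff[OF openin_Int[OF U bb_chart(1)[OF E c]], of x] by simp
  thus ?thesis using x by (intro that[of x]) auto
qed

text \<open>As in \<open>vsec_local\<close>, one chart around each point suffices, since the
  transition operators are norm continuous.\<close>

lemma csec_local:
  assumes E: "banach_bundle X E" and U: "openin X U"
    and loc: "!!p. p \<in> U ==> \<exists>W U' \<tau> x. openin X W \<and> p \<in> W \<and> (U', \<tau>) \<in> charts E \<and> W \<subseteq> U' \<and>
      conton X W x \<and> (\<forall>q\<in>W. s q = \<tau> q (x q))"
  shows "continuous_section X E U s" unfolding continuous_section_def
proof clarify
  fix V \<sigma> assume c: "(V, \<sigma>) \<in> charts E"
  note oV = bb_chart(1)[OF E c]
  define y where "y q = inv_into UNIV (\<sigma> q) (s q)" for q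
  have yI: "y q = z" if "q \<in> V" "s q = \<sigma> q z" for q z
    using that chart_inj[OF E c that(1)] unfolding y_def by (metis UNIV_I f_inv_into_f rangeI)
  have "conton X (U \<inter> V) y \<and> (\<forall>q\<in>U \<inter> V. s q = \<sigma> q (y q))"
  proof
    have *: "\<exists>W. openin X W \<and> p \<in> W \<and> (\<exists>g. conton X W g \<and> (\<forall>q\<in>W. s q = \<sigma> q (g q) \<and> y q = g q))"
      if p: "p \<in> U" "p \<in> V" for p
    proof -
      obtain W U' \<tau> x where W: "openin X W" "p \<in> W" "(U', \<tau>) \<in> charts E" "W \<subseteq> U'" "conton X W x"
        "\<forall>q\<in>W. s q = \<tau> q (x q)" using loc[OF p(1)] by (elim exE conjE)
      obtain A where A: "conton X (U' \<inter> V) A" "!!p x. p \<in> U' ==> p \<in> V ==> \<tau> p x = \<sigma> p (blinfun_apply (A p) x)"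
        by (rule bb_trans[OF E W(3) c], rule that)
      have s: "s q = \<sigma> q (A q (x q))" if "q \<in> W \<inter> V" for q using that W(4,6) A(2) by auto
      moreover have "conton X (W \<inter> V) (\<lambda>q. A q (x q))"
        using W(4) by (intro conton_blinfun_apply conton_subset[OF A(1)] conton_subset[OF W(5)]) auto
      ultimately show ?thesis using W(1,2) oV p(2) yI[OF _ s] by (intro exI[of _ "W \<inter> V"] conjI exI[of _ "\<lambda>q. A q (x q)"]) auto
    qed
    show "conton X (U \<inter> V) y"
    proof (rule conton_local)
      fix p assume "p \<in> U \<inter> V"
      with *[of p] show "\<exists>W. openin X W \<and> p \<in> W \<and> (\<exists>g. conton X W g \<and> (\<forall>q\<in>W. y q = g q))" by blast
    qed
    show "\<forall>q\<in>U \<inter> V. s q = \<sigma> q (y q)" using * by fastforce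
  qed
  thus "\<exists>c. continuous_map (subtopology X (U \<inter> V)) euclidean c \<and> (\<forall>p\<in>U \<inter> V. s p = \<sigma> p (c p))"
    using conton_iff[OF openin_Int[OF U oV], of y] by blast
qed

lemma csec_chart:
  assumes E: "banach_bundle X E" and c: "(U', \<tau>) \<in> charts E" and U: "openin X U" "U \<subseteq> U'"
    and x: "conton X U x" and s: "!!p. p \<in> U ==> s p = \<tau> p (x p)"
  shows "continuous_section X E U s"
proof (rule csec_local[OF E U(1)])
  fix p assume p: "p \<in> U"
  show "\<exists>W U' \<tau> x. openin X W \<and> p \<in> W \<and> (U', \<tau>) \<in> charts E \<and> W \<subseteq> U' \<and> conton X W x \<and> (\<forall>q\<in>W. s q = \<tau> q (x q))"
    using assms p by (intro exI[of _ U] exI[of _ U'] exI[of _ \<tau>] exI[of _ x]) auto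
qed

lemma csec_locally:
  assumes E: "banach_bundle X E" and U: "openin X U"
    and loc: "!!p. p \<in> U ==> \<exists>W s'. openin X W \<and> p \<in> W \<and> continuous_section X E W s' \<and> (\<forall>q\<in>W. s q = s' q)"
  shows "continuous_section X E U s"
proof (rule csec_local[OF E U])
  fix p assume p: "p \<in> U"
  obtain W s' where W: "openin X W" "p \<in> W" "continuous_section X E W s'" "\<forall>q\<in>W. s q = s' q" using loc[OF p] by (elim exE conjE)
  have "p \<in> topspace X" using openin_subset[OF U] p by blast
  then obtain U' \<tau> where c: "(U', \<tau>) \<in> charts E" "p \<in> U'" by (rule bb_cover[OF E])
  obtain x where "conton X (W \<inter> U') x" "!!p. p \<in> W ==> p \<in> U' ==> s' p = \<tau> p (x p)" by (rule csecD[OF E W(3,1) c(1)], rule that)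
  thus "\<exists>W U' \<tau> x. openin X W \<and> p \<in> W \<and> (U', \<tau>) \<in> charts E \<and> W \<subseteq> U' \<and> conton X W x \<and> (\<forall>q\<in>W. s q = \<tau> q (x q))"
    using W c bb_chart(1)[OF E c(1)] by (intro exI[of _ "W \<inter> U'"] exI[of _ U'] exI[of _ \<tau>] exI[of _ x]) auto
qed

lemma csec_subset:
  assumes E: "banach_bundle X E" and "continuous_section X E U s" "openin X U" "openin X U'" "U' \<subseteq> U"
  shows "continuous_section X E U' s" by (rule csec_locally[OF E assms(4)]) (use assms(2-5) in blast)

lemma csec_cong:
  assumes E: "banach_bundle X E" and "continuous_section X E U s" "openin X U" "!!p. p \<in> U ==> s' p = s p"
  shows "continuous_section X E U s'"
proof (rule csec_locally[OF E assms(3)])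
  fix p assume "p \<in> U"
  thus "\<exists>W s. openin X W \<and> p \<in> W \<and> continuous_section X E W s \<and> (\<forall>q\<in>W. s' q = s q)" using assms by (intro exI[of _ U] exI[of _ s]) auto
qed

lemma csec_fibre:
  assumes E: "banach_bundle X E" and s: "continuous_section X E U s" and U: "openin X U" and p: "p \<in> U"
  shows "s p \<in> fibre E p"
proof -
  have "p \<in> topspace X" using openin_subset[OF U] p by blast
  then obtain U' \<tau> where c: "(U', \<tau>) \<in> charts E" "p \<in> U'" by (rule bb_cover[OF E])
  obtain x where "!!p. p \<in> U ==> p \<in> U' ==> s p = \<tau> p (x p)" by (rule csecD[OF E s U c(1)], rule that)
  thus ?thesis using chart_mem[OF E c] p c(2) by simp
qed

lemma csec_comb:
  fixes I :: "'i set"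
  assumes E: "banach_bundle X E" and U: "openin X U"
    and s: "!!i. i \<in> I ==> continuous_section X E U (s i)" and a: "!!i. i \<in> I ==> conton X U (a i)"
  shows "continuous_section X E U (\<lambda>p. \<Sum>i\<in>I. fscale E (a i p) (s i p))"
proof (rule csec_local[OF E U])
  interpret m: kspace "mscale E" by (rule bb_kspace[OF E])
  fix p assume p: "p \<in> U"
  have "p \<in> topspace X" using openin_subset[OF U] p by blast
  then obtain U' \<tau> where c: "(U', \<tau>) \<in> charts E" "p \<in> U'" by (rule bb_cover[OF E])
  have "\<exists>x. conton X (U \<inter> U') x \<and> (\<forall>p\<in>U \<inter> U'. s i p = \<tau> p (x p))" if "i \<in> I" for i by (rule csecD[OF E s[OF that] U c(1)]) blast
  then obtain x where x: "!!i. i \<in> I ==> conton X (U \<inter> U') (x i)" "!!i p. i \<in> I ==> p \<in> U \<inter> U' ==> s i p = \<tau> p (x i p)" by metis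
  have "conton X (U \<inter> U') (\<lambda>p. \<Sum>i\<in>I. mscale E (a i p) (x i p))"
    by (intro conton_sum m.conton_scale x(1)) (auto intro: conton_subset[OF a])
  moreover have "(\<Sum>i\<in>I. fscale E (a i q) (s i q)) = \<tau> q (\<Sum>i\<in>I. mscale E (a i q) (x i q))" if "q \<in> U \<inter> U'" for q
    using that x(2) by (subst chart_comb[OF E c(1)]) auto
  ultimately show "\<exists>W U' \<tau> x. openin X W \<and> p \<in> W \<and> (U', \<tau>) \<in> charts E \<and> W \<subseteq> U' \<and> conton X W x \<and>
      (\<forall>q\<in>W. (\<Sum>i\<in>I. fscale E (a i q) (s i q)) = \<tau> q (x q))" using U c bb_chart(1)[OF E c(1)] p
    by (intro exI[of _ "U \<inter> U'"] exI[of _ U'] exI[of _ \<tau>] exI[of _ "\<lambda>p. \<Sum>i\<in>I. mscale E (a i p) (x i p)"]) auto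
qed

lemma csec_add:
  assumes E: "banach_bundle X E" and U: "openin X U"
    and s: "continuous_section X E U s" "continuous_section X E U s'"
  shows "continuous_section X E U (\<lambda>p. s p + s' p)"
proof -
  interpret f: vector_space "fscale E" by (rule bb_vs[OF E])
  have "continuous_section X E U (\<lambda>p. \<Sum>b\<in>{False, True}. fscale E 1 ((if b then s else s') p))"
    using s by (intro csec_comb[OF E U] conton_const) auto
  thus ?thesis by (rule csec_cong[OF E _ U]) (simp add: add.commute)
qed

lemma csec_scale:
  assumes E: "banach_bundle X E" and U: "openin X U" and s: "continuous_section X E U s" and a: "conton X U a"
  shows "continuous_section X E U (\<lambda>p. fscale E (a p) (s p))" using csec_comb[OF E U, of "{()}" "\<lambda>_. s" "\<lambda>_. a"] s a by simp

lemma csec_zero: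
  assumes E: "banach_bundle X E" and U: "openin X U"
  shows "continuous_section X E U (\<lambda>p. 0)" using csec_comb[OF E U, of "{}"] by simp

lemma csec_diff:
  assumes E: "banach_bundle X E" and U: "openin X U"
    and s: "continuous_section X E U s" "continuous_section X E U s'"
  shows "continuous_section X E U (\<lambda>p. s p - s' p)"
proof -
  interpret f: vector_space "fscale E" by (rule bb_vs[OF E])
  have "continuous_section X E U (\<lambda>p. s p + fscale E (-1) (s' p))" by (intro csec_add[OF E U] csec_scale[OF E U] s conton_const)
  thus ?thesis by (rule csec_cong[OF E _ U]) simp
qed

section \<open>Finite dimensional subbundles\<close>

lemma induced_simps: "vfibre (induced_vbundle X E W) = W" "vscale (induced_vbundle X E W) = fscale E"
  "(U, n, e) \<in> frames (induced_vbundle X E W) \<longleftrightarrow> openin X U \<and> (\<forall>i<n. continuous_section X E U (\<lambda>p. e p i)) \<and>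
     (\<forall>p\<in>U. is_basis (fscale E) (W p) n (e p))" by (simp_all add: induced_vbundle_def)

text \<open>On the subbundle the values are the coefficients in the frame. That the functionals are
  defined on the whole model space and vary continuously is what makes coefficients of sections
  continuous.\<close>

lemma frame_functionals:
  fixes E :: "('b, 'k :: {real_normed_field, euclidean_space}, 'v :: ab_group_add, 'm :: banach) bbundle"
  assumes E: "banach_bundle X E" and fr: "(U, n, e) \<in> frames (induced_vbundle X E W)" and p0: "p0 \<in> U"
    and c: "(U', \<tau>) \<in> charts E" "p0 \<in> U'"
  obtains O' \<alpha> where "openin X O'" "p0 \<in> O'" "O' \<subseteq> U" "O' \<subseteq> U'" "!!i. conton X O' (\<alpha> i :: 'b => 'm \<Rightarrow>\<^sub>L 'k)"
    "!!i y. i < n ==> y \<in> O' ==> klin (mscale E) (*) (\<alpha> i y)"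
    "!!i y c x. i < n ==> y \<in> O' ==> \<tau> y x = (\<Sum>i<n. fscale E (c i) (e y i)) ==> \<alpha> i y x = c i"
proof -
  have U: "openin X U" and e: "!!i. i < n ==> continuous_section X E U (\<lambda>p. e p i)"
    and b: "!!p. p \<in> U ==> is_basis (fscale E) (W p) n (e p)" using fr by (auto simp: induced_simps)
  note oU' = bb_chart(1)[OF E c(1)]
  have "\<exists>x. conton X (U \<inter> U') x \<and> (\<forall>p\<in>U \<inter> U'. e p i = \<tau> p (x p))" if "i < n" for i by (rule csecD[OF E e[OF that] U c(1)]) blast
  then obtain w where w: "!!i. i < n ==> conton X (U \<inter> U') (w i)" "!!i p. i < n ==> p \<in> U \<inter> U' ==> e p i = \<tau> p (w i p)" by metis
  have comb: "(\<Sum>i<n. fscale E (c i) (e p i)) = \<tau> p (\<Sum>i<n. mscale E (c i) (w i p))" if "p \<in> U \<inter> U'" for p and c :: "nat => 'k"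
    using that w(2) by (subst chart_comb[OF E c(1)]) auto
  have "lin_indep (fscale E) n (e p0)" using b[OF p0] by (simp add: vector_space.is_basis_iff[OF bb_vs[OF E]])
  hence li: "lin_indep (mscale E) n (\<lambda>i. w i p0)" using p0 c(2) unfolding lin_indep_def by (simp add: comb chart_eq_0[OF E c])
  have p0': "p0 \<in> U \<inter> U'" using p0 c(2) by blast
  obtain O' \<alpha> where *: "openin X O'" "p0 \<in> O'" "O' \<subseteq> U \<inter> U'" "!!i. conton X O' (\<alpha> i :: 'b => 'm \<Rightarrow>\<^sub>L 'k)"
    "!!i y. i < n ==> y \<in> O' ==> klin (mscale E) (*) (\<alpha> i y)" "!!i y c. i < n ==> y \<in> O' ==> \<alpha> i y (\<Sum>i<n. mscale E (c i) (w i y)) = c i"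
    by (rule frame_coordinates[OF bb_kspace[OF E] openin_Int[OF U oU'] p0' w(1) li], assumption, rule that)
  show thesis
  proof (rule that[OF *(1,2) _ _ *(4,5)])
    fix i y x and a :: "nat => 'k" assume "i < n" "y \<in> O'" "\<tau> y x = (\<Sum>i<n. fscale E (a i) (e y i))"
    moreover from this have "y \<in> U \<inter> U'" using *(3) by blast
    ultimately have "x = (\<Sum>i<n. mscale E (a i) (w i y))" using comb[of y a] chart_inj[OF E c(1), of y] by simp
    thus "\<alpha> i y x = a i" using *(6) \<open>i < n\<close> \<open>y \<in> O'\<close> by simp
  qed (use *(3) in auto)
qed

text \<open>The coefficients arise by applying the functionals of \<open>frame_functionals\<close>
  to the local expression of \<open>s\<close>, and both are continuous.\<close>

lemma frame_coefficients:
  fixes E :: "('b, 'k :: {real_normed_field, euclidean_space}, 'v :: ab_group_add, 'm :: banach) bbundle"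
  assumes E: "banach_bundle X E" and fr: "(U, n, e) \<in> frames (induced_vbundle X E W)"
    and O': "openin X O'" "O' \<subseteq> U" and s: "continuous_section X E O' s" and mem: "!!p. p \<in> O' ==> s p \<in> W p"
  obtains a where "!!i. i < n ==> conton X O' (a i)" "!!p. p \<in> O' ==> s p = (\<Sum>i<n. fscale E (a i p) (e p i))"
proof -
  have b: "!!p. p \<in> U ==> is_basis (fscale E) (W p) n (e p)" using fr by (auto simp: induced_simps)
  interpret f: vector_space "fscale E" by (rule bb_vs[OF E])
  have "\<exists>a. s p = (\<Sum>i<n. fscale E (a i) (e p i))" if "p \<in> O'" for p
    using mem[OF that] b[of p] that O'(2) unfolding f.is_basis_iff by auto
  then obtain a where a: "!!p. p \<in> O' ==> s p = (\<Sum>i<n. fscale E (a p i) (e p i))" by metis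
  have "conton X O' (\<lambda>p. a p i)" if i: "i < n" for i
  proof (rule conton_local)
    fix p assume p: "p \<in> O'"
    have "p \<in> topspace X" using openin_subset[OF O'(1)] p by blast
    then obtain U' \<tau> where c: "(U', \<tau>) \<in> charts E" "p \<in> U'" by (rule bb_cover[OF E])
    have pU: "p \<in> U" using p O'(2) by blast
    obtain Q \<alpha> where *: "openin X Q" "p \<in> Q" "Q \<subseteq> U" "Q \<subseteq> U'" "!!i. conton X Q (\<alpha> i :: 'b => 'm \<Rightarrow>\<^sub>L 'k)"
      "!!i y. i < n ==> y \<in> Q ==> klin (mscale E) (*) (\<alpha> i y)"
      "!!i y c x. i < n ==> y \<in> Q ==> \<tau> y x = (\<Sum>i<n. fscale E (c i) (e y i)) ==> \<alpha> i y x = c i"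
      by (rule frame_functionals[OF E fr pU c], rule that)
    obtain x where x: "conton X (O' \<inter> U') x" "!!p. p \<in> O' ==> p \<in> U' ==> s p = \<tau> p (x p)" by (rule csecD[OF E s O'(1) c(1)], rule that)
    have "conton X (O' \<inter> Q) (\<lambda>q. \<alpha> i q (x q))"
      using *(4) by (intro conton_blinfun_apply conton_subset[OF *(5)] conton_subset[OF x(1)]) auto
    moreover have "a q i = \<alpha> i q (x q)" if "q \<in> O' \<inter> Q" for q
    proof -
      have "\<tau> q (x q) = (\<Sum>i<n. fscale E (a q i) (e q i))" using a[of q] x(2)[of q] that *(4) by auto
      thus ?thesis using *(7)[OF i, of q "x q" "a q"] that by auto
    qed
    ultimately show "\<exists>V. openin X V \<and> p \<in> V \<and> (\<exists>g. conton X V g \<and> (\<forall>q\<in>V. a q i = g q))"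
      using O'(1) *(1,2) p by (intro exI[of _ "O' \<inter> Q"]) auto
  qed
  thus ?thesis using a by (intro that[of "\<lambda>i p. a p i"])
qed

text \<open>Transition matrices between frames of continuous sections are continuous by
  \<open>frame_coefficients\<close>, so a frame around each point is all that has to be
  supplied.\<close>

lemma fin_dim_subbundleI:
  fixes E :: "('b, 'k :: {real_normed_field, euclidean_space}, 'v :: ab_group_add, 'm :: banach) bbundle"
  assumes E: "banach_bundle X E"
    and fr: "!!p. p \<in> topspace X ==> \<exists>U n e. p \<in> U \<and> openin X U \<and> (\<forall>i<n. continuous_section X E U (\<lambda>p. e p i)) \<and>
      (\<forall>p\<in>U. is_basis (fscale E) (W p) n (e p))"
  shows "fin_dim_subbundle X E W"
proof -
  interpret f: vector_space "fscale E" by (rule bb_vs[OF E])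
  let ?W = "induced_vbundle X E W"
  have fr': "\<exists>U n e. p \<in> U \<and> (U, n, e) \<in> frames ?W" if "p \<in> topspace X" for p using fr[OF that] unfolding induced_simps by blast
  have "continuous_in_frames X ?W ?W (\<lambda>p u. u)" unfolding continuous_in_frames_def
  proof clarify
    fix U n e U' m f assume *: "(U, n, e) \<in> frames ?W" and star: "(U', m, f) \<in> frames ?W"
    have o: "openin X U" "openin X U'" using * star by (auto simp: induced_simps)
    have o': "openin X (U \<inter> U')" "U \<inter> U' \<subseteq> U'" using o by auto
    have "\<exists>a. (\<forall>i<m. conton X (U \<inter> U') (a i)) \<and> (\<forall>p\<in>U \<inter> U'. e p j = (\<Sum>i<m. fscale E (a i p) (f p i)))"
      if j: "j < n" for j
    proof (rule frame_coefficients[OF E star o', of "\<lambda>p. e p j"])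
      show "continuous_section X E (U \<inter> U') (\<lambda>p. e p j)" using * j by (intro csec_subset[OF E _ o(1) o'(1)]) (auto simp: induced_simps)
      show "e p j \<in> W p" if "p \<in> U \<inter> U'" for p
      proof -
        have "is_basis (fscale E) (W p) n (e p)" using * that by (auto simp: induced_simps)
        thus ?thesis using j unfolding is_basis_def by (auto intro: f.span_base)
      qed
    qed blast
    then obtain a where a: "!!j i. j < n ==> i < m ==> conton X (U \<inter> U') (a j i)"
      "!!j p. j < n ==> p \<in> U \<inter> U' ==> e p j = (\<Sum>i<m. fscale E (a j i p) (f p i))" by metis
    show "\<exists>a. (\<forall>i<m. \<forall>j<n. continuous_map (subtopology X (U \<inter> U')) euclidean (a i j)) \<and>
          (\<forall>p\<in>U \<inter> U'. \<forall>j<n. e p j = (\<Sum>i<m. vscale ?W (a i j p) (f p i)))"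
      using a by (intro exI[of _ "\<lambda>i j. a j i"]) (auto simp: conton_iff[OF o'(1)] induced_simps)
  qed
  moreover have "\<Union>(fst ` frames ?W) = topspace X"
  proof (intro subset_antisym subsetI)
    fix p assume "p \<in> \<Union>(fst ` frames ?W)"
    then obtain U n e where "(U, n, e) \<in> frames ?W" "p \<in> U" by force
    thus "p \<in> topspace X" using openin_subset[of X U] unfolding induced_simps by blast
  next
    fix p assume "p \<in> topspace X"
    from fr'[OF this] obtain U n e where "p \<in> U" "(U, n, e) \<in> frames ?W" by blast
    thus "p \<in> \<Union>(fst ` frames ?W)" by force
  qed
  ultimately have "vector_bundle X ?W" unfolding vector_bundle_def using f.vector_space_axioms by (auto simp: induced_simps)
  moreover have "W p \<subseteq> fibre E p" if p: "p \<in> topspace X" for p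
  proof -
    obtain U n e where *: "p \<in> U" "openin X U" "\<forall>i<n. continuous_section X E U (\<lambda>p. e p i)"
      "\<forall>p\<in>U. is_basis (fscale E) (W p) n (e p)" using fr[OF p] by (elim exE conjE)
    have "e p i \<in> fibre E p" if "i < n" for i using csec_fibre[OF E _ *(2,1)] *(3) that by blast
    hence "f.span (e p ` {..<n}) \<subseteq> fibre E p" by (intro f.span_minimal bb_subspace[OF E p]) auto
    thus ?thesis using *(1,4) unfolding is_basis_def by auto
  qed
  ultimately show ?thesis by (simp add: fin_dim_subbundle_def)
qed

text \<open>Maps into and out of a subbundle can hereafter be checked with sections of the ambient
  bundle.\<close>

lemma vsec_induced_iff:
  assumes E: "banach_bundle X E" and W: "fin_dim_subbundle X E W" and U: "openin X U"
  shows "vsec X (induced_vbundle X E W) U s \<longleftrightarrow> continuous_section X E U s \<and> (\<forall>p\<in>U. s p \<in> W p)"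
proof -
  let ?W = "induced_vbundle X E W"
  have vb: "vector_bundle X ?W" using W by (simp add: fin_dim_subbundle_def)
  have sub: "U \<subseteq> topspace X" by (rule openin_subset[OF U])
  show ?thesis
  proof
    assume s: "vsec X ?W U s"
    have "\<forall>p\<in>U. s p \<in> W p" using vsec_fibre[OF vb s] sub by (auto simp: induced_simps)
    moreover have "continuous_section X E U s"
    proof (rule csec_locally[OF E U])
      fix p assume p: "p \<in> U"
      hence "p \<in> topspace X" using sub by blast
      then obtain U' n e where f: "(U', n, e) \<in> frames ?W" "p \<in> U'" by (rule vb_cover[OF vb])
      have oU': "openin X U'" by (rule vb_frame(1)[OF vb f(1)])
      have o: "openin X (U \<inter> U')" using U oU' by (rule openin_Int)
      obtain a where a: "!!i. i < n ==> conton X (U \<inter> U') (a i)"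
        "!!p. p \<in> U ==> p \<in> U' ==> s p = (\<Sum>i<n. vscale ?W (a i p) (e p i))" by (rule vsecD[OF s f(1)], rule that)
      have "continuous_section X E (U \<inter> U') (\<lambda>p. \<Sum>i<n. fscale E (a i p) (e p i))"
        using f(1) a(1) by (intro csec_comb[OF E o] csec_subset[OF E _ oU' o]) (auto simp: induced_simps)
      thus "\<exists>W s'. openin X W \<and> p \<in> W \<and> continuous_section X E W s' \<and> (\<forall>q\<in>W. s q = s' q)"
        using a(2) p f(2) o by (intro exI[of _ "U \<inter> U'"] exI[of _ "\<lambda>p. \<Sum>i<n. fscale E (a i p) (e p i)"]) (auto simp: induced_simps)
    qed
    ultimately show "continuous_section X E U s \<and> (\<forall>p\<in>U. s p \<in> W p)" by blast
  next
    assume s: "continuous_section X E U s \<and> (\<forall>p\<in>U. s p \<in> W p)"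
    show "vsec X ?W U s"
    proof (rule vsecI)
      fix U' n e assume f: "(U', n, e) \<in> frames ?W"
      have oU': "openin X U'" by (rule vb_frame(1)[OF vb f])
      have o: "openin X (U \<inter> U')" "U \<inter> U' \<subseteq> U'" using U oU' by auto
      have "continuous_section X E (U \<inter> U') s" using csec_subset[OF E conjunct1[OF s] U o(1)] by blast
      then obtain a where "!!i. i < n ==> conton X (U \<inter> U') (a i)" "!!p. p \<in> U \<inter> U' ==> s p = (\<Sum>i<n. fscale E (a i p) (e p i))"
        by (rule frame_coefficients[OF E f o]) (use s in blast)+
      thus "\<exists>a. (\<forall>i<n. conton X (U \<inter> U') (a i)) \<and> (\<forall>p\<in>U \<inter> U'. s p = (\<Sum>i<n. vscale ?W (a i p) (e p i)))"
        by (intro exI[of _ a]) (auto simp: induced_simps)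
    qed
  qed
qed

section \<open>Norm continuous families\<close>

abbreviation fibre_linear where "fibre_linear E F p \<equiv> linear_between (fscale E) (fscale F) (fibre E p) (fibre F p)"

text \<open>One pair of charts near the point is enough. This local form is the one that is
  constructed and glued; \<open>nmor_on_imp_charts\<close> recovers the condition for all
  charts.\<close>

abbreviation nmor_at :: "'b topology => ('b, 'k, 'v, 'm :: real_normed_vector) bbundle
     => ('b, 'k, 'w, 'n :: real_normed_vector) bbundle => ('b => 'v => 'w) => 'b => bool" where
  "nmor_at X E F L p \<equiv> \<exists>W U1 \<tau> U2 \<sigma> A. openin X W \<and> p \<in> W \<and> (U1, \<tau>) \<in> charts E \<and> (U2, \<sigma>) \<in> charts F \<and> W \<subseteq> U1 \<and> W \<subseteq> U2 \<and> conton X W A \<and>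
     (\<forall>q\<in>W. \<forall>x. L q (\<tau> q x) = \<sigma> q (blinfun_apply (A q) x))"

definition nmor_on :: "'b topology => ('b, 'k, 'v, 'm :: real_normed_vector) bbundle
     => ('b, 'k, 'w, 'n :: real_normed_vector) bbundle => 'b set => ('b => 'v => 'w) => bool" where
  "nmor_on X E F U L \<longleftrightarrow> (\<forall>p\<in>U. nmor_at X E F L p)"

lemma nmor_onI:
  assumes "!!p. p \<in> U ==> nmor_at X E F L p"
  shows "nmor_on X E F U L" unfolding nmor_on_def using assms by (rule ballI)

lemma nmor_onI':
  assumes "openin X W" "(U1, \<tau>) \<in> charts E" "(U2, \<sigma>) \<in> charts F" "W \<subseteq> U1" "W \<subseteq> U2" "conton X W A"
    "!!q x. q \<in> W ==> L q (\<tau> q x) = \<sigma> q (blinfun_apply (A q) x)"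
  shows "nmor_on X E F W L"
proof (rule nmor_onI)
  fix p assume "p \<in> W"
  thus "nmor_at X E F L p" using assms by (intro exI[of _ W] exI[of _ U1] exI[of _ \<tau>] exI[of _ U2] exI[of _ \<sigma>] exI[of _ A]) auto
qed

lemma nmor_on_subset: "nmor_on X E F U L ==> U' \<subseteq> U ==> nmor_on X E F U' L"
  by (rule nmor_onI, unfold nmor_on_def) (erule bspec, rule subsetD)

lemma nmor_on_charts:
  assumes E: "banach_bundle X E" and F: "banach_bundle X F" and L: "nmor_on X E F U L" and p: "p \<in> U"
    and c: "(V, \<tau>) \<in> charts E" "p \<in> V" and d: "(V', \<sigma>) \<in> charts F" "p \<in> V'"
  obtains W A where "openin X W" "p \<in> W" "W \<subseteq> V" "W \<subseteq> V'" "conton X W A" "!!q x. q \<in> W ==> L q (\<tau> q x) = \<sigma> q (blinfun_apply (A q) x)"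
proof -
  obtain W U1 \<tau>1 U2 \<sigma>1 A where *: "openin X W" "p \<in> W" "(U1, \<tau>1) \<in> charts E" "(U2, \<sigma>1) \<in> charts F"
    "W \<subseteq> U1" "W \<subseteq> U2" "conton X W A" "\<forall>q\<in>W. \<forall>x. L q (\<tau>1 q x) = \<sigma>1 q (blinfun_apply (A q) x)"
    using bspec[OF L[unfolded nmor_on_def] p] by (elim exE conjE)
  obtain T where T: "conton X (V \<inter> U1) T" "!!p x. p \<in> V ==> p \<in> U1 ==> \<tau> p x = \<tau>1 p (blinfun_apply (T p) x)"
    by (rule bb_trans[OF E c(1) *(3)], rule that)
  obtain S where S: "conton X (U2 \<inter> V') S" "!!p x. p \<in> U2 ==> p \<in> V' ==> \<sigma>1 p x = \<sigma> p (blinfun_apply (S p) x)"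
    by (rule bb_trans[OF F *(4) d(1)], rule that)
  show thesis
  proof (rule that[of "W \<inter> (V \<inter> V')" "\<lambda>q. S q o\<^sub>L A q o\<^sub>L T q"])
    show "openin X (W \<inter> (V \<inter> V'))" using *(1) bb_chart(1)[OF E c(1)] bb_chart(1)[OF F d(1)] by auto
    show "conton X (W \<inter> (V \<inter> V')) (\<lambda>q. S q o\<^sub>L A q o\<^sub>L T q)"
      using *(5,6) by (intro conton_blinfun_compose conton_subset[OF S(1)] conton_subset[OF T(1)] conton_subset[OF *(7)]) auto
    fix q x assume q: "q \<in> W \<inter> (V \<inter> V')"
    hence q': "q \<in> W" "q \<in> V" "q \<in> V'" "q \<in> U1" "q \<in> U2" using *(5,6) by auto
    have "L q (\<tau>1 q (T q x)) = \<sigma>1 q (A q (T q x))" using *(8) q'(1) by blast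
    thus "L q (\<tau> q x) = \<sigma> q (blinfun_apply (S q o\<^sub>L A q o\<^sub>L T q) x)" using T(2)[of q] S(2)[of q] q' by simp
  qed (use * c d in auto)
qed

lemma nmor_on_imp_charts:
  assumes E: "banach_bundle X E" and F: "banach_bundle X F" and L: "nmor_on X E F (topspace X) L"
  shows "norm_continuous_in_charts X E F L" unfolding norm_continuous_in_charts_def
proof clarify
  fix V \<tau> V' \<sigma> assume c: "(V, \<tau>) \<in> charts E" and d: "(V', \<sigma>) \<in> charts F"
  have o: "openin X (V \<inter> V')" using bb_chart(1)[OF E c] bb_chart(1)[OF F d] by auto
  \<comment> \<open>Charts are injective, so the local operator is unique and the pointwise choice
    coincides with the continuous one near each point.\<close>
  define A where "A q = (SOME B. \<forall>x. L q (\<tau> q x) = \<sigma> q (blinfun_apply B x))" for q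
  have loc: "\<exists>W B. openin X W \<and> p \<in> W \<and> W \<subseteq> V \<inter> V' \<and> conton X W B \<and>
      (\<forall>q\<in>W. A q = B q \<and> (\<forall>x. L q (\<tau> q x) = \<sigma> q (blinfun_apply (A q) x)))" if p: "p \<in> V \<inter> V'" for p
  proof -
    have pX: "p \<in> topspace X" using openin_subset[OF o] p by blast
    have p': "p \<in> V" "p \<in> V'" using p by auto
    obtain W B where W: "openin X W" "p \<in> W" "W \<subseteq> V" "W \<subseteq> V'" "conton X W B" "!!q x. q \<in> W ==> L q (\<tau> q x) = \<sigma> q (blinfun_apply (B q) x)"
      by (rule nmor_on_charts[OF E F L pX c p'(1) d p'(2)], rule that)
    have "A q = B q \<and> (\<forall>x. L q (\<tau> q x) = \<sigma> q (blinfun_apply (A q) x))" if q: "q \<in> W" for q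
    proof -
      have A: "\<forall>x. L q (\<tau> q x) = \<sigma> q (blinfun_apply (A q) x)" unfolding A_def by (rule someI_ex) (use W(6)[OF q] in blast)
      have "q \<in> V'" using q W(4) by blast
      have "A q x = B q x" for x using A W(6)[OF q, of x] chart_inj[OF F d \<open>q \<in> V'\<close>] by metis
      thus ?thesis using A by (auto intro: blinfun_eqI)
    qed
    thus ?thesis using W by blast
  qed
  have "conton X (V \<inter> V') A"
  proof (rule conton_local)
    fix p assume "p \<in> V \<inter> V'"
    from loc[OF this] show "\<exists>W. openin X W \<and> p \<in> W \<and> (\<exists>g. conton X W g \<and> (\<forall>q\<in>W. A q = g q))" by blast
  qed
  moreover have "\<forall>p\<in>V \<inter> V'. \<forall>x. L p (\<tau> p x) = \<sigma> p (blinfun_apply (A p) x)" using loc by blast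
  ultimately show "\<exists>A. continuous_map (subtopology X (V \<inter> V')) euclidean A \<and>
          (\<forall>p\<in>V \<inter> V'. \<forall>x. L p (\<tau> p x) = \<sigma> p (blinfun_apply (A p) x))" using conton_iff[OF o, of A] by blast
qed

lemma bundle_morphismD:
  assumes E: "banach_bundle X E" and F: "banach_bundle X F" and L: "bundle_morphism X E F L"
  shows "nmor_on X E F (topspace X) L"
    and "p \<in> topspace X ==> fibre_linear E F p (L p)"
proof -
  have n: "norm_continuous_in_charts X E F L" using L by (simp add: bundle_morphism_def)
  show "nmor_on X E F (topspace X) L"
  proof (rule nmor_onI)
    fix p assume p: "p \<in> topspace X"
    obtain V \<tau> where c: "(V, \<tau>) \<in> charts E" "p \<in> V" using bb_cover[OF E p] .
    obtain V' \<sigma> where d: "(V', \<sigma>) \<in> charts F" "p \<in> V'" using bb_cover[OF F p] .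
    have o: "openin X (V \<inter> V')" using bb_chart(1)[OF E c(1)] bb_chart(1)[OF F d(1)] by auto
    obtain A where A: "continuous_map (subtopology X (V \<inter> V')) euclidean A"
      "!!p x. p \<in> V ==> p \<in> V' ==> L p (\<tau> p x) = \<sigma> p (blinfun_apply (A p) x)"
      by (rule norm_continuous_in_chartsD[OF n c(1) d(1)], rule that)
    have "conton X (V \<inter> V') A" using A(1) conton_iff[OF o, of A] by simp
    thus "nmor_at X E F L p" using o c d A(2)
      by (intro exI[of _ "V \<inter> V'"] exI[of _ V] exI[of _ \<tau>] exI[of _ V'] exI[of _ \<sigma>] exI[of _ A]) auto
  qed
  show "p \<in> topspace X ==> fibre_linear E F p (L p)" using L by (simp add: bundle_morphism_def)
qed

lemma bundle_morphismI:
  assumes "banach_bundle X E" "banach_bundle X F" "nmor_on X E F (topspace X) L"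
    "!!p. p \<in> topspace X ==> fibre_linear E F p (L p)"
  shows "bundle_morphism X E F L" using nmor_on_imp_charts[OF assms(1-3)] assms(4) by (simp add: bundle_morphism_def)

lemma nmor_sec:
  assumes E: "banach_bundle X E" and F: "banach_bundle X F" and L: "nmor_on X E F U L" and U: "openin X U"
    and s: "continuous_section X E U s"
  shows "continuous_section X F U (\<lambda>p. L p (s p))"
proof (rule csec_local[OF F U])
  fix p assume p: "p \<in> U"
  obtain W U1 \<tau> U2 \<sigma> A where *: "openin X W" "p \<in> W" "(U1, \<tau>) \<in> charts E" "(U2, \<sigma>) \<in> charts F"
    "W \<subseteq> U1" "W \<subseteq> U2" "conton X W A" "\<forall>q\<in>W. \<forall>x. L q (\<tau> q x) = \<sigma> q (blinfun_apply (A q) x)"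
    using bspec[OF L[unfolded nmor_on_def] p] by (elim exE conjE)
  obtain x where x: "conton X (U \<inter> U1) x" "!!p. p \<in> U ==> p \<in> U1 ==> s p = \<tau> p (x p)" by (rule csecD[OF E s U *(3)], rule that)
  have "conton X (W \<inter> U) (\<lambda>q. A q (x q))" using *(5) by (intro conton_blinfun_apply conton_subset[OF *(7)] conton_subset[OF x(1)]) auto
  thus "\<exists>W U' \<tau> x. openin X W \<and> p \<in> W \<and> (U', \<tau>) \<in> charts F \<and> W \<subseteq> U' \<and> conton X W x \<and> (\<forall>q\<in>W. L q (s q) = \<tau> q (x q))" using * U p x(2)
    by (intro exI[of _ "W \<inter> U"] exI[of _ U2] exI[of _ \<sigma>] exI[of _ "\<lambda>q. A q (x q)"]) auto
qed

lemma nmor_comb: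
  fixes I :: "'i set"
  assumes E: "banach_bundle X E" and F: "banach_bundle X F" and U: "openin X U" and I: "finite I"
    and L: "!!i. i \<in> I ==> nmor_on X E F U (L i)" and a: "!!i. i \<in> I ==> conton X U (a i)"
  shows "nmor_on X E F U (\<lambda>p u. \<Sum>i\<in>I. fscale F (a i p) (L i p u))"
proof (rule nmor_onI)
  interpret m: kspace "mscale F" by (rule bb_kspace[OF F])
  note bb = m.bounded_bilinear_scale
  fix p assume p: "p \<in> U"
  have pX: "p \<in> topspace X" using openin_subset[OF U] p by blast
  obtain V \<tau> where c: "(V, \<tau>) \<in> charts E" "p \<in> V" using bb_cover[OF E pX] .
  obtain V' \<sigma> where d: "(V', \<sigma>) \<in> charts F" "p \<in> V'" using bb_cover[OF F pX] .
  define good where "good i W A \<longleftrightarrow> openin X W \<and> p \<in> W \<and> W \<subseteq> V \<and> W \<subseteq> V' \<and> conton X W A \<and>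
     (\<forall>q x. q \<in> W --> L i q (\<tau> q x) = \<sigma> q (blinfun_apply (A q) x))" for i W A
  have "\<exists>W A. good i W A" if "i \<in> I" for i unfolding good_def by (rule nmor_on_charts[OF E F L[OF that] p c d]) blast
  then obtain W A where "!!i. i \<in> I ==> good i (W i) (A i)" by metis
  hence W: "!!i. i \<in> I ==> openin X (W i)" "!!i. i \<in> I ==> p \<in> W i" "!!i. i \<in> I ==> W i \<subseteq> V"
    "!!i. i \<in> I ==> W i \<subseteq> V'" "!!i. i \<in> I ==> conton X (W i) (A i)" "!!i q x. i \<in> I ==> q \<in> W i ==> L i q (\<tau> q x) = \<sigma> q (blinfun_apply (A i q) x)"
    unfolding good_def by auto
  define W0 where "W0 = (U \<inter> (V \<inter> V')) \<inter> (\<Inter>i\<in>I. W i)"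
  have o: "openin X (U \<inter> (V \<inter> V'))" using U bb_chart(1)[OF E c(1)] bb_chart(1)[OF F d(1)] by auto
  have W0: "openin X W0"
  proof (cases "I = {}")
    case False
    thus ?thesis unfolding W0_def using I W(1) by (intro openin_Int[OF o] openin_INT2) auto
  qed (use o in \<open>simp add: W0_def\<close>)
  define B where "B q = (\<Sum>i\<in>I. bounded_bilinear.prod_right (mscale F) (a i q) o\<^sub>L A i q)" for q
  have "conton X W0 B" unfolding B_def
  proof (intro conton_sum conton_blinfun_compose)
    fix i assume i: "i \<in> I"
    show "conton X W0 (A i)" using i by (intro conton_subset[OF W(5)]) (auto simp: W0_def)
    have "conton X W0 (a i)" using i by (intro conton_subset[OF a]) (auto simp: W0_def)
    thus "conton X W0 (\<lambda>q. bounded_bilinear.prod_right (mscale F) (a i q))"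
      unfolding conton_def by (auto intro: bounded_linear.tendsto[OF bounded_bilinear.bounded_linear_prod_right[OF bb]])
  qed
  moreover have "(\<Sum>i\<in>I. fscale F (a i q) (L i q (\<tau> q x))) = \<sigma> q (blinfun_apply (B q) x)" if q: "q \<in> W0" for q x
  proof -
    have q': "q \<in> V'" "!!i. i \<in> I ==> q \<in> W i" using q by (auto simp: W0_def)
    have "\<sigma> q (B q x) = (\<Sum>i\<in>I. fscale F (a i q) (\<sigma> q (A i q x)))" unfolding B_def blinfun_sum_apply
      by (simp add: bounded_bilinear.prod_right.rep_eq[OF bb] chart_comb[OF F d(1) q'(1)])
    thus ?thesis using W(6) q'(2) by simp
  qed
  ultimately show "nmor_at X E F (\<lambda>q u. (\<Sum>i\<in>I. fscale F (a i q) (L i q u))) p" using c d p W0 W(2)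
    by (intro exI[of _ W0] exI[of _ V] exI[of _ \<tau>] exI[of _ V'] exI[of _ \<sigma>] exI[of _ B]) (auto simp: W0_def)
qed

text \<open>The factor vanishes off a closed set inside \<open>U\<close>, so the product extends by
  zero to all of \<open>X\<close>, whatever \<open>L\<close> is outside \<open>U\<close>.\<close>

lemma nmor_bump:
  assumes E: "banach_bundle X E" and F: "banach_bundle X F" and U: "openin X U"
    and L: "nmor_on X E F U L" and a: "conton X (topspace X) a"
    and K: "closedin X K" "K \<subseteq> U" "!!p. p \<in> topspace X - K ==> a p = 0"
  shows "nmor_on X E F (topspace X) (\<lambda>p u. fscale F (a p) (L p u))"
proof (rule nmor_onI)
  interpret f: vector_space "fscale F" by (rule bb_vs[OF F])
  fix p assume p: "p \<in> topspace X"
  have sub: "U \<subseteq> topspace X" by (rule openin_subset[OF U])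
  show "nmor_at X E F (\<lambda>q u. fscale F (a q) (L q u)) p"
  proof (cases "p \<in> U")
    case True
    have "nmor_on X E F U (\<lambda>p u. \<Sum>i\<in>{()}. fscale F (a p) (L p u))"
      using L a sub by (intro nmor_comb[OF E F U]) (auto elim: conton_subset)
    from bspec[OF this[unfolded nmor_on_def] True] show ?thesis by simp
  next
    case False
    obtain V \<tau> where c: "(V, \<tau>) \<in> charts E" "p \<in> V" using bb_cover[OF E p] .
    obtain V' \<sigma> where d: "(V', \<sigma>) \<in> charts F" "p \<in> V'" using bb_cover[OF F p] .
    have "openin X ((topspace X - K) \<inter> (V \<inter> V'))" using K(1) bb_chart(1)[OF E c(1)] bb_chart(1)[OF F d(1)] by (auto simp: openin_diff)
    moreover have "fscale F (a q) (L q (\<tau> q x)) = \<sigma> q (blinfun_apply 0 x)"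
      if "q \<in> (topspace X - K) \<inter> (V \<inter> V')" for q x using K(3)[of q] that chart_0[OF F d(1), of q] by simp
    ultimately show ?thesis using p False K(2) c d conton_const
      by (intro exI[of _ "(topspace X - K) \<inter> (V \<inter> V')"] exI[of _ V] exI[of _ \<tau>] exI[of _ V'] exI[of _ \<sigma>] exI[of _ "\<lambda>_. 0"]) auto
  qed
qed

lemma csec_bump:
  assumes E: "banach_bundle X E" and U: "openin X U"
    and s: "continuous_section X E U s" and a: "conton X (topspace X) a"
    and K: "closedin X K" "K \<subseteq> U" "!!p. p \<in> topspace X - K ==> a p = 0"
  shows "continuous_section X E (topspace X) (\<lambda>p. fscale E (a p) (s p))"
proof (rule csec_locally[OF E openin_topspace])
  interpret f: vector_space "fscale E" by (rule bb_vs[OF E])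
  fix p assume p: "p \<in> topspace X"
  show "\<exists>W s'. openin X W \<and> p \<in> W \<and> continuous_section X E W s' \<and> (\<forall>q\<in>W. fscale E (a q) (s q) = s' q)"
  proof (cases "p \<in> U")
    case True
    thus ?thesis using csec_scale[OF E U s conton_subset[OF a openin_subset[OF U]]] U by blast
  next
    case False
    have o: "openin X (topspace X - K)" using K(1) by (auto simp: openin_diff)
    show ?thesis using csec_zero[OF E o] o p False K(2,3) by (intro exI[of _ "topspace X - K"] exI[of _ "\<lambda>_. 0"]) auto
  qed
qed

text \<open>Scalar valued counterpart of \<open>nmor_on\<close>. A single chart covers
  \<open>U\<close>, as the coordinate functionals arise in one chart.\<close>

definition functional_on ::
  "'b topology => ('b, 'k :: real_normed_vector, 'v, 'm :: real_normed_vector) bbundle => 'b set => ('b => 'v => 'k) => bool" where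
  "functional_on X E U \<phi> \<longleftrightarrow> (\<exists>U1 \<tau> A. U \<subseteq> U1 \<and> (U1, \<tau>) \<in> charts E \<and> conton X U A \<and> (\<forall>q\<in>U. \<forall>x. \<phi> q (\<tau> q x) = blinfun_apply (A q) x))"

text \<open>Sums of such operators make up the projection onto the index bundle.\<close>

lemma nmor_rank_one:
  fixes E :: "('b, 'k :: {real_normed_field, euclidean_space}, 'v :: ab_group_add, 'm :: banach) bbundle"
  assumes E: "banach_bundle X E" and F: "banach_bundle X F" and U: "openin X U"
    and \<phi>: "functional_on X E U \<phi>" and y: "continuous_section X F U y"
  shows "nmor_on X E F U (\<lambda>p u. fscale F (\<phi> p u) (y p))"
proof (rule nmor_onI)
  interpret m: kspace "mscale F" by (rule bb_kspace[OF F])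
  note bb = m.bounded_bilinear_scale
  obtain U1 \<tau> A where *: "U \<subseteq> U1" "(U1, \<tau>) \<in> charts E" "conton X U A" "\<forall>q\<in>U. \<forall>x. \<phi> q (\<tau> q x) = blinfun_apply (A q) x"
    using \<phi> unfolding functional_on_def by (elim exE conjE)
  fix p assume p: "p \<in> U"
  have pX: "p \<in> topspace X" using openin_subset[OF U] p by blast
  obtain V' \<sigma> where d: "(V', \<sigma>) \<in> charts F" "p \<in> V'" using bb_cover[OF F pX] .
  obtain z where z: "conton X (U \<inter> V') z" "!!p. p \<in> U ==> p \<in> V' ==> y p = \<sigma> p (z p)" by (rule csecD[OF F y U d(1)], rule that)
  have "conton X (U \<inter> V') (\<lambda>q. bounded_bilinear.prod_left (mscale F) (z q) o\<^sub>L A q)"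
  proof (intro conton_blinfun_compose)
    show "conton X (U \<inter> V') A" using *(3) by (rule conton_subset) auto
    show "conton X (U \<inter> V') (\<lambda>q. bounded_bilinear.prod_left (mscale F) (z q))"
      using z(1) unfolding conton_def by (auto intro: bounded_linear.tendsto[OF bounded_bilinear.bounded_linear_prod_left[OF bb]])
  qed
  moreover have "fscale F (\<phi> q (\<tau> q x)) (y q) = \<sigma> q (blinfun_apply (bounded_bilinear.prod_left (mscale F) (z q) o\<^sub>L A q) x)"
    if "q \<in> U \<inter> V'" for q x using that *(4) z(2)[of q] by (simp add: bounded_bilinear.prod_left.rep_eq[OF bb] chart_scale[OF F d(1)])
  ultimately show "nmor_at X E F (\<lambda>q u. fscale F (\<phi> q u) (y q)) p" using *(1,2) d p U bb_chart(1)[OF F d(1)]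
    by (intro exI[of _ "U \<inter> V'"] exI[of _ U1] exI[of _ \<tau>] exI[of _ V'] exI[of _ \<sigma>]
        exI[of _ "\<lambda>q. bounded_bilinear.prod_left (mscale F) (z q) o\<^sub>L A q"]) auto
qed

section \<open>Partitions of unity\<close>

text \<open>\<open>Q\<close> singles out the open sets over which some local construction exists.
  The closed sets \<open>K i\<close>, off which the functions vanish, are delivered as well because
  extension by zero requires them.\<close>

lemma partition_of_unity:
  assumes X: "compact_space X" "Hausdorff_space X"
    and cover: "!!p. p \<in> topspace X ==> \<exists>U. openin X U \<and> p \<in> U \<and> Q U"
  obtains n :: nat and U K and \<rho> :: "nat => 'b => real" where
    "!!i. i < n ==> openin X (U i)" "!!i. i < n ==> Q (U i)" "!!i. i < n ==> closedin X (K i)"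
    "!!i. i < n ==> K i \<subseteq> U i" "!!i. i < n ==> conton X (topspace X) (\<rho> i)"
    "!!i p. i < n ==> p \<in> topspace X - K i ==> \<rho> i p = 0" "!!p. p \<in> topspace X ==> (\<Sum>i<n. \<rho> i p) = 1"
proof -
  have normal: "normal_space X" using X by (simp add: compact_Hausdorff_or_regular_imp_normal_space)
  define bump where "bump U K g \<longleftrightarrow> openin X U \<and> Q U \<and> closedin X K \<and> K \<subseteq> U \<and> continuous_map X euclideanreal g \<and>
    (\<forall>p\<in>topspace X. g p \<ge> 0) \<and> (\<forall>p\<in>topspace X - K. g p = 0)" for U K and g :: "'b => real"
  have "\<exists>U K g. bump U K g \<and> g p > 0" if p: "p \<in> topspace X" for p
  proof -
    obtain U where U: "openin X U" "p \<in> U" "Q U" using cover[OF p] by blast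
    have "closedin X {p}" using X(2) p by (simp add: closedin_Hausdorff_singleton)
    moreover have "closedin X (topspace X - U)" using U(1) by (simp add: closedin_diff)
    moreover have "disjnt (topspace X - U) {p}" using U(2) by (simp add: disjnt_def)
    ultimately obtain f where f: "continuous_map X euclideanreal f" "f ` (topspace X - U) \<subseteq> {0}" "f ` {p} \<subseteq> {1}"
      using Urysohn_lemma_alt[OF normal, of "topspace X - U" "{p}" 0 1] by metis
    \<comment> \<open>\<open>f\<close> is 0 off \<open>U\<close> and 1 at \<open>p\<close>. The
      level 1/3 gives a closed set inside \<open>U\<close>; the higher level 1/2 makes
      \<open>g\<close> vanish off this set while \<open>g p = 1/2\<close>.\<close>
    define K where "K = {q \<in> topspace X. f q \<in> {1/3..}}"
    define g where "g q = max 0 (f q - 1/2)" for q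
    have "closedin X K" unfolding K_def by (rule closedin_continuous_map_preimage[OF f(1)]) simp
    moreover have "K \<subseteq> U" using f(2) by (force simp: K_def)
    moreover have "continuous_map X euclideanreal g"
      unfolding g_def using f(1) by (intro continuous_map_real_max continuous_map_diff) auto
    moreover have "g q = 0" if "q \<in> topspace X - K" for q using that by (auto simp: K_def g_def)
    ultimately have "bump U K g" using U unfolding bump_def by (auto simp: g_def)
    moreover have "g p > 0" using f(3) by (simp add: g_def)
    ultimately show ?thesis by blast
  qed
  then obtain U K g where b: "!!p. p \<in> topspace X ==> bump (U p) (K p) (g p)" "!!p. p \<in> topspace X ==> g p p > 0" by metis
  define V where "V p = {q \<in> topspace X. g p q \<in> {0<..}}" for p
  have oV: "openin X (V p)" if "p \<in> topspace X" for p
    unfolding V_def using b(1)[OF that] by (intro openin_continuous_map_preimage[of X euclideanreal]) (auto simp: bump_def)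
  have "topspace X \<subseteq> \<Union>(V ` topspace X)" using b(2) by (force simp: V_def)
  then obtain \<F> where \<F>: "finite \<F>" "\<F> \<subseteq> V ` topspace X" "topspace X \<subseteq> \<Union>\<F>"
    using compactinD[of X "topspace X" "V ` topspace X"] X(1) oV by (auto simp: compact_space_def)
  then obtain P where P: "P \<subseteq> topspace X" "finite P" "\<F> = V ` P" by (meson finite_subset_image)
  obtain h where h: "bij_betw h {..<card P} P" using ex_bij_betw_nat_finite[OF P(2)] by (auto simp: atLeast0LessThan)
  define n where "n = card P"
  have hP: "h i \<in> topspace X" if "i < n" for i using h P(1) that by (auto simp: bij_betw_def n_def)
  note bh = b(1)[OF hP, unfolded bump_def]
  define S where "S q = (\<Sum>i<n. g (h i) q)" for q
  have S: "S q > 0" if q: "q \<in> topspace X" for q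
  proof -
    obtain p where "p \<in> P" "q \<in> V p" using \<F>(3) P(3) q by blast
    moreover from this have "p \<in> h ` {..<n}" using h by (simp add: bij_betw_def n_def)
    ultimately obtain i where i: "i < n" "q \<in> V (h i)" by auto
    have "g (h i) q \<le> S q" unfolding S_def using i(1) bh q by (intro member_le_sum) auto
    thus ?thesis using i(2) by (simp add: V_def)
  qed
  have cg: "conton X (topspace X) (g (h i))" if "i < n" for i using bh[OF that] by (simp add: conton_topspace)
  have cS: "conton X (topspace X) S" unfolding S_def by (intro conton_sum cg) simp
  show thesis
  proof (rule that[of n "\<lambda>i. U (h i)" "\<lambda>i. K (h i)" "\<lambda>i p. g (h i) p / S p"])
    show "conton X (topspace X) (\<lambda>p. g (h i) p / S p)" if "i < n" for i
      unfolding conton_def using contonD[OF cg[OF that]] contonD[OF cS] S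
      by (auto intro!: tendsto_divide simp: less_imp_neq[THEN not_sym])
    show "(\<Sum>i<n. g (h i) p / S p) = 1" if "p \<in> topspace X" for p using S[OF that] by (simp add: S_def sum_divide_distrib[symmetric])
  qed (use bh in auto)
qed

lemma conton_of_real: "conton X U f ==> conton X U (\<lambda>p. of_real (f p) :: 'k :: real_normed_algebra_1)"
  unfolding conton_def by (auto intro!: tendsto_of_real)

text \<open>The alternative \<open>c i = 0\<close> is made for partitions of unity: a summand is
  known to be linear only over its own open set, and its weight is zero elsewhere.\<close>

lemma linear_between_sum:
  assumes t: "vector_space t" and B: "module.subspace t B" and f: "!!i. i \<in> I ==> c i = 0 \<or> linear_between s t A B (f i)"
  shows "linear_between s t A B (\<lambda>u. \<Sum>i\<in>I. t (c i) (f i u))"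
proof -
  interpret t: vector_space t by fact
  have "t (c i) (f i u) \<in> B" if "i \<in> I" "u \<in> A" for i u
    using f[OF that(1)] that(2) t.subspace_0[OF B] t.subspace_scale[OF B] unfolding linear_between_def by auto
  moreover have "t (c i) (f i (u + v)) = t (c i) (f i u) + t (c i) (f i v)" if "i \<in> I" "u \<in> A" "v \<in> A" for i u v
    using f[OF that(1)] that(2,3) unfolding linear_between_def by (auto simp: t.scale_right_distrib)
  moreover have "t (c i) (f i (s a u)) = t a (t (c i) (f i u))" if "i \<in> I" "u \<in> A" for i u a
    using f[OF that(1)] that(2) unfolding linear_between_def by (auto simp: mult.commute)
  ultimately show ?thesis unfolding linear_between_def by (auto simp: sum.distrib t.scale_sum_right intro!: t.subspace_sum[OF B])
qed

section \<open>Parametrices, the index bundle and its independence of choices\<close>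

section \<open>Transversality in charts\<close>

lemma is_basis_cong:
  assumes "vector_space s" "!!i. i < n ==> e i = f i"
  shows "is_basis s V n e \<longleftrightarrow> is_basis s V n f"
proof -
  have "(\<Sum>i<n. s (c i) (e i)) = (\<Sum>i<n. s (c i) (f i))" for c using assms(2) by (intro sum.cong) auto
  thus ?thesis unfolding vector_space.is_basis_iff[OF assms(1)] lin_indep_def by simp
qed

context
  fixes X :: "'b topology"
    and E :: "('b, 'k :: {real_normed_field, euclidean_space}, 'v :: ab_group_add, 'm :: banach) bbundle"
    and F :: "('b, 'k, 'w :: ab_group_add, 'n :: banach) bbundle"
    and U \<tau> U' \<sigma> q and M :: "'v => 'w" and B :: "'m \<Rightarrow>\<^sub>L 'n" and w :: "nat => 'n" and N :: nat
  assumes E: "banach_bundle X E" and F: "banach_bundle X F"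
    and c: "(U, \<tau>) \<in> charts E" "q \<in> U" and d: "(U', \<sigma>) \<in> charts F" "q \<in> U'"
    and MB: "!!x. M (\<tau> q x) = \<sigma> q (blinfun_apply B x)"
    and lin: "fibre_linear E F q M"
begin

lemma local_klin: "klin (mscale E) (mscale F) B" unfolding klin_def
proof (intro allI)
  fix a x
  have "\<sigma> q (B (mscale E a x)) = M (fscale E a (\<tau> q x))" by (simp add: MB[symmetric] chart_scale[OF E c])
  also have "\<dots> = fscale F a (M (\<tau> q x))" using lin chart_mem[OF E c, of x] unfolding linear_between_def by blast
  also have "\<dots> = \<sigma> q (mscale F a (B x))" by (simp add: MB chart_scale[OF F d])
  finally show "B (mscale E a x) = mscale F a (B x)" by (simp add: chart_inj[OF F d])
qed

lemma local_preimage: "{u \<in> fibre E q. \<exists>c. M u = (\<Sum>i<N. fscale F (c i) (\<sigma> q (w i)))} =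
    \<tau> q ` {x. \<exists>c. blinfun_apply B x = (\<Sum>i<N. mscale F (c i) (w i))}"
proof -
  have *: "M (\<tau> q x) = (\<Sum>i<N. fscale F (c i) (\<sigma> q (w i))) \<longleftrightarrow> B x = (\<Sum>i<N. mscale F (c i) (w i))" for x c
    by (simp add: MB chart_comb[OF F d, symmetric] chart_inj[OF F d])
  show ?thesis
  proof (intro subset_antisym subsetI)
    fix u assume "u \<in> {u \<in> fibre E q. \<exists>c. M u = (\<Sum>i<N. fscale F (c i) (\<sigma> q (w i)))}"
    hence u: "u \<in> fibre E q" "\<exists>c. M u = (\<Sum>i<N. fscale F (c i) (\<sigma> q (w i)))" by auto
    obtain x where x: "u = \<tau> q x" using c(2) u(1) by (rule chart_surj[OF E c(1)])
    have "x \<in> {x. \<exists>c. B x = (\<Sum>i<N. mscale F (c i) (w i))}" using u(2) unfolding x * by blast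
    thus "u \<in> \<tau> q ` {x. \<exists>c. B x = (\<Sum>i<N. mscale F (c i) (w i))}" unfolding x by (rule imageI)
  next
    fix u assume "u \<in> \<tau> q ` {x. \<exists>c. B x = (\<Sum>i<N. mscale F (c i) (w i))}"
    then obtain x where x: "u = \<tau> q x" "\<exists>c. B x = (\<Sum>i<N. mscale F (c i) (w i))" by blast
    show "u \<in> {u \<in> fibre E q. \<exists>c. M u = (\<Sum>i<N. fscale F (c i) (\<sigma> q (w i)))}"
      using x(2) chart_mem[OF E c, of x] unfolding x(1) mem_Collect_eq * by blast
  qed
qed

lemma local_kernel:
  assumes "fin_dim (fscale E) {u \<in> fibre E q. M u = 0}"
  shows "fin_dim (mscale E) {x. blinfun_apply B x = 0}"
proof -
  interpret f: vector_space "fscale E" by (rule bb_vs[OF E])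
  interpret m: kspace "mscale E" by (rule bb_kspace[OF E])
  have M0: "M (\<tau> q x) = 0 \<longleftrightarrow> B x = 0" for x by (simp add: MB chart_eq_0[OF F d])
  have eq: "{u \<in> fibre E q. M u = 0} = \<tau> q ` {x. B x = 0}"
  proof (intro subset_antisym subsetI)
    fix u assume "u \<in> {u \<in> fibre E q. M u = 0}"
    hence u: "u \<in> fibre E q" "M u = 0" by auto
    obtain x where x: "u = \<tau> q x" using c(2) u(1) by (rule chart_surj[OF E c(1)])
    show "u \<in> \<tau> q ` {x. B x = 0}" using u(2) unfolding x M0 by blast
  qed (use chart_mem[OF E c] M0 in auto)
  obtain n e where e: "is_basis (fscale E) (\<tau> q ` {x. B x = 0}) n e" using assms unfolding eq by (rule f.fin_dim_basis')
  have "\<exists>x. e i = \<tau> q x" if "i < n" for i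
  proof -
    have "e i \<in> f.span (e ` {..<n})" using that by (intro f.span_base) auto
    thus ?thesis using e unfolding is_basis_def by auto
  qed
  then obtain x where x: "!!i. i < n ==> e i = \<tau> q (x i)" by metis
  have "is_basis (fscale E) (\<tau> q ` {x. B x = 0}) n (\<lambda>i. \<tau> q (x i))" using e is_basis_cong[OF f.vector_space_axioms x] by simp
  hence "is_basis (mscale E) {x. B x = 0} n x" by (simp add: chart_is_basis[OF E c])
  thus ?thesis by (rule m.is_basis_fin_dim)
qed

lemma local_transversal: "(\<forall>z\<in>fibre F q. \<exists>u\<in>fibre E q. \<exists>c. z = M u + (\<Sum>i<N. fscale F (c i) (\<sigma> q (w i)))) \<longleftrightarrow>
   (\<forall>v. \<exists>x c. blinfun_apply B x + (\<Sum>i<N. mscale F (c i) (w i)) = v)"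
proof -
  have *: "M (\<tau> q x) + (\<Sum>i<N. fscale F (c i) (\<sigma> q (w i))) = \<sigma> q (B x + (\<Sum>i<N. mscale F (c i) (w i)))" for x c
    by (simp add: MB chart_comb[OF F d] chart_add[OF F d])
  show ?thesis
  proof (intro iffI allI ballI)
    fix v assume "\<forall>z\<in>fibre F q. \<exists>u\<in>fibre E q. \<exists>c. z = M u + (\<Sum>i<N. fscale F (c i) (\<sigma> q (w i)))"
    from bspec[OF this chart_mem[OF F d, of v]] obtain u a where
      u: "u \<in> fibre E q" "\<sigma> q v = M u + (\<Sum>i<N. fscale F (a i) (\<sigma> q (w i)))" by (elim bexE exE)
    obtain x where x: "u = \<tau> q x" using c(2) u(1) by (rule chart_surj[OF E c(1)])
    have "v = B x + (\<Sum>i<N. mscale F (a i) (w i))" using u(2) unfolding x * chart_inj[OF F d] .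
    thus "\<exists>x c. B x + (\<Sum>i<N. mscale F (c i) (w i)) = v" by (intro exI[of _ x] exI[of _ a]) simp
  next
    fix z assume a: "\<forall>v. \<exists>x c. B x + (\<Sum>i<N. mscale F (c i) (w i)) = v" and "z \<in> fibre F q"
    obtain v where v: "z = \<sigma> q v" using d(2) \<open>z \<in> fibre F q\<close> by (rule chart_surj[OF F d(1)])
    obtain x a where "B x + (\<Sum>i<N. mscale F (a i) (w i)) = v" using a by blast
    hence "z = M (\<tau> q x) + (\<Sum>i<N. fscale F (a i) (\<sigma> q (w i)))" unfolding v * by simp
    thus "\<exists>u\<in>fibre E q. \<exists>c. z = M u + (\<Sum>i<N. fscale F (c i) (\<sigma> q (w i)))"
      using chart_mem[OF E c, of x] by (intro bexI[of _ "\<tau> q x"] exI[of _ a])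
  qed
qed

end

definition loc :: "('m => 'v) => 'v => 'm" where "loc f = inv_into UNIV f"

lemma loc_chart:
  assumes "banach_bundle X E" "(U, \<tau>) \<in> charts E" "p \<in> U"
  shows "loc (\<tau> p) (\<tau> p x) = x" unfolding loc_def using bb_chart(3)[OF assms] by (auto simp: bij_betw_def intro: inv_into_f_f)

lemma frame_local:
  assumes F: "banach_bundle X F" and fr: "(U, N, f) \<in> frames (induced_vbundle X F V)" and d: "(U', \<sigma>) \<in> charts F"
  obtains w where "!!i. i < N ==> conton X (U \<inter> U') (w i)" "!!i p. i < N ==> p \<in> U ==> p \<in> U' ==> f p i = \<sigma> p (w i p)"
proof -
  have U: "openin X U" and s: "!!i. i < N ==> continuous_section X F U (\<lambda>p. f p i)" using fr by (auto simp: induced_simps)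
  have "\<exists>x. conton X (U \<inter> U') x \<and> (\<forall>p\<in>U \<inter> U'. f p i = \<sigma> p (x p))" if "i < N" for i by (rule csecD[OF F s[OF that] U d]) blast
  then obtain w where "!!i. i < N ==> conton X (U \<inter> U') (w i) \<and> (\<forall>p\<in>U \<inter> U'. f p i = \<sigma> p (w i p))" by metis
  thus ?thesis by (intro that[of w]) auto
qed

lemma transversal_subbundleD:
  assumes "transversal_subbundle X E F L V"
  shows "fin_dim_subbundle X F V" "vector_bundle X (induced_vbundle X F V)"
    and "p \<in> topspace X ==> V p \<subseteq> fibre F p"
    and "p \<in> topspace X ==> z \<in> fibre F p ==> \<exists>u\<in>fibre E p. \<exists>v\<in>V p. z = L p u + v"
proof -
  show "fin_dim_subbundle X F V" "vector_bundle X (induced_vbundle X F V)" "p \<in> topspace X ==> V p \<subseteq> fibre F p"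
    using assms by (auto simp: transversal_subbundle_def fin_dim_subbundle_def)
  assume "p \<in> topspace X" "z \<in> fibre F p"
  hence "z \<in> {y + v | y v. y \<in> L p ` fibre E p \<and> v \<in> V p}" using assms by (simp add: transversal_subbundle_def)
  thus "\<exists>u\<in>fibre E p. \<exists>v\<in>V p. z = L p u + v" by blast
qed

text \<open>What one bordered chart provides: a frame \<open>e\<close> of the index bundle,
  functionals \<phi> dual to it, and a right inverse \<open>R\<close> of \<open>L\<close> modulo
  \<open>V\<close>.\<close>

definition par_loc :: "'b topology => ('b, 'k, 'v, 'm :: banach) bbundle =>
   ('b, 'k :: {real_normed_field, euclidean_space}, 'w :: ab_group_add, 'n :: banach) bbundle => ('b => 'v => 'w)
   => ('b => 'w set) => 'b set => nat => ('b => nat => 'v :: ab_group_add) => (nat => 'b => 'v => 'k) => ('b => 'w => 'v) => bool" where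
  "par_loc X E F L V Q d e \<phi> R \<longleftrightarrow> (\<forall>j<d. continuous_section X E Q (\<lambda>p. e p j)) \<and>
    (\<forall>p\<in>Q. is_basis (fscale E) (index_space E L V p) d (e p)) \<and> (\<forall>j<d. functional_on X E Q (\<phi> j)) \<and>
    (\<forall>j<d. \<forall>p\<in>Q. linear_between (fscale E) (*) (fibre E p) UNIV (\<phi> j p)) \<and>
    (\<forall>i<d. \<forall>j<d. \<forall>p\<in>Q. \<phi> i p (e p j) = (if i = j then 1 else 0)) \<and>
    nmor_on X F E Q R \<and> (\<forall>p\<in>Q. fibre_linear F E p (R p)) \<and> (\<forall>p\<in>Q. \<forall>z\<in>fibre F p. L p (R p z) - z \<in> V p)"

text \<open>In charts \<open>L\<close> is bordered by a frame of \<open>V\<close>, and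
  transversality at \<open>p0\<close> is what makes the bordered operator bijective. The blocks
  \<open>e\<close> and \<open>R\<close> of the solution, carried back by the charts, are the frame
  and the parametrix.\<close>

lemma parametrix_local:
  fixes E :: "('b, 'k :: {real_normed_field, euclidean_space}, 'v :: ab_group_add, 'm :: banach) bbundle"
    and F :: "('b, 'k, 'w :: ab_group_add, 'n :: banach) bbundle"
  assumes E: "banach_bundle X E" and F: "banach_bundle X F" and L: "bundle_morphism X E F L"
    and V: "transversal_subbundle X E F L V" and p0: "p0 \<in> topspace X"
    and ker: "fin_dim (fscale E) {u \<in> fibre E p0. L p0 u = 0}"
  obtains Q d e \<phi> R where "openin X Q" "p0 \<in> Q" "par_loc X E F L V Q d e \<phi> R"
proof -
  note Vb = transversal_subbundleD(2)[OF V]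
  note ks = bb_kspace[OF E] and kt = bb_kspace[OF F]
  interpret fF: vector_space "fscale F" by (rule bb_vs[OF F])
  obtain U1 \<tau> where c: "(U1, \<tau>) \<in> charts E" "p0 \<in> U1" using bb_cover[OF E p0] .
  obtain U2 \<sigma> where d: "(U2, \<sigma>) \<in> charts F" "p0 \<in> U2" using bb_cover[OF F p0] .
  obtain U3 N f where f: "(U3, N, f) \<in> frames (induced_vbundle X F V)" "p0 \<in> U3" using vb_cover[OF Vb p0] .
  obtain W A where W: "openin X W" "p0 \<in> W" "W \<subseteq> U1" "W \<subseteq> U2" "conton X W A" "!!q x. q \<in> W ==> L q (\<tau> q x) = \<sigma> q (blinfun_apply (A q) x)"
    by (rule nmor_on_charts[OF E F bundle_morphismD(1)[OF E F L] p0 c d], rule that)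
  obtain w where w: "!!i. i < N ==> conton X (U3 \<inter> U2) (w i)" "!!i p. i < N ==> p \<in> U3 ==> p \<in> U2 ==> f p i = \<sigma> p (w i p)"
    by (rule frame_local[OF F f(1) d(1)], rule that)
  define U where "U = W \<inter> U3"
  have oU3: "openin X U3" by (rule vb_frame(1)[OF Vb f(1)])
  have U: "openin X U" "p0 \<in> U" "U \<subseteq> W" "U \<subseteq> U3" "U \<subseteq> U1" "U \<subseteq> U2" "U \<subseteq> topspace X"
    using W f(2) oU3 openin_subset[OF W(1)] by (auto simp: U_def)
  have lin: "fibre_linear E F q (L q)" if "q \<in> U" for q using bundle_morphismD(2)[OF E F L] that U(7) by blast
  have Vq: "V q = {\<Sum>i<N. fscale F (a i) (\<sigma> q (w i q)) |a. True}" if q: "q \<in> U" for q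
  proof -
    have qU3: "q \<in> U3" "q \<in> U2" using q U by auto
    have "V q = {\<Sum>i<N. fscale F (a i) (f q i) |a. True}" using vb_frame'(2)[OF Vb f(1) qU3(1)] by (simp add: induced_simps)
    moreover have "(\<Sum>i<N. fscale F (a i) (f q i)) = (\<Sum>i<N. fscale F (a i) (\<sigma> q (w i q)))" for a using w(2) qU3 by (intro sum.cong) auto
    ultimately show ?thesis by simp
  qed
  have indep: "lin_indep (mscale F) N (\<lambda>i. w i p0)"
  proof -
    have "lin_indep (fscale F) N (f p0)" using vb_frame'(1)[OF Vb f] by (simp add: induced_simps)
    moreover have "(\<Sum>i<N. fscale F (a i) (f p0 i)) = (\<Sum>i<N. fscale F (a i) (\<sigma> p0 (w i p0)))" for a
      using w(2) f(2) d(2) by (intro sum.cong) auto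
    ultimately have "lin_indep (fscale F) N (\<lambda>i. \<sigma> p0 (w i p0))" unfolding lin_indep_def by simp
    thus ?thesis using chart_lin_indep[OF F d] by blast
  qed
  have surj: "\<exists>x a. A p0 x + (\<Sum>i<N. mscale F (a i) (w i p0)) = v" for v
  proof -
    have "\<exists>u\<in>fibre E p0. \<exists>a. z = L p0 u + (\<Sum>i<N. fscale F (a i) (\<sigma> p0 (w i p0)))" if "z \<in> fibre F p0" for z
      using transversal_subbundleD(4)[OF V p0 that] unfolding Vq[OF U(2)] by blast
    thus ?thesis using local_transversal[OF E F c d W(6)[OF W(2)] lin[OF U(2)], where w = "\<lambda>i. w i p0" and N = N] by blast
  qed
  have cA: "conton X U A" by (rule conton_subset[OF W(5) U(3)])
  have kA: "klin (mscale E) (mscale F) (A q)" if q: "q \<in> U" for q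
    by (rule local_klin[OF E F c(1) _ d(1) _ W(6) lin[OF q]]) (use q U in auto)
  have cw: "conton X U (w i)" if "i < N" for i by (rule conton_subset[OF w(1)[OF that]]) (use U in auto)
  have kerA: "fin_dim (mscale E) {x. A p0 x = 0}" by (rule local_kernel[OF E F c d W(6)[OF W(2)] lin[OF U(2)] ker])
  show thesis
  proof (rule bordered_local_fredholm[OF ks kt U(1,2) cA kA cw kerA surj indep])
    fix d' \<phi> Q R e \<alpha> \<beta>
    assume *: "openin X Q" "p0 \<in> Q" "Q \<subseteq> U" "!!j. j < d' ==> klin (mscale E) (*) (\<phi> j :: 'm \<Rightarrow>\<^sub>L 'k)"
      "conton X Q R" "!!j. conton X Q (e j)" "!!i. conton X Q (\<alpha> i :: 'b => 'n \<Rightarrow>\<^sub>L 'k)"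
      "!!y. y \<in> Q ==> bordered_solution (mscale E) (mscale F) N d' (A y) (\<lambda>i. w i y) (\<lambda>j. blinfun_apply (\<phi> j))
         (blinfun_apply (R y)) (\<lambda>j. e j y) (\<lambda>i. blinfun_apply (\<alpha> i y)) (\<beta> y)"
    have Q: "Q \<subseteq> U1" "Q \<subseteq> U2" "Q \<subseteq> W" using *(3) U by auto
    have lt: "loc (\<tau> q) (\<tau> q x) = x" and ls: "loc (\<sigma> q) (\<sigma> q y) = y" if "q \<in> Q" for q x y
      using loc_chart[OF E c(1), of q] loc_chart[OF F d(1), of q] that Q by auto
    have ts: "\<exists>x. u = \<tau> q x" if "q \<in> Q" "u \<in> fibre E q" for q u using that Q(1) by (auto elim: chart_surj[OF E c(1), rotated])
    have ss: "\<exists>x. u = \<sigma> q x" if "q \<in> Q" "u \<in> fibre F q" for q u using that Q(2) by (auto elim: chart_surj[OF F d(1), rotated])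
    note ca = chart_add[OF E c(1), symmetric] chart_scale[OF E c(1), symmetric]
      chart_add[OF F d(1), symmetric] chart_scale[OF F d(1), symmetric]
    show thesis
    proof (rule that[of Q d' "\<lambda>p j. \<tau> p (e j p)" "\<lambda>j p u. \<phi> j (loc (\<tau> p) u)" "\<lambda>p z. \<tau> p (R p (loc (\<sigma> p) z))", OF *(1,2)], unfold par_loc_def, intro conjI allI impI ballI)
      show "continuous_section X E Q (\<lambda>p. \<tau> p (e j p))" for j by (rule csec_chart[OF E c(1) *(1) Q(1) *(6) refl])
      show "is_basis (fscale E) (index_space E L V p) d' (\<lambda>j. \<tau> p (e j p))" if p: "p \<in> Q" for p
      proof -
        have pp: "p \<in> U" "p \<in> U1" "p \<in> U2" "p \<in> W" using p *(3) Q by auto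
        have "index_space E L V p = {u \<in> fibre E p. \<exists>a. L p u = (\<Sum>i<N. fscale F (a i) (\<sigma> p (w i p)))}"
          unfolding index_space_def Vq[OF pp(1)] by blast
        also have "\<dots> = \<tau> p ` {x. \<exists>a. A p x = (\<Sum>i<N. mscale F (a i) (w i p))}"
          by (rule local_preimage[OF E F c(1) pp(2) d(1) pp(3) W(6)[OF pp(4)] lin[OF pp(1)]])
        finally have eq: "index_space E L V p = \<tau> p ` {x. \<exists>a. A p x = (\<Sum>i<N. mscale F (a i) (w i p))}" .
        show ?thesis unfolding eq by (rule iffD2[OF chart_is_basis[OF E c(1) pp(2)] bordered_kernel_frame[OF ks kt *(8)[OF p]]])
      qed
      show "functional_on X E Q (\<lambda>p u. \<phi> j (loc (\<tau> p) u))" for j unfolding functional_on_def using Q(1) c(1) lt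
        by (intro exI[of _ U1] exI[of _ \<tau>] exI[of _ "\<lambda>_. \<phi> j"]) (auto simp: conton_const)
      show "linear_between (fscale E) (*) (fibre E p) UNIV (\<lambda>u. \<phi> j (loc (\<tau> p) u))" if jd: "j < d'" and p: "p \<in> Q" for j p
        unfolding linear_between_def
      proof (intro conjI ballI allI UNIV_I)
        have p1: "p \<in> U1" using p Q(1) by blast
        fix u assume "u \<in> fibre E p"
        then obtain x where x: "u = \<tau> p x" using ts[OF p] by blast
        show "\<phi> j (loc (\<tau> p) (fscale E a u)) = a * \<phi> j (loc (\<tau> p) u)" for a using *(4)[OF jd] p1 by (simp add: x ca lt[OF p] klin_def)
        fix v assume "v \<in> fibre E p"
        then obtain y where y: "v = \<tau> p y" using ts[OF p] by blast
        show "\<phi> j (loc (\<tau> p) (u + v)) = \<phi> j (loc (\<tau> p) u) + \<phi> j (loc (\<tau> p) v)"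
          using p1 by (simp add: x y ca lt[OF p] blinfun.add_right)
      qed
      show "\<phi> i (loc (\<tau> p) (\<tau> p (e j p))) = (if i = j then 1 else 0)" if "i < d'" "j < d'" "p \<in> Q" for i j p
        using bordered_dual[OF ks kt *(8)[OF that(3)] that(1,2)] by (simp add: lt[OF that(3)])
      show "nmor_on X F E Q (\<lambda>p z. \<tau> p (R p (loc (\<sigma> p) z)))" by (rule nmor_onI'[OF *(1) d(1) c(1) Q(2) Q(1) *(5)]) (simp add: ls)
      show "fibre_linear F E p (\<lambda>z. \<tau> p (R p (loc (\<sigma> p) z)))" if p: "p \<in> Q" for p
      proof -
        have pp: "p \<in> U1" "p \<in> U2" "p \<in> U" using p Q *(3) by auto
        have kR: "klin (mscale F) (mscale E) (R p)" by (rule bordered_klin(1)[OF ks kt *(8)[OF p] kA[OF pp(3)] refl *(4)])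
        show ?thesis unfolding linear_between_def
        proof (intro conjI ballI allI)
          fix u assume "u \<in> fibre F p"
          then obtain x where x: "u = \<sigma> p x" using ss[OF p] by blast
          show "\<tau> p (R p (loc (\<sigma> p) u)) \<in> fibre E p" by (rule chart_mem[OF E c(1) pp(1)])
          show "\<tau> p (R p (loc (\<sigma> p) (fscale F a u))) = fscale E a (\<tau> p (R p (loc (\<sigma> p) u)))" for a
            using kR pp by (simp add: x ca ls[OF p] klin_def)
          fix v assume "v \<in> fibre F p"
          then obtain y where y: "v = \<sigma> p y" using ss[OF p] by blast
          show "\<tau> p (R p (loc (\<sigma> p) (u + v))) = \<tau> p (R p (loc (\<sigma> p) u)) + \<tau> p (R p (loc (\<sigma> p) v))"
            using pp by (simp add: x y ca ls[OF p] blinfun.add_right)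
        qed
      qed
      show "L p (\<tau> p (R p (loc (\<sigma> p) z))) - z \<in> V p" if p: "p \<in> Q" and z: "z \<in> fibre F p" for p z
      proof -
        have pp: "p \<in> U1" "p \<in> U2" "p \<in> U" "p \<in> W" using p Q *(3) by auto
        obtain y where y: "z = \<sigma> p y" using ss[OF p z] by blast
        have "A p (R p y) + (\<Sum>i<N. mscale F (\<alpha> i p y) (w i p)) = y" by (rule bordered_parametrix[OF ks kt *(8)[OF p]])
        hence eq: "\<sigma> p y = \<sigma> p (A p (R p y)) + (\<Sum>i<N. fscale F (\<alpha> i p y) (\<sigma> p (w i p)))"
          by (metis chart_add[OF F d(1) pp(2)] chart_comb[OF F d(1) pp(2)])
        have "L p (\<tau> p (R p (loc (\<sigma> p) z))) = \<sigma> p (A p (R p y))" using W(6)[OF pp(4)] by (simp add: y ls[OF p])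
        hence "L p (\<tau> p (R p (loc (\<sigma> p) z))) - z = \<sigma> p (A p (R p y)) - \<sigma> p y" by (simp add: y)
        also have "\<dots> = (\<Sum>i<N. fscale F (- \<alpha> i p y) (\<sigma> p (w i p)))" by (subst eq) (simp add: sum_negf)
        finally have "L p (\<tau> p (R p (loc (\<sigma> p) z))) - z = (\<Sum>i<N. fscale F (- \<alpha> i p y) (\<sigma> p (w i p)))" .
        thus ?thesis unfolding Vq[OF pp(3)] by (rule lin_comb_memI)
      qed
    qed
  qed
qed

section \<open>Parametrices and the index bundle\<close>

lemma linear_betweenD:
  assumes "linear_between s t A B f"
  shows "u \<in> A ==> f u \<in> B" "u \<in> A ==> v \<in> A ==> f (u + v) = f u + f v" "u \<in> A ==> f (s c u) = t c (f u)"
  using assms unfolding linear_between_def by blast+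

lemma linear_between_diff:
  assumes f: "linear_between s t A B f" and A: "module.subspace s A" and s: "vector_space s" and t: "vector_space t"
    and u: "u \<in> A" "v \<in> A"
  shows "f (u - v) = f u - f v"
proof -
  interpret s: vector_space s by fact
  interpret t: vector_space t by fact
  have "u - v \<in> A" by (rule s.subspace_diff[OF A u])
  from linear_betweenD(2)[OF f this u(2)] show ?thesis by simp
qed

abbreviation index_vbundle where "index_vbundle X E L V \<equiv> induced_vbundle X E (index_space E L V)"

text \<open>Again \<open>c i = 0\<close> covers summands that may leave the subspace where their
  weight vanishes.\<close>

lemma linear_between_comb':
  assumes s: "vector_space s" and t: "vector_space t" and V: "module.subspace s V"
    and T: "linear_between s t V W T" and e: "!!i. i < n ==> c i = 0 \<or> e i \<in> V"
  shows "T (\<Sum>i<(n::nat). s (c i) (e i)) = (\<Sum>i<n. t (c i) (T (e i)))" and "(\<Sum>i<n. s (c i) (e i)) \<in> V"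
proof -
  interpret s: vector_space s by fact
  interpret t: vector_space t by fact
  define e' where "e' i = (if e i \<in> V then e i else 0)" for i
  have e': "e' i \<in> V" for i using s.subspace_0[OF V] by (simp add: e'_def)
  have eq: "(\<Sum>i<n. s (c i) (e i)) = (\<Sum>i<n. s (c i) (e' i))" using e by (intro sum.cong) (auto simp: e'_def)
  have "T (\<Sum>i<n. s (c i) (e' i)) = (\<Sum>i<n. t (c i) (T (e' i)))" by (rule linear_between_comb[OF s t V T e'])
  also have "\<dots> = (\<Sum>i<n. t (c i) (T (e i)))" using e by (intro sum.cong) (auto simp: e'_def)
  finally show "T (\<Sum>i<n. s (c i) (e i)) = (\<Sum>i<n. t (c i) (T (e i)))" unfolding eq .
  show "(\<Sum>i<n. s (c i) (e i)) \<in> V" unfolding eq by (intro s.subspace_sum[OF V] s.subspace_scale[OF V] e')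
qed

lemma nmor_on_cong:
  assumes E: "banach_bundle X E" and L: "nmor_on X E F U L" and eq: "!!p u. p \<in> topspace X ==> u \<in> fibre E p ==> L' p u = L p u"
  shows "nmor_on X E F U L'"
proof (rule nmor_onI)
  fix p assume p: "p \<in> U"
  obtain W U1 \<tau> U2 \<sigma> A where *: "openin X W" "p \<in> W" "(U1, \<tau>) \<in> charts E" "(U2, \<sigma>) \<in> charts F"
    "W \<subseteq> U1" "W \<subseteq> U2" "conton X W A" "\<forall>q\<in>W. \<forall>x. L q (\<tau> q x) = \<sigma> q (blinfun_apply (A q) x)"
    using bspec[OF L[unfolded nmor_on_def] p] by (elim exE conjE)
  have "L' q (\<tau> q x) = L q (\<tau> q x)" if "q \<in> W" for q x
  proof (rule eq)
    have "q \<in> U1" using that *(5) by blast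
    thus "q \<in> topspace X" "\<tau> q x \<in> fibre E q" by (rule chart_topspace[OF E *(3)], rule chart_mem[OF E *(3)])
  qed
  thus "nmor_at X E F L' p" using * by (intro exI[of _ W] exI[of _ U1] exI[of _ \<tau>] exI[of _ U2] exI[of _ \<sigma>] exI[of _ A]) auto
qed

context
  fixes X :: "'b topology"
    and E :: "('b, 'k :: {real_normed_field, euclidean_space}, 'v :: ab_group_add, 'm :: banach) bbundle"
    and F :: "('b, 'k, 'w :: ab_group_add, 'n :: banach) bbundle"
    and L :: "'b => 'v => 'w"
  assumes X: "compact_space X" "Hausdorff_space X"
    and E: "banach_bundle X E" and F: "banach_bundle X F" and L: "bundle_morphism X E F L"
    and ker: "!!p. p \<in> topspace X ==> fin_dim (fscale E) {u \<in> fibre E p. L p u = 0}"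
begin

interpretation e: vector_space "fscale E" by (rule bb_vs[OF E])
interpretation f: vector_space "fscale F" by (rule bb_vs[OF F])

lemma par_loc_ex:
  assumes V: "transversal_subbundle X E F L V" and p: "p \<in> topspace X"
  shows "\<exists>Q. openin X Q \<and> p \<in> Q \<and> (\<exists>d e \<phi> R. par_loc X E F L V Q d e \<phi> R)" by (rule parametrix_local[OF E F L V p ker[OF p]]) blast

lemma index_subbundle:
  assumes V: "transversal_subbundle X E F L V"
  shows "fin_dim_subbundle X E (index_space E L V)"
proof (rule fin_dim_subbundleI[OF E])
  fix p assume p: "p \<in> topspace X"
  obtain Q d e \<phi> R where "openin X Q" "p \<in> Q" "par_loc X E F L V Q d e \<phi> R" using par_loc_ex[OF V p] by blast
  thus "\<exists>U n e. p \<in> U \<and> openin X U \<and> (\<forall>i<n. continuous_section X E U (\<lambda>p. e p i)) \<and>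
      (\<forall>p\<in>U. is_basis (fscale E) (index_space E L V p) n (e p))"
    unfolding par_loc_def by (intro exI[of _ Q] exI[of _ d] exI[of _ e]) blast
qed

lemma parametrix_partition:
  assumes V: "transversal_subbundle X E F L V"
  obtains n :: nat and U K and \<rho> :: "nat => 'b => real" and d e \<phi> R where
    "!!i. i < n ==> openin X (U i)" "!!i. i < n ==> par_loc X E F L V (U i) (d i) (e i) (\<phi> i) (R i)" "!!i. i < n ==> closedin X (K i)"
    "!!i. i < n ==> K i \<subseteq> U i" "!!i. i < n ==> conton X (topspace X) (\<lambda>p. of_real (\<rho> i p) :: 'k)"
    "!!i p. i < n ==> p \<in> topspace X - K i ==> of_real (\<rho> i p) = (0 :: 'k)" "!!p. p \<in> topspace X ==> (\<Sum>i<n. of_real (\<rho> i p) :: 'k) = 1"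
proof -
  define good where "good U \<longleftrightarrow> (\<exists>d e \<phi> R. par_loc X E F L V U d e \<phi> R)" for U
  obtain n :: nat and U K and \<rho> :: "nat => 'b => real" where *:
    "!!i. i < n ==> openin X (U i)" "!!i. i < n ==> good (U i)" "!!i. i < n ==> closedin X (K i)"
    "!!i. i < n ==> K i \<subseteq> U i" "!!i. i < n ==> conton X (topspace X) (\<rho> i)"
    "!!i p. i < n ==> p \<in> topspace X - K i ==> \<rho> i p = 0" "!!p. p \<in> topspace X ==> (\<Sum>i<n. \<rho> i p) = 1"
    by (rule partition_of_unity[OF X, of good], rule par_loc_ex[OF V, folded good_def], assumption, rule that)
  from *(2) obtain d e \<phi> R where p: "!!i. i < n ==> par_loc X E F L V (U i) (d i) (e i) (\<phi> i) (R i)" unfolding good_def by metis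
  have "(\<Sum>i<n. of_real (\<rho> i p) :: 'k) = 1" if "p \<in> topspace X" for p using *(7)[OF that] by (simp flip: of_real_sum)
  moreover have "conton X (topspace X) (\<lambda>p. of_real (\<rho> i p) :: 'k)" if "i < n" for i by (rule conton_of_real[OF *(5)[OF that]])
  ultimately show ?thesis using * p by (intro that[of n U d e \<phi> R K \<rho>]) simp_all
qed

lemma L_linear: "p \<in> topspace X ==> fibre_linear E F p (L p)" by (rule bundle_morphismD(2)[OF E F L])

text \<open>The condition that \<open>L p (R p z) - z\<close> lies in \<open>V p\<close> is affine
  in \<open>R p\<close>, so local solutions can be averaged with weights of sum one.\<close>

lemma parametrix:
  assumes V: "transversal_subbundle X E F L V"
  obtains R where "bundle_morphism X F E R" "!!p z. p \<in> topspace X ==> z \<in> fibre F p ==> L p (R p z) - z \<in> V p"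
proof (rule parametrix_partition[OF V])
  fix n :: nat and U K and \<rho> :: "nat => 'b => real" and d e \<phi> R
  assume U: "!!i. i < n ==> openin X (U i)" and P: "!!i. i < n ==> par_loc X E F L V (U i) (d i) (e i) (\<phi> i) (R i)"
    and K: "!!i. i < n ==> closedin X (K i)"
    "!!i. i < n ==> K i \<subseteq> U i" and \<rho>: "!!i. i < n ==> conton X (topspace X) (\<lambda>p. of_real (\<rho> i p) :: 'k)"
    "!!i p. i < n ==> p \<in> topspace X - K i ==> of_real (\<rho> i p) = (0 :: 'k)" "!!p. p \<in> topspace X ==> (\<Sum>i<n. of_real (\<rho> i p) :: 'k) = 1"
  have nR: "nmor_on X F E (U i) (R i)" if "i < n" for i using P[OF that] unfolding par_loc_def by blast
  have lR: "of_real (\<rho> i p) = (0::'k) \<or> fibre_linear F E p (R i p)"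
    and vR: "of_real (\<rho> i p) = (0::'k) \<or> (\<forall>z\<in>fibre F p. L p (R i p z) - z \<in> V p)"
    if "i < n" "p \<in> topspace X" for i p
  proof -
    have "p \<in> U i \<or> of_real (\<rho> i p) = (0::'k)" using K(2)[OF that(1)] \<rho>(2)[OF that(1)] that(2) by blast
    thus "of_real (\<rho> i p) = (0::'k) \<or> fibre_linear F E p (R i p)" "of_real (\<rho> i p) = (0::'k) \<or> (\<forall>z\<in>fibre F p. L p (R i p z) - z \<in> V p)"
      using P[OF that(1)] unfolding par_loc_def by blast+
  qed
  define S where "S p z = (\<Sum>i<n. fscale E (of_real (\<rho> i p)) (R i p z))" for p z
  have "bundle_morphism X F E S"
  proof (rule bundle_morphismI[OF F E])
    have "nmor_on X F E (topspace X) (\<lambda>p z. \<Sum>i<n. fscale E 1 (fscale E (of_real (\<rho> i p)) (R i p z)))"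
      using nmor_bump[OF F E U nR \<rho>(1) K \<rho>(2)] by (intro nmor_comb[OF F E openin_topspace]) (auto simp: conton_const)
    thus "nmor_on X F E (topspace X) S" by (simp add: S_def[abs_def])
    show "fibre_linear F E p (S p)" if "p \<in> topspace X" for p unfolding S_def[abs_def] using lR that
      by (intro linear_between_sum[OF e.vector_space_axioms bb_subspace[OF E]]) auto
  qed
  moreover have "L p (S p z) - z \<in> V p" if p: "p \<in> topspace X" and z: "z \<in> fibre F p" for p z
  proof -
    have sV: "f.subspace (V p)" using vb_subspace[OF transversal_subbundleD(2)[OF V] p] by (simp add: induced_simps)
    have "of_real (\<rho> i p) = (0::'k) \<or> R i p z \<in> fibre E p" if "i < n" for i using lR[OF that p] z unfolding linear_between_def by blast
    hence "L p (S p z) = (\<Sum>i<n. fscale F (of_real (\<rho> i p)) (L p (R i p z)))" unfolding S_def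
      by (rule linear_between_comb'(1)[OF e.vector_space_axioms f.vector_space_axioms bb_subspace[OF E p] L_linear[OF p]])
    \<comment> \<open>As the weights add up to one, \<open>z\<close> can be distributed over the
      summands.\<close>
    hence "L p (S p z) - z = (\<Sum>i<n. fscale F (of_real (\<rho> i p)) (L p (R i p z))) - fscale F (\<Sum>i<n. of_real (\<rho> i p)) z"
      using \<rho>(3)[OF p] by simp
    also have "\<dots> = (\<Sum>i<n. fscale F (of_real (\<rho> i p)) (L p (R i p z) - z))"
      unfolding f.scale_sum_left f.scale_right_diff_distrib sum_subtractf ..
    also have "\<dots> \<in> V p"
    proof (rule f.subspace_sum[OF sV])
      fix i assume "i \<in> {..<n}"
      hence "of_real (\<rho> i p) = (0::'k) \<or> L p (R i p z) - z \<in> V p" using vR[of i p] p z by blast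
      thus "fscale F (of_real (\<rho> i p)) (L p (R i p z) - z) \<in> V p" using f.subspace_scale[OF sV] f.subspace_0[OF sV] by auto
    qed
    finally show ?thesis .
  qed
  ultimately show thesis by (rule that)
qed

text \<open>An average of projections onto one subspace is again a projection onto it. The last
  clause serves maps \<open>J\<close> whose continuity is known only on the index bundle: composed
  with \<open>P\<close> they become morphisms on all of \<open>E\<close>.\<close>

lemma index_projection:
  assumes V: "transversal_subbundle X E F L V"
  obtains P where "bundle_morphism X E E P" "!!p u. p \<in> topspace X ==> u \<in> fibre E p ==> P p u \<in> index_space E L V p"
    "!!p u. p \<in> topspace X ==> u \<in> index_space E L V p ==> P p u = u"
    "!!J. (!!p. p \<in> topspace X ==> linear_between (fscale E) (fscale F) (index_space E L V p) (fibre F p) (J p)) ==>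
      (!!Q s. openin X Q ==> continuous_section X E Q s ==> (!!p. p \<in> Q ==> s p \<in> index_space E L V p) ==>
        continuous_section X F Q (\<lambda>p. J p (s p))) ==> bundle_morphism X E F (\<lambda>p u. J p (P p u))"
proof (rule parametrix_partition[OF V])
  let ?I = "index_space E L V"
  have Ib: "vector_bundle X (induced_vbundle X E ?I)" and Isub: "!!p. p \<in> topspace X ==> ?I p \<subseteq> fibre E p"
    using index_subbundle[OF V] by (auto simp: fin_dim_subbundle_def)
  have sI: "e.subspace (?I p)" if "p \<in> topspace X" for p using vb_subspace[OF Ib that] by (simp add: induced_simps)
  fix n :: nat and U K and \<rho> :: "nat => 'b => real" and d e \<phi> R
  assume U: "!!i. i < n ==> openin X (U i)" and PL: "!!i. i < n ==> par_loc X E F L V (U i) (d i) (e i) (\<phi> i) (R i)"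
    and K: "!!i. i < n ==> closedin X (K i)"
    "!!i. i < n ==> K i \<subseteq> U i" and \<rho>: "!!i. i < n ==> conton X (topspace X) (\<lambda>p. of_real (\<rho> i p) :: 'k)"
    "!!i p. i < n ==> p \<in> topspace X - K i ==> of_real (\<rho> i p) = (0 :: 'k)" "!!p. p \<in> topspace X ==> (\<Sum>i<n. of_real (\<rho> i p) :: 'k) = 1"
  have es: "continuous_section X E (U i) (\<lambda>p. e i p j)" and \<phi>f: "functional_on X E (U i) (\<phi> i j)" if "i < n" "j < d i" for i j
    using PL[OF that(1)] that(2) unfolding par_loc_def by blast+
  have eb: "is_basis (fscale E) (?I p) (d i) (e i p)" if "i < n" "p \<in> U i" for i p
    using PL[OF that(1)] that(2) unfolding par_loc_def by blast
  have \<phi>l: "linear_between (fscale E) (*) (fibre E p) UNIV (\<phi> i j p)" if "i < n" "j < d i" "p \<in> U i" for i j p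
    using PL[OF that(1)] that(2,3) unfolding par_loc_def by blast
  have \<phi>e: "\<phi> i j p (e i p k) = (if j = k then 1 else 0)" if "i < n" "j < d i" "k < d i" "p \<in> U i" for i j k p
    using PL[OF that(1)] that(2-4) unfolding par_loc_def by blast
  have UK: "of_real (\<rho> i p) = (0::'k) \<or> p \<in> U i" if "i < n" "p \<in> topspace X" for i p
    using K(2)[OF that(1)] \<rho>(2)[OF that(1)] that(2) by blast
  have eI: "e i p j \<in> ?I p" if "i < n" "j < d i" "p \<in> U i" for i j p
    using eb[OF that(1,3)] that(2) unfolding is_basis_def by (auto intro: e.span_base)
  define Q where "Q i p u = (\<Sum>j<d i. fscale E (\<phi> i j p u) (e i p j))" for i p u
  have QI: "Q i p u \<in> ?I p" if "i < n" "p \<in> U i" for i p u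
  proof -
    have "p \<in> topspace X" using openin_subset[OF U[OF that(1)]] that(2) by blast
    thus ?thesis unfolding Q_def by (intro e.subspace_sum[OF sI] e.subspace_scale[OF sI] eI that) auto
  qed
  have Qlin: "linear_between (fscale E) (fscale E) (fibre E p) (?I p) (Q i p)" if "i < n" "p \<in> U i" for i p
    unfolding linear_between_def
  proof (intro conjI ballI allI)
    show "Q i p u \<in> ?I p" for u by (rule QI[OF that])
    fix u assume u: "u \<in> fibre E p"
    show "Q i p (fscale E c u) = fscale E c (Q i p u)" for c
      using \<phi>l[OF that(1) _ that(2)] u unfolding Q_def linear_between_def by (simp add: e.scale_sum_right)
    fix v assume v: "v \<in> fibre E p"
    show "Q i p (u + v) = Q i p u + Q i p v" using \<phi>l[OF that(1) _ that(2)] u v unfolding Q_def linear_between_def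
      by (simp add: e.scale_left_distrib sum.distrib)
  qed
  have Qid: "Q i p u = u" if ip: "i < n" "p \<in> U i" and u: "u \<in> ?I p" for i p u
  proof -
    have pX: "p \<in> topspace X" using openin_subset[OF U[OF ip(1)]] ip(2) by blast
    obtain c where c: "u = (\<Sum>j<d i. fscale E (c j) (e i p j))" using u eb[OF ip] unfolding e.is_basis_iff by auto
    have "\<phi> i j p u = c j" if j: "j < d i" for j
    proof -
      have "\<phi> i j p u = (\<Sum>k<d i. c k * \<phi> i j p (e i p k))" unfolding c using eI[OF \<open>i < n\<close> _ \<open>p \<in> U i\<close>] Isub[OF pX]
        by (intro linear_between_comb[OF e.vector_space_axioms _ bb_subspace[OF E pX] \<phi>l[OF \<open>i < n\<close> j \<open>p \<in> U i\<close>]])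
          (auto intro!: vector_space.intro simp: algebra_simps)
      also have "\<dots> = (\<Sum>k<d i. if k = j then c k else 0)" using \<phi>e[OF \<open>i < n\<close> j _ \<open>p \<in> U i\<close>] by (intro sum.cong) auto
      finally show ?thesis using j by simp
    qed
    thus ?thesis unfolding Q_def by (subst (2) c) simp
  qed
  define P where "P p u = (\<Sum>i<n. fscale E (of_real (\<rho> i p)) (Q i p u))" for p u
  have Plin: "linear_between (fscale E) (fscale E) (fibre E p) (?I p) (P p)" if "p \<in> topspace X" for p
    unfolding P_def[abs_def] using UK[OF _ that] Qlin by (intro linear_between_sum[OF e.vector_space_axioms sI[OF that]]) blast
  \<comment> \<open>\<open>J\<close> after \<open>P\<close> is a weighted sum of rank one maps with
    functional \<open>\<phi> i j\<close> and vector \<open>J p (e i p j)\<close>, so continuity of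
    \<open>J\<close> on frame sections is enough. The target \<open>G\<close> is arbitrary because
    \<open>E\<close> with the identity gives \<open>P\<close> itself.\<close>
  have gen: "nmor_on X E G (topspace X) (\<lambda>p u. J p (P p u))"
    if G: "banach_bundle X G"
    and Jl: "!!p. p \<in> topspace X ==> linear_between (fscale E) (fscale G) (?I p) (fibre G p) (J p)"
    and Js: "!!Q s. openin X Q ==> continuous_section X E Q s ==> (!!p. p \<in> Q ==> s p \<in> ?I p) ==>
        continuous_section X G Q (\<lambda>p. J p (s p))"
    for J and G :: "('b, 'k, 'x :: ab_group_add, 'y :: banach) bbundle"
  proof (rule nmor_on_cong[OF E])
    interpret g: vector_space "fscale G" by (rule bb_vs[OF G])
    have "nmor_on X E G (U i) (\<lambda>p u. \<Sum>j<d i. fscale G 1 (fscale G (\<phi> i j p u) (J p (e i p j))))" if i: "i < n" for i using eI[OF i]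
      by (intro nmor_comb[OF E G U[OF i]] nmor_rank_one[OF E G U[OF i] \<phi>f[OF i]] Js[OF U[OF i] es[OF i]]) (auto simp: conton_const)
    hence "nmor_on X E G (topspace X) (\<lambda>p u. fscale G (of_real (\<rho> i p)) (\<Sum>j<d i. fscale G 1 (fscale G (\<phi> i j p u) (J p (e i p j)))))"
      if i: "i < n" for i using i by (intro nmor_bump[OF E G U[OF i] _ \<rho>(1)[OF i] K[OF i] \<rho>(2)[OF i]]) auto
    thus "nmor_on X E G (topspace X) (\<lambda>p u. \<Sum>i<n. fscale G 1 (fscale G (of_real (\<rho> i p))
        (\<Sum>j<d i. fscale G 1 (fscale G (\<phi> i j p u) (J p (e i p j))))))"
      by (intro nmor_comb[OF E G openin_topspace]) (auto simp: conton_const)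
    fix p u assume p: "p \<in> topspace X" and u: "u \<in> fibre E p"
    have "J p (P p u) = (\<Sum>i<n. fscale G (of_real (\<rho> i p)) (J p (Q i p u)))" unfolding P_def using UK[OF _ p] QI
      by (intro linear_between_comb'(1)[OF e.vector_space_axioms g.vector_space_axioms sI[OF p] Jl[OF p]]) blast
    also have "\<dots> = (\<Sum>i<n. fscale G (of_real (\<rho> i p)) (\<Sum>j<d i. fscale G (\<phi> i j p u) (J p (e i p j))))"
    proof (intro sum.cong refl)
      fix i assume i: "i \<in> {..<n}"
      show "fscale G (of_real (\<rho> i p)) (J p (Q i p u)) = fscale G (of_real (\<rho> i p)) (\<Sum>j<d i. fscale G (\<phi> i j p u) (J p (e i p j)))"
      proof (cases "p \<in> U i")
        case True
        have "J p (Q i p u) = (\<Sum>j<d i. fscale G (\<phi> i j p u) (J p (e i p j)))" unfolding Q_def using i True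
          by (intro linear_between_comb[OF e.vector_space_axioms g.vector_space_axioms sI[OF p] Jl[OF p]] eI) auto
        thus ?thesis by simp
      next
        case False thus ?thesis using UK[OF _ p, of i] i by auto
      qed
    qed
    finally show "J p (P p u) = (\<Sum>i<n. fscale G 1 (fscale G (of_real (\<rho> i p))
        (\<Sum>j<d i. fscale G 1 (fscale G (\<phi> i j p u) (J p (e i p j))))))" by simp
  qed
  show thesis
  proof (rule that[of P])
    have id: "linear_between (fscale E) (fscale E) (?I p) (fibre E p) (\<lambda>u. u)" if "p \<in> topspace X" for p
      using Isub[OF that] unfolding linear_between_def by blast
    show "bundle_morphism X E E P"
    proof (rule bundle_morphismI[OF E E])
      show "nmor_on X E E (topspace X) P" by (rule gen[OF E id])
      fix p assume p: "p \<in> topspace X"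
      show "fibre_linear E E p (P p)" using linear_between_compose[OF Plin[OF p] id[OF p]] .
    qed
    show "P p u \<in> ?I p" if "p \<in> topspace X" "u \<in> fibre E p" for p u
      using Plin[OF that(1)] that(2) unfolding linear_between_def by blast
    show "P p u = u" if p: "p \<in> topspace X" and u: "u \<in> ?I p" for p u
    proof -
      have "fscale E (of_real (\<rho> i p)) (Q i p u) = fscale E (of_real (\<rho> i p)) u" if "i < n" for i
        using UK[OF that p] Qid[OF that _ u] by auto
      hence "P p u = (\<Sum>i<n. fscale E (of_real (\<rho> i p)) u)" unfolding P_def by (intro sum.cong refl) (simp only: lessThan_iff)
      also have "\<dots> = fscale E (\<Sum>i<n. of_real (\<rho> i p)) u" by (simp add: e.scale_sum_left)
      finally show ?thesis using \<rho>(3)[OF p] by simp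
    qed
    fix J
    assume J: "!!p. p \<in> topspace X ==> linear_between (fscale E) (fscale F) (?I p) (fibre F p) (J p)"
      "!!Q s. openin X Q ==> continuous_section X E Q s ==> (!!p. p \<in> Q ==> s p \<in> ?I p) ==>
        continuous_section X F Q (\<lambda>p. J p (s p))"
    show "bundle_morphism X E F (\<lambda>p u. J p (P p u))"
    proof (rule bundle_morphismI[OF E F])
      show "nmor_on X E F (topspace X) (\<lambda>p u. J p (P p u))" by (rule gen[OF F J])
      fix p assume p: "p \<in> topspace X"
      show "fibre_linear E F p (\<lambda>u. J p (P p u))" by (rule linear_between_compose[OF Plin[OF p] J(1)[OF p]])
    qed
  qed
qed

section \<open>Comparison of two transversal subbundles\<close>

lemma transversal_facts:
  assumes "transversal_subbundle X E F L V"
  shows "fin_dim_subbundle X E (index_space E L V)" "vector_bundle X (index_vbundle X E L V)"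
    "vector_bundle X (induced_vbundle X F V)" "fin_dim_subbundle X F V"
    "p \<in> topspace X ==> f.subspace (V p)" "p \<in> topspace X ==> e.subspace (index_space E L V p)" "p \<in> topspace X ==> V p \<subseteq> fibre F p"
proof -
  show 1: "fin_dim_subbundle X E (index_space E L V)" by (rule index_subbundle[OF assms])
  thus 2: "vector_bundle X (index_vbundle X E L V)" by (simp add: fin_dim_subbundle_def)
  show 3: "vector_bundle X (induced_vbundle X F V)" "fin_dim_subbundle X F V" by (rule transversal_subbundleD[OF assms])+
  show "p \<in> topspace X ==> f.subspace (V p)" "p \<in> topspace X ==> e.subspace (index_space E L V p)"
    using vb_subspace[OF 3(1)] vb_subspace[OF 2] by (simp_all add: induced_simps)
  show "p \<in> topspace X ==> V p \<subseteq> fibre F p" by (rule transversal_subbundleD(3)[OF assms])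
qed

text \<open>With \<open>u' = u + R p y\<close>, the triple of \<open>u'\<close>,
  \<open>L p u' - y\<close> and \<open>y\<close> is the point of the common kernel described at
  \<open>index_independent\<close>. Subtracting \<open>R' p (L p u' - y)\<close> reads the same
  triple from the other side, so exchanging \<open>R\<close> and \<open>R'\<close> gives the
  inverse.\<close>

definition swap_map :: "('b => 'w => 'v) => ('b => 'w => 'v) => 'b => 'v \<times> 'w => 'v \<times> 'w" where
  "swap_map R R' p = (\<lambda>(u, y). (u + R p y - R' p (L p (u + R p y) - y), L p (u + R p y) - y))"

lemma swap_map_secmap:
  assumes A: "transversal_subbundle X E F L A" and B: "transversal_subbundle X E F L B"
    and R: "bundle_morphism X F E R" "!!p z. p \<in> topspace X ==> z \<in> fibre F p ==> L p (R p z) - z \<in> A p"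
    and R': "bundle_morphism X F E R'" "!!p z. p \<in> topspace X ==> z \<in> fibre F p ==> L p (R' p z) - z \<in> B p"
  shows "secmap X (index_vbundle X E L A \<oplus>\<^sub>V induced_vbundle X F B) (index_vbundle X E L B \<oplus>\<^sub>V induced_vbundle X F A) (swap_map R R')"
proof (rule secmap_sumI)
  note a = transversal_facts[OF A] and b = transversal_facts[OF B]
  note nL = bundle_morphismD[OF E F L] and nR = bundle_morphismD[OF F E R(1)] and nR' = bundle_morphismD[OF F E R'(1)]
  show "vector_bundle X (index_vbundle X E L B)" "vector_bundle X (induced_vbundle X F A)" by (rule b, rule a)
  have mem: "u \<in> fibre E p \<and> y \<in> fibre F p \<and> R p y \<in> fibre E p \<and> u + R p y \<in> fibre E p \<and> L p (u + R p y) - y \<in> A p \<and>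
      L p (u + R p y) - y \<in> fibre F p \<and> R' p (L p (u + R p y) - y) \<in> fibre E p \<and>
      u + R p y - R' p (L p (u + R p y) - y) \<in> index_space E L B p"
    if p: "p \<in> topspace X" and u: "u \<in> index_space E L A p" and y: "y \<in> B p" for p u y
  proof -
    have 1: "u \<in> fibre E p" "L p u \<in> A p" using u by (auto simp: index_space_def)
    have 2: "y \<in> fibre F p" using y b(7)[OF p] by blast
    have 3: "R p y \<in> fibre E p" by (rule linear_betweenD(1)[OF nR(2)[OF p] 2])
    have 4: "u + R p y \<in> fibre E p" by (rule e.subspace_add[OF bb_subspace[OF E p] 1(1) 3])
    have eq5: "L p (u + R p y) - y = L p u + (L p (R p y) - y)" using linear_betweenD(2)[OF nL(2)[OF p] 1(1) 3] by simp
    have 5: "L p (u + R p y) - y \<in> A p" unfolding eq5 by (rule f.subspace_add[OF a(5)[OF p] 1(2) R(2)[OF p 2]])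
    hence 6: "L p (u + R p y) - y \<in> fibre F p" using a(7)[OF p] by blast
    define v where "v = L p (u + R p y) - y"
    have 7: "R' p v \<in> fibre E p" unfolding v_def by (rule linear_betweenD(1)[OF nR'(2)[OF p] 6])
    have 8: "u + R p y - R' p v \<in> fibre E p" by (rule e.subspace_diff[OF bb_subspace[OF E p] 4 7])
    have "L p (u + R p y - R' p v) = L p (u + R p y) - L p (R' p v)"
      by (rule linear_between_diff[OF nL(2)[OF p] bb_subspace[OF E p] e.vector_space_axioms f.vector_space_axioms 4 7])
    also have "\<dots> = y - (L p (R' p v) - v)" by (simp add: v_def)
    also have "\<dots> \<in> B p" by (rule f.subspace_diff[OF b(5)[OF p] y R'(2)[OF p 6[folded v_def]]])
    finally have "u + R p y - R' p v \<in> index_space E L B p" using 8 by (simp add: index_space_def)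
    thus ?thesis using 1 2 3 4 5 6 7 by (simp add: v_def)
  qed
  {
    fix p assume p: "p \<in> topspace X"
    show "linear_between (vscale (index_vbundle X E L A \<oplus>\<^sub>V induced_vbundle X F B))
      (vscale (index_vbundle X E L B \<oplus>\<^sub>V induced_vbundle X F A)) (vfibre (index_vbundle X E L A \<oplus>\<^sub>V induced_vbundle X F B) p)
      (vfibre (index_vbundle X E L B \<oplus>\<^sub>V induced_vbundle X F A) p) (swap_map R R' p)"
      unfolding linear_between_def vfibre_sum induced_simps
    proof (intro conjI ballI allI)
      note l = linear_betweenD[OF nL(2)[OF p]] and r = linear_betweenD[OF nR(2)[OF p]] and r' = linear_betweenD[OF nR'(2)[OF p]]
      fix x assume "x \<in> index_space E L A p \<times> B p"
      then obtain u y where x: "x = (u, y)" "u \<in> index_space E L A p" "y \<in> B p" by blast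
      note m = mem[OF p x(2,3)]
      show "swap_map R R' p x \<in> index_space E L B p \<times> A p" using m by (simp add: x(1) swap_map_def)
      fix c
      have g: "fscale E c u + R p (fscale F c y) = fscale E c (u + R p y)" using r m by (simp add: e.scale_right_distrib)
      have h: "L p (fscale E c (u + R p y)) - fscale F c y = fscale F c (L p (u + R p y) - y)"
        using l(3)[of "u + R p y" c] m by (simp add: f.scale_right_diff_distrib)
      show "swap_map R R' p (vscale (index_vbundle X E L A \<oplus>\<^sub>V induced_vbundle X F B) c x) =
          vscale (index_vbundle X E L B \<oplus>\<^sub>V induced_vbundle X F A) c (swap_map R R' p x)" using r'(3)[of "L p (u + R p y) - y" c] m
        by (simp add: x(1) swap_map_def vscale_sum induced_simps g h e.scale_right_diff_distrib)
    next
      note l = linear_betweenD[OF nL(2)[OF p]] and r = linear_betweenD[OF nR(2)[OF p]] and r' = linear_betweenD[OF nR'(2)[OF p]]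
      fix x x' assume "x \<in> index_space E L A p \<times> B p" "x' \<in> index_space E L A p \<times> B p"
      then obtain u y u' y' where x: "x = (u, y)" "u \<in> index_space E L A p" "y \<in> B p"
        and x': "x' = (u', y')" "u' \<in> index_space E L A p" "y' \<in> B p" by blast
      note m = mem[OF p x(2,3)] and m' = mem[OF p x'(2,3)]
      have g: "(u + u') + R p (y + y') = (u + R p y) + (u' + R p y')" using r m m' by (simp add: algebra_simps)
      have h: "L p ((u + R p y) + (u' + R p y')) - (y + y') = (L p (u + R p y) - y) + (L p (u' + R p y') - y')"
        using l(2)[of "u + R p y" "u' + R p y'"] m m' by (simp add: algebra_simps)
      have k: "R' p ((L p (u + R p y) - y) + (L p (u' + R p y') - y')) = R' p (L p (u + R p y) - y) + R' p (L p (u' + R p y') - y')"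
        using r'(2) m m' by blast
      show "swap_map R R' p (x + x') = swap_map R R' p x + swap_map R R' p x'"
        unfolding x(1) x'(1) swap_map_def add_Pair prod.case g h k by (simp add: algebra_simps)
    qed
  next
    fix U \<sigma> assume U: "openin X U"
      and \<sigma>: "vsec X (index_vbundle X E L A \<oplus>\<^sub>V induced_vbundle X F B) U \<sigma>"
    have UX: "U \<subseteq> topspace X" by (rule openin_subset[OF U])
    have s: "continuous_section X E U (\<lambda>p. fst (\<sigma> p))" "!!p. p \<in> U ==> fst (\<sigma> p) \<in> index_space E L A p"
      "continuous_section X F U (\<lambda>p. snd (\<sigma> p))" "!!p. p \<in> U ==> snd (\<sigma> p) \<in> B p"
      using \<sigma> unfolding vsec_sum_iff[OF a(2) b(3) U] vsec_induced_iff[OF E a(1) U] vsec_induced_iff[OF F b(4) U] by auto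
    have nLU: "nmor_on X E F U L" and nRU: "nmor_on X F E U R" and nRU': "nmor_on X F E U R'"
      using nL(1) nR(1) nR'(1) UX by (auto elim: nmor_on_subset)
    have s1: "continuous_section X E U (\<lambda>p. fst (\<sigma> p) + R p (snd (\<sigma> p)))" by (intro csec_add[OF E U] s nmor_sec[OF F E nRU U])
    have s2: "continuous_section X F U (\<lambda>p. L p (fst (\<sigma> p) + R p (snd (\<sigma> p))) - snd (\<sigma> p))"
      by (intro csec_diff[OF F U] s nmor_sec[OF E F nLU U s1])
    have s3: "continuous_section X E U (\<lambda>p. fst (\<sigma> p) + R p (snd (\<sigma> p)) - R' p (L p (fst (\<sigma> p) + R p (snd (\<sigma> p))) - snd (\<sigma> p)))"
      by (intro csec_diff[OF E U] s1 nmor_sec[OF F E nRU' U s2])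
    show "vsec X (index_vbundle X E L B) U (\<lambda>p. fst (swap_map R R' p (\<sigma> p))) \<and>
        vsec X (induced_vbundle X F A) U (\<lambda>p. snd (swap_map R R' p (\<sigma> p)))"
      unfolding vsec_induced_iff[OF E b(1) U] vsec_induced_iff[OF F a(4) U] swap_map_def split_beta fst_conv snd_conv
    proof (intro conjI ballI)
      fix p assume p: "p \<in> U"
      have pX: "p \<in> topspace X" using p UX by blast
      note m = mem[OF pX s(2)[OF p] s(4)[OF p]]
      show "fst (\<sigma> p) + R p (snd (\<sigma> p)) - R' p (L p (fst (\<sigma> p) + R p (snd (\<sigma> p))) - snd (\<sigma> p)) \<in> index_space E L B p"
        "L p (fst (\<sigma> p) + R p (snd (\<sigma> p))) - snd (\<sigma> p) \<in> A p" using m by blast+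
    qed (rule s3, rule s2)
  }
qed

text \<open>Both sides are isomorphic to the kernel of \<open>(u, v, v') \<mapsto> L u - v - v'\<close> on \<open>E \<oplus> V \<oplus> V'\<close>.\<close>

lemma index_independent:
  assumes A: "transversal_subbundle X E F L A" and B: "transversal_subbundle X E F L B"
  shows "vb_iso X (index_vbundle X E L A \<oplus>\<^sub>V induced_vbundle X F B) (index_vbundle X E L B \<oplus>\<^sub>V induced_vbundle X F A)"
proof -
  note a = transversal_facts[OF A] and b = transversal_facts[OF B]
  obtain R where R: "bundle_morphism X F E R" "!!p z. p \<in> topspace X ==> z \<in> fibre F p ==> L p (R p z) - z \<in> A p"
    by (rule parametrix[OF A], rule that)
  obtain R' where R': "bundle_morphism X F E R'" "!!p z. p \<in> topspace X ==> z \<in> fibre F p ==> L p (R' p z) - z \<in> B p"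
    by (rule parametrix[OF B], rule that)
  have inv: "swap_map S' S p (swap_map S S' p x) = x" for S S' p x by (cases x) (simp add: swap_map_def)
  show ?thesis by (rule vb_isoI[OF vector_bundle_sum[OF a(2) b(3)] vector_bundle_sum[OF b(2) a(3)]
          swap_map_secmap[OF A B R R'] swap_map_secmap[OF B A R' R] inv inv])
qed

text \<open>By \<open>index_independent\<close>, \<open>[E(L, A)] - [A] = [E(L, B)] - [B]\<close>;
  in terms of bundles, the stabiliser is enlarged by \<open>A\<close>.\<close>

lemma index_stable_independent:
  assumes A: "transversal_subbundle X E F L A" and B: "transversal_subbundle X E F L B"
    and st: "stably_iso X (index_vbundle X E L A) (induced_vbundle X F A)"
  shows "stably_iso X (index_vbundle X E L B) (induced_vbundle X F B)"
proof -
  let ?IA = "index_vbundle X E L A" and ?IB = "index_vbundle X E L B"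
    and ?A = "induced_vbundle X F A" and ?B = "induced_vbundle X F B"
  note vA = transversal_facts(2,3)[OF A] and vB = transversal_facts(2,3)[OF B]
  obtain G where G: "G \<in> VB X" and i: "vb_iso X (?IA \<oplus>\<^sub>V G) (?A \<oplus>\<^sub>V G)" using st unfolding stably_iso_def by blast
  note GV = VB_bundle[OF G] and s = vector_bundle_sum
  have "vb_iso X (?IB \<oplus>\<^sub>V (?A \<oplus>\<^sub>V G)) ((?IB \<oplus>\<^sub>V ?A) \<oplus>\<^sub>V G)" by (intro vb_iso_sym[OF vb_iso_assoc] vA vB GV)
  also have "vb_iso X \<dots> ((?IA \<oplus>\<^sub>V ?B) \<oplus>\<^sub>V G)" by (intro vb_iso_sum_cong vb_iso_sym[OF index_independent[OF A B]] vb_iso_refl[OF GV])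
  also have "vb_iso X \<dots> ((?IA \<oplus>\<^sub>V G) \<oplus>\<^sub>V ?B)" by (intro vb_iso_swap_middle vA vB GV)
  also have "vb_iso X \<dots> ((?A \<oplus>\<^sub>V G) \<oplus>\<^sub>V ?B)" by (intro vb_iso_sum_cong i vb_iso_refl vB)
  also have "vb_iso X \<dots> (?B \<oplus>\<^sub>V (?A \<oplus>\<^sub>V G))" by (intro vb_iso_comm s vA vB GV)
  finally show ?thesis by (rule stably_isoI[OF vB]) (intro s vA GV)
qed

end

section \<open>General position and transversal subbundles\<close>

section \<open>Maps from finite dimensional bundles\<close>

abbreviation vbfibre_linear where "vbfibre_linear Z F p \<equiv> linear_between (vscale Z) (fscale F) (vfibre Z p) (fibre F p)"

text \<open>The bridge between the two kinds of bundle. Tested on sections, it needs neither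
  matrices nor charts.\<close>

definition vmor :: "'b topology => ('b, 'k :: {real_normed_field, euclidean_space}, 'z :: ab_group_add) vbundle
     => ('b, 'k, 'w :: ab_group_add, 'n :: banach) bbundle => ('b => 'z => 'w) => bool" where "vmor X Z F S \<longleftrightarrow>
     (\<forall>p\<in>topspace X. vbfibre_linear Z F p (S p)) \<and> (\<forall>U \<sigma>. openin X U --> vsec X Z U \<sigma> --> continuous_section X F U (\<lambda>p. S p (\<sigma> p)))"

lemma vmor_linear: "vmor X Z F S ==> p \<in> topspace X ==>
    vbfibre_linear Z F p (S p)"
  and vmor_sec: "vmor X Z F S ==> openin X U ==> vsec X Z U \<sigma> ==> continuous_section X F U (\<lambda>p. S p (\<sigma> p))" unfolding vmor_def by blast+

lemma vmor_comb:
  assumes F: "banach_bundle X F" and "finite I" and S: "!!i. i \<in> I ==> vmor X Z F (S i)"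
    and a: "!!i. i \<in> I ==> conton X (topspace X) (a i)"
  shows "vmor X Z F (\<lambda>p z. \<Sum>i\<in>I. fscale F (a i p) (S i p z))" unfolding vmor_def
proof (intro conjI ballI allI impI)
  fix p assume p: "p \<in> topspace X"
  show "vbfibre_linear Z F p (\<lambda>z. \<Sum>i\<in>I. fscale F (a i p) (S i p z))"
    using vmor_linear[OF S p] by (intro linear_between_sum[OF bb_vs[OF F] bb_subspace[OF F p]]) blast
next
  fix U \<sigma> assume U: "openin X U" and \<sigma>: "vsec X Z U \<sigma>"
  show "continuous_section X F U (\<lambda>p. \<Sum>i\<in>I. fscale F (a i p) (S i p (\<sigma> p)))"
    by (intro csec_comb[OF F U] vmor_sec[OF S U \<sigma>] conton_subset[OF a openin_subset[OF U]])
qed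

lemma vmor_add:
  assumes F: "banach_bundle X F" and S: "vmor X Z F S" "vmor X Z F T"
  shows "vmor X Z F (\<lambda>p z. S p z + T p z)"
proof -
  interpret f: vector_space "fscale F" by (rule bb_vs[OF F])
  have "vmor X Z F (\<lambda>p z. \<Sum>i\<in>{0,1::nat}. fscale F 1 ((if i = 0 then S else T) p z))"
    by (rule vmor_comb[OF F]) (use S in \<open>auto simp: conton_const\<close>)
  thus ?thesis by simp
qed

lemma vmor_of_secmap:
  assumes "secmap X Z Y T" "vmor X Y F S"
  shows "vmor X Z F (\<lambda>p z. S p (T p z))" using assms unfolding secmap_def vmor_def by (auto intro: linear_between_compose)

lemma vmor_induced:
  assumes F: "banach_bundle X F" and W: "fin_dim_subbundle X F W"
  shows "vmor X (induced_vbundle X F W) F (\<lambda>p u. u)" unfolding vmor_def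
proof (intro conjI ballI allI impI)
  fix p assume "p \<in> topspace X"
  thus "linear_between (vscale (induced_vbundle X F W)) (fscale F) (vfibre (induced_vbundle X F W) p) (fibre F p) (\<lambda>u. u)"
    using W unfolding linear_between_def induced_simps fin_dim_subbundle_def by blast
next
  fix U \<sigma> assume U: "openin X U" and "vsec X (induced_vbundle X F W) U \<sigma>"
  thus "continuous_section X F U \<sigma>" by (simp add: vsec_induced_iff[OF F W U])
qed

lemma vmor_compose:
  assumes E: "banach_bundle X E" and F: "banach_bundle X F" and S: "vmor X Z E S" and L: "bundle_morphism X E F L"
  shows "vmor X Z F (\<lambda>p z. L p (S p z))" unfolding vmor_def
proof (intro conjI ballI allI impI)
  fix p assume p: "p \<in> topspace X"
  show "vbfibre_linear Z F p (\<lambda>z. L p (S p z))"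
    by (rule linear_between_compose[OF vmor_linear[OF S p] bundle_morphismD(2)[OF E F L p]])
next
  fix U \<sigma> assume U: "openin X U" and \<sigma>: "vsec X Z U \<sigma>"
  show "continuous_section X F U (\<lambda>p. L p (S p (\<sigma> p)))"
    by (rule nmor_sec[OF E F nmor_on_subset[OF bundle_morphismD(1)[OF E F L] openin_subset[OF U]] U vmor_sec[OF S U \<sigma>]])
qed

context
  fixes X :: "'b topology"
    and Z :: "('b, 'k :: {real_normed_field, euclidean_space}, 'z :: ab_group_add) vbundle"
    and F :: "('b, 'k, 'w :: ab_group_add, 'n :: banach) bbundle"
    and S :: "'b => 'z => 'w"
  assumes F: "banach_bundle X F" and Z: "vector_bundle X Z" and S: "vmor X Z F S"
    and inj: "!!p z. p \<in> topspace X ==> z \<in> vfibre Z p ==> S p z = 0 ==> z = 0"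
begin

interpretation z: vector_space "vscale Z" by (rule vb_vs[OF Z])
interpretation f: vector_space "fscale F" by (rule bb_vs[OF F])

lemma vmor_frame:
  assumes fr: "(U, n, e) \<in> frames Z" and p: "p \<in> U"
  shows "is_basis (fscale F) (S p ` vfibre Z p) n (\<lambda>i. S p (e p i))"
    "S p (\<Sum>i<n. vscale Z (c i) (e p i)) = (\<Sum>i<n. fscale F (c i) (S p (e p i)))"
proof -
  have pX: "p \<in> topspace X" using openin_subset[OF vb_frame(1)[OF Z fr]] p by blast
  note fb = vb_frame'[OF Z fr p]
  show comb: "S p (\<Sum>i<n. vscale Z (c i) (e p i)) = (\<Sum>i<n. fscale F (c i) (S p (e p i)))" for c
    by (rule linear_between_comb[OF z.vector_space_axioms f.vector_space_axioms vb_subspace[OF Z pX] vmor_linear[OF S pX]])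
      (rule vb_frame_mem[OF Z fr _ p])
  have "lin_indep (fscale F) n (\<lambda>i. S p (e p i))" unfolding lin_indep_def
  proof (intro allI impI)
    fix c i assume c: "(\<Sum>i<n. fscale F (c i) (S p (e p i))) = 0" and i: "i < n"
    have "(\<Sum>i<n. vscale Z (c i) (e p i)) = 0" by (rule inj[OF pX _ c[folded comb]]) (unfold fb(2), rule lin_comb_memI, rule refl)
    thus "c i = 0" by (rule lin_indepD[OF fb(1) _ i])
  qed
  moreover have "S p ` vfibre Z p = {\<Sum>i<n. fscale F (c i) (S p (e p i)) |c. True}" unfolding fb(2) comb[symmetric] by blast
  ultimately show "is_basis (fscale F) (S p ` vfibre Z p) n (\<lambda>i. S p (e p i))" unfolding f.is_basis_iff by blast
qed

lemma image_subbundle: "fin_dim_subbundle X F (\<lambda>p. S p ` vfibre Z p)"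
proof (rule fin_dim_subbundleI[OF F])
  fix p assume p: "p \<in> topspace X"
  obtain U n e where fr: "(U, n, e) \<in> frames Z" "p \<in> U" using vb_cover[OF Z p] .
  have U: "openin X U" by (rule vb_frame(1)[OF Z fr(1)])
  show "\<exists>U n e. p \<in> U \<and> openin X U \<and> (\<forall>i<n. continuous_section X F U (\<lambda>p. e p i)) \<and>
      (\<forall>p\<in>U. is_basis (fscale F) (S p ` vfibre Z p) n (e p))"
    using fr(2) U vmor_sec[OF S U vb_frame_sec[OF Z fr(1)]] vmor_frame(1)[OF fr(1)]
    by (intro exI[of _ U] exI[of _ n] exI[of _ "\<lambda>p i. S p (e p i)"]) simp
qed

text \<open>\<open>S\<close> carries frames of \<open>Z\<close> to frames of \<open>W\<close>. By
  \<open>frame_coefficients\<close> a section of \<open>W\<close> has continuous coefficients in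
  such a frame, and these are the coefficients of its preimage; so the inverse is
  continuous.\<close>

lemma vb_iso_induced:
  assumes W: "fin_dim_subbundle X F W" and im: "!!p. p \<in> topspace X ==> S p ` vfibre Z p = W p"
  shows "vb_iso X Z (induced_vbundle X F W)"
proof (rule vb_isoI)
  show vW: "vector_bundle X (induced_vbundle X F W)" using W by (simp add: fin_dim_subbundle_def)
  define T where "T p = inv_into (vfibre Z p) (S p)" for p
  have lin: "linear_between (vscale Z) (fscale F) (vfibre Z p) (W p) (S p)" if "p \<in> topspace X" for p
    using vmor_linear[OF S that] im[OF that] unfolding linear_between_def by blast
  note lb = linear_betweenD[OF lin]
  have ij: "inj_on (S p) (vfibre Z p)" if p: "p \<in> topspace X" for p
  proof (rule inj_onI)
    fix x y assume xy: "x \<in> vfibre Z p" "y \<in> vfibre Z p" and eq: "S p x = S p y"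
    have "S p (x - y) = 0"
      using linear_between_diff[OF lin[OF p] vb_subspace[OF Z p] z.vector_space_axioms f.vector_space_axioms xy] eq by simp
    thus "x = y" using inj[OF p z.subspace_diff[OF vb_subspace[OF Z p] xy]] by simp
  qed
  have TS: "T p (S p u) = u" if "p \<in> topspace X" "u \<in> vfibre Z p" for p u
    unfolding T_def by (rule inv_into_f_f[OF ij[OF that(1)] that(2)])
  have ST: "S p (T p w) = w" "T p w \<in> vfibre Z p" if "p \<in> topspace X" "w \<in> W p" for p w
    unfolding T_def using that im by (auto intro: f_inv_into_f inv_into_into)
  show "T p (S p u) = u" if "p \<in> topspace X" "u \<in> vfibre Z p" for p u by (rule TS[OF that])
  show "S p (T p w) = w" if "p \<in> topspace X" "w \<in> vfibre (induced_vbundle X F W) p" for p w using ST that by (simp add: induced_simps)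
  show "secmap X Z (induced_vbundle X F W) S" unfolding secmap_def induced_simps
  proof (intro conjI ballI allI impI)
    fix U \<sigma> assume U: "openin X U" and \<sigma>: "vsec X Z U \<sigma>"
    have "S p (\<sigma> p) \<in> W p" if "p \<in> U" for p using openin_subset[OF U] that lb(1) vsec_fibre[OF Z \<sigma>] by blast
    thus "vsec X (induced_vbundle X F W) U (\<lambda>p. S p (\<sigma> p))" using vmor_sec[OF S U \<sigma>] by (simp add: vsec_induced_iff[OF F W U])
  qed (rule lin)
  show "secmap X (induced_vbundle X F W) Z T" unfolding secmap_def induced_simps
  proof (intro conjI ballI allI impI)
    fix p assume p: "p \<in> topspace X"
    show "linear_between (fscale F) (vscale Z) (W p) (vfibre Z p) (T p)" unfolding linear_between_def
    proof (intro conjI ballI allI)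
      fix u assume u: "u \<in> W p"
      note su = ST[OF p u]
      show "T p u \<in> vfibre Z p" by (rule su)
      show "T p (fscale F c u) = vscale Z c (T p u)" for c
        using TS[OF p z.subspace_scale[OF vb_subspace[OF Z p] su(2), of c]] lb(3)[OF p su(2)] su(1) by simp
      fix v assume v: "v \<in> W p"
      note sv = ST[OF p v]
      show "T p (u + v) = T p u + T p v"
        using TS[OF p z.subspace_add[OF vb_subspace[OF Z p] su(2) sv(2)]] lb(2)[OF p su(2) sv(2)] su(1) sv(1) by simp
    qed
  next
    fix U s assume U: "openin X U" and s: "vsec X (induced_vbundle X F W) U s"
    have s': "continuous_section X F U s" "!!p. p \<in> U ==> s p \<in> W p" using s by (auto simp: vsec_induced_iff[OF F W U])
    show "vsec X Z U (\<lambda>p. T p (s p))"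
    proof (rule vsec_local[OF Z U])
      fix p assume p: "p \<in> U"
      hence pX: "p \<in> topspace X" using openin_subset[OF U] by blast
      obtain U1 n e where fr: "(U1, n, e) \<in> frames Z" "p \<in> U1" using vb_cover[OF Z pX] .
      have U1: "openin X U1" by (rule vb_frame(1)[OF Z fr(1)])
      define O' where "O' = U \<inter> U1"
      have O': "openin X O'" "O' \<subseteq> U" "O' \<subseteq> U1" "O' \<subseteq> topspace X" "p \<in> O'"
        using U U1 openin_subset[OF U] p fr(2) by (auto simp: O'_def)
      have bas: "is_basis (fscale F) (W q) n (\<lambda>i. S q (e q i))" if "q \<in> U1" for q
        using vmor_frame(1)[OF fr(1) that] im openin_subset[OF U1] that by auto
      have fr': "(U1, n, \<lambda>p i. S p (e p i)) \<in> frames (induced_vbundle X F W)"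
        unfolding induced_simps using U1 vmor_sec[OF S U1 vb_frame_sec[OF Z fr(1)]] bas by simp
      have m': "!!q. q \<in> O' ==> s q \<in> W q" using s'(2) O'(2) by blast
      obtain a where a: "!!i. i < n ==> conton X O' (a i)" "!!q. q \<in> O' ==> s q = (\<Sum>i<n. fscale F (a i q) (S q (e q i)))"
        by (rule frame_coefficients[OF F fr' O'(1,3) csec_subset[OF F s'(1) U O'(1,2)] m'], assumption, rule that)
      have "T q (s q) = (\<Sum>i<n. vscale Z (a i q) (e q i))" if q: "q \<in> O'" for q
      proof -
        have qU: "q \<in> U1" "q \<in> topspace X" using q O' by auto
        have "s q = S q (\<Sum>i<n. vscale Z (a i q) (e q i))" unfolding a(2)[OF q] vmor_frame(2)[OF fr(1) qU(1)] ..
        moreover have "(\<Sum>i<n. vscale Z (a i q) (e q i)) \<in> vfibre Z q"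
          unfolding vb_frame'(2)[OF Z fr(1) qU(1)] by (rule lin_comb_memI[OF refl])
        ultimately show ?thesis using TS[OF qU(2)] by simp
      qed
      thus "\<exists>W U' n e a. openin X W \<and> p \<in> W \<and> (U', n, e) \<in> frames Z \<and> W \<subseteq> U' \<and>
          (\<forall>i<n. conton X W (a i)) \<and> (\<forall>q\<in>W. T q (s q) = (\<Sum>i<n. vscale Z (a i q) (e q i)))" using O' fr(1) a(1)
        by (intro exI[of _ O'] exI[of _ U1] exI[of _ n] exI[of _ e] exI[of _ a]) auto
    qed
  qed
qed (rule Z)

end

section \<open>Maps in general position\<close>

lemma vmor_frame_local:
  assumes F: "banach_bundle X F" and Z: "vector_bundle X Z" and S: "vmor X Z F S"
    and fr: "(U, n, e) \<in> frames Z" and d: "(U', \<sigma>) \<in> charts F"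
  obtains w where "!!i. i < n ==> conton X (U \<inter> U') (w i)" "!!i p. i < n ==> p \<in> U ==> p \<in> U' ==> S p (e p i) = \<sigma> p (w i p)"
proof -
  have U: "openin X U" by (rule vb_frame(1)[OF Z fr])
  have "\<exists>x. conton X (U \<inter> U') x \<and> (\<forall>p\<in>U \<inter> U'. S p (e p i) = \<sigma> p (x p))" if "i < n" for i
    by (rule csecD[OF F vmor_sec[OF S U vb_frame_sec[OF Z fr that]] U d]) blast
  then obtain w where "!!i. i < n ==> conton X (U \<inter> U') (w i) \<and> (\<forall>p\<in>U \<inter> U'. S p (e p i) = \<sigma> p (w i p))" by metis
  thus ?thesis by (intro that[of w]) auto
qed

definition frame_coord :: "('k => 'v => 'v :: ab_group_add) => nat => (nat => 'v) => 'v => nat => 'k" where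
  "frame_coord s n e g = (SOME c. g = (\<Sum>l<n. s (c l) (e l)))"

lemma (in vector_space) frame_coord:
  assumes "lin_indep scale n e" "l < n"
  shows "frame_coord scale n e (\<Sum>l<n. scale (c l) (e l)) l = c l"
proof (rule lin_indep_diff[OF assms(1) _ assms(2), symmetric])
  show "(\<Sum>l<n. scale (c l) (e l)) = (\<Sum>l<n. scale (frame_coord scale n e (\<Sum>l<n. scale (c l) (e l)) l) (e l))"
    unfolding frame_coord_def by (rule someI[of "\<lambda>d. (\<Sum>l<n. scale (c l) (e l)) = (\<Sum>l<n. scale (d l) (e l))"]) (rule refl)
qed

text \<open>\<open>T\<close> is moved by \<rho> times the map that sends the frame of
  \<open>G\<close> to vectors \<open>x l\<close>, constant in the chart. These are independent
  modulo the images of both frames over the compact set \<open>K\<close>, which forces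
  \<open>g = 0\<close> where \<rho> is nonzero.\<close>

lemma general_position_step:
  fixes F :: "('b, 'k :: {real_normed_field, euclidean_space}, 'w :: ab_group_add, 'n :: banach) bbundle"
    and \<rho> :: "'b => 'k"
  assumes X: "compact_space X" and F: "banach_bundle X F" and inf: "\<not> fin_dim (mscale F) UNIV"
    and M: "vector_bundle X M" and G: "vector_bundle X G" and S: "vmor X M F S" and T: "vmor X G F T"
    and U: "openin X U" and d: "(U', \<sigma>) \<in> charts F" "U \<subseteq> U'"
    and fG: "(U1, n, e) \<in> frames G" "U \<subseteq> U1" and fM: "(U2, m, f) \<in> frames M" "U \<subseteq> U2"
    and K: "closedin X K" "K \<subseteq> U" and \<rho>: "conton X (topspace X) \<rho>" "!!p. p \<in> topspace X - K ==> \<rho> p = 0"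
  obtains T' where "vmor X G F T'" "!!p g. p \<in> topspace X ==> \<rho> p = 0 ==> T' p g = T p g"
    "!!p g u. p \<in> topspace X ==> \<rho> p \<noteq> 0 ==> g \<in> vfibre G p ==> u \<in> vfibre M p ==> T' p g = S p u ==> g = 0"
proof -
  interpret g: vector_space "vscale G" by (rule vb_vs[OF G])
  interpret m: vector_space "vscale M" by (rule vb_vs[OF M])
  interpret f: vector_space "fscale F" by (rule bb_vs[OF F])
  interpret n: kspace "mscale F" by (rule bb_kspace[OF F])
  obtain y where y: "!!i. i < m ==> conton X (U2 \<inter> U') (y i)" "!!i p. i < m ==> p \<in> U2 ==> p \<in> U' ==> S p (f p i) = \<sigma> p (y i p)"
    by (rule vmor_frame_local[OF F M S fM(1) d(1)], rule that)
  obtain z where z: "!!i. i < n ==> conton X (U1 \<inter> U') (z i)" "!!i p. i < n ==> p \<in> U1 ==> p \<in> U' ==> T p (e p i) = \<sigma> p (z i p)"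
    by (rule vmor_frame_local[OF F G T fG(1) d(1)], rule that)
  \<comment> \<open>The vectors to be avoided: images under \<open>S\<close> of the frame of
    \<open>M\<close>, then images under \<open>T\<close> of the frame of \<open>G\<close>, since the
    old \<open>T\<close> still contributes to the new map.\<close>
  define w where "w j = (if j < m then y j else z (j - m))" for j
  have cK: "compactin X K" using X K(1) closedin_compact_space by blast
  have cw: "continuous_map (subtopology X K) euclidean (w j)" if "j < m + n" for j
  proof -
    have "conton X U (w j)"
    proof (cases "j < m")
      case True
      have "conton X U (y j)" by (rule conton_subset[OF y(1)[OF True]]) (use d(2) fM(2) in blast)
      thus ?thesis using True by (simp add: w_def)
    next
      case False
      have "conton X U (z (j - m))" by (rule conton_subset[OF z(1)]) (use d(2) fG(2) that False in auto)
      thus ?thesis using False by (simp add: w_def)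
    qed
    hence "continuous_map (subtopology X U) euclidean (w j)" using conton_iff[OF U] by blast
    thus ?thesis by (rule continuous_map_from_subtopology_mono[OF _ K(2)])
  qed
  \<comment> \<open>Only points of \<open>K\<close> matter, as \<rho> vanishes elsewhere. The
    \<open>x l\<close> do not depend on \<open>p\<close>.\<close>
  obtain x where x: "!!p a c l. p \<in> K ==> (\<Sum>l<n. mscale F (c l) (x l)) = (\<Sum>j<m+n. mscale F (a j) (w j p)) ==> l < n ==> c l = 0"
    using avoid_compact_families[OF bb_kspace[OF F] inf cK, of "m + n" w n] cw by blast
  define C where "C p g l = frame_coord (vscale G) n (e p) g l" for p g l
  define D where "D p g = fscale F (\<rho> p) (\<Sum>l<n. fscale F (C p g l) (\<sigma> p (x l)))" for p g
  have C: "C p (\<Sum>l<n. vscale G (c l) (e p l)) l = c l" if "p \<in> U1" "l < n" for p c l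
    unfolding C_def by (rule g.frame_coord[OF vb_frame'(1)[OF G fG(1) that(1)] that(2)])
  have gC: "\<exists>c. g = (\<Sum>l<n. vscale G (c l) (e p l))" if "p \<in> U1" "g \<in> vfibre G p" for p g using that vb_frame'(2)[OF G fG(1)] by blast
  have D0: "D p g = 0" if "p \<in> topspace X" "p \<notin> K" for p g using \<rho>(2)[of p] that by (simp add: D_def)
  have D_eq: "D p (\<Sum>l<n. vscale G (c l) (e p l)) = \<sigma> p (\<Sum>l<n. mscale F (\<rho> p * c l) (x l))" if "p \<in> U" for p c
  proof -
    have "p \<in> U'" "p \<in> U1" using that d(2) fG(2) by auto
    thus ?thesis unfolding D_def using C by (simp add: chart_comb[OF F d(1)] f.scale_sum_right)
  qed
  have D: "vmor X G F D" unfolding vmor_def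
  proof (intro conjI ballI allI impI)
    fix p assume p: "p \<in> topspace X"
    show "vbfibre_linear G F p (D p)"
    proof (cases "p \<in> K")
      case False
      thus ?thesis using D0[OF p] f.subspace_0[OF bb_subspace[OF F p]] by (simp add: linear_between_def)
    next
      case True
      hence pU: "p \<in> U" "p \<in> U1" "p \<in> U'" using K(2) d(2) fG(2) by auto
      show ?thesis unfolding linear_between_def
      proof (intro conjI ballI allI)
        fix u assume "u \<in> vfibre G p"
        then obtain c where c: "u = (\<Sum>l<n. vscale G (c l) (e p l))" using gC[OF pU(2)] by blast
        show "D p u \<in> fibre F p" unfolding c D_eq[OF pU(1)] by (rule chart_mem[OF F d(1) pU(3)])
        have "vscale G a u = (\<Sum>l<n. vscale G (a * c l) (e p l))" for a unfolding c by (simp add: g.scale_sum_right)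
        thus "D p (vscale G a u) = fscale F a (D p u)" for a by (simp only: D_eq[OF pU(1)] c chart_scale[OF F d(1) pU(3), symmetric])
            (simp add: n.scale_sum_right mult.left_commute)
        fix v assume "v \<in> vfibre G p"
        then obtain c' where c': "v = (\<Sum>l<n. vscale G (c' l) (e p l))" using gC[OF pU(2)] by blast
        have "u + v = (\<Sum>l<n. vscale G (c l + c' l) (e p l))" unfolding c c' by (simp add: g.scale_left_distrib sum.distrib)
        thus "D p (u + v) = D p u + D p v" by (simp only: D_eq[OF pU(1)] c c' chart_add[OF F d(1) pU(3), symmetric])
            (simp add: distrib_left n.scale_left_distrib sum.distrib)
      qed
    qed
  next
    fix Q s assume Q: "openin X Q" and s: "vsec X G Q s"
    show "continuous_section X F Q (\<lambda>p. D p (s p))"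
    proof (rule csec_locally[OF F Q])
      fix p assume p: "p \<in> Q"
      show "\<exists>W s'. openin X W \<and> p \<in> W \<and> continuous_section X F W s' \<and> (\<forall>q\<in>W. D q (s q) = s' q)"
      proof (cases "p \<in> U")
        case True
        obtain a where a: "!!i. i < n ==> conton X (Q \<inter> U1) (a i)" "!!p. p \<in> Q ==> p \<in> U1 ==> s p = (\<Sum>i<n. vscale G (a i p) (e p i))"
          by (rule vsecD[OF s fG(1)], rule that)
        have QU: "openin X (Q \<inter> U)" using Q U by auto
        have "conton X (Q \<inter> U) (a i)" if "i < n" for i by (rule conton_subset[OF a(1)[OF that]]) (use fG(2) in blast)
        moreover have "conton X (Q \<inter> U) \<rho>" by (rule conton_subset[OF \<rho>(1)]) (use openin_subset[OF Q] in blast)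
        ultimately have "conton X (Q \<inter> U) (\<lambda>q. \<Sum>i<n. mscale F (\<rho> q * a i q) (x i))"
          by (intro conton_sum n.conton_scale conton_mult conton_const) auto
        moreover have "D q (s q) = \<sigma> q (\<Sum>i<n. mscale F (\<rho> q * a i q) (x i))" if "q \<in> Q \<inter> U" for q
        proof -
          have q: "q \<in> U" "q \<in> U1" "q \<in> Q" using that fG(2) by auto
          show ?thesis unfolding a(2)[OF q(3,2)] by (rule D_eq[OF q(1)])
        qed
        ultimately have "continuous_section X F (Q \<inter> U) (\<lambda>q. D q (s q))" using d(2) by (intro csec_chart[OF F d(1) QU]) auto
        thus ?thesis using QU p True by blast
      next
        case False
        have o: "openin X (Q \<inter> (topspace X - K))" using Q K(1) by (auto simp: openin_diff)
        show ?thesis using csec_zero[OF F o] o p False K(2) D0 openin_subset[OF Q]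
          by (intro exI[of _ "Q \<inter> (topspace X - K)"] exI[of _ "\<lambda>_. 0"]) auto
      qed
    qed
  qed
  show thesis
  proof (rule that[of "\<lambda>p g. T p g + D p g"])
    show "vmor X G F (\<lambda>p g. T p g + D p g)" by (rule vmor_add[OF F T D])
    show "T p g + D p g = T p g" if "p \<in> topspace X" "\<rho> p = 0" for p g using that by (simp add: D_def)
    fix p g u assume p: "p \<in> topspace X" and r: "\<rho> p \<noteq> 0" and g: "g \<in> vfibre G p" and u: "u \<in> vfibre M p"
      and eq: "T p g + D p g = S p u"
    have pK: "p \<in> K" using \<rho>(2)[of p] p r by blast
    hence pU: "p \<in> U" "p \<in> U1" "p \<in> U2" "p \<in> U'" using K(2) d(2) fG(2) fM(2) by auto
    obtain c where c: "g = (\<Sum>l<n. vscale G (c l) (e p l))" using gC[OF pU(2) g] by blast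
    obtain b where b: "u = (\<Sum>l<m. vscale M (b l) (f p l))" using u vb_frame'(2)[OF M fM(1) pU(3)] by blast
    have "T p g = (\<Sum>l<n. fscale F (c l) (T p (e p l)))" unfolding c
      by (rule linear_between_comb[OF g.vector_space_axioms f.vector_space_axioms vb_subspace[OF G p] vmor_linear[OF T p]])
        (rule vb_frame_mem[OF G fG(1) _ pU(2)])
    hence Tg: "T p g = \<sigma> p (\<Sum>l<n. mscale F (c l) (z l p))" using z(2) pU by (simp add: chart_comb[OF F d(1)])
    have "S p u = (\<Sum>l<m. fscale F (b l) (S p (f p l)))" unfolding b
      by (rule linear_between_comb[OF m.vector_space_axioms f.vector_space_axioms vb_subspace[OF M p] vmor_linear[OF S p]])
        (rule vb_frame_mem[OF M fM(1) _ pU(3)])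
    hence Su: "S p u = \<sigma> p (\<Sum>l<m. mscale F (b l) (y l p))" using y(2) pU by (simp add: chart_comb[OF F d(1)])
    have "\<sigma> p ((\<Sum>l<n. mscale F (c l) (z l p)) + (\<Sum>l<n. mscale F (\<rho> p * c l) (x l))) = \<sigma> p (\<Sum>l<m. mscale F (b l) (y l p))"
      unfolding chart_add[OF F d(1) pU(4)] Tg[symmetric] Su[symmetric] eq[symmetric] D_eq[OF pU(1), symmetric] c ..
    hence "(\<Sum>l<n. mscale F (\<rho> p * c l) (x l)) = (\<Sum>l<m. mscale F (b l) (y l p)) + (\<Sum>l<n. mscale F (- c l) (z l p))"
      unfolding chart_inj[OF F d(1) pU(4)] by (simp add: sum_negf algebra_simps)
    also have "\<dots> = (\<Sum>j<m+n. mscale F (if j < m then b j else - c (j - m)) (w j p))" unfolding sum_lessThan_add w_def by simp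
    finally have "\<rho> p * c l = 0" if "l < n" for l by (rule x[OF pK _ that])
    hence "c l = 0" if "l < n" for l using r that by simp
    thus "g = 0" unfolding c by (intro sum.neutral) simp
  qed
qed

text \<open>One function of a partition of unity at a time: after \<open>k\<close> steps the
  conclusion holds wherever one of the first \<open>k\<close> functions is nonzero, and the next
  step leaves \<open>T\<close> alone where its own function vanishes. The case \<open>u = 0\<close>
  is injectivity of \<open>T\<close>.\<close>

lemma general_position:
  fixes F :: "('b, 'k :: {real_normed_field, euclidean_space}, 'w :: ab_group_add, 'n :: banach) bbundle"
  assumes X: "compact_space X" "Hausdorff_space X" and F: "banach_bundle X F" and inf: "\<not> fin_dim (mscale F) UNIV"
    and M: "vector_bundle X M" and G: "vector_bundle X G" and S: "vmor X M F S"
  obtains T where "vmor X G F T" "!!p g u. p \<in> topspace X ==> g \<in> vfibre G p ==> u \<in> vfibre M p ==> T p g = S p u ==> g = 0"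
proof -
  define good where "good U \<longleftrightarrow> (\<exists>U' \<sigma> U1 n e U2 m f. (U', \<sigma>) \<in> charts F \<and> U \<subseteq> U' \<and>
    (U1, n, e) \<in> frames G \<and> U \<subseteq> U1 \<and> (U2, m, f) \<in> frames M \<and> U \<subseteq> U2)" for U
  have ex: "\<exists>U. openin X U \<and> p \<in> U \<and> good U" if p: "p \<in> topspace X" for p
  proof -
    obtain U' \<sigma> where d: "(U', \<sigma>) \<in> charts F" "p \<in> U'" using bb_cover[OF F p] .
    obtain U1 n e where G1: "(U1, n, e) \<in> frames G" "p \<in> U1" using vb_cover[OF G p] .
    obtain U2 m f where M1: "(U2, m, f) \<in> frames M" "p \<in> U2" using vb_cover[OF M p] .
    have "openin X (U' \<inter> U1 \<inter> U2)" by (intro openin_Int bb_chart(1)[OF F d(1)] vb_frame(1)[OF G G1(1)] vb_frame(1)[OF M M1(1)])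
    moreover have "good (U' \<inter> U1 \<inter> U2)" unfolding good_def using d G1 M1 by blast
    ultimately show ?thesis using d G1 M1 by blast
  qed
  obtain n :: nat and U K and \<rho> :: "nat => 'b => real" where P:
    "!!i. i < n ==> openin X (U i)" "!!i. i < n ==> good (U i)" "!!i. i < n ==> closedin X (K i)"
    "!!i. i < n ==> K i \<subseteq> U i" "!!i. i < n ==> conton X (topspace X) (\<rho> i)"
    "!!i p. i < n ==> p \<in> topspace X - K i ==> \<rho> i p = 0" "!!p. p \<in> topspace X ==> (\<Sum>i<n. \<rho> i p) = 1"
    by (rule partition_of_unity[OF X, of good], rule ex, assumption, rule that)
  have "\<exists>T. vmor X G F T \<and> (\<forall>p\<in>topspace X. (\<exists>j<k. \<rho> j p \<noteq> 0) --> (\<forall>g\<in>vfibre G p. \<forall>u\<in>vfibre M p. T p g = S p u --> g = 0))" if "k \<le> n" for k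
    using that
  proof (induction k)
    case 0
    have "vmor X G F (\<lambda>p z. \<Sum>i\<in>({}::nat set). fscale F ((\<lambda>_ _. 0) i p) ((\<lambda>_ _ _. 0) i p z))" by (rule vmor_comb[OF F]) auto
    thus ?case by auto
  next
    case (Suc k)
    then obtain T where T: "vmor X G F T" and inj: "\<forall>p\<in>topspace X. (\<exists>j<k. \<rho> j p \<noteq> 0) -->
        (\<forall>g\<in>vfibre G p. \<forall>u\<in>vfibre M p. T p g = S p u --> g = 0)" by auto
    have k: "k < n" using Suc by simp
    obtain U' \<sigma> U1 n' e U2 m f where *: "(U', \<sigma>) \<in> charts F" "U k \<subseteq> U'"
      "(U1, n', e) \<in> frames G" "U k \<subseteq> U1" "(U2, m, f) \<in> frames M" "U k \<subseteq> U2" using P(2)[OF k] unfolding good_def by (elim exE conjE)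
    have r0: "of_real (\<rho> k p) = (0::'k)" if "p \<in> topspace X - K k" for p using P(6)[OF k that] by simp
    obtain T' where T': "vmor X G F T'" "!!p g. p \<in> topspace X ==> of_real (\<rho> k p) = (0::'k) ==> T' p g = T p g"
      "!!p g u. p \<in> topspace X ==> of_real (\<rho> k p) \<noteq> (0::'k) ==> g \<in> vfibre G p ==> u \<in> vfibre M p ==> T' p g = S p u ==> g = 0"
      by (rule general_position_step[OF X(1) F inf M G S T P(1)[OF k] * P(3,4)[OF k] conton_of_real[OF P(5)[OF k]] r0], assumption, rule that)
    have "g = 0" if h: "p \<in> topspace X" "j < Suc k" "\<rho> j p \<noteq> 0" "g \<in> vfibre G p" "u \<in> vfibre M p" "T' p g = S p u" for p g u j
    proof (cases "\<rho> k p = 0")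
      case True
      hence "j < k" using h(2,3) less_Suc_eq by metis
      moreover have "T p g = S p u" using T'(2)[OF h(1)] True h(6) by simp
      ultimately show ?thesis using inj h by blast
    next
      case False
      thus ?thesis using T'(3)[OF h(1) _ h(4-6)] by simp
    qed
    thus ?case using T'(1) by blast
  qed
  from this[OF order_refl] obtain T where T: "vmor X G F T" "\<forall>p\<in>topspace X. (\<exists>j<n. \<rho> j p \<noteq> 0) -->
      (\<forall>g\<in>vfibre G p. \<forall>u\<in>vfibre M p. T p g = S p u --> g = 0)" by (elim exE conjE) (rule that)
  have nz: "\<exists>j<n. \<rho> j p \<noteq> 0" if "p \<in> topspace X" for p
  proof (rule ccontr)
    assume "\<not> (\<exists>j<n. \<rho> j p \<noteq> 0)"
    hence "(\<Sum>i<n. \<rho> i p) = 0" by (intro sum.neutral) auto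
    thus False using P(7)[OF that] by simp
  qed
  show thesis
  proof (rule that[OF T(1)])
    fix p g u assume h: "p \<in> topspace X" "g \<in> vfibre G p" "u \<in> vfibre M p" "T p g = S p u"
    show "g = 0" using T(2)[rule_format, OF h(1) nz[OF h(1)] h(2-4)] .
  qed
qed

section \<open>Existence of transversal subbundles\<close>

text \<open>The vectors may be dependent at \<open>y0\<close>, while bordering requires independent
  ones. A subfamily with the same span at \<open>y0\<close> is bordered instead, and near
  \<open>y0\<close> this subfamily already complements the image.\<close>

lemma open_surjective:
  fixes A :: "'y => 'm::banach \<Rightarrow>\<^sub>L 'n::banach"
    and s :: "'k::{real_normed_field,euclidean_space} => 'm => 'm" and t :: "'k => 'n => 'n" and N :: nat
  assumes s: "kspace s" and t: "kspace t" and U: "openin Y U" "y0 \<in> U"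
    and cA: "conton Y U A" and A: "!!y. y \<in> U ==> klin s t (A y)"
    and cw: "!!i. i < N ==> conton Y U (w i)"
    and ker: "fin_dim s {x. A y0 x = 0}"
    and surj: "!!v. \<exists>x c. A y0 x + (\<Sum>i<N. t (c i) (w i y0)) = v"
  obtains U' where "openin Y U'" "y0 \<in> U'" "U' \<subseteq> U" "!!y v. y \<in> U' ==> \<exists>x c. A y x + (\<Sum>i<N. t (c i) (w i y)) = v"
proof -
  interpret t: kspace t by (rule t)
  obtain r idx where idx: "!!i. i < r ==> idx i < N" and ind: "lin_indep t r ((\<lambda>i. w i y0) \<circ> idx)"
    and sp: "{\<Sum>i<r. t (c i) (w (idx i) y0) |c. True} = {\<Sum>i<N. t (c i) (w i y0) |c. True}"
    by (rule t.lin_indep_extract[of N "\<lambda>i. w i y0"], rule that)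
  have ind': "lin_indep t r (\<lambda>i. w (idx i) y0)" using ind by (simp add: o_def)
  have surj': "\<exists>x c. A y0 x + (\<Sum>i<r. t (c i) (w (idx i) y0)) = v" for v
  proof -
    obtain x c where v: "A y0 x + (\<Sum>i<N. t (c i) (w i y0)) = v" using surj by blast
    have "(\<Sum>i<N. t (c i) (w i y0)) \<in> {\<Sum>i<r. t (c i) (w (idx i) y0) |c. True}" unfolding sp by (rule lin_comb_memI[OF refl])
    then obtain c' where "(\<Sum>i<N. t (c i) (w i y0)) = (\<Sum>i<r. t (c' i) (w (idx i) y0))" by blast
    thus ?thesis using v by (intro exI[of _ x] exI[of _ c']) simp
  qed
  show thesis
  proof (rule bordered_local_fredholm[OF s t U cA A, of r "\<lambda>i. w (idx i)"])
    fix d \<phi> U' R e \<alpha> \<beta>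
    assume *: "openin Y U'" "y0 \<in> U'" "U' \<subseteq> U"
      "!!y. y \<in> U' ==> bordered_solution s t r d (A y) (\<lambda>i. w (idx i) y) (\<lambda>j. blinfun_apply (\<phi> j :: 'm \<Rightarrow>\<^sub>L 'k))
         (blinfun_apply (R y)) (\<lambda>j. e j y) (\<lambda>i. blinfun_apply (\<alpha> i y :: 'n \<Rightarrow>\<^sub>L 'k)) (\<beta> y)"
    show thesis
    proof (rule that[OF *(1-3)])
      fix y v assume y: "y \<in> U'"
      have 1: "A y (R y v) + (\<Sum>i<r. t (\<alpha> i y v) (w (idx i) y)) = v" by (rule bordered_parametrix[OF s t *(4)[OF y]])
      have "(\<Sum>i<r. t (\<alpha> i y v) (w (idx i) y)) \<in> t.span ((\<lambda>i. w i y) ` {..<N})"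
        using idx by (intro t.span_sum t.span_scale t.span_base) auto
      then obtain c where "(\<Sum>i<r. t (\<alpha> i y v) (w (idx i) y)) = (\<Sum>i<N. t (c i) (w i y))" unfolding t.span_image_lessThan by blast
      thus "\<exists>x c. A y x + (\<Sum>i<N. t (c i) (w i y)) = v" using 1 by (intro exI[of _ "R y v"] exI[of _ c]) simp
    qed
  qed (assumption | rule cw idx ker surj' ind')+
qed

text \<open>Finitely many neighbourhoods cover \<open>X\<close>, and the least of their \<epsilon>
  works everywhere; the 1 in the minimum takes care of an empty cover.\<close>

lemma compact_uniform:
  fixes P :: "'b => real => bool"
  assumes X: "compact_space X"
    and loc: "!!p. p \<in> topspace X ==> \<exists>U \<epsilon>. openin X U \<and> p \<in> U \<and> \<epsilon> > 0 \<and> (\<forall>q\<in>U. \<forall>t. \<bar>t\<bar> < \<epsilon> --> P q t)"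
  obtains \<epsilon> where "\<epsilon> > 0" "!!q t. q \<in> topspace X ==> \<bar>t\<bar> < \<epsilon> ==> P q t"
proof -
  obtain U \<epsilon> where U: "!!p. p \<in> topspace X ==> openin X (U p) \<and> p \<in> U p \<and> \<epsilon> p > 0 \<and> (\<forall>q\<in>U p. \<forall>t. \<bar>t\<bar> < \<epsilon> p --> P q t)" using loc by metis
  obtain \<F> where \<F>: "finite \<F>" "\<F> \<subseteq> U ` topspace X" "topspace X \<subseteq> \<Union>\<F>"
    using compactinD[of X "topspace X" "U ` topspace X"] X U by (auto simp: compact_space_def)
  then obtain Q where Q: "Q \<subseteq> topspace X" "finite Q" "\<F> = U ` Q" by (meson finite_subset_image)
  define \<delta> where "\<delta> = Min (insert 1 (\<epsilon> ` Q))"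
  show thesis
  proof (rule that[of \<delta>])
    show "\<delta> > 0" using U Q by (auto simp: \<delta>_def)
    fix q t assume q: "q \<in> topspace X" and t: "\<bar>t\<bar> < \<delta>"
    obtain p where p: "p \<in> Q" "q \<in> U p" using \<F>(3) Q(3) q by blast
    have "\<delta> \<le> \<epsilon> p" unfolding \<delta>_def using Q(2) p(1) by (intro Min_le) auto
    thus "P q t" using U[of p] p t Q(1) by force
  qed
qed

definition trivial_vbundle :: "'b topology => nat => ('b, 'k :: {real_normed_field, euclidean_space}, 'k poly) vbundle" where
  "trivial_vbundle X N = \<lparr>vfibre = (\<lambda>p. {\<Sum>k<N. smult (c k) (monom 1 k) |c. True}), vscale = smult,
     frames = {(topspace X, N, \<lambda>p k. monom 1 k)}\<rparr>"

lemma coeff_comb: "coeff (\<Sum>j<N. smult (a j) (monom (1::'k::comm_ring_1) j)) k = (if k < (N::nat) then a k else 0)"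
proof -
  have "coeff (\<Sum>j<N. smult (a j) (monom 1 j)) k = (\<Sum>j<N. if j = k then a j else 0)" unfolding coeff_sum by (intro sum.cong) auto
  thus ?thesis by simp
qed

lemma trivial_vbundle: "vector_bundle X (trivial_vbundle X N :: ('b, 'k :: {real_normed_field, euclidean_space}, 'k poly) vbundle)"
proof -
  interpret p: vector_space "smult :: 'k => 'k poly => 'k poly" by (rule vector_space_smult)
  have ind: "lin_indep (smult :: 'k => _) N (monom 1)" unfolding lin_indep_def
  proof (intro allI impI)
    fix c i assume "(\<Sum>k<N. smult (c k) (monom (1::'k) k)) = 0" "i < N"
    thus "c i = 0" using coeff_comb[of c N i] by simp
  qed
  have "continuous_in_frames X (trivial_vbundle X N) (trivial_vbundle X N :: ('b, 'k, 'k poly) vbundle) (\<lambda>p u. u)"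
    unfolding continuous_in_frames_def trivial_vbundle_def
    by (auto intro!: exI[of _ "\<lambda>i j p. if i = j then 1 else 0"] simp: if_distrib[of "\<lambda>c. smult c _"] cong: if_cong)
  thus ?thesis using ind vector_space_smult unfolding vector_bundle_def by (auto simp: trivial_vbundle_def p.is_basis_iff)
qed

lemma trivial_vmor:
  fixes F :: "('b, 'k :: {real_normed_field, euclidean_space}, 'w :: ab_group_add, 'n :: banach) bbundle"
  assumes F: "banach_bundle X F" and s: "!!k. k < N ==> continuous_section X F (topspace X) (s k)"
  shows "vmor X (trivial_vbundle X N) F (\<lambda>p c. \<Sum>k<N. fscale F (coeff c k) (s k p))" unfolding vmor_def
proof (intro conjI ballI allI impI)
  interpret f: vector_space "fscale F" by (rule bb_vs[OF F])
  fix p assume p: "p \<in> topspace X"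
  show "linear_between (vscale (trivial_vbundle X N)) (fscale F) (vfibre (trivial_vbundle X N) p) (fibre F p)
     (\<lambda>c. \<Sum>k<N. fscale F (coeff c k) (s k p))" using csec_fibre[OF F s openin_topspace p] unfolding linear_between_def
    by (auto simp: trivial_vbundle_def f.scale_left_distrib sum.distrib f.scale_sum_right
        intro!: f.subspace_sum[OF bb_subspace[OF F p]] f.subspace_scale[OF bb_subspace[OF F p]])
next
  fix U \<sigma> assume U: "openin X U" and \<sigma>: "vsec X (trivial_vbundle X N :: ('b, 'k, 'k poly) vbundle) U \<sigma>"
  have UX: "U \<inter> topspace X = U" using openin_subset[OF U] by blast
  have fr: "(topspace X, N, \<lambda>p k. monom 1 k) \<in> frames (trivial_vbundle X N :: ('b, 'k, 'k poly) vbundle)"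
    by (simp add: trivial_vbundle_def)
  obtain a where a: "!!i. i < N ==> conton X (U \<inter> topspace X) (a i)"
    "!!p. p \<in> U ==> p \<in> topspace X ==> \<sigma> p = (\<Sum>i<N. vscale (trivial_vbundle X N) (a i p) (monom 1 i))" by (rule vsecD[OF \<sigma> fr], rule that)
  have "continuous_section X F U (\<lambda>p. \<Sum>k\<in>{..<N}. fscale F (a k p) (s k p))"
    by (intro csec_comb[OF F U] csec_subset[OF F s openin_topspace U openin_subset[OF U]]) (use a(1) in \<open>auto simp: UX\<close>)
  moreover have "(\<Sum>k<N. fscale F (coeff (\<sigma> p) k) (s k p)) = (\<Sum>k<N. fscale F (a k p) (s k p))" if p: "p \<in> U" for p
  proof -
    have "\<sigma> p = (\<Sum>i<N. smult (a i p) (monom 1 i))" using a(2)[OF p] openin_subset[OF U] p by (auto simp: trivial_vbundle_def)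
    thus ?thesis by (intro sum.cong) (simp_all add: coeff_comb)
  qed
  ultimately show "continuous_section X F U (\<lambda>p. \<Sum>k<N. fscale F (coeff (\<sigma> p) k) (s k p))" by (rule csec_cong[OF F _ U])
qed

context
  fixes X :: "'b topology"
    and E :: "('b, 'k :: {real_normed_field, euclidean_space}, 'v :: ab_group_add, 'm :: banach) bbundle"
    and F :: "('b, 'k, 'w :: ab_group_add, 'n :: banach) bbundle"
    and L :: "'b => 'v => 'w" and k :: "'b => int"
  assumes X: "compact_space X" "Hausdorff_space X"
    and E: "banach_bundle X E" and F: "banach_bundle X F" and L: "bundle_morphism X E F L"
    and fred: "!!p. p \<in> topspace X ==> fredholm_of_index (fscale E) (fscale F) (fibre E p) (fibre F p) (L p) (k p)"
begin

interpretation e: vector_space "fscale E" by (rule bb_vs[OF E])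
interpretation f: vector_space "fscale F" by (rule bb_vs[OF F])
interpretation m: kspace "mscale F" by (rule bb_kspace[OF F])

lemma fredholm_kernel: "p \<in> topspace X ==> fin_dim (fscale E) {u \<in> fibre E p. L p u = 0}"
  using fred unfolding fredholm_of_index_def by blast

text \<open>A basis of a complement of the image at \<open>p\<close> is extended by constants in a
  chart. That it fills up the image is an open condition by \<open>open_surjective\<close>.\<close>

lemma local_spanning:
  assumes p: "p \<in> topspace X"
  shows "\<exists>U U' \<sigma> x N. openin X U \<and> p \<in> U \<and> (U', \<sigma>) \<in> charts F \<and> U \<subseteq> U' \<and>
    (\<forall>q\<in>U. \<forall>z\<in>fibre F q. \<exists>u\<in>fibre E q. \<exists>c. z = L q u + (\<Sum>i<(N::nat). fscale F (c i) (\<sigma> q (x i))))"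
proof -
  obtain U1 \<tau> where c: "(U1, \<tau>) \<in> charts E" "p \<in> U1" using bb_cover[OF E p] .
  obtain U2 \<sigma> where d: "(U2, \<sigma>) \<in> charts F" "p \<in> U2" using bb_cover[OF F p] .
  note lin = bundle_morphismD(2)[OF E F L]
  obtain W A where W: "openin X W" "p \<in> W" "W \<subseteq> U1" "W \<subseteq> U2" "conton X W A" "!!q x. q \<in> W ==> L q (\<tau> q x) = \<sigma> q (blinfun_apply (A q) x)"
    by (rule nmor_on_charts[OF E F bundle_morphismD(1)[OF E F L] p c d], rule that)
  obtain C where C: "fin_dim (fscale F) C" "{y + c | y c. y \<in> L p ` fibre E p \<and> c \<in> C} = fibre F p"
    using fred[OF p] unfolding fredholm_of_index_def by (elim conjE exE) (rule that)
  obtain N e where b: "is_basis (fscale F) C N e" using C(1) by (rule f.fin_dim_basis')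
  have CF: "C \<subseteq> fibre F p"
  proof
    fix y assume y: "y \<in> C"
    have "L p 0 = 0" using linear_betweenD(3)[OF lin[OF p] e.subspace_0[OF bb_subspace[OF E p]], of 0] by simp
    hence "0 \<in> L p ` fibre E p" using imageI[OF e.subspace_0[OF bb_subspace[OF E p]], of "L p"] by simp
    hence "0 + y \<in> {y + c | y c. y \<in> L p ` fibre E p \<and> c \<in> C}" using y by blast
    thus "y \<in> fibre F p" unfolding C(2) by simp
  qed
  have "\<exists>x. e i = \<sigma> p x" if i: "i < N" for i
  proof -
    have "e i \<in> C" using b i unfolding is_basis_def by (auto intro: f.span_base)
    hence "e i \<in> fibre F p" using CF by blast
    with d(2) show ?thesis by (rule chart_surj[OF F d(1)]) blast
  qed
  then obtain x where x: "!!i. i < N ==> e i = \<sigma> p (x i)" by metis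
  have "\<exists>u\<in>fibre E p. \<exists>c. z = L p u + (\<Sum>i<N. fscale F (c i) (\<sigma> p (x i)))" if z: "z \<in> fibre F p" for z
  proof -
    have "z \<in> {y + c | y c. y \<in> L p ` fibre E p \<and> c \<in> C}" unfolding C(2) by (rule z)
    then obtain u y where u: "u \<in> fibre E p" "y \<in> C" "z = L p u + y" by blast
    obtain c where "y = (\<Sum>i<N. fscale F (c i) (e i))" using u(2) b unfolding f.is_basis_iff by blast
    also have "\<dots> = (\<Sum>i<N. fscale F (c i) (\<sigma> p (x i)))" using x by (intro sum.cong) auto
    finally show ?thesis using u by blast
  qed
  hence surj: "\<exists>xa c. blinfun_apply (A p) xa + (\<Sum>i<N. mscale F (c i) (x i)) = v" for v
    using local_transversal[OF E F c d W(6)[OF W(2)] lin[OF p], where w = x and N = N] by blast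
  have sub: "q \<in> U1" "q \<in> U2" "q \<in> topspace X" if "q \<in> W" for q using that W openin_subset[OF W(1)] by auto
  have kA: "klin (mscale E) (mscale F) (A q)" if q: "q \<in> W" for q
    by (rule local_klin[OF E F c(1) sub(1)[OF q] d(1) sub(2)[OF q] W(6)[OF q] lin[OF sub(3)[OF q]]])
  have kerA: "fin_dim (mscale E) {x. A p x = 0}" by (rule local_kernel[OF E F c d W(6)[OF W(2)] lin[OF p] fredholm_kernel[OF p]])
  obtain U where U: "openin X U" "p \<in> U" "U \<subseteq> W" "!!y v. y \<in> U ==> \<exists>xa c. blinfun_apply (A y) xa + (\<Sum>i<N. mscale F (c i) (x i)) = v"
    by (rule open_surjective[OF bb_kspace[OF E] bb_kspace[OF F] W(1,2,5) kA conton_const[of _ _ "x _"] kerA surj], assumption, rule that)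
  have "\<forall>q\<in>U. \<forall>z\<in>fibre F q. \<exists>u\<in>fibre E q. \<exists>c. z = L q u + (\<Sum>i<N. fscale F (c i) (\<sigma> q (x i)))"
  proof
    fix q assume q: "q \<in> U"
    have qW: "q \<in> W" using q U(3) by blast
    show "\<forall>z\<in>fibre F q. \<exists>u\<in>fibre E q. \<exists>c. z = L q u + (\<Sum>i<N. fscale F (c i) (\<sigma> q (x i)))"
      using local_transversal[OF E F c(1) sub(1)[OF qW] d(1) sub(2)[OF qW] W(6)[OF qW] lin[OF sub(3)[OF qW]], where w = x and N = N]
        U(4)[OF q] by blast
  qed
  thus ?thesis by (intro exI[of _ U] exI[of _ U2] exI[of _ \<sigma>] exI[of _ x] exI[of _ N] conjI U(1,2) d(1) order_trans[OF U(3) W(4)])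
qed

text \<open>Local spanning sections are cut off by a partition of unity. At each point some weight
  is nonzero, and dividing by it recovers the local sections that belong to it.\<close>

lemma spanning_sections:
  obtains N :: nat and s where "!!k. k < N ==> continuous_section X F (topspace X) (s k)"
    "!!p z. p \<in> topspace X ==> z \<in> fibre F p ==> \<exists>u\<in>fibre E p. \<exists>c. z = L p u + (\<Sum>k<N. fscale F (c k) (s k p))"
proof -
  define good where "good U \<longleftrightarrow> (\<exists>U' \<sigma> x N. (U', \<sigma>) \<in> charts F \<and> U \<subseteq> U' \<and>
    (\<forall>q\<in>U. \<forall>z\<in>fibre F q. \<exists>u\<in>fibre E q. \<exists>c. z = L q u + (\<Sum>i<(N::nat). fscale F (c i) (\<sigma> q (x i)))))" for U
  have ex: "\<exists>U. openin X U \<and> p \<in> U \<and> good U" if "p \<in> topspace X" for p using local_spanning[OF that] unfolding good_def by blast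
  obtain n :: nat and U K and \<rho> :: "nat => 'b => real" where P:
    "!!i. i < n ==> openin X (U i)" "!!i. i < n ==> good (U i)" "!!i. i < n ==> closedin X (K i)"
    "!!i. i < n ==> K i \<subseteq> U i" "!!i. i < n ==> conton X (topspace X) (\<rho> i)"
    "!!i p. i < n ==> p \<in> topspace X - K i ==> \<rho> i p = 0" "!!p. p \<in> topspace X ==> (\<Sum>i<n. \<rho> i p) = 1"
    by (rule partition_of_unity[OF X, of good], rule ex, assumption, rule that)
  define good' where "good' i U' \<sigma> x N \<longleftrightarrow> (U', \<sigma>) \<in> charts F \<and> U i \<subseteq> U' \<and>
    (\<forall>q\<in>U i. \<forall>z\<in>fibre F q. \<exists>u\<in>fibre E q. \<exists>c. z = L q u + (\<Sum>j<(N::nat). fscale F (c j) (\<sigma> q (x j))))" for i U' \<sigma> x N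
  have "\<exists>U' \<sigma> x N. good' i U' \<sigma> x N" if "i < n" for i using P(2)[OF that] unfolding good_def good'_def .
  then obtain U' \<sigma> x N where good': "!!i. i < n ==> good' i (U' i) (\<sigma> i) (x i) (N i)" by metis
  have *: "(U' i, \<sigma> i) \<in> charts F" "U i \<subseteq> U' i"
    "!!q z. q \<in> U i ==> z \<in> fibre F q ==> \<exists>u\<in>fibre E q. \<exists>c. z = L q u + (\<Sum>j<N i. fscale F (c j) (\<sigma> i q (x i j)))"
    if "i < n" for i
  proof -
    note g = good'[OF that, unfolded good'_def]
    show "(U' i, \<sigma> i) \<in> charts F" "U i \<subseteq> U' i" by (rule conjunct1[OF g], rule conjunct1[OF conjunct2[OF g]])
    show "\<exists>u\<in>fibre E q. \<exists>c. z = L q u + (\<Sum>j<N i. fscale F (c j) (\<sigma> i q (x i j)))" if "q \<in> U i" "z \<in> fibre F q" for q z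
      by (rule bspec[OF bspec[OF conjunct2[OF conjunct2[OF g]] that(1)] that(2)])
  qed
  define S where "S = (\<lambda>(i, j) p. fscale F (of_real (\<rho> i p)) (\<sigma> i p (x i j)))"
  define I where "I = (SIGMA i:{..<n}. {..<N i})"
  have I: "finite I" by (simp add: I_def)
  then obtain h where h: "bij_betw h {..<card I} I" using ex_bij_betw_nat_finite[OF I] by (auto simp: atLeast0LessThan)
  have cS: "continuous_section X F (topspace X) (S ij)" if ij: "ij \<in> I" for ij
  proof -
    obtain i j where i: "ij = (i, j)" "i < n" using ij by (auto simp: I_def)
    have r0: "of_real (\<rho> i p) = (0::'k)" if "p \<in> topspace X - K i" for p using P(6)[OF i(2) that] by simp
    have "continuous_section X F (U i) (\<lambda>p. \<sigma> i p (x i j))"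
      by (rule csec_chart[OF F *(1)[OF i(2)] P(1)[OF i(2)] *(2)[OF i(2)] conton_const refl])
    from csec_bump[OF F P(1)[OF i(2)] this conton_of_real[OF P(5)[OF i(2)]] P(3,4)[OF i(2)] r0]
    show ?thesis by (simp add: i(1) S_def)
  qed
  show thesis
  proof (rule that[of "card I" "\<lambda>k. S (h k)"])
    show "continuous_section X F (topspace X) (S (h k))" if "k < card I" for k by (rule cS) (use h that in \<open>auto simp: bij_betw_def\<close>)
    fix p z assume p: "p \<in> topspace X" and z: "z \<in> fibre F p"
    have "\<exists>i<n. \<rho> i p \<noteq> 0"
    proof (rule ccontr)
      assume "\<not> (\<exists>i<n. \<rho> i p \<noteq> 0)"
      hence "(\<Sum>i<n. \<rho> i p) = 0" by (intro sum.neutral) auto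
      thus False using P(7)[OF p] by simp
    qed
    then obtain i where i: "i < n" "\<rho> i p \<noteq> 0" by blast
    hence "p \<in> U i" using P(4)[OF i(1)] P(6)[OF i(1), of p] p by blast
    then obtain u c where u: "u \<in> fibre E p" "z = L p u + (\<Sum>j<N i. fscale F (c j) (\<sigma> i p (x i j)))" using *(3)[OF i(1) _ z] by blast
    have "\<sigma> i p (x i j) \<in> f.span ((\<lambda>k. S (h k) p) ` {..<card I})" if j: "j < N i" for j
    proof -
      have "(i, j) \<in> h ` {..<card I}" using h i(1) j by (auto simp: bij_betw_def I_def)
      hence "S (i, j) p \<in> (\<lambda>k. S (h k) p) ` {..<card I}" by force
      hence "fscale F (1 / of_real (\<rho> i p)) (S (i, j) p) \<in> f.span ((\<lambda>k. S (h k) p) ` {..<card I})" by (intro f.span_scale f.span_base)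
      thus ?thesis using i(2) by (simp add: S_def)
    qed
    hence "(\<Sum>j<N i. fscale F (c j) (\<sigma> i p (x i j))) \<in> f.span ((\<lambda>k. S (h k) p) ` {..<card I})" by (intro f.span_sum f.span_scale) auto
    then obtain c' where "(\<Sum>j<N i. fscale F (c j) (\<sigma> i p (x i j))) = (\<Sum>k<card I. fscale F (c' k) (S (h k) p))"
      unfolding f.span_image_lessThan by blast
    thus "\<exists>u\<in>fibre E p. \<exists>c. z = L p u + (\<Sum>k<card I. fscale F (c k) (S (h k) p))" using u by (intro bexI[of _ u] exI[of _ c']) simp_all
  qed
qed

text \<open>\<open>open_surjective\<close> is applied over the product of \<open>X\<close> with the
  real line at the points \<open>(p, 0)\<close>, the real coordinate being the size of the
  perturbation. Compactness of \<open>X\<close> makes the bound uniform.\<close>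

lemma transversal_stable:
  assumes s: "!!k. k < N ==> continuous_section X F (topspace X) (s k)" "!!k. k < N ==> continuous_section X F (topspace X) (s' k)"
    and span: "!!p z. p \<in> topspace X ==> z \<in> fibre F p ==> \<exists>u\<in>fibre E p. \<exists>c. z = L p u + (\<Sum>k<(N::nat). fscale F (c k) (s k p))"
  obtains \<epsilon> where "\<epsilon> > 0" "!!p r. p \<in> topspace X ==> \<bar>r\<bar> < \<epsilon> ==>
    \<forall>z\<in>fibre F p. \<exists>u\<in>fibre E p. \<exists>c. z = L p u + (\<Sum>k<N. fscale F (c k) (s k p + fscale F (of_real r) (s' k p)))"
proof (rule compact_uniform[OF X(1), where P = "\<lambda>p r. \<forall>z\<in>fibre F p. \<exists>u\<in>fibre E p. \<exists>c.
     z = L p u + (\<Sum>k<N. fscale F (c k) (s k p + fscale F (of_real r) (s' k p)))"])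
  fix p assume p: "p \<in> topspace X"
  obtain U1 \<tau> where c: "(U1, \<tau>) \<in> charts E" "p \<in> U1" using bb_cover[OF E p] .
  obtain U2 \<sigma> where d: "(U2, \<sigma>) \<in> charts F" "p \<in> U2" using bb_cover[OF F p] .
  note lin = bundle_morphismD(2)[OF E F L]
  obtain W A where W: "openin X W" "p \<in> W" "W \<subseteq> U1" "W \<subseteq> U2" "conton X W A" "!!q x. q \<in> W ==> L q (\<tau> q x) = \<sigma> q (blinfun_apply (A q) x)"
    by (rule nmor_on_charts[OF E F bundle_morphismD(1)[OF E F L] p c d], rule that)
  have WX: "W \<subseteq> topspace X" by (rule openin_subset[OF W(1)])
  have U2: "topspace X \<inter> U2 = U2" using openin_subset[OF bb_chart(1)[OF F d(1)]] by blast
  have loc: "\<exists>x. conton X U2 x \<and> (\<forall>q\<in>U2. t q = \<sigma> q (x q))" if "continuous_section X F (topspace X) t" for t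
    by (rule csecD[OF F that openin_topspace d(1)]) (use U2 in auto)
  define rep where "rep t x \<longleftrightarrow> conton X U2 x \<and> (\<forall>q\<in>U2. t q = \<sigma> q (x q))" for t x
  have "\<exists>x. rep (s k) x" "\<exists>x. rep (s' k) x" if "k < N" for k
    unfolding rep_def by (rule loc[OF s(1)[OF that]], rule loc[OF s(2)[OF that]])
  then obtain a b where "!!k. k < N ==> rep (s k) (a k)" "!!k. k < N ==> rep (s' k) (b k)" by metis
  hence a: "!!k. k < N ==> conton X U2 (a k)" "!!k q. k < N ==> q \<in> U2 ==> s k q = \<sigma> q (a k q)"
    and b: "!!k. k < N ==> conton X U2 (b k)" "!!k q. k < N ==> q \<in> U2 ==> s' k q = \<sigma> q (b k q)" unfolding rep_def by simp_all
  define Y where "Y = prod_topology X euclideanreal"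
  have cf: "continuous_map Y X fst" and cs: "continuous_map Y euclideanreal snd"
    by (simp_all add: Y_def continuous_map_fst continuous_map_snd)
  define D where "D = {y \<in> topspace Y. fst y \<in> W}"
  have D: "openin Y D" unfolding D_def by (rule openin_continuous_map_preimage[OF cf W(1)])
  have Dp: "(p, 0) \<in> D" using p W(2) by (simp add: D_def Y_def)
  have cfst: "conton Y D (\<lambda>y. g (fst y))" if "conton X W g" for g :: "'b => 'x::topological_space"
    unfolding D_def by (rule conton_compose[OF cf that W(1)])
  have csnd: "conton Y D (\<lambda>y. of_real (snd y) :: 'k)"
    by (rule conton_of_real, rule conton_subset[OF cs[unfolded conton_topspace]]) (simp add: D_def)
  define w where "w k y = a k (fst y) + mscale F (of_real (snd y)) (b k (fst y))" for k and y :: "'b \<times> real"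
  have cw: "conton Y D (w k)" if "k < N" for k
    unfolding w_def[abs_def] by (intro conton_add m.conton_scale csnd cfst conton_subset[OF a(1)[OF that] W(4)]
      conton_subset[OF b(1)[OF that] W(4)])
  have sub: "q \<in> U1" "q \<in> U2" "q \<in> topspace X" if "q \<in> W" for q using that W WX by auto
  have trans: "(\<forall>z\<in>fibre F q. \<exists>u\<in>fibre E q. \<exists>c. z = L q u + (\<Sum>k<N. fscale F (c k) (s k q + fscale F (of_real r) (s' k q)))) \<longleftrightarrow>
      (\<forall>v. \<exists>x c. blinfun_apply (A q) x + (\<Sum>i<N. mscale F (c i) (w i (q, r))) = v)" if q: "q \<in> W" for q r
  proof -
    have "\<sigma> q (w k (q, r)) = s k q + fscale F (of_real r) (s' k q)" if "k < N" for k
      using a(2)[OF that sub(2)[OF q]] b(2)[OF that sub(2)[OF q]]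
      by (simp add: w_def chart_add[OF F d(1) sub(2)[OF q]] chart_scale[OF F d(1) sub(2)[OF q]])
    hence "(\<Sum>k<N. fscale F (c k) (\<sigma> q (w k (q, r)))) = (\<Sum>k<N. fscale F (c k) (s k q + fscale F (of_real r) (s' k q)))" for c
      by (intro sum.cong) auto
    thus ?thesis using local_transversal[OF E F c(1) sub(1)[OF q] d(1) sub(2)[OF q] W(6)[OF q] lin[OF sub(3)[OF q]],
          where w = "\<lambda>k. w k (q, r)" and N = N] by simp
  qed
  have surj: "\<exists>x c. blinfun_apply (A (fst (p, 0::real))) x + (\<Sum>i<N. mscale F (c i) (w i (p, 0))) = v" for v
    using trans[OF W(2), of 0] span[OF p] by simp
  have kA: "klin (mscale E) (mscale F) (A (fst y))" if y: "y \<in> D" for y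
  proof -
    have q: "fst y \<in> W" using y by (simp add: D_def)
    show ?thesis by (rule local_klin[OF E F c(1) sub(1)[OF q] d(1) sub(2)[OF q] W(6)[OF q] lin[OF sub(3)[OF q]]])
  qed
  have kerA: "fin_dim (mscale E) {x. blinfun_apply (A (fst (p, 0::real))) x = 0}"
    using local_kernel[OF E F c d W(6)[OF W(2)] lin[OF p] fredholm_kernel[OF p]] by simp
  obtain U where U: "openin Y U" "(p, 0) \<in> U" "U \<subseteq> D"
    "!!y v. y \<in> U ==> \<exists>x c. blinfun_apply (A (fst y)) x + (\<Sum>i<N. mscale F (c i) (w i y)) = v"
    by (rule open_surjective[OF bb_kspace[OF E] bb_kspace[OF F] D Dp cfst[OF W(5)] kA cw kerA surj], assumption, assumption, rule that)
  have "\<exists>O' J. openin X O' \<and> openin euclideanreal J \<and> p \<in> O' \<and> 0 \<in> J \<and> O' \<times> J \<subseteq> U"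
    using U(1)[unfolded Y_def openin_prod_topology_alt] U(2) by (elim allE impE)
  then obtain O' J where O': "openin X O'" "open J" "p \<in> O'" "0 \<in> J" "O' \<times> J \<subseteq> U" by (elim exE conjE) (rule that, simp_all)
  obtain \<epsilon> where \<epsilon>: "\<epsilon> > 0" "ball 0 \<epsilon> \<subseteq> J" using O'(2,4) open_contains_ball by blast
  have "\<forall>z\<in>fibre F q. \<exists>u\<in>fibre E q. \<exists>c. z = L q u + (\<Sum>k<N. fscale F (c k) (s k q + fscale F (of_real r) (s' k q)))"
    if q: "q \<in> O'" and r: "\<bar>r\<bar> < \<epsilon>" for q r
  proof -
    have y: "(q, r) \<in> U" using O'(5) \<epsilon>(2) q r by (auto simp: subset_iff)
    hence "q \<in> W" using U(3) by (auto simp: D_def)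
    thus ?thesis using trans U(4)[OF y] by simp
  qed
  thus "\<exists>U \<epsilon>. openin X U \<and> p \<in> U \<and> \<epsilon> > 0 \<and> (\<forall>q\<in>U. \<forall>r. \<bar>r\<bar> < \<epsilon> -->
      (\<forall>z\<in>fibre F q. \<exists>u\<in>fibre E q. \<exists>c. z = L q u + (\<Sum>k<N. fscale F (c k) (s k q + fscale F (of_real r) (s' k q)))))"
    using O' \<epsilon>(1) by (intro exI[of _ O'] exI[of _ \<epsilon>]) blast
qed (rule that)

lemma transversal_subbundleI:
  assumes W: "fin_dim_subbundle X F W"
    and sp: "!!p z. p \<in> topspace X ==> z \<in> fibre F p ==> \<exists>u\<in>fibre E p. \<exists>v\<in>W p. z = L p u + v"
  shows "transversal_subbundle X E F L W" unfolding transversal_subbundle_def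
proof (intro conjI W ballI Set.set_eqI iffI)
  fix p z assume p: "p \<in> topspace X"
  {
    assume "z \<in> {y + v | y v. y \<in> L p ` fibre E p \<and> v \<in> W p}"
    then obtain u v where "u \<in> fibre E p" "v \<in> W p" "z = L p u + v" by blast
    moreover have "v \<in> fibre F p" using W p \<open>v \<in> W p\<close> by (auto simp: fin_dim_subbundle_def)
    ultimately show "z \<in> fibre F p"
      using f.subspace_add[OF bb_subspace[OF F p]] linear_betweenD(1)[OF bundle_morphismD(2)[OF E F L p]] by blast
  next
    assume "z \<in> fibre F p"
    thus "z \<in> {y + v | y v. y \<in> L p ` fibre E p \<and> v \<in> W p}" using sp[OF p] by blast
  }
qed

text \<open>If the model of \<open>F\<close> is finite dimensional, \<open>F\<close> itself is
  transversal. Otherwise the spanning sections, possibly dependent, define a map \<open>S\<close>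
  from a trivial bundle. For \<open>T\<close> in general position to \<open>S\<close>, the map
  \<open>S + r T\<close> is injective when \<open>r \<noteq> 0\<close> and still transversal when
  \<open>r\<close> is small.\<close>

lemma transversal_exists:
  obtains V where "transversal_subbundle X E F L V"
proof (cases "fin_dim (mscale F) UNIV")
  case True
  then obtain n b where b: "is_basis (mscale F) UNIV n b" by (rule m.fin_dim_basis')
  have "fin_dim_subbundle X F (fibre F)"
  proof (rule fin_dim_subbundleI[OF F])
    fix p assume p: "p \<in> topspace X"
    obtain U \<sigma> where d: "(U, \<sigma>) \<in> charts F" "p \<in> U" using bb_cover[OF F p] .
    have "is_basis (fscale F) (fibre F q) n (\<lambda>i. \<sigma> q (b i))" if "q \<in> U" for q
    proof -
      have "fibre F q = \<sigma> q ` UNIV" using bb_chart(3)[OF F d(1) that] by (simp add: bij_betw_def)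
      thus ?thesis using chart_is_basis[OF F d(1) that, of UNIV n b] b by simp
    qed
    moreover have "continuous_section X F U (\<lambda>q. \<sigma> q (b i))" for i
      by (rule csec_chart[OF F d(1) bb_chart(1)[OF F d(1)] order_refl conton_const refl])
    ultimately show "\<exists>U n e. p \<in> U \<and> openin X U \<and> (\<forall>i<n. continuous_section X F U (\<lambda>p. e p i)) \<and>
      (\<forall>p\<in>U. is_basis (fscale F) (fibre F p) n (e p))"
      using d(2) bb_chart(1)[OF F d(1)] by (intro exI[of _ U] exI[of _ n] exI[of _ "\<lambda>q i. \<sigma> q (b i)"]) simp
  qed
  hence "transversal_subbundle X E F L (fibre F)"
  proof (rule transversal_subbundleI)
    fix p z assume p: "p \<in> topspace X" and z: "z \<in> fibre F p"
    have u: "0 \<in> fibre E p" by (rule e.subspace_0[OF bb_subspace[OF E p]])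
    have "L p 0 = 0" using linear_betweenD(3)[OF bundle_morphismD(2)[OF E F L p] u, of 0] by simp
    thus "\<exists>u\<in>fibre E p. \<exists>v\<in>fibre F p. z = L p u + v" using u z by (intro bexI[of _ 0] bexI[of _ z]) auto
  qed
  thus thesis by (rule that)
next
  case inf: False
  obtain N :: nat and s where s: "!!k. k < N ==> continuous_section X F (topspace X) (s k)"
    "!!p z. p \<in> topspace X ==> z \<in> fibre F p ==> \<exists>u\<in>fibre E p. \<exists>c. z = L p u + (\<Sum>k<N. fscale F (c k) (s k p))"
    by (rule spanning_sections, rule that)
  define Z :: "('b, 'k, 'k poly) vbundle" where "Z = trivial_vbundle X N"
  define S where "S p c = (\<Sum>k<N. fscale F (coeff c k) (s k p))" for p c
  have Z: "vector_bundle X Z" unfolding Z_def by (rule trivial_vbundle)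
  have S: "vmor X Z F S" unfolding Z_def S_def[abs_def] by (rule trivial_vmor[OF F s(1)])
  obtain T where T: "vmor X Z F T" "!!p g u. p \<in> topspace X ==> g \<in> vfibre Z p ==> u \<in> vfibre Z p ==> T p g = S p u ==> g = 0"
    by (rule general_position[OF X F inf Z Z S], rule that)
  have Zmem: "(\<Sum>k<N. smult (c k) (monom 1 k)) \<in> vfibre Z p" for c p unfolding Z_def trivial_vbundle_def by (auto)
  have fr: "(topspace X, N, \<lambda>p k. monom 1 k) \<in> frames Z" by (simp add: Z_def trivial_vbundle_def)
  have vsZ: "vscale Z = smult" by (simp add: Z_def trivial_vbundle_def)
  have cs': "continuous_section X F (topspace X) (\<lambda>p. T p (monom 1 k))" if "k < N" for k
    by (rule vmor_sec[OF T(1) openin_topspace vb_frame_sec[OF Z fr that]]) obtain \<epsilon> where \<epsilon>: "\<epsilon> > 0" "!!p r. p \<in> topspace X ==> \<bar>r\<bar> < \<epsilon> ==>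
    \<forall>z\<in>fibre F p. \<exists>u\<in>fibre E p. \<exists>c. z = L p u + (\<Sum>k<N. fscale F (c k) (s k p + fscale F (of_real r) (T p (monom 1 k))))"
    by (rule transversal_stable[OF s(1) cs' s(2)], assumption, assumption, assumption, assumption, rule that)
  define r where "r = \<epsilon> / 2"
  have r: "\<bar>r\<bar> < \<epsilon>" "r \<noteq> 0" using \<epsilon>(1) by (auto simp: r_def)
  define S' where "S' p c = S p c + (\<Sum>i\<in>{()}. fscale F (of_real r) (T p c))" for p c
  have S': "vmor X Z F S'" unfolding S'_def[abs_def] by (rule vmor_add[OF F S], rule vmor_comb[OF F]) (auto simp: T(1) conton_const)
  have inj: "c = 0" if p: "p \<in> topspace X" and c: "c \<in> vfibre Z p" and 0: "S' p c = 0" for p c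
  proof -
    interpret z: vector_space "vscale Z" by (rule vb_vs[OF Z])
    note sub = vb_subspace[OF Z p]
    have "T p (vscale Z (of_real r) c) = fscale F (of_real r) (T p c)" by (rule linear_betweenD(3)[OF vmor_linear[OF T(1) p] c])
    also have "\<dots> = - S p c" using 0 by (simp add: S'_def eq_neg_iff_add_eq_0 add.commute)
    also have "\<dots> = S p (vscale Z (-1) c)" using linear_betweenD(3)[OF vmor_linear[OF S p] c, of "-1"] by simp
    \<comment> \<open>\<open>T\<close> at \<open>r c\<close> equals \<open>S\<close> at
      \<open>- c\<close>, and general position yields \<open>r c = 0\<close>.\<close>
    finally have "vscale Z (of_real r) c = 0" by (rule T(2)[OF p z.subspace_scale[OF sub c] z.subspace_scale[OF sub c]])
    thus ?thesis using r(2) by simp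
  qed
  have comb: "S' p (\<Sum>k<N. smult (c k) (monom 1 k)) = (\<Sum>k<N. fscale F (c k) (s k p + fscale F (of_real r) (T p (monom 1 k))))"
    if p: "p \<in> topspace X" for p c
  proof -
    have "S' p (monom 1 k) = s k p + fscale F (of_real r) (T p (monom 1 k))" if "k < N" for k
      using that by (simp add: S'_def S_def if_distrib[of "\<lambda>c. fscale F c _"] cong: if_cong)
    thus ?thesis using vmor_frame(2)[OF F Z S' inj fr p, where c = c] by (simp add: vsZ)
  qed
  have "transversal_subbundle X E F L (\<lambda>p. S' p ` vfibre Z p)"
  proof (rule transversal_subbundleI[OF image_subbundle[OF F Z S' inj]])
    fix p z assume p: "p \<in> topspace X" and z: "z \<in> fibre F p"
    obtain u c where "u \<in> fibre E p" "z = L p u + (\<Sum>k<N. fscale F (c k) (s k p + fscale F (of_real r) (T p (monom 1 k))))"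
      using \<epsilon>(2)[OF p r(1)] z by blast
    thus "\<exists>u\<in>fibre E p. \<exists>v\<in>S' p ` vfibre Z p. z = L p u + v" unfolding comb[OF p, symmetric] using Zmem by blast
  qed assumption+
  thus thesis by (rule that)
qed

end

section \<open>The cylinder: slices of bundles, subbundles and morphisms\<close>

section \<open>Pullbacks and homotopy invariance\<close>

lemma pullback_simps [simp]:
  "fibre (pullback Y f E) = (\<lambda>y. fibre E (f y))" "fscale (pullback Y f E) = fscale E" "mscale (pullback Y f E) = mscale E"
  by (simp_all add: pullback_def)

lemma pullback_charts: "charts (pullback Y f E) = (\<lambda>(U, \<tau>). ({y\<in>topspace Y. f y \<in> U}, \<lambda>y. \<tau> (f y))) ` charts E"
  by (simp add: pullback_def)

lemma pullback_chart: "(U, \<tau>) \<in> charts E ==> ({y \<in> topspace Y. f y \<in> U}, \<lambda>y. \<tau> (f y)) \<in> charts (pullback Y f E)"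
  unfolding pullback_charts by (rule image_eqI[of _ _ "(U, \<tau>)"]) simp_all

lemma pullback_chartE:
  assumes "(V, \<sigma>) \<in> charts (pullback Y f E)"
  obtains U \<tau> where "(U, \<tau>) \<in> charts E" "V = {y \<in> topspace Y. f y \<in> U}" "\<sigma> = (\<lambda>y. \<tau> (f y))"
  using assms unfolding pullback_charts by auto

context
  fixes X :: "'b topology" and Y :: "'c topology" and f :: "'c => 'b"
  assumes f: "continuous_map Y X f"
begin

lemma pullback_continuous:
  assumes "continuous_map (subtopology X U) euclidean g" "V \<subseteq> {y \<in> topspace Y. f y \<in> U}"
  shows "continuous_map (subtopology Y V) euclidean (\<lambda>y. g (f y))"
proof -
  have "continuous_map (subtopology Y V) (subtopology X U) f"
    using f assms(2) by (auto simp: continuous_map_in_subtopology intro: continuous_map_from_subtopology)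
  from continuous_map_compose[OF this assms(1)] show ?thesis by (simp add: o_def)
qed

lemma norm_continuous_pullback:
  assumes L: "norm_continuous_in_charts X E F L"
  shows "norm_continuous_in_charts Y (pullback Y f E) (pullback Y f F) (\<lambda>y. L (f y))" unfolding norm_continuous_in_charts_def
proof (intro ballI, clarify)
  fix V \<sigma> V' \<sigma>' assume "(V, \<sigma>) \<in> charts (pullback Y f E)" "(V', \<sigma>') \<in> charts (pullback Y f F)"
  then obtain U \<tau> U' \<tau>' where *: "(U, \<tau>) \<in> charts E" "V = {y \<in> topspace Y. f y \<in> U}" "\<sigma> = (\<lambda>y. \<tau> (f y))"
    "(U', \<tau>') \<in> charts F" "V' = {y \<in> topspace Y. f y \<in> U'}" "\<sigma>' = (\<lambda>y. \<tau>' (f y))" by (elim pullback_chartE) (rule that)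
  obtain A where A: "continuous_map (subtopology X (U \<inter> U')) euclidean A"
    "!!p x. p \<in> U ==> p \<in> U' ==> L p (\<tau> p x) = \<tau>' p (blinfun_apply (A p) x)" by (rule norm_continuous_in_chartsD[OF L *(1,4)], rule that)
  have "continuous_map (subtopology Y (V \<inter> V')) euclidean (\<lambda>y. A (f y))" by (rule pullback_continuous[OF A(1)]) (auto simp: *)
  thus "\<exists>A. continuous_map (subtopology Y (V \<inter> V')) euclidean A \<and> (\<forall>p\<in>V \<inter> V'. \<forall>x. L (f p) (\<sigma> p x) = \<sigma>' p (blinfun_apply (A p) x))"
    using A(2) by (intro exI[of _ "\<lambda>y. A (f y)"]) (auto simp: *)
qed

lemma f_topspace: "y \<in> topspace Y ==> f y \<in> topspace X" using f by (auto simp: continuous_map_def)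

lemma banach_bundle_pullback:
  assumes E: "banach_bundle X E"
  shows "banach_bundle Y (pullback Y f E)" unfolding banach_bundle_def pullback_simps
proof (intro conjI)
  show "vector_space (fscale E)" "normed_scale (mscale E)" using E by (simp_all add: banach_bundle_def)
  have "norm_continuous_in_charts X E E (\<lambda>p u. u)" using E by (simp add: banach_bundle_def)
  thus "norm_continuous_in_charts Y (pullback Y f E) (pullback Y f E) (\<lambda>p u. u)" by (rule norm_continuous_pullback)
  show "\<forall>(U, \<tau>)\<in>charts (pullback Y f E). openin Y U \<and>
        (\<forall>p\<in>U. Vector_Spaces.linear (mscale E) (fscale E) (\<tau> p) \<and> bij_betw (\<tau> p) UNIV (fibre E (f p)))"
  proof clarify
    fix V \<sigma> assume "(V, \<sigma>) \<in> charts (pullback Y f E)"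
    then obtain U \<tau> where *: "(U, \<tau>) \<in> charts E" "V = {y \<in> topspace Y. f y \<in> U}" "\<sigma> = (\<lambda>y. \<tau> (f y))" by (rule pullback_chartE)
    show "openin Y V \<and> (\<forall>p\<in>V. Vector_Spaces.linear (mscale E) (fscale E) (\<sigma> p) \<and> bij_betw (\<sigma> p) UNIV (fibre E (f p)))"
      using openin_continuous_map_preimage[OF f bb_chart(1)[OF E *(1)]] bb_chart(2,3)[OF E *(1)] by (simp add: *)
  qed
  show "\<Union> (fst ` charts (pullback Y f E)) = topspace Y"
  proof (intro equalityI subsetI)
    fix y assume "y \<in> \<Union> (fst ` charts (pullback Y f E))"
    thus "y \<in> topspace Y" by (auto simp: pullback_charts)
  next
    fix y assume y: "y \<in> topspace Y"
    obtain U \<tau> where *: "(U, \<tau>) \<in> charts E" "f y \<in> U" using bb_cover[OF E f_topspace[OF y]] .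
    show "y \<in> \<Union> (fst ` charts (pullback Y f E))" using y *(2) by (intro UnionI[OF imageI[OF pullback_chart[OF *(1)]]]) auto
  qed
qed

lemma bundle_morphism_pullback: "bundle_morphism X E F L ==> bundle_morphism Y (pullback Y f E) (pullback Y f F) (\<lambda>y. L (f y))"
  unfolding bundle_morphism_def using norm_continuous_pullback[of E F L] f_topspace by simp

lemma csec_pullback:
  assumes s: "continuous_section X E Q s"
  shows "continuous_section Y (pullback Y f E) {y \<in> topspace Y. f y \<in> Q} (\<lambda>y. s (f y))" unfolding continuous_section_def
proof clarify
  fix V \<sigma> assume "(V, \<sigma>) \<in> charts (pullback Y f E)"
  then obtain U \<tau> where *: "(U, \<tau>) \<in> charts E" "V = {y \<in> topspace Y. f y \<in> U}" "\<sigma> = (\<lambda>y. \<tau> (f y))" by (rule pullback_chartE)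
  obtain c where c: "continuous_map (subtopology X (Q \<inter> U)) euclidean c" "\<forall>p\<in>Q \<inter> U. s p = \<tau> p (c p)"
    using s *(1) unfolding continuous_section_def by fast
  have "continuous_map (subtopology Y ({y \<in> topspace Y. f y \<in> Q} \<inter> V)) euclidean (\<lambda>y. c (f y))"
    by (rule pullback_continuous[OF c(1)]) (auto simp: *)
  thus "\<exists>c. continuous_map (subtopology Y ({y \<in> topspace Y. f y \<in> Q} \<inter> V)) euclidean c \<and>
      (\<forall>p\<in>{y \<in> topspace Y. f y \<in> Q} \<inter> V. s (f p) = \<sigma> p (c p))" using c(2) by (intro exI[of _ "\<lambda>y. c (f y)"]) (auto simp: *)
qed

lemma subbundle_pullback:
  fixes E :: "('b, 'k :: {real_normed_field, euclidean_space}, 'v :: ab_group_add, 'm :: banach) bbundle"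
  assumes E: "banach_bundle X E" and W: "fin_dim_subbundle X E W"
  shows "fin_dim_subbundle Y (pullback Y f E) (\<lambda>y. W (f y))"
proof (rule fin_dim_subbundleI[OF banach_bundle_pullback[OF E]])
  fix y assume y: "y \<in> topspace Y"
  have Wb: "vector_bundle X (induced_vbundle X E W)" using W by (simp add: fin_dim_subbundle_def)
  obtain U n e where fr: "(U, n, e) \<in> frames (induced_vbundle X E W)" "f y \<in> U" using vb_cover[OF Wb f_topspace[OF y]] .
  have "continuous_section Y (pullback Y f E) {y \<in> topspace Y. f y \<in> U} (\<lambda>y. e (f y) i)" if "i < n" for i
    using fr(1) that csec_pullback[of E U "\<lambda>p. e p i"] by (simp add: induced_simps)
  thus "\<exists>U n e. y \<in> U \<and> openin Y U \<and> (\<forall>i<n. continuous_section Y (pullback Y f E) U (\<lambda>p. e p i)) \<and>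
      (\<forall>p\<in>U. is_basis (fscale (pullback Y f E)) (W (f p)) n (e p))"
    using fr y openin_continuous_map_preimage[OF f] unfolding induced_simps
    by (intro exI[of _ "{y \<in> topspace Y. f y \<in> U}"] exI[of _ n] exI[of _ "\<lambda>y. e (f y)"]) auto
qed

end

lemma cylinder_compact: "compact_space X ==> compact_space (cylinder X)" "Hausdorff_space X ==> Hausdorff_space (cylinder X)"
  unfolding cylinder_def by (auto simp: compact_space_prod_topology Hausdorff_space_prod_topology Hausdorff_space_subtopology
      intro!: compact_space_subtopology)

lemma topspace_cylinder: "topspace (cylinder X) = topspace X \<times> {0..1}" by (simp add: cylinder_def)

lemma continuous_map_cylinder_fst: "continuous_map (cylinder X) X fst" by (simp add: cylinder_def continuous_map_fst)

lemma continuous_map_cylinder_snd: "continuous_map (cylinder X) euclideanreal snd"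
  using continuous_map_snd[of X "top_of_set {0..1}"] unfolding cylinder_def continuous_map_in_subtopology by blast

lemma continuous_map_incl: "t \<in> {0..1} ==> continuous_map X (cylinder X) (incl t)"
  by (simp add: cylinder_def incl_def[abs_def] continuous_map_pairwise o_def)

text \<open>An equality of records: chart domains lie in \<open>topspace X\<close>, so even they
  come back unchanged. Morphisms and subbundles over the cylinder therefore restrict to slices
  without any identification.\<close>

lemma pullback_slice:
  assumes E: "banach_bundle X E" and t: "t \<in> {0..1}"
  shows "pullback X (incl t) (pullback (cylinder X) fst E) = E"
proof -
  have fst_incl: "fst (incl t p) = p" for p :: 'a by (simp add: incl_def)
  have dom: "{p \<in> topspace X. incl t p \<in> {y \<in> topspace (cylinder X). fst y \<in> U}} = U" if "(U, \<tau>) \<in> charts E" for U \<tau>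
    using openin_subset[OF bb_chart(1)[OF E that]] t by (auto simp: incl_def topspace_cylinder)
  have "charts (pullback X (incl t) (pullback (cylinder X) fst E)) = (\<lambda>x. x) ` charts E" unfolding pullback_charts image_image
  proof (rule image_cong[OF refl])
    fix x assume x: "x \<in> charts E"
    obtain U \<tau> where [simp]: "x = (U, \<tau>)" by (cases x)
    show "(case case x of (U, \<tau>) => ({y \<in> topspace (cylinder X). fst y \<in> U}, \<lambda>y. \<tau> (fst y)) of
        (U, \<tau>) => ({y \<in> topspace X. incl t y \<in> U}, \<lambda>y. \<tau> (incl t y))) = x"
      unfolding \<open>x = (U, \<tau>)\<close> prod.case fst_incl dom[OF x[unfolded \<open>x = (U, \<tau>)\<close>]] by (rule refl)
  qed
  thus ?thesis by (intro bbundle.equality) (simp_all add: fst_incl)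
qed

lemma slice_morphism:
  assumes E: "banach_bundle X E" and F: "banach_bundle X F" and t: "t \<in> {0..1}"
    and H: "bundle_morphism (cylinder X) (pullback (cylinder X) fst E) (pullback (cylinder X) fst F) H"
  shows "bundle_morphism X E F (\<lambda>p. H (p, t))" using bundle_morphism_pullback[OF continuous_map_incl[OF t] H]
  unfolding pullback_slice[OF E t] pullback_slice[OF F t] by (simp add: incl_def)

lemma slice_subbundle:
  assumes E: "banach_bundle X E" and t: "t \<in> {0..1}"
    and W: "fin_dim_subbundle (cylinder X) (pullback (cylinder X) fst E) W"
  shows "fin_dim_subbundle X E (\<lambda>p. W (p, t))"
  using subbundle_pullback[OF continuous_map_incl[OF t] banach_bundle_pullback[OF continuous_map_cylinder_fst E] W]
  unfolding pullback_slice[OF E t] by (simp add: incl_def)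

text \<open>At an entry \<open>c i\<close> of largest norm, row \<open>i\<close> of the equation
  gives \<open>norm (c i) \<le> q * norm (c i)\<close> with \<open>q < 1\<close>.\<close>

lemma near_identity_kernel:
  fixes a :: "nat => nat => 'k::real_normed_field"
  assumes a: "(\<Sum>i<n. \<Sum>j<n. norm (a i j - (if i = j then 1 else 0))) < 1"
    and c: "!!i. i < n ==> (\<Sum>j<n. a i j * c j) = 0" and "j < n"
  shows "c j = 0"
proof -
  define M where "M = Max ((\<lambda>j. norm (c j)) ` {..<n})"
  have ne: "(\<lambda>j. norm (c j)) ` {..<n} \<noteq> {}" using \<open>j < n\<close> by auto
  have M: "norm (c j) \<le> M" if "j < n" for j unfolding M_def using that by (intro Max_ge) auto
  have "M \<in> (\<lambda>j. norm (c j)) ` {..<n}" unfolding M_def by (rule Max_in[OF _ ne]) simp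
  then obtain i where i: "i < n" "norm (c i) = M" by auto
  have M0: "M \<ge> 0" unfolding i(2)[symmetric] by simp
  have "(\<Sum>j<n. (a i j - (if i = j then 1 else 0)) * c j) = (\<Sum>j<n. a i j * c j) - (\<Sum>j<n. (if i = j then 1 else 0) * c j)"
    by (simp add: left_diff_distrib sum_subtractf)
  also have "(\<Sum>j<n. (if i = j then 1 else 0) * c j) = c i" using i(1) by (simp add: if_distrib[of "\<lambda>x. x * _"] cong: if_cong)
  finally have "c i = - (\<Sum>j<n. (a i j - (if i = j then 1 else 0)) * c j)" using c[OF i(1)] by simp
  hence "M \<le> (\<Sum>j<n. norm ((a i j - (if i = j then 1 else 0)) * c j))"
    unfolding i(2)[symmetric] by (simp only: norm_minus_cancel norm_sum)
  also have "\<dots> \<le> (\<Sum>j<n. norm (a i j - (if i = j then 1 else 0)) * M)"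
    unfolding norm_mult using M by (intro sum_mono mult_left_mono) auto
  also have "\<dots> = (\<Sum>j<n. norm (a i j - (if i = j then 1 else 0))) * M" by (rule sum_distrib_right[symmetric])
  also have "\<dots> \<le> (\<Sum>i<n. \<Sum>j<n. norm (a i j - (if i = j then 1 else 0))) * M"
    by (intro mult_right_mono M0 member_le_sum[where f = "\<lambda>i. \<Sum>j<n. norm (a i j - (if i = j then 1 else 0))"])
      (use i(1) in \<open>auto intro: sum_nonneg\<close>)
  finally have "M \<le> (\<Sum>i<n. \<Sum>j<n. norm (a i j - (if i = j then 1 else 0))) * M" .
  hence "M \<le> 0" using a M0 by (smt (verit, best) mult_le_cancel_right1)
  hence "norm (c j) \<le> 0" using M[OF \<open>j < n\<close>] by linarith
  thus ?thesis by simp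
qed

text \<open>Equal dimensions make an injective map onto. Since \<open>f\<close> is linear on
  \<open>A\<close> only, the count is made with explicit bases.\<close>

lemma inj_basis_image:
  assumes s: "vector_space s" and t: "vector_space t"
    and e: "is_basis s A n e" and e': "is_basis t B n e'" and f: "linear_between s t A B f"
    and inj: "!!c. f (\<Sum>i<n. s (c i) (e i)) = 0 ==> \<forall>i<n. c i = 0"
  shows "f ` A = B"
proof -
  interpret s: vector_space s by (rule s)
  interpret t: vector_space t by (rule t)
  have A: "A = {\<Sum>i<n. s (c i) (e i) |c. True}" and B: "t.span (e' ` {..<n}) = B" "inj_on e' {..<n}"
    using e e' unfolding s.is_basis_iff by (auto simp: is_basis_def)
  have eA: "e i \<in> A" if "i < n" for i using e that unfolding is_basis_def by (auto intro: s.span_base)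
  have comb: "f (\<Sum>i<n. s (c i) (e i)) = (\<Sum>i<n. t (c i) (f (e i)))" for c
    by (rule linear_between_comb[OF s t s.is_basis_subspace[OF e] f]) (rule eA)
  have "lin_indep t n (\<lambda>i. f (e i))" using inj unfolding lin_indep_def comb by blast
  hence ind: "inj_on (\<lambda>i. f (e i)) {..<n}" "t.independent ((\<lambda>i. f (e i)) ` {..<n})" unfolding t.lin_indep_iff by auto
  have sub: "(\<lambda>i. f (e i)) ` {..<n} \<subseteq> t.span (e' ` {..<n})" unfolding B using linear_betweenD(1)[OF f] eA by auto
  have "B \<subseteq> t.span ((\<lambda>i. f (e i)) ` {..<n})"
  proof (rule subsetI, rule ccontr)
    fix y assume y: "y \<in> B" "y \<notin> t.span ((\<lambda>i. f (e i)) ` {..<n})"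
    have i: "t.independent (insert y ((\<lambda>i. f (e i)) ` {..<n}))" by (rule t.independent_insertI[OF y(2) ind(2)])
    have "insert y ((\<lambda>i. f (e i)) ` {..<n}) \<subseteq> t.span (e' ` {..<n})" using sub y(1) B(1) by simp
    from t.independent_span_bound[OF _ i this]
    have "card (insert y ((\<lambda>i. f (e i)) ` {..<n})) \<le> n" using B(2) by (simp add: card_image)
    moreover have "y \<notin> (\<lambda>i. f (e i)) ` {..<n}" using y(2) t.span_base[of y "(\<lambda>i. f (e i)) ` {..<n}"] by blast
    ultimately show False using ind(1) by (simp add: card_image)
  qed
  also have "\<dots> = f ` A" unfolding t.span_image_lessThan A comb[symmetric] by blast
  finally show ?thesis using linear_betweenD(1)[OF f] by blast
qed

context
  fixes X :: "'b topology"
    and E :: "('b, 'k :: {real_normed_field, euclidean_space}, 'v :: ab_group_add, 'm :: banach) bbundle"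
    and W :: "'b \<times> real => 'v set"
  assumes X: "compact_space X" "Hausdorff_space X" and E: "banach_bundle X E"
    and W: "fin_dim_subbundle (cylinder X) (pullback (cylinder X) fst E) W"
begin

interpretation e: vector_space "fscale E" by (rule bb_vs[OF E])

text \<open>In a local frame of \<open>W\<close> the projection has a matrix that is continuous over
  the cylinder and equal to the identity at \<open>(p0, t0)\<close>. Matrices near the identity are
  injective, and both slices have rank \<open>n\<close> there.\<close>

lemma slice_bijective_local:
  assumes t0: "t0 \<in> {0..1}" and p0: "p0 \<in> topspace X" and P: "bundle_morphism X E E P"
    and Pm: "!!p u. p \<in> topspace X ==> u \<in> fibre E p ==> P p u \<in> W (p, t0)"
    and Pi: "!!p u. p \<in> topspace X ==> u \<in> W (p, t0) ==> P p u = u"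
  shows "\<exists>U \<epsilon>. openin X U \<and> p0 \<in> U \<and> \<epsilon> > 0 \<and> (\<forall>p\<in>U. \<forall>r. \<bar>r\<bar> < \<epsilon> --> t0 + r \<in> {0..1} -->
    (\<forall>u\<in>W (p, t0 + r). P p u = 0 --> u = 0) \<and> P p ` W (p, t0 + r) = W (p, t0))"
proof -
  let ?Y = "cylinder X" and ?E = "pullback (cylinder X) fst E"
  note fstc = continuous_map_cylinder_fst[of X]
  have EY: "banach_bundle ?Y ?E" by (rule banach_bundle_pullback[OF fstc E])
  have Wb: "vector_bundle ?Y (induced_vbundle ?Y ?E W)" and Wsub: "!!y. y \<in> topspace ?Y ==> W y \<subseteq> fibre E (fst y)"
    using W by (auto simp: fin_dim_subbundle_def)
  have y0: "(p0, t0) \<in> topspace ?Y" using p0 t0 by (simp add: topspace_cylinder)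
  obtain U1 \<tau> where c: "(U1, \<tau>) \<in> charts E" "p0 \<in> U1" using bb_cover[OF E p0] .
  define C where "C = {y \<in> topspace ?Y. fst y \<in> U1}"
  have c': "(C, \<lambda>y. \<tau> (fst y)) \<in> charts ?E" unfolding C_def by (rule pullback_chart[OF c(1)])
  have y0C: "(p0, t0) \<in> C" using y0 c(2) by (simp add: C_def)
  obtain Q n e where fr: "(Q, n, e) \<in> frames (induced_vbundle ?Y ?E W)" "(p0, t0) \<in> Q" using vb_cover[OF Wb y0] .
  have eb: "is_basis (fscale E) (W y) n (e y)" if "y \<in> Q" for y using fr(1) that by (simp add: induced_simps)
  obtain O' \<alpha> where O': "openin ?Y O'" "(p0, t0) \<in> O'" "O' \<subseteq> Q" "O' \<subseteq> C" "!!i. conton ?Y O' (\<alpha> i :: 'b \<times> real => 'm \<Rightarrow>\<^sub>L 'k)"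
    "!!i y c x. i < n ==> y \<in> O' ==> \<tau> (fst y) x = (\<Sum>i<n. fscale E (c i) (e y i)) ==> \<alpha> i y x = c i"
    by (rule frame_functionals[OF EY fr c' y0C], rule that) auto
  obtain w where w: "!!i. i < n ==> conton ?Y (Q \<inter> C) (w i)" "!!i y. i < n ==> y \<in> Q ==> y \<in> C ==> e y i = \<tau> (fst y) (w i y)"
    by (rule frame_local[OF EY fr(1) c'], rule that)
  obtain V B where V: "openin X V" "p0 \<in> V" "V \<subseteq> U1" "conton X V B" "!!q x. q \<in> V ==> P q (\<tau> q x) = \<tau> q (blinfun_apply (B q) x)"
    by (rule nmor_on_charts[OF E E bundle_morphismD(1)[OF E E P] p0 c c], rule that)
  \<comment> \<open>The retraction onto the slice at \<open>t0\<close>: images under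
    \<open>P\<close> lie in this slice, so their coefficients are taken in the frame at
    \<open>r y\<close>.\<close>
  define r :: "'b \<times> real => 'b \<times> real" where "r y = (fst y, t0)" for y
  have rc: "continuous_map ?Y ?Y r"
    using continuous_map_compose[OF fstc continuous_map_incl[OF t0]] by (simp add: o_def incl_def r_def[abs_def])
  define D where "D = {y \<in> topspace ?Y. fst y \<in> V} \<inter> O' \<inter> {y \<in> topspace ?Y. r y \<in> O'}"
  have D: "openin ?Y D" unfolding D_def
    by (intro openin_Int O'(1) openin_continuous_map_preimage[OF fstc V(1)] openin_continuous_map_preimage[OF rc O'(1)])
  have Dp: "(p0, t0) \<in> D" using y0 V(2) O'(2) by (simp add: D_def r_def)
  define a where "a i j y = \<alpha> i (r y) (B (fst y) (w j y))" for i j y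
  have ca: "conton ?Y D (a i j)" if ij: "i < n" "j < n" for i j
  proof -
    have "conton ?Y {y \<in> topspace ?Y. r y \<in> O'} (\<lambda>y. \<alpha> i (r y))" by (rule conton_compose[OF rc O'(5,1)])
    hence "conton ?Y D (\<lambda>y. \<alpha> i (r y))" by (rule conton_subset) (auto simp: D_def)
    moreover have "conton ?Y {y \<in> topspace ?Y. fst y \<in> V} (\<lambda>y. B (fst y))" by (rule conton_compose[OF fstc V(4,1)])
    hence "conton ?Y D (\<lambda>y. B (fst y))" by (rule conton_subset) (auto simp: D_def)
    moreover have "conton ?Y D (w j)" by (rule conton_subset[OF w(1)[OF ij(2)]]) (use O'(3,4) in \<open>auto simp: D_def\<close>)
    ultimately show ?thesis unfolding a_def[abs_def] by (intro conton_blinfun_apply)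
  qed
  have comb: "P (fst y) (\<Sum>j<n. fscale E (c j) (e y j)) = \<tau> (fst y) (B (fst y) (\<Sum>j<n. mscale E (c j) (w j y)))"
    if y: "y \<in> D" for y c
  proof -
    have q: "fst y \<in> V" "fst y \<in> U1" "y \<in> Q" "y \<in> C" using y V(3) O'(3,4) by (auto simp: D_def)
    have "(\<Sum>j<n. fscale E (c j) (e y j)) = \<tau> (fst y) (\<Sum>j<n. mscale E (c j) (w j y))"
      unfolding chart_comb[OF E c(1) q(2)] using w(2)[OF _ q(3,4)] by (intro sum.cong) auto
    thus ?thesis using V(5)[OF q(1)] by simp
  qed
  interpret m: kspace "mscale E" by (rule bb_kspace[OF E])
  have kB: "klin (mscale E) (mscale E) (B q)" if q: "q \<in> V" for q
  proof -
    have q': "q \<in> U1" "q \<in> topspace X" using q V(3) openin_subset[OF V(1)] by auto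
    show ?thesis by (rule local_klin[OF E E c(1) q'(1) c(1) q'(1) V(5)[OF q] bundle_morphismD(2)[OF E E P q'(2)]])
  qed
  \<comment> \<open>The distance of the matrix from the identity; the open set
    \<open>g y < 1\<close> is where \<open>near_identity_kernel\<close> applies.\<close>
  define g where "g y = (\<Sum>i<n. \<Sum>j<n. norm (a i j y - (if i = j then 1 else 0)))" for y
  have cg: "conton ?Y D g" unfolding g_def[abs_def]
    by (intro conton_sum) (use ca in \<open>auto simp: conton_def intro!: tendsto_norm tendsto_diff\<close>)
  have g0: "g (p0, t0) = 0"
  proof -
    have yQ: "(p0, t0) \<in> Q" "(p0, t0) \<in> C" using O' by auto
    have "a i j (p0, t0) = (if i = j then 1 else 0)" if ij: "i < n" "j < n" for i j
    proof -
      have ej: "e (p0, t0) j \<in> W (p0, t0)" using eb[OF yQ(1)] ij(2) unfolding is_basis_def by (auto intro: e.span_base)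
      have s: "(\<Sum>i<n. fscale E (if i = j then 1 else 0) (e (p0, t0) i)) = e (p0, t0) j"
        using e.sum_scale_single[OF ij(2), of 1] by simp
      have "\<tau> p0 (B p0 (w j (p0, t0))) = P p0 (e (p0, t0) j)" using V(5)[OF V(2)] w(2)[OF ij(2) yQ] by simp
      also have "\<dots> = (\<Sum>i<n. fscale E (if i = j then 1 else 0) (e (p0, t0) i))" unfolding s by (rule Pi[OF p0 ej])
      finally have "\<alpha> i (p0, t0) (B p0 (w j (p0, t0))) = (if i = j then 1 else 0)" using O'(6)[OF ij(1) O'(2)] by simp
      thus ?thesis by (simp add: a_def r_def)
    qed
    thus ?thesis by (simp add: g_def)
  qed
  define D' where "D' = {y \<in> D. g y < 1}"
  have "openin (subtopology ?Y D) {y \<in> topspace (subtopology ?Y D). g y \<in> {..<1}}"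
    by (rule openin_continuous_map_preimage[of _ euclideanreal]) (use cg conton_iff[OF D] in auto)
  moreover have "{y \<in> topspace (subtopology ?Y D). g y \<in> {..<1}} = D'" using openin_subset[OF D] by (auto simp: D'_def)
  ultimately have D': "openin ?Y D'" using openin_open_subtopology[OF D] by auto
  have good: "(\<forall>u\<in>W y. P (fst y) u = 0 --> u = 0) \<and> P (fst y) ` W y = W (fst y, t0)" if y: "y \<in> D'" for y
  proof -
    have yD: "y \<in> D" and gy: "g y < 1" using y by (auto simp: D'_def)
    have yT: "y \<in> topspace ?Y" "fst y \<in> topspace X" using yD openin_subset[OF D] by (auto simp: topspace_cylinder)
    have q: "fst y \<in> V" "fst y \<in> U1" "y \<in> Q" "r y \<in> Q" "r y \<in> O'" using yD V(3) O'(3) by (auto simp: D_def)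
    have inj: "\<forall>i<n. c i = 0" if 0: "P (fst y) (\<Sum>j<n. fscale E (c j) (e y j)) = 0" for c
    proof (intro allI impI)
      fix j assume j: "j < n"
      have "\<tau> (fst y) (B (fst y) (\<Sum>j<n. mscale E (c j) (w j y))) = 0" using 0 unfolding comb[OF yD] .
      hence "B (fst y) (\<Sum>j<n. mscale E (c j) (w j y)) = 0" unfolding chart_eq_0[OF E c(1) q(2)] .
      hence B0: "(\<Sum>j<n. mscale E (c j) (B (fst y) (w j y))) = 0" using kB[OF q(1)] by (simp add: blinfun.sum_right klin_def)
      have z: "(\<Sum>j<n. a i j y * c j) = 0" if i: "i < n" for i
      proof -
        have Be: "\<exists>b. \<tau> (fst y) (B (fst y) (w j y)) = (\<Sum>i<n. fscale E (b i) (e (r y) i))" if j: "j < n" for j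
        proof -
          have "\<tau> (fst y) (B (fst y) (w j y)) = P (fst y) (\<tau> (fst y) (w j y))" using V(5)[OF q(1)] by simp
          also have "\<dots> \<in> W (r y)" unfolding r_def by (rule Pm[OF yT(2) chart_mem[OF E c(1) q(2)]])
          finally show ?thesis using eb[OF q(4)] unfolding e.is_basis_iff by auto
        qed
        then obtain b where b: "!!j. j < n ==> \<tau> (fst y) (B (fst y) (w j y)) = (\<Sum>i<n. fscale E (b j i) (e (r y) i))" by metis
        have ab: "a i' j y = b j i'" if "i' < n" "j < n" for i' j
          unfolding a_def using O'(6)[OF that(1) q(5), of "B (fst y) (w j y)" "b j"] b[OF that(2)] by (simp add: r_def)
        have "0 = \<tau> (fst y) (\<Sum>j<n. mscale E (c j) (B (fst y) (w j y)))" unfolding B0 using chart_0[OF E c(1) q(2)] by simp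
        also have "\<dots> = (\<Sum>j<n. fscale E (c j) (\<Sum>i<n. fscale E (b j i) (e (r y) i)))"
          unfolding chart_comb[OF E c(1) q(2)] using b by (intro sum.cong) auto
        also have "\<dots> = (\<Sum>i<n. fscale E (\<Sum>j<n. b j i * c j) (e (r y) i))"
          unfolding e.scale_sum_right e.scale_sum_left by (subst sum.swap) (simp add: mult.commute)
        finally have "(\<Sum>i<n. fscale E (\<Sum>j<n. b j i * c j) (e (r y) i)) = 0" by simp
        moreover have "lin_indep (fscale E) n (e (r y))" using eb[OF q(4)] unfolding e.is_basis_iff by blast
        ultimately have "(\<Sum>j<n. b j i * c j) = 0" using i lin_indepD by fast
        thus ?thesis using ab[OF i] by simp
      qed
      show "c j = 0" by (rule near_identity_kernel[where a = "\<lambda>i j. a i j y" and n = n and c = c, OF gy[unfolded g_def] z j])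
    qed
    have "P (fst y) ` W y = W (r y)"
    proof (rule inj_basis_image[OF e.vector_space_axioms e.vector_space_axioms eb[OF q(3)] eb[OF q(4)] _ inj])
      show "linear_between (fscale E) (fscale E) (W y) (W (r y)) (P (fst y))"
        using bundle_morphismD(2)[OF E E P yT(2)] Wsub[OF yT(1)] Pm[OF yT(2)] unfolding linear_between_def r_def by blast
    qed
    moreover have "u = 0" if u: "u \<in> W y" "P (fst y) u = 0" for u
    proof -
      obtain c where c: "u = (\<Sum>j<n. fscale E (c j) (e y j))" using u(1) eb[OF q(3)] unfolding e.is_basis_iff by blast
      show ?thesis using inj[OF u(2)[unfolded c]] unfolding c by (intro sum.neutral) simp
    qed
    ultimately show ?thesis by (simp add: r_def)
  qed
  have "(p0, t0) \<in> D'" using Dp g0 by (simp add: D'_def)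
  with D'[unfolded cylinder_def openin_prod_topology_alt]
  have "\<exists>U J. openin X U \<and> openin (top_of_set {0..1}) J \<and> p0 \<in> U \<and> t0 \<in> J \<and> U \<times> J \<subseteq> D'" by (elim allE impE)
  then obtain U J where UJ: "openin X U" "openin (top_of_set {0..1}) J" "p0 \<in> U" "t0 \<in> J" "U \<times> J \<subseteq> D'" by (elim exE conjE) (rule that)
  obtain \<epsilon> where \<epsilon>: "\<epsilon> > 0" "ball t0 \<epsilon> \<inter> {0..1} \<subseteq> J" using UJ(2,4) unfolding openin_contains_ball by blast
  have "(p, t0 + r) \<in> D'" if "p \<in> U" "\<bar>r\<bar> < \<epsilon>" "t0 + r \<in> {0..1}" for p r
  proof -
    have "t0 + r \<in> J" using \<epsilon>(2) that(2,3) by (auto simp: dist_real_def)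
    thus ?thesis using UJ(5) that(1) by blast
  qed
  thus ?thesis using UJ(1,3) \<epsilon>(1) good by (intro exI[of _ U] exI[of _ \<epsilon>]) force
qed

text \<open>Nearby slices are isomorphic, and the interval is connected. The projection onto a slice
  is the one of \<open>index_projection\<close> for the identity morphism, whose index space is the
  slice itself.\<close>

lemma slices_isomorphic:
  assumes "s \<in> {0..1}" "t \<in> {0..1}"
  shows "vb_iso X (induced_vbundle X E (\<lambda>p. W (p, s))) (induced_vbundle X E (\<lambda>p. W (p, t)))"
proof (rule connected_equivalence_relation[of "{0..1::real}" s t, OF _ assms])
  note Wt = slice_subbundle[OF E _ W]
  have id: "bundle_morphism X E E (\<lambda>p u. u)" using E by (auto simp: bundle_morphism_def linear_between_def banach_bundle_def)
  have sing: "{u \<in> fibre E p. u = 0} = {0}" if "p \<in> topspace X" for p using e.subspace_0[OF bb_subspace[OF E that]] by auto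
  have ker: "fin_dim (fscale E) {u \<in> fibre E p. u = 0}" if "p \<in> topspace X" for p
    unfolding sing[OF that] fin_dim_def by (intro exI[of _ "{}"]) (simp add: e.span_empty)
  fix t0 :: real assume t0: "t0 \<in> {0..1}"
  have sub: "W (p, t0) \<subseteq> fibre E p" if "p \<in> topspace X" for p using Wt[OF t0] that by (auto simp: fin_dim_subbundle_def)
  have "{y + v |y v. y \<in> (\<lambda>u. u) ` fibre E p \<and> v \<in> W (p, t0)} = fibre E p" if p: "p \<in> topspace X" for p
  proof (intro Set.set_eqI iffI)
    fix z
    assume "z \<in> {y + v |y v. y \<in> (\<lambda>u. u) ` fibre E p \<and> v \<in> W (p, t0)}"
    thus "z \<in> fibre E p" using sub[OF p] e.subspace_add[OF bb_subspace[OF E p]] by auto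
  next
    fix z assume "z \<in> fibre E p"
    moreover have "0 \<in> W (p, t0)" using e.subspace_0 vb_subspace[of X "induced_vbundle X E (\<lambda>p. W (p, t0))", OF _ p] Wt[OF t0]
      by (simp add: fin_dim_subbundle_def induced_simps)
    ultimately show "z \<in> {y + v |y v. y \<in> (\<lambda>u. u) ` fibre E p \<and> v \<in> W (p, t0)}" by force
  qed
  hence tr: "transversal_subbundle X E E (\<lambda>p u. u) (\<lambda>p. W (p, t0))" using Wt[OF t0] by (simp add: transversal_subbundle_def)
  have ix: "index_space E (\<lambda>p u. u) (\<lambda>p. W (p, t0)) p = W (p, t0)" if "p \<in> topspace X" for p
    using sub[OF that] by (auto simp: index_space_def)
  obtain P where P: "bundle_morphism X E E P"
    "!!p u. p \<in> topspace X ==> u \<in> fibre E p ==> P p u \<in> index_space E (\<lambda>p u. u) (\<lambda>p. W (p, t0)) p"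
    "!!p u. p \<in> topspace X ==> u \<in> index_space E (\<lambda>p u. u) (\<lambda>p. W (p, t0)) p ==> P p u = u"
    by (rule index_projection[OF X E E id ker tr], assumption, rule that)
  have P': "P p u \<in> W (p, t0)" if "p \<in> topspace X" "u \<in> fibre E p" for p u using P(2)[OF that] ix[OF that(1)] by simp
  have P'': "P p u = u" if "p \<in> topspace X" "u \<in> W (p, t0)" for p u using P(3)[OF that(1)] ix[OF that(1)] that(2) by simp
  obtain \<epsilon> where \<epsilon>: "\<epsilon> > 0" "!!p r. p \<in> topspace X ==> \<bar>r\<bar> < \<epsilon> ==> t0 + r \<in> {0..1} -->
    (\<forall>u\<in>W (p, t0 + r). P p u = 0 --> u = 0) \<and> P p ` W (p, t0 + r) = W (p, t0)"
    by (rule compact_uniform[OF X(1), of "\<lambda>p r. t0 + r \<in> {0..1} -->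
      (\<forall>u\<in>W (p, t0 + r). P p u = 0 --> u = 0) \<and> P p ` W (p, t0 + r) = W (p, t0)"],
      rule slice_bijective_local[OF t0 _ P(1) P' P''], assumption+, rule that)
  have "vb_iso X (induced_vbundle X E (\<lambda>p. W (p, t0))) (induced_vbundle X E (\<lambda>p. W (p, t)))"
    if t: "t \<in> {0..1}" "dist t0 t < \<epsilon>" for t
  proof (rule vb_iso_sym, rule vb_iso_induced[OF E])
    have g: "(\<forall>u\<in>W (p, t). P p u = 0 --> u = 0) \<and> P p ` W (p, t) = W (p, t0)" if "p \<in> topspace X" for p
      using \<epsilon>(2)[OF that, of "t - t0"] t by (auto simp: dist_real_def)
    show "vector_bundle X (induced_vbundle X E (\<lambda>p. W (p, t)))" using Wt[OF t(1)] by (simp add: fin_dim_subbundle_def)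
    show "vmor X (induced_vbundle X E (\<lambda>p. W (p, t))) E P" by (rule vmor_compose[OF E E vmor_induced[OF E Wt[OF t(1)]] P(1)])
    show "z = 0" if "p \<in> topspace X" "z \<in> vfibre (induced_vbundle X E (\<lambda>p. W (p, t))) p" "P p z = 0" for p z
      using g[OF that(1)] that(2,3) by (simp add: induced_simps)
    show "P p ` vfibre (induced_vbundle X E (\<lambda>p. W (p, t))) p = W (p, t0)" if "p \<in> topspace X" for p
      using g[OF that] by (simp add: induced_simps)
  qed (rule Wt[OF t0])
  thus "\<exists>T. openin (top_of_set {0..1}) T \<and> t0 \<in> T \<and>
      (\<forall>t\<in>T. vb_iso X (induced_vbundle X E (\<lambda>p. W (p, t0))) (induced_vbundle X E (\<lambda>p. W (p, t))))"
    using t0 \<epsilon>(1) by (intro exI[of _ "{0..1} \<inter> ball t0 \<epsilon>"]) (auto simp: openin_open)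
qed (auto intro: vb_iso_sym vb_iso_trans)

end

section \<open>Passage between the index and the homotopy\<close>

section \<open>Fredholm maps of index zero\<close>

lemma (in vector_space) span_disjoint:
  assumes S: "independent S" and AB: "A \<subseteq> S" "B \<subseteq> S" "A \<inter> B = {}" and x: "x \<in> span A" "x \<in> span B"
  shows "x = 0"
proof -
  have "representation S x = representation A x" "representation S x = representation B x"
    using representation_extend[OF S] x AB by blast+
  hence "representation S x b = 0" for b using AB(3) representation_ne_zero[of A x b] representation_ne_zero[of B x b] by auto
  moreover have "x \<in> span S" using x(1) span_mono[OF AB(1)] by blast
  ultimately show ?thesis using sum_nonzero_representation_eq[OF S, of x] by simp
qed

text \<open>Between the preimage of \<open>W\<close> and \<open>W\<close>, both of dimension
  \<open>n\<close>, kernel and cokernel of \<open>H\<close> have the same dimension. As the image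
  and \<open>W\<close> together fill \<open>B\<close>, a complement of the image can be found inside
  \<open>W\<close>.\<close>

lemma fredholm_index_zero:
  fixes n :: nat
  assumes s: "vector_space s" and t: "vector_space t" and A: "module.subspace s A" and H: "linear_between s t A B H"
    and W: "W \<subseteq> B" and B: "module.subspace t B" and span: "!!z. z \<in> B ==> \<exists>u\<in>A. \<exists>v\<in>W. z = H u + v"
    and e: "is_basis s {u \<in> A. H u \<in> W} n e" and w: "is_basis t W n w"
  shows "fredholm_of_index s t A B H 0"
proof -
  interpret s: vector_space s by (rule s)
  interpret t: vector_space t by (rule t)
  interpret st: vector_space_pair s t ..
  note Hl = linear_betweenD[OF H]
  define I where "I = {u \<in> A. H u \<in> W}"
  have I: "s.subspace I" and Wsub: "t.subspace W" unfolding I_def by (rule s.is_basis_subspace[OF e], rule t.is_basis_subspace[OF w])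
  have dI: "s.dim I = n" and dW: "t.dim W = n" unfolding I_def by (rule s.is_basis_dim[OF e], rule t.is_basis_dim[OF w])
  have fI: "finite S" if "s.independent S" "S \<subseteq> I" for S
  proof -
    have "I = s.span (e ` {..<n})" using e by (simp add: is_basis_def I_def)
    thus ?thesis using s.independent_span_bound[OF _ that(1), of "e ` {..<n}"] that(2) by simp
  qed
  have fW: "finite S" if "t.independent S" "S \<subseteq> W" for S
  proof -
    have "W = t.span (w ` {..<n})" using w by (simp add: is_basis_def)
    thus ?thesis using t.independent_span_bound[OF _ that(1), of "w ` {..<n}"] that(2) by simp
  qed
  define K where "K = {u \<in> A. H u = 0}"
  have K: "s.subspace K"
  proof (rule s.subspaceI)
    have "H (s 0 0) = t 0 (H 0)" by (rule Hl(3)[OF s.subspace_0[OF A]])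
    thus "0 \<in> K" using s.subspace_0[OF A] by (simp add: K_def)
    show "x + y \<in> K" if "x \<in> K" "y \<in> K" for x y using that Hl(2) s.subspace_add[OF A] by (simp add: K_def)
    show "s c x \<in> K" if "x \<in> K" for c x using that Hl(3) s.subspace_scale[OF A] by (simp add: K_def)
  qed
  have KI: "K \<subseteq> I" using t.subspace_0[OF Wsub] by (auto simp: K_def I_def)
  obtain B0 where B0: "B0 \<subseteq> K" "s.independent B0" "K \<subseteq> s.span B0" by (rule s.maximal_independent_subset[of K])
  have KB: "K = s.span B0" using B0(3) s.span_minimal[OF B0(1) K] by blast
  obtain BI where BI: "B0 \<subseteq> BI" "BI \<subseteq> I" "s.independent BI" "I \<subseteq> s.span BI"
    by (rule s.maximal_independent_subset_extend[OF order_trans[OF B0(1) KI] B0(2)])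
  have IB: "I = s.span BI" using BI(4) s.span_minimal[OF BI(2) I] by blast
  have fBI: "finite BI" "finite B0" using fI[OF BI(3,2)] BI(1) finite_subset by auto
  have cBI: "card BI = n" using dI s.dim_span_eq_card_independent[OF BI(3)] IB by simp
  \<comment> \<open>\<open>H\<close> is linear on \<open>A\<close> only; \<open>g\<close> is linear
    everywhere and agrees with \<open>H\<close> on \<open>I\<close>.\<close>
  obtain g where g: "Vector_Spaces.linear s t g" "!!x. x \<in> BI ==> g x = H x" using st.linear_independent_extend[OF BI(3), of H] by auto
  interpret g: Vector_Spaces.linear s t g by (rule g(1))
  have "s.span BI \<subseteq> {u \<in> I. g u = H u}"
  proof (rule s.span_minimal)
    show "BI \<subseteq> {u \<in> I. g u = H u}" using BI(2) g(2) by auto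
    show "s.subspace {u \<in> I. g u = H u}"
    proof (rule s.subspaceI)
      have "0 \<in> K" by (rule s.subspace_0[OF K])
      thus "0 \<in> {u \<in> I. g u = H u}" using s.subspace_0[OF I] by (simp add: K_def)
      show "x + y \<in> {u \<in> I. g u = H u}" if "x \<in> {u \<in> I. g u = H u}" "y \<in> {u \<in> I. g u = H u}" for x y
        using that s.subspace_add[OF I] Hl(2) by (simp add: g.add I_def)
      show "s c x \<in> {u \<in> I. g u = H u}" if "x \<in> {u \<in> I. g u = H u}" for c x
        using that s.subspace_scale[OF I] Hl(3) by (simp add: g.scale I_def)
    qed
  qed
  hence gH: "g u = H u" if "u \<in> I" for u using that IB by blast
  \<comment> \<open>A basis of \<open>I\<close> modulo the kernel. Its image is independent and
    extends to a basis \<open>D\<close> of \<open>W\<close>; the added vectors span the complement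
    \<open>C\<close>.\<close>
  define N where "N = BI - B0"
  have N: "N \<subseteq> BI" "N \<inter> B0 = {}" "s.independent N" "s.span N \<subseteq> I"
    using BI(3) s.span_minimal[OF _ I, of N] BI(2) s.independent_mono[OF BI(3)] by (auto simp: N_def)
  have "inj_on g (s.span N)"
  proof (rule iffD2[OF g.inj_on_iff_eq_0[OF s.subspace_span]], intro ballI impI)
    fix x assume x: "x \<in> s.span N" "g x = 0"
    hence "x \<in> K" using gH[of x] N(4) by (auto simp: K_def I_def)
    thus "x = 0" using s.span_disjoint[OF BI(3) N(1) BI(1) N(2) x(1)] KB by simp
  qed
  hence M: "t.independent (g ` N)" "inj_on g N" using g.independent_inj_on_image[OF N(3)] inj_on_subset[OF _ s.span_superset] by blast+
  have "g u \<in> W" if "u \<in> I" for u using gH[OF that] that by (simp add: I_def)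
  hence MW: "g ` N \<subseteq> W" using N(1) BI(2) by blast
  obtain D where D: "g ` N \<subseteq> D" "D \<subseteq> W" "t.independent D" "W \<subseteq> t.span D" by (rule t.maximal_independent_subset_extend[OF MW M(1)])
  have WD: "W = t.span D" using D(4) t.span_minimal[OF D(2) Wsub] by blast
  have fD: "finite D" by (rule fW[OF D(3,2)])
  have cD: "card D = n" using dW t.dim_span_eq_card_independent[OF D(3)] WD by simp
  define C where "C = t.span (D - g ` N)"
  have CW: "C \<subseteq> W" unfolding C_def by (rule t.span_minimal[OF _ Wsub]) (use D(2) in blast)
  have "card (D - g ` N) = n - card N" using card_Diff_subset[OF finite_subset[OF D(1) fD] D(1)] card_image[OF M(2)] cD by simp
  also have "card N = n - card B0" unfolding N_def using card_Diff_subset[OF fBI(2) BI(1)] cBI by simp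
  also have "n - (n - card B0) = card B0" using card_mono[OF fBI(1) BI(1)] cBI by simp
  finally have card: "card (D - g ` N) = card B0" .
  have dims: "t.dim C = s.dim K" unfolding C_def KB t.dim_span_eq_card_independent[OF t.independent_mono[OF D(3) Diff_subset]]
      s.dim_span_eq_card_independent[OF B0(2)] by (rule card)
  have gM: "g u \<in> t.span (g ` N)" if "u \<in> I" for u
  proof -
    have "g ` BI \<subseteq> insert 0 (g ` N)"
    proof
      fix z assume "z \<in> g ` BI"
      then obtain b where b: "b \<in> BI" "z = g b" by blast
      show "z \<in> insert 0 (g ` N)"
      proof (cases "b \<in> B0")
        case True
        hence "H b = 0" using B0(1) by (auto simp: K_def)
        thus ?thesis using g(2)[OF b(1)] b(2) by simp
      qed (use b in \<open>auto simp: N_def\<close>)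
    qed
    hence "t.span (g ` BI) \<subseteq> t.span (insert 0 (g ` N))" by (rule t.span_mono)
    moreover have "g u \<in> t.span (g ` BI)" using that IB g.span_image[of BI] by auto
    ultimately show ?thesis by auto
  qed
  show ?thesis unfolding fredholm_of_index_def
  proof (intro conjI exI[of _ C])
    show "fin_dim s {u \<in> A. H u = 0}" using KB fBI(2) unfolding fin_dim_def K_def by blast
    show "fin_dim t C" unfolding C_def fin_dim_def using fD by blast
    show "0 = int (s.dim {u \<in> A. H u = 0}) - int (t.dim C)" using dims by (simp add: K_def)
    show "H ` A \<inter> C = {0}"
    proof -
      have "z = 0" if z: "z \<in> H ` A \<inter> C" for z
      proof -
      obtain u where u: "u \<in> A" "z = H u" using z by blast
      hence uI: "u \<in> I" using z CW by (auto simp: I_def)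
      have "z \<in> t.span (g ` N)" using gM[OF uI] gH[OF uI] u(2) by simp
      thus ?thesis using t.span_disjoint[OF D(3,1), of "D - g ` N" z] z by (auto simp: C_def)
      qed
      moreover have "H 0 = 0" "0 \<in> A" using s.subspace_0[OF K] by (auto simp: K_def)
      hence "0 \<in> H ` A \<inter> C" unfolding C_def using t.span_zero by force
      ultimately show ?thesis by blast
    qed
    show "{y + c |y c. y \<in> H ` A \<and> c \<in> C} = B"
    proof (intro equalityI subsetI)
      fix z assume "z \<in> {y + c |y c. y \<in> H ` A \<and> c \<in> C}"
      then obtain u c where "u \<in> A" "c \<in> C" "z = H u + c" by blast
      thus "z \<in> B" using t.subspace_add[OF B] Hl(1) CW W by blast
    next
      fix z assume "z \<in> B"
      then obtain u v where u: "u \<in> A" "v \<in> W" "z = H u + v" using span by blast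
      have "D = g ` N \<union> (D - g ` N)" using D(1) by blast
      hence "v \<in> t.span (g ` N \<union> (D - g ` N))" using u(2) WD by simp
      then obtain a b where ab: "v = a + b" "a \<in> t.span (g ` N)" "b \<in> C" unfolding t.span_Un C_def by blast
      obtain x where x: "x \<in> s.span N" "a = g x" using ab(2) g.span_image[of N] by auto
      have xI: "x \<in> I" using x(1) N(4) by blast
      hence xA: "x \<in> A" by (simp add: I_def)
      have "z = H (u + x) + b" using u(3) ab(1) x(2) gH[OF xI] Hl(2)[OF u(1) xA] by (simp add: add.assoc)
      thus "z \<in> {y + c |y c. y \<in> H ` A \<and> c \<in> C}" using s.subspace_add[OF A u(1) xA] ab(3) by blast
    qed
  qed
qed

text \<open>In charts the inverse is \<open>binv\<close> of the local operator, bounded by the open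
  mapping theorem and continuous because inversion is.\<close>

lemma bundle_iso_of_bij:
  fixes E :: "('b, 'k :: {real_normed_field, euclidean_space}, 'v :: ab_group_add, 'm :: banach) bbundle"
    and F :: "('b, 'k, 'w :: ab_group_add, 'n :: banach) bbundle"
  assumes E: "banach_bundle X E" and F: "banach_bundle X F" and L: "bundle_morphism X E F L"
    and bij: "!!p. p \<in> topspace X ==> bij_betw (L p) (fibre E p) (fibre F p)"
  shows "bundle_iso X E F L"
proof -
  interpret e: vector_space "fscale E" by (rule bb_vs[OF E])
  interpret f: vector_space "fscale F" by (rule bb_vs[OF F])
  define M where "M p = inv_into (fibre E p) (L p)" for p
  have left_inv: "M p (L p u) = u" if "p \<in> topspace X" "u \<in> fibre E p" for p u
    unfolding M_def using bij[OF that(1)] that(2) by (rule bij_betw_inv_into_left)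
  have right_inv: "L p (M p z) = z" if "p \<in> topspace X" "z \<in> fibre F p" for p z
    unfolding M_def using bij[OF that(1)] that(2) by (rule bij_betw_inv_into_right)
  have Mm: "M p z \<in> fibre E p" if "p \<in> topspace X" "z \<in> fibre F p" for p z
    unfolding M_def by (rule inv_into_into) (use bij[OF that(1)] that(2) in \<open>simp add: bij_betw_def\<close>)
  note lin = linear_betweenD[OF bundle_morphismD(2)[OF E F L]]
  have "bundle_morphism X F E M"
  proof (rule bundle_morphismI[OF F E])
    fix p assume p: "p \<in> topspace X"
    show "fibre_linear F E p (M p)" unfolding linear_between_def
    proof (intro conjI ballI allI)
      fix u assume u: "u \<in> fibre F p"
      note mu = Mm[OF p u] right_inv[OF p u]
      show "M p u \<in> fibre E p" by (rule mu)
      show "M p (fscale F c u) = fscale E c (M p u)" for c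
        using left_inv[OF p e.subspace_scale[OF bb_subspace[OF E p] mu(1), of c]] lin(3)[OF p mu(1)] mu(2) by simp
      fix v assume v: "v \<in> fibre F p"
      note mv = Mm[OF p v] right_inv[OF p v]
      show "M p (u + v) = M p u + M p v"
        using left_inv[OF p e.subspace_add[OF bb_subspace[OF E p] mu(1) mv(1)]] lin(2)[OF p mu(1) mv(1)] mu(2) mv(2) by simp
    qed
  next
    show "nmor_on X F E (topspace X) M"
    proof (rule nmor_onI)
      fix p assume p: "p \<in> topspace X"
      obtain U1 \<tau> where c: "(U1, \<tau>) \<in> charts E" "p \<in> U1" using bb_cover[OF E p] .
      obtain U2 \<sigma> where d: "(U2, \<sigma>) \<in> charts F" "p \<in> U2" using bb_cover[OF F p] .
      obtain W A where W: "openin X W" "p \<in> W" "W \<subseteq> U1" "W \<subseteq> U2" "conton X W A"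
        "!!q x. q \<in> W ==> L q (\<tau> q x) = \<sigma> q (blinfun_apply (A q) x)"
        by (rule nmor_on_charts[OF E F bundle_morphismD(1)[OF E F L] p c d], rule that)
      have sub: "q \<in> U1" "q \<in> U2" "q \<in> topspace X" if "q \<in> W" for q using that W(3,4) openin_subset[OF W(1)] by auto
      have bA: "bij (blinfun_apply (A q))" if q: "q \<in> W" for q
      proof (rule bijI)
        show "inj (blinfun_apply (A q))"
        proof (rule injI)
          fix x y assume "A q x = A q y"
          hence "L q (\<tau> q x) = L q (\<tau> q y)" using W(6)[OF q] by simp
          hence "M q (L q (\<tau> q x)) = M q (L q (\<tau> q y))" by (rule arg_cong)
          hence "\<tau> q x = \<tau> q y" unfolding left_inv[OF sub(3)[OF q] chart_mem[OF E c(1) sub(1)[OF q]]] .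
          thus "x = y" using chart_inj[OF E c(1) sub(1)[OF q]] by simp
        qed
        have "\<exists>x. y = A q x" for y
        proof -
          note fy = chart_mem[OF F d(1) sub(2)[OF q], of y]
          obtain x where x: "M q (\<sigma> q y) = \<tau> q x" using sub(1)[OF q] Mm[OF sub(3)[OF q] fy] by (rule chart_surj[OF E c(1)])
          have "\<sigma> q y = \<sigma> q (A q x)" using right_inv[OF sub(3)[OF q] fy] W(6)[OF q] x by simp
          thus ?thesis using chart_inj[OF F d(1) sub(2)[OF q]] by blast
        qed
        thus "surj (blinfun_apply (A q))" unfolding surj_def by blast
      qed
      have "conton X W (\<lambda>q. binv (A q))" unfolding conton_def using tendsto_binv[OF bA] contonD[OF W(5)] by blast
      moreover have "M q (\<sigma> q y) = \<tau> q (binv (A q) y)" if q: "q \<in> W" for q y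
        using left_inv[OF sub(3)[OF q] chart_mem[OF E c(1) sub(1)[OF q], of "binv (A q) y"]] W(6)[OF q] binv_right[OF bA[OF q]] by simp
      ultimately show "nmor_at X F E M p" using W(1-4) c(1) d(1)
        by (intro exI[of _ W] exI[of _ U2] exI[of _ \<sigma>] exI[of _ U1] exI[of _ \<tau>] exI[of _ "\<lambda>q. binv (A q)"]) auto
    qed
  qed
  thus ?thesis unfolding bundle_iso_def using L left_inv right_inv by (intro conjI exI[of _ M]) auto
qed

section \<open>Index and homotopy\<close>

context
  fixes X :: "'b topology"
    and E :: "('b, 'k :: {real_normed_field, euclidean_space}, 'v :: ab_group_add, 'm :: banach) bbundle"
    and F :: "('b, 'k, 'w :: ab_group_add, 'n :: banach) bbundle"
    and L :: "'b => 'v => 'w" and k :: "'b => int"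
  assumes X: "compact_space X" "Hausdorff_space X"
    and E: "banach_bundle X E" and F: "banach_bundle X F" and L: "bundle_morphism X E F L"
    and fred: "!!p. p \<in> topspace X ==> fredholm_of_index (fscale E) (fscale F) (fibre E p) (fibre F p) (L p) (k p)"
begin

interpretation e: vector_space "fscale E" by (rule bb_vs[OF E])
interpretation f: vector_space "fscale F" by (rule bb_vs[OF F])

lemma iso_of_homotopy:
  assumes "homotopic_to_iso X E F L"
  obtains V where "transversal_subbundle X E F L V" "vb_iso X (index_vbundle X E L V) (induced_vbundle X F V)"
proof -
  let ?Y = "cylinder X" and ?E = "pullback (cylinder X) fst E" and ?F = "pullback (cylinder X) fst F"
  note fstc = continuous_map_cylinder_fst[of X]
  have EY: "banach_bundle ?Y ?E" and FY: "banach_bundle ?Y ?F" by (rule banach_bundle_pullback[OF fstc E], rule banach_bundle_pullback[OF fstc F])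
  note Y = cylinder_compact(1)[OF X(1)] cylinder_compact(2)[OF X(2)]
  obtain H where H: "fredholm_morphism ?Y ?E ?F H" "\<forall>p\<in>topspace X. \<forall>u\<in>fibre E p. pullback_morphism (incl 0) H p u = L p u"
    "bundle_iso X E F (pullback_morphism (incl 1) H)" using assms unfolding homotopic_to_iso_def by (elim exE conjE) (rule that)
  obtain k' where HY: "bundle_morphism ?Y ?E ?F H"
    and fY: "!!y. y \<in> topspace ?Y ==> fredholm_of_index (fscale ?E) (fscale ?F) (fibre ?E y) (fibre ?F y) (H y) k'"
    using H(1) unfolding fredholm_morphism_def by (elim exE conjE) (rule that, assumption, erule bspec)
  have kY: "fin_dim (fscale ?E) {u \<in> fibre ?E y. H y u = 0}" if "y \<in> topspace ?Y" for y
    using fY[OF that] unfolding fredholm_of_index_def by (rule conjunct1)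
  obtain V where V: "transversal_subbundle ?Y ?E ?F H V" by (rule transversal_exists[OF Y EY FY HY fY], assumption, rule that)
  define W where "W = index_space ?E H V"
  have W: "fin_dim_subbundle ?Y ?E W" unfolding W_def by (rule index_subbundle[OF Y EY FY HY kY V])
  have Vs: "fin_dim_subbundle ?Y ?F V" by (rule transversal_subbundleD(1)[OF V])
  have W_iff: "u \<in> W (p, t) \<longleftrightarrow> u \<in> fibre E p \<and> H (p, t) u \<in> V (p, t)" for u p t by (simp add: W_def index_space_def)
  have 01: "(0::real) \<in> {0..1}" "(1::real) \<in> {0..1}" by auto
  note W0 = slice_subbundle[OF E 01(1) W] and W1 = slice_subbundle[OF E 01(2) W]
    and V0 = slice_subbundle[OF F 01(1) Vs] and V1 = slice_subbundle[OF F 01(2) Vs]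
  have vW: "vector_bundle X (induced_vbundle X E (\<lambda>p. W (p, 0)))" "vector_bundle X (induced_vbundle X E (\<lambda>p. W (p, 1)))"
    using W0 W1 by (simp_all add: fin_dim_subbundle_def)
  obtain M where M': "bundle_morphism X F E M" "\<forall>p\<in>topspace X. (\<forall>u\<in>fibre E p. M p (pullback_morphism (incl 1) H p u) = u) \<and>
     (\<forall>w\<in>fibre F p. pullback_morphism (incl 1) H p (M p w) = w)" using H(3) unfolding bundle_iso_def by (elim exE conjE) (rule that)
  have M: "bundle_morphism X F E M" "!!p u. p \<in> topspace X ==> u \<in> fibre E p ==> M p (H (p, 1) u) = u"
    "!!p w. p \<in> topspace X ==> w \<in> fibre F p ==> H (p, 1) (M p w) = w" using M' by (auto simp: pullback_morphism_def incl_def)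
  note M0 = linear_betweenD[OF bundle_morphismD(2)[OF F E M(1)]]
  have L0: "L p u = H (p, 0) u" if "p \<in> topspace X" "u \<in> fibre E p" for p u
    using H(2) that by (simp add: pullback_morphism_def incl_def)
  have tr: "transversal_subbundle X E F L (\<lambda>p. V (p, 0))"
  proof (rule transversal_subbundleI[OF X E F L fred V0])
    fix p z assume p: "p \<in> topspace X" and z: "z \<in> fibre F p"
    have "(p, 0) \<in> topspace ?Y" using p by (simp add: topspace_cylinder)
    from transversal_subbundleD(4)[OF V this, of z] z obtain u v where "u \<in> fibre E p" "v \<in> V (p, 0)" "z = H (p, 0) u + v" by auto
    thus "\<exists>u\<in>fibre E p. \<exists>v\<in>V (p, 0). z = L p u + v" using L0[OF p] by auto
  qed
  \<comment> \<open>\<open>H (p, 0)\<close> and \<open>L p\<close> agree on the fibres over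
    \<open>X\<close> only, and the two families may differ at other \<open>p\<close>. Hence an
    isomorphism given by the identity and not an equality of bundles.\<close>
  have "vb_iso X (induced_vbundle X E (\<lambda>p. W (p, 0))) (induced_vbundle X E (index_space E L (\<lambda>p. V (p, 0))))"
  proof (rule vb_iso_induced[OF E vW(1) vmor_induced[OF E W0]])
    show "fin_dim_subbundle X E (index_space E L (\<lambda>p. V (p, 0)))"
      by (rule index_subbundle[OF X E F L fredholm_kernel[OF X E F L fred] tr])
    show "(\<lambda>u. u) ` vfibre (induced_vbundle X E (\<lambda>p. W (p, 0))) p = index_space E L (\<lambda>p. V (p, 0)) p" if "p \<in> topspace X" for p
      using L0[OF that] by (auto simp: induced_simps index_space_def W_iff)
  qed
  hence "vb_iso X (induced_vbundle X E (index_space E L (\<lambda>p. V (p, 0)))) (induced_vbundle X E (\<lambda>p. W (p, 0)))" by (rule vb_iso_sym)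
  also have "vb_iso X \<dots> (induced_vbundle X E (\<lambda>p. W (p, 1)))" by (rule slices_isomorphic[OF X E W 01])
  \<comment> \<open>\<open>W (p, 1)\<close> is the preimage of \<open>V (p, 1)\<close> under the
    bijection \<open>H (p, 1)\<close>.\<close>
  also have "vb_iso X \<dots> (induced_vbundle X F (\<lambda>p. V (p, 1)))"
  proof (rule vb_iso_induced[OF F vW(2) _ _ V1])
    show "vmor X (induced_vbundle X E (\<lambda>p. W (p, 1))) F (\<lambda>p u. H (p, 1) u)"
      by (rule vmor_compose[OF E F vmor_induced[OF E W1] slice_morphism[OF E F 01(2) HY]])
    fix p assume p: "p \<in> topspace X"
    show "u = 0" if "u \<in> vfibre (induced_vbundle X E (\<lambda>p. W (p, 1))) p" "H (p, 1) u = 0" for u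
    proof -
      have "u = M p 0" using M(2)[OF p, of u] that by (simp add: induced_simps W_iff)
      thus ?thesis using M0(3)[OF p f.subspace_0[OF bb_subspace[OF F p]], of 0] by simp
    qed
    have "\<exists>u\<in>W (p, 1). v = H (p, 1) u" if v: "v \<in> V (p, 1)" for v
    proof -
      have vF: "v \<in> fibre F p" using V1 p v by (auto simp: fin_dim_subbundle_def)
      thus ?thesis using M(3)[OF p vF] M0(1)[OF p vF] v by (intro bexI[of _ "M p v"]) (simp_all add: W_iff)
    qed
    thus "(\<lambda>u. H (p, 1) u) ` vfibre (induced_vbundle X E (\<lambda>p. W (p, 1))) p = V (p, 1)" by (auto simp: induced_simps W_iff)
  qed
  also have "vb_iso X \<dots> (induced_vbundle X F (\<lambda>p. V (p, 0)))" by (rule slices_isomorphic[OF X F Vs 01(2,1)])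
  finally show thesis by (rule that[OF tr])
qed

lemma fredholm_ker: "p \<in> topspace X ==> fin_dim (fscale E) {u \<in> fibre E p. L p u = 0}" using fred unfolding fredholm_of_index_def by blast

lemma fredholm_transversal_facts:
  assumes "transversal_subbundle X E F L V"
  shows "fin_dim_subbundle X E (index_space E L V)" "vector_bundle X (index_vbundle X E L V)"
    "vector_bundle X (induced_vbundle X F V)" "fin_dim_subbundle X F V"
    "p \<in> topspace X ==> f.subspace (V p)" "p \<in> topspace X ==> e.subspace (index_space E L V p)" "p \<in> topspace X ==> V p \<subseteq> fibre F p"
  by (rule transversal_facts[OF X E F L fredholm_ker assms]; assumption)+

lemmas morphism_linear = linear_betweenD[OF bundle_morphismD(2)[OF E F L]]

text \<open>A bundle \<open>G\<close> with \<open>E(L, V) \<oplus> G \<cong> V \<oplus> G\<close> is moved into \<open>F\<close> in general position to \<open>V\<close>. For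
  \<open>W = V \<oplus> G\<close> this gives \<open>E(L, W) \<cong> E(L, V) \<oplus> G \<cong> W\<close>.\<close>

lemma unstable_iso:
  assumes inf: "\<not> fin_dim (mscale F) UNIV" and tr: "transversal_subbundle X E F L V"
    and st: "stably_iso X (index_vbundle X E L V) (induced_vbundle X F V)"
  obtains W where "transversal_subbundle X E F L W" "vb_iso X (index_vbundle X E L W) (induced_vbundle X F W)"
proof -
  let ?I = "index_vbundle X E L V" and ?V = "induced_vbundle X F V"
  note v = fredholm_transversal_facts[OF tr]
  obtain G where G: "G \<in> VB X" and iso: "vb_iso X (?I \<oplus>\<^sub>V G) (?V \<oplus>\<^sub>V G)" using st unfolding stably_iso_def by blast
  note GV = VB_bundle[OF G]
  interpret g: vector_space "vscale G" by (rule vb_vs[OF GV])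
  obtain T where T: "vmor X G F T" "!!p g u. p \<in> topspace X ==> g \<in> vfibre G p ==> u \<in> vfibre ?V p ==> T p g = u ==> g = 0"
    by (rule general_position[OF X F inf v(3) GV vmor_induced[OF F v(4)]], rule that)
  note lT = linear_betweenD[OF vmor_linear[OF T(1)]]
  have T0: "T p 0 = 0" if p: "p \<in> topspace X" for p using lT(3)[OF p g.subspace_0[OF vb_subspace[OF GV p]], of 0] by simp
  have TV: "g = 0" if "p \<in> topspace X" "g \<in> vfibre G p" "T p g \<in> V p" for p g
    by (rule T(2)[OF that(1,2) _ refl]) (simp add: induced_simps that(3))
  define S where "S p = (\<lambda>(y, g). y + T p g)" for p
  have S: "vmor X (?V \<oplus>\<^sub>V G) F S" unfolding vmor_def
  proof (intro conjI ballI allI impI)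
    fix p assume p: "p \<in> topspace X"
    show "linear_between (vscale (?V \<oplus>\<^sub>V G)) (fscale F) (vfibre (?V \<oplus>\<^sub>V G) p) (fibre F p) (S p)"
      unfolding linear_between_def vfibre_sum induced_simps using lT[OF p] f.subspace_add[OF bb_subspace[OF F p]] v(7)[OF p]
      by (auto simp: S_def vscale_sum induced_simps f.scale_right_distrib)
  next
    fix U \<sigma> assume U: "openin X U" and "vsec X (?V \<oplus>\<^sub>V G) U \<sigma>"
    hence s: "vsec X ?V U (\<lambda>p. fst (\<sigma> p))" "vsec X G U (\<lambda>p. snd (\<sigma> p))" unfolding vsec_sum_iff[OF v(3) GV U] by blast+
    have "continuous_section X F U (\<lambda>p. fst (\<sigma> p) + T p (snd (\<sigma> p)))"
      by (rule csec_add[OF F U vmor_sec[OF vmor_induced[OF F v(4)] U s(1)] vmor_sec[OF T(1) U s(2)]])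
    thus "continuous_section X F U (\<lambda>p. S p (\<sigma> p))" by (simp add: S_def split_beta)
  qed
  have S0: "z = 0" if p: "p \<in> topspace X" and z: "z \<in> vfibre (?V \<oplus>\<^sub>V G) p" and 0: "S p z = 0" for p z
  proof -
    obtain y g where yg: "z = (y, g)" "y \<in> V p" "g \<in> vfibre G p" using z by (auto simp: vfibre_sum induced_simps)
    have "T p g = - y" using 0 by (simp add: yg(1) S_def eq_neg_iff_add_eq_0 add.commute)
    hence "T p g \<in> V p" using f.subspace_neg[OF v(5)[OF p] yg(2)] by simp
    hence "g = 0" by (rule TV[OF p yg(3)])
    thus ?thesis using 0 T0[OF p] by (simp add: yg(1) S_def zero_prod_def)
  qed
  define W where "W p = S p ` vfibre (?V \<oplus>\<^sub>V G) p" for p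
  note sumV = vector_bundle_sum[OF v(3) GV]
  have W: "fin_dim_subbundle X F W" unfolding W_def[abs_def] by (rule image_subbundle[OF F sumV S S0])
  have isoW: "vb_iso X (?V \<oplus>\<^sub>V G) (induced_vbundle X F W)" by (rule vb_iso_induced[OF F sumV S S0 W]) (simp_all add: W_def)
  have W_iff: "z \<in> W p \<longleftrightarrow> (\<exists>y\<in>V p. \<exists>g\<in>vfibre G p. z = y + T p g)" for z p by (force simp: W_def S_def vfibre_sum induced_simps)
  have VW: "y \<in> W p" if "p \<in> topspace X" "y \<in> V p" for p y
    unfolding W_iff using that T0 g.subspace_0[OF vb_subspace[OF GV that(1)]] by force
  have trW: "transversal_subbundle X E F L W"
  proof (rule transversal_subbundleI[OF X E F L fred W])
    fix p z assume "p \<in> topspace X" "z \<in> fibre F p"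
    thus "\<exists>u\<in>fibre E p. \<exists>v\<in>W p. z = L p u + v" using transversal_subbundleD(4)[OF tr] VW by blast
  qed
  note w = fredholm_transversal_facts[OF trW]
  \<comment> \<open>The parametrix lifts \<open>G\<close> to \<open>E\<close>:
    \<open>L p (R p (T p g))\<close> is \<open>T p g\<close> up to an element of
    \<open>V p\<close>.\<close>
  obtain R where R: "bundle_morphism X F E R" "!!p z. p \<in> topspace X ==> z \<in> fibre F p ==> L p (R p z) - z \<in> V p"
    by (rule parametrix[OF X E F L fredholm_ker tr], assumption, rule that)
  have RT: "vmor X G E (\<lambda>p g. R p (T p g))" by (rule vmor_compose[OF F E T(1) R(1)])
  note lR = linear_betweenD[OF vmor_linear[OF RT]]
  \<comment> \<open>Maps \<open>E(L, V) \<oplus> G\<close> onto \<open>E(L, W)\<close>. The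
    component \<open>g\<close> is determined by the value of \<open>L p\<close>, being its part
    along \<open>T p\<close>, because the image of \<open>T p\<close> meets \<open>V p\<close> only
    in zero.\<close>
  define S' where "S' p = (\<lambda>(u, g). u + R p (T p g))" for p
  have key: "L p (u + R p (T p g)) = L p u + (L p (R p (T p g)) - T p g) + T p g"
    if "p \<in> topspace X" "u \<in> fibre E p" "g \<in> vfibre G p" for p u g using morphism_linear(2)[OF that(1,2) lR(1)[OF that(1,3)]] by simp
  have RV: "L p (R p (T p g)) - T p g \<in> V p" if "p \<in> topspace X" "g \<in> vfibre G p" for p g by (rule R(2)[OF that(1) lT(1)[OF that]])
  have S': "vmor X (?I \<oplus>\<^sub>V G) E S'" unfolding vmor_def
  proof (intro conjI ballI allI impI)
    fix p assume p: "p \<in> topspace X"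
    have sub: "index_space E L V p \<subseteq> fibre E p" by (auto simp: index_space_def)
    show "linear_between (vscale (?I \<oplus>\<^sub>V G)) (fscale E) (vfibre (?I \<oplus>\<^sub>V G) p) (fibre E p) (S' p)"
      unfolding linear_between_def vfibre_sum induced_simps using lR[OF p] e.subspace_add[OF bb_subspace[OF E p]] sub
      by (auto simp: S'_def vscale_sum induced_simps e.scale_right_distrib)
  next
    fix U \<sigma> assume U: "openin X U" and "vsec X (?I \<oplus>\<^sub>V G) U \<sigma>"
    hence s: "vsec X ?I U (\<lambda>p. fst (\<sigma> p))" "vsec X G U (\<lambda>p. snd (\<sigma> p))" unfolding vsec_sum_iff[OF v(2) GV U] by blast+
    have "continuous_section X E U (\<lambda>p. fst (\<sigma> p) + R p (T p (snd (\<sigma> p))))"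
      by (rule csec_add[OF E U vmor_sec[OF vmor_induced[OF E v(1)] U s(1)] vmor_sec[OF RT U s(2)]])
    thus "continuous_section X E U (\<lambda>p. S' p (\<sigma> p))" by (simp add: S'_def split_beta)
  qed
  have "vb_iso X (?I \<oplus>\<^sub>V G) (index_vbundle X E L W)"
  proof (rule vb_iso_induced[OF E vector_bundle_sum[OF v(2) GV] S' _ w(1)])
    fix p assume p: "p \<in> topspace X"
    note sV = v(5)[OF p]
    fix z assume z: "z \<in> vfibre (?I \<oplus>\<^sub>V G) p" and 0: "S' p z = 0"
    obtain u g where ug: "z = (u, g)" "u \<in> fibre E p" "L p u \<in> V p" "g \<in> vfibre G p"
      using z by (auto simp: vfibre_sum induced_simps index_space_def)
    have "L p (u + R p (T p g)) = 0" using 0 morphism_linear(3)[OF p e.subspace_0[OF bb_subspace[OF E p]], of 0] by (simp add: ug(1) S'_def)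
    hence "T p g = - (L p u + (L p (R p (T p g)) - T p g))" unfolding key[OF p ug(2,4)] by (metis add.commute eq_neg_iff_add_eq_0)
    also have "\<dots> \<in> V p" by (intro f.subspace_neg[OF sV] f.subspace_add[OF sV] ug(3) RV[OF p ug(4)])
    finally have "g = 0" by (rule TV[OF p ug(4)])
    moreover have "R p (T p 0) = 0" using lR(3)[OF p g.subspace_0[OF vb_subspace[OF GV p]], of 0] by simp
    ultimately show "z = 0" using 0 by (simp add: ug(1) S'_def zero_prod_def)
  next
    fix p assume p: "p \<in> topspace X"
    note sV = v(5)[OF p]
    show "S' p ` vfibre (?I \<oplus>\<^sub>V G) p = index_space E L W p"
    proof (intro equalityI subsetI)
      fix x assume "x \<in> S' p ` vfibre (?I \<oplus>\<^sub>V G) p"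
      then obtain u g where ug: "x = u + R p (T p g)" "u \<in> fibre E p" "L p u \<in> V p" "g \<in> vfibre G p"
        by (auto simp: vfibre_sum induced_simps index_space_def S'_def)
      have "L p x \<in> W p" unfolding ug(1) key[OF p ug(2,4)] W_iff
        by (intro bexI[of _ "L p u + (L p (R p (T p g)) - T p g)"] bexI[of _ g] refl ug(4) f.subspace_add[OF sV] ug(3) RV[OF p ug(4)])
      moreover have "x \<in> fibre E p" unfolding ug(1) by (rule e.subspace_add[OF bb_subspace[OF E p] ug(2) lR(1)[OF p ug(4)]])
      ultimately show "x \<in> index_space E L W p" by (simp add: index_space_def)
    next
      fix x assume "x \<in> index_space E L W p"
      then obtain y g where x: "x \<in> fibre E p" "y \<in> V p" "g \<in> vfibre G p" "L p x = y + T p g" unfolding index_space_def W_iff by blast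
      note Rg = lR(1)[OF p x(3)]
      have "L p (x - R p (T p g)) = y - (L p (R p (T p g)) - T p g)"
        using linear_between_diff[OF bundle_morphismD(2)[OF E F L p] bb_subspace[OF E p] e.vector_space_axioms f.vector_space_axioms x(1) Rg] x(4)
        by simp
      also have "\<dots> \<in> V p" by (rule f.subspace_diff[OF sV x(2) RV[OF p x(3)]])
      finally have "(x - R p (T p g), g) \<in> vfibre (?I \<oplus>\<^sub>V G) p"
        using x(3) e.subspace_diff[OF bb_subspace[OF E p] x(1) Rg] by (simp add: vfibre_sum induced_simps index_space_def)
      moreover have "x = S' p (x - R p (T p g), g)" by (simp add: S'_def)
      ultimately show "x \<in> S' p ` vfibre (?I \<oplus>\<^sub>V G) p" by blast
    qed
  qed
  hence "vb_iso X (index_vbundle X E L W) (?I \<oplus>\<^sub>V G)" by (rule vb_iso_sym)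
  also note iso
  also note isoW
  finally show thesis by (rule that[OF trW])
qed

lemma homotopy_of_iso:
  assumes tr: "transversal_subbundle X E F L W"
    and iso: "vb_iso X (index_vbundle X E L W) (induced_vbundle X F W)"
  shows "homotopic_to_iso X E F L"
proof -
  let ?I = "index_space E L W"
  let ?Y = "cylinder X" and ?E = "pullback (cylinder X) fst E" and ?F = "pullback (cylinder X) fst F"
  note fstc = continuous_map_cylinder_fst[of X]
  have EY: "banach_bundle ?Y ?E" and FY: "banach_bundle ?Y ?F" by (rule banach_bundle_pullback[OF fstc E], rule banach_bundle_pullback[OF fstc F])
  note w = fredholm_transversal_facts[OF tr]
  obtain J J' where J: "secmap X (induced_vbundle X E ?I) (induced_vbundle X F W) J"
    "secmap X (induced_vbundle X F W) (induced_vbundle X E ?I) J'"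
    "!!p u. p \<in> topspace X ==> u \<in> vfibre (induced_vbundle X E ?I) p ==> J' p (J p u) = u"
    "!!p w. p \<in> topspace X ==> w \<in> vfibre (induced_vbundle X F W) p ==> J p (J' p w) = w" by (rule vb_isoE[OF iso], rule that)
  have lJ: "linear_between (fscale E) (fscale F) (?I p) (W p) (J p)" and lJ': "linear_between (fscale F) (fscale E) (W p) (?I p) (J' p)"
    if "p \<in> topspace X" for p using secmap_linear[OF J(1) that] secmap_linear[OF J(2) that] by (simp_all add: induced_simps)
  have JJ: "J' p (J p u) = u" if "p \<in> topspace X" "u \<in> ?I p" for p u using J(3) that by (simp add: induced_simps)
  have JJ': "J p (J' p u) = u" if "p \<in> topspace X" "u \<in> W p" for p u using J(4) that by (simp add: induced_simps)
  have IE: "?I p \<subseteq> fibre E p" and LI: "u \<in> ?I p ==> L p u \<in> W p" for p u by (auto simp: index_space_def)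
  have I_iff: "u \<in> ?I p \<longleftrightarrow> u \<in> fibre E p \<and> L p u \<in> W p" for p u by (simp add: index_space_def)
  have J1: "linear_between (fscale E) (fscale F) (?I p) (fibre F p) (J p)" if "p \<in> topspace X" for p
    using lJ[OF that] w(7)[OF that] unfolding linear_between_def by blast
  have J2: "continuous_section X F Q (\<lambda>p. J p (s p))"
    if Q: "openin X Q" and s: "continuous_section X E Q s" "!!p. p \<in> Q ==> s p \<in> ?I p" for Q s
  proof -
    have "vsec X (induced_vbundle X E ?I) Q s" unfolding vsec_induced_iff[OF E w(1) Q] using s by blast
    from secmap_sec[OF J(1) Q this] show ?thesis unfolding vsec_induced_iff[OF F w(4) Q] by (rule conjunct1)
  qed
  have L1: "linear_between (fscale E) (fscale F) (?I p) (fibre F p) (L p)" if "p \<in> topspace X" for p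
    using bundle_morphismD(2)[OF E F L that] IE unfolding linear_between_def by blast
  have L2: "continuous_section X F Q (\<lambda>p. L p (s p))" if Q: "openin X Q" and s: "continuous_section X E Q s" for Q s
    by (rule nmor_sec[OF E F nmor_on_subset[OF bundle_morphismD(1)[OF E F L] openin_subset[OF Q]] Q s])
  obtain P where P: "bundle_morphism X E E P" "!!p u. p \<in> topspace X ==> u \<in> fibre E p ==> P p u \<in> ?I p"
    "!!p u. p \<in> topspace X ==> u \<in> ?I p ==> P p u = u"
    and JP: "bundle_morphism X E F (\<lambda>p u. J p (P p u))" and LP: "bundle_morphism X E F (\<lambda>p u. L p (P p u))"
  proof (rule index_projection[OF X E F L fredholm_ker tr], assumption)
    fix P assume P: "bundle_morphism X E E P" "!!p u. p \<in> topspace X ==> u \<in> fibre E p ==> P p u \<in> ?I p"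
      "!!p u. p \<in> topspace X ==> u \<in> ?I p ==> P p u = u"
      and gen: "!!J. (!!p. p \<in> topspace X ==> linear_between (fscale E) (fscale F) (?I p) (fibre F p) (J p)) ==>
        (!!Q s. openin X Q ==> continuous_section X E Q s ==> (!!p. p \<in> Q ==> s p \<in> ?I p) ==>
          continuous_section X F Q (\<lambda>p. J p (s p))) ==> bundle_morphism X E F (\<lambda>p u. J p (P p u))"
    have "bundle_morphism X E F (\<lambda>p u. J p (P p u))" by (rule gen[of J], erule J1, rule J2)
    moreover have "bundle_morphism X E F (\<lambda>p u. L p (P p u))" by (rule gen[of L], erule L1, rule L2)
    ultimately show thesis using P by (intro that[of P])
  qed
  note lP = linear_betweenD[OF bundle_morphismD(2)[OF E E P(1)]]
  \<comment> \<open>Coefficients 1, \<open>t\<close> and \<open>- t\<close> for \<open>L\<close>,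
    \<open>J P\<close> and \<open>L P\<close>: the homotopy is one combination of pulled back
    morphisms, to which \<open>nmor_comb\<close> applies.\<close>
  define a where "a i y = (if i = 0 then 1 else if i = 1 then of_real (snd y) else - of_real (snd y) :: 'k)" for i :: nat and y :: "'b \<times> real"
  define B where "B i = (if i = 0 then L else if i = 1 then (\<lambda>p u. J p (P p u)) else (\<lambda>p u. L p (P p u)))" for i :: nat
  have B: "bundle_morphism X E F (B i)" for i using L JP LP by (simp add: B_def)
  have BY: "bundle_morphism ?Y ?E ?F (\<lambda>y. B i (fst y))" for i by (rule bundle_morphism_pullback[OF fstc B])
  define H where "H y u = (\<Sum>i\<in>{..<3}. fscale ?F (a i y) (B i (fst y) u))" for y u
  have ca: "conton ?Y (topspace ?Y) (a i)" for i
  proof -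
    have "conton ?Y (topspace ?Y) (\<lambda>y. of_real (snd y) :: 'k)"
      by (rule conton_of_real) (use continuous_map_cylinder_snd in \<open>simp add: conton_topspace\<close>)
    moreover from conton_diff[OF conton_const[of _ _ 0] this] have "conton ?Y (topspace ?Y) (\<lambda>y. - of_real (snd y) :: 'k)" by simp
    ultimately show ?thesis by (cases "i = 0"; cases "i = 1") (simp_all add: a_def[abs_def] conton_const)
  qed
  have HY: "bundle_morphism ?Y ?E ?F H"
  proof (rule bundle_morphismI[OF EY FY])
    show "nmor_on ?Y ?E ?F (topspace ?Y) H"
      unfolding H_def[abs_def] by (rule nmor_comb[OF EY FY openin_topspace]) (use bundle_morphismD(1)[OF EY FY BY] ca in auto)
    show "fibre_linear ?E ?F y (H y)" if y: "y \<in> topspace ?Y" for y unfolding H_def[abs_def] using bundle_morphismD(2)[OF EY FY BY y]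
      by (intro linear_between_sum[OF bb_vs[OF FY] bb_subspace[OF FY y]]) blast
  qed
  have H: "H (p, t) u = L p u + fscale F (of_real t) (J p (P p u) - L p (P p u))" for p t u
    by (simp add: H_def a_def B_def numeral_3_eq_3 f.scale_right_diff_distrib)
  have jW: "J p (P p u) - L p (P p u) \<in> W p" if "p \<in> topspace X" "u \<in> fibre E p" for p u
    using f.subspace_diff[OF w(5)[OF that(1)]] linear_betweenD(1)[OF lJ[OF that(1)] P(2)[OF that]] LI[OF P(2)[OF that]] by blast
  have fredH: "fredholm_of_index (fscale E) (fscale F) (fibre E p) (fibre F p) (H (p, t)) 0"
    if p: "p \<in> topspace X" and t: "t \<in> {0..1}" for p t
  proof -
    have tW: "fscale F (of_real t) (J p (P p u) - L p (P p u)) \<in> W p" if "u \<in> fibre E p" for u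
      by (rule f.subspace_scale[OF w(5)[OF p] jW[OF p that]])
    \<comment> \<open>The perturbation takes values in \<open>W p\<close>, so the preimage of
      \<open>W p\<close> is the same for all \<open>t\<close>. It has the dimension of
      \<open>W p\<close> because of \<open>J\<close>, which gives index 0 by
      \<open>fredholm_index_zero\<close>.\<close>
    have Heq: "{u \<in> fibre E p. H (p, t) u \<in> W p} = ?I p"
    proof (intro Set.set_eqI iffI)
      fix u assume "u \<in> {u \<in> fibre E p. H (p, t) u \<in> W p}"
      hence u: "u \<in> fibre E p" "H (p, t) u \<in> W p" by auto
      have "L p u = H (p, t) u - fscale F (of_real t) (J p (P p u) - L p (P p u))" by (simp add: H)
      also have "\<dots> \<in> W p" by (rule f.subspace_diff[OF w(5)[OF p] u(2) tW[OF u(1)]])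
      finally show "u \<in> ?I p" using u(1) by (simp add: I_iff)
    next
      fix u assume u: "u \<in> ?I p"
      hence uE: "u \<in> fibre E p" using IE by blast
      have "H (p, t) u \<in> W p" unfolding H by (rule f.subspace_add[OF w(5)[OF p] LI[OF u] tW[OF uE]])
      thus "u \<in> {u \<in> fibre E p. H (p, t) u \<in> W p}" using uE by blast
    qed
    obtain U n e where fr: "(U, n, e) \<in> frames (induced_vbundle X E ?I)" "p \<in> U" using vb_cover[OF w(2) p] .
    have vJ: "vmor X (induced_vbundle X E ?I) F J" by (rule vmor_of_secmap[OF J(1) vmor_induced[OF F w(4)]])
    have J0: "u = 0" if p: "p \<in> topspace X" and u: "u \<in> vfibre (induced_vbundle X E ?I) p" and 0: "J p u = 0" for p u
      using J(3)[OF p u] linear_betweenD(3)[OF lJ'[OF p] f.subspace_0[OF w(5)[OF p]], of 0] unfolding 0 by simp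
    have "J p ` ?I p = W p"
    proof (intro equalityI subsetI)
      show "y \<in> W p" if "y \<in> J p ` ?I p" for y using that linear_betweenD(1)[OF lJ[OF p]] by blast
      show "y \<in> J p ` ?I p" if "y \<in> W p" for y
        using JJ'[OF p that] linear_betweenD(1)[OF lJ'[OF p] that] by (intro image_eqI[of _ _ "J' p y"]) simp_all
    qed
    hence "is_basis (fscale F) (W p) n (\<lambda>i. J p (e p i))" using vmor_frame(1)[OF F w(2) vJ J0 fr] by (simp add: induced_simps)
    moreover have "is_basis (fscale E) {u \<in> fibre E p. H (p, t) u \<in> W p} n (e p)" unfolding Heq using fr by (simp add: induced_simps)
    moreover have "fibre_linear E F p (H (p, t))"
      using bundle_morphismD(2)[OF EY FY HY, of "(p, t)"] p t by (simp add: topspace_cylinder)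
    moreover have "\<exists>u\<in>fibre E p. \<exists>v\<in>W p. z = H (p, t) u + v" if z: "z \<in> fibre F p" for z
    proof -
      obtain u v where u: "u \<in> fibre E p" "v \<in> W p" "z = L p u + v" using transversal_subbundleD(4)[OF tr p z] by blast
      have "v - fscale F (of_real t) (J p (P p u) - L p (P p u)) \<in> W p" by (rule f.subspace_diff[OF w(5)[OF p] u(2) tW[OF u(1)]])
      moreover have "z = H (p, t) u + (v - fscale F (of_real t) (J p (P p u) - L p (P p u)))" unfolding u(3) H by simp
      ultimately show ?thesis using u(1) by blast
    qed
    ultimately show ?thesis
      by (intro fredholm_index_zero[OF e.vector_space_axioms f.vector_space_axioms bb_subspace[OF E p] _ w(7)[OF p] bb_subspace[OF F p]])
  qed
  have 01: "(1::real) \<in> {0..1}" by simp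
  have H1: "H (p, 1) u = L p u + (J p (P p u) - L p (P p u))" for p u by (simp add: H)
  have iso1: "bundle_iso X E F (\<lambda>p. H (p, 1))"
  proof (rule bundle_iso_of_bij[OF E F slice_morphism[OF E F 01 HY]])
    fix p assume p: "p \<in> topspace X"
    note sE = bb_subspace[OF E p]
    note ml = linear_between_diff[OF bundle_morphismD(2)[OF E F slice_morphism[OF E F 01 HY] p] sE e.vector_space_axioms f.vector_space_axioms]
      linear_between_diff[OF bundle_morphismD(2)[OF E F L p] sE e.vector_space_axioms f.vector_space_axioms]
      linear_between_diff[OF bundle_morphismD(2)[OF E E P(1) p] sE e.vector_space_axioms e.vector_space_axioms]
    have PE: "P p u \<in> fibre E p" if "u \<in> fibre E p" for u using P(2)[OF p that] IE by blast
    \<comment> \<open>\<open>H (p, 1) u\<close> is \<open>L p (u - P p u) + J p (P p u)\<close>, the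
      second term lying in \<open>W p\<close>. If the sum vanishes, \<open>u - P p u\<close> lies in
      the index space, where \<open>P\<close> is the identity; but \<open>P\<close> also kills it.
      So \<open>u = P p u\<close> and \<open>J p u = 0\<close>.\<close>
    have ker1: "u = 0" if u: "u \<in> fibre E p" and 0: "H (p, 1) u = 0" for u
    proof -
      have "L p (u - P p u) = - J p (P p u)" using 0 unfolding H1 ml(2)[OF u PE[OF u]] by (simp add: eq_neg_iff_add_eq_0 algebra_simps)
      also have "\<dots> \<in> W p" by (rule f.subspace_neg[OF w(5)[OF p] linear_betweenD(1)[OF lJ[OF p] P(2)[OF p u]]])
      finally have "u - P p u \<in> ?I p" using e.subspace_diff[OF sE u PE[OF u]] by (simp add: I_iff)
      from P(3)[OF p this] have "u = P p u" unfolding ml(3)[OF u PE[OF u]] P(3)[OF p P(2)[OF p u]] by simp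
      hence "J p u = 0" "u \<in> ?I p" using 0 P(2)[OF p u] unfolding H1 by auto
      thus "u = 0" using JJ[OF p, of u] linear_betweenD(3)[OF lJ'[OF p] f.subspace_0[OF w(5)[OF p]], of 0] by simp
    qed
    have "inj_on (H (p, 1)) (fibre E p)"
    proof (rule inj_onI)
      fix x y assume xy: "x \<in> fibre E p" "y \<in> fibre E p" "H (p, 1) x = H (p, 1) y"
      have "H (p, 1) (x - y) = 0" using ml(1)[OF xy(1,2)] xy(3) by simp
      from ker1[OF e.subspace_diff[OF sE xy(1,2)] this] show "x = y" by simp
    qed
    moreover have "H (p, 1) ` fibre E p = fibre F p"
    proof (intro equalityI subsetI)
      show "z \<in> fibre F p" if "z \<in> H (p, 1) ` fibre E p" for z
        using that linear_betweenD(1)[OF bundle_morphismD(2)[OF E F slice_morphism[OF E F 01 HY] p]] by blast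
      fix z assume z: "z \<in> fibre F p"
      obtain x v where x: "x \<in> fibre E p" "v \<in> W p" "z = L p x + v" using transversal_subbundleD(4)[OF tr p z] by blast
      define y where "y = L p (P p x) + v"
      have y: "y \<in> W p" unfolding y_def by (rule f.subspace_add[OF w(5)[OF p] LI[OF P(2)[OF p x(1)]] x(2)])
      have b: "J' p y \<in> ?I p" by (rule linear_betweenD(1)[OF lJ'[OF p] y])
      have bE: "J' p y \<in> fibre E p" using b IE by blast
      \<comment> \<open>The part of \<open>x\<close> killed by \<open>P\<close> is kept, and
        \<open>J' p\<close> solves for the rest of \<open>z\<close>, which is \<open>y\<close> and
        lies in \<open>W p\<close>.\<close>
      define u where "u = (x - P p x) + J' p y"
      have dE: "x - P p x \<in> fibre E p" by (rule e.subspace_diff[OF sE x(1) PE[OF x(1)]])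
      have uE: "u \<in> fibre E p" unfolding u_def by (rule e.subspace_add[OF sE dE bE])
      have Pu: "P p u = J' p y"
        unfolding u_def lP(2)[OF p dE bE] ml(3)[OF x(1) PE[OF x(1)]] P(3)[OF p P(2)[OF p x(1)]] P(3)[OF p b] by simp
      have "L p u = L p x - L p (P p x) + L p (J' p y)" unfolding u_def morphism_linear(2)[OF p dE bE] ml(2)[OF x(1) PE[OF x(1)]] ..
      hence "H (p, 1) u = L p x - L p (P p x) + y" unfolding H1 Pu JJ'[OF p y] by simp
      also have "\<dots> = z" unfolding y_def x(3) by simp
      finally show "z \<in> H (p, 1) ` fibre E p" using uE by blast
    qed
    ultimately show "bij_betw (H (p, 1)) (fibre E p) (fibre F p)" by (simp add: bij_betw_def)
  qed
  show ?thesis unfolding homotopic_to_iso_def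
  proof (intro exI[of _ H] conjI ballI)
    show "fredholm_morphism ?Y ?E ?F H" unfolding fredholm_morphism_def
      by (intro conjI HY exI[of _ 0] ballI) (use fredH in \<open>auto simp: topspace_cylinder\<close>)
    show "pullback_morphism (incl 0) H p u = L p u" for p u by (simp add: pullback_morphism_def incl_def H)
    show "bundle_iso X E F (pullback_morphism (incl 1) H)" using iso1 by (simp add: pullback_morphism_def incl_def)
  qed
qed

end

text \<open>Without points, the assumption on the fibres of \<open>F\<close> does not make the model
  space infinite dimensional, which general position requires.\<close>

lemma homotopic_to_iso_empty:
  fixes E :: "('b, 'k :: {real_normed_field, euclidean_space}, 'v :: ab_group_add, 'm :: banach) bbundle"
    and F :: "('b, 'k, 'w :: ab_group_add, 'n :: banach) bbundle"
  assumes E: "banach_bundle X E" and F: "banach_bundle X F" and X: "topspace X = {}"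
  shows "homotopic_to_iso X E F L"
proof -
  note EY = banach_bundle_pullback[OF continuous_map_cylinder_fst E] and FY = banach_bundle_pullback[OF continuous_map_cylinder_fst F]
  have Y: "topspace (cylinder X) = {}" using X by (simp add: topspace_cylinder)
  have mor: "bundle_morphism (cylinder X) (pullback (cylinder X) fst E) (pullback (cylinder X) fst F) (\<lambda>_ _. 0)"
    by (rule bundle_morphismI[OF EY FY]) (simp_all add: Y nmor_on_def)
  have "bundle_morphism X E F (\<lambda>_ _. 0)" by (rule bundle_morphismI[OF E F]) (simp_all add: X nmor_on_def)
  hence "bundle_iso X E F (\<lambda>_ _. 0)" by (rule bundle_iso_of_bij[OF E F]) (simp add: X)
  thus ?thesis unfolding homotopic_to_iso_def fredholm_morphism_def
    using mor by (intro exI[of _ "\<lambda>_ _. 0"]) (simp add: X Y pullback_morphism_def)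
qed

lemma model_infinite:
  fixes F :: "('b, 'k :: {real_normed_field, euclidean_space}, 'w :: ab_group_add, 'n :: banach) bbundle"
  assumes F: "banach_bundle X F" and p: "p \<in> topspace X" "\<not> fin_dim (fscale F) (fibre F p)"
  shows "\<not> fin_dim (mscale F) UNIV"
proof
  interpret m: kspace "mscale F" by (rule bb_kspace[OF F])
  interpret f: vector_space "fscale F" by (rule bb_vs[OF F])
  assume "fin_dim (mscale F) UNIV"
  then obtain n b where b: "is_basis (mscale F) UNIV n b" by (rule m.fin_dim_basis')
  obtain U \<sigma> where d: "(U, \<sigma>) \<in> charts F" "p \<in> U" using bb_cover[OF F p(1)] .
  have "is_basis (fscale F) (\<sigma> p ` UNIV) n (\<lambda>i. \<sigma> p (b i))" using chart_is_basis[OF F d, of UNIV n b] b by blast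
  moreover have "\<sigma> p ` UNIV = fibre F p" using bb_chart(3)[OF F d] by (simp add: bij_betw_def)
  ultimately show False using f.is_basis_fin_dim p(2) by metis
qed

theorem corollary5p2:
  fixes X :: "'b topology"
    and E :: "('b, 'k :: {real_normed_field, euclidean_space}, 'v :: ab_group_add, 'm :: banach) bbundle"
    and F :: "('b, 'k, 'w :: ab_group_add, 'n :: banach) bbundle"
    and L :: "'b \<Rightarrow> 'v \<Rightarrow> 'w"
  assumes "compact_space X" and "Hausdorff_space X"
    and "banach_bundle X E" and "banach_bundle X F"
    and "fredholm_morphism X E F L"
  shows "(homotopic_to_iso X E F L \<longrightarrow> ind X E F L = \<one>\<^bsub>K_group X\<^esub>) \<and>
    ((\<forall>p\<in>topspace X. \<not> fin_dim (fscale F) (fibre F p)) \<longrightarrow>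
       (ind X E F L = \<one>\<^bsub>K_group X\<^esub> \<longleftrightarrow> homotopic_to_iso X E F L))"
proof -
  note X = assms(1,2) and E = assms(3) and F = assms(4)
  obtain k where L: "bundle_morphism X E F L"
    and fred: "!!p. p \<in> topspace X ==> fredholm_of_index (fscale E) (fscale F) (fibre E p) (fibre F p) (L p) k"
    using assms(5) unfolding fredholm_morphism_def by (elim exE conjE) (rule that, assumption, erule bspec)
  have ker: "fin_dim (fscale E) {u \<in> fibre E p. L p u = 0}" if "p \<in> topspace X" for p
    using fred[OF that] unfolding fredholm_of_index_def by (rule conjunct1)
  \<comment> \<open>The very choice made in \<open>ind\<close>. Any other transversal subbundle has
    to be compared with it through \<open>index_stable_independent\<close>.\<close>
  define V where "V = (SOME V. transversal_subbundle X E F L V)"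
  have ex: "\<exists>V. transversal_subbundle X E F L V" by (rule transversal_exists[OF X E F L fred], assumption, rule exI)
  have V: "transversal_subbundle X E F L V" unfolding V_def by (rule someI_ex[OF ex])
  note v = transversal_facts[OF X E F L ker V]
  have ind: "ind X E F L = \<one>\<^bsub>K_group X\<^esub> \<longleftrightarrow>
      stably_iso X (index_vbundle X E L V) (induced_vbundle X F V)"
    unfolding ind_def Let_def V_def[symmetric] by (rule K_class_one_iff[OF v(2,3)])
  have 1: "ind X E F L = \<one>\<^bsub>K_group X\<^esub>" if h: "homotopic_to_iso X E F L"
  proof -
    obtain W where W: "transversal_subbundle X E F L W"
      and iso: "vb_iso X (index_vbundle X E L W) (induced_vbundle X F W)"
      by (rule iso_of_homotopy[OF X E F L fred h], assumption, rule that)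
    note w = transversal_facts[OF X E F L ker W]
    \<comment> \<open>An isomorphism is a stable one, with the zero bundle as stabiliser.\<close>
    have st: "stably_iso X (index_vbundle X E L W) (induced_vbundle X F W)"
      by (rule stably_isoI[OF w(2,3) vb_iso_sum_cong[OF iso vb_iso_refl[OF vector_bundle_zero]] vector_bundle_zero])
    show ?thesis unfolding ind by (rule index_stable_independent[OF X E F L ker W V st])
  qed
  have "homotopic_to_iso X E F L"
    if inf: "\<forall>p\<in>topspace X. \<not> fin_dim (fscale F) (fibre F p)" and 0: "ind X E F L = \<one>\<^bsub>K_group X\<^esub>"
  proof (cases "topspace X = {}")
    case True
    thus ?thesis by (rule homotopic_to_iso_empty[OF E F])
  next
    case False
    then obtain p where p: "p \<in> topspace X" by blast
    have ninf: "\<not> fin_dim (mscale F) UNIV" by (rule model_infinite[OF F p bspec[OF inf p]])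
    obtain W where "transversal_subbundle X E F L W" "vb_iso X (index_vbundle X E L W) (induced_vbundle X F W)"
      by (rule unstable_iso[OF X E F L fred ninf V 0[unfolded ind]], assumption, rule that)
    thus ?thesis by (rule homotopy_of_iso[OF X E F L fred, rotated])
  qed
  thus ?thesis using 1 by blast
qed

end
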